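(* Let $K$ be a transverse knot in $(S^3,\xi_{st})$ that is transversely isotopic to the closure of a $3$-braid $\beta\in B_3$ whose fractional Dehn twist coefficient satisfies $\tau(\beta)>1$. Then $\psi(K)\neq 0$, where $\psi$ is computed in Khovanov homology with coefficients in $\mathbb{Q}$, in $\mathbb{Z}$, and in $\mathbb{Z}/2\mathbb{Z}$; moreover $\psi'(K)\neq 0$.
   Context: $B_n$ is the Artin braid group with standard generators $\sigma_1,\dots,\sigma_{n-1}$; $\Delta^2=(\sigma_1\cdots\sigma_{n-1})^n$ is the full twist. The closure $\hat\beta$ of a braid is naturally a transverse link in the standard contact $3$-sphere $(S^3,\xi_{st})$, $\xi_{st}=\ker(dz+r^2d\theta)$, and transverse links up to transverse isotopy correspond to braids up to braid relations, conjugation and positive (de)stabilization. Khovanov complex conventions: for an oriented link diagram $D$ with $n_+$ positive and $n_-$ negative crossings, a Kauffman state chooses a $0$- or $1$-resolution at each crossing; to a state with $r$ one-resolutions and circles $C_1,\dots,C_m$ one assigns $V^{\otimes m}$, $V$ free on $v_+,v_-$ with $p(v_\pm)=\pm1$; homological grading $i=r-n_-$, quantum grading $j=p+i+n_+-n_-$; differential given by the merge map $m(v_+\otimes v_+)=v_+$, $m(v_+\otimes v_-)=m(v_-\otimes v_+)=v_-$, $m(v_-\otimes v_-)=0$ and split map $\Delta(v_+)=v_+\otimes v_-+v_-\otimes v_+$, $\Delta(v_-)=v_-\otimes v_-$, with the usual signs. Plamenevskaya's transverse invariant $\psi(\hat\beta)$ is the homology class of $v_-\otimes\cdots\otimes v_-$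 in the oriented resolution of the closed braid diagram (the $0$-resolution at every positive crossing and the $1$-resolution at every negative crossing); it lies in $Kh^{0}_{\mathrm{sl}(\hat\beta)}$ with $\mathrm{sl}(\hat\beta)=-b+n_+-n_-$ ($b$ the strand number) and is, up to sign, an invariant of the transverse link. The reduced version $\psi'$ lives in reduced Khovanov homology over $\mathbb{Z}/2\mathbb{Z}$ (quotient of the complex of a diagram with a marked point by the subcomplex of generators labelling the marked circle by $v_-$, quantum grading shifted by $-1$): it is the class of the generator in the oriented resolution labelling the marked circle $v_+$ and all other circles $v_-$. Fractional Dehn twist coefficient: a braid is Dehornoy positive ($\beta>1$) if for some $i$ it has a word containing no $\sigma_j^{\pm1}$ with $j<i$ and only positive powers of $\sigma_i$; $\alpha<\beta$ iff $\alpha^{-1}\beta>1$ defines a total left order on $B_n$. For $\beta\in B_n$ let $\lfloor\beta\rfloor$ be the unique integer $m$ with $\Delta^{2m}\le\beta<\Delta^{2m+2}$; then $\tau(\beta)=\lim_{k\to\infty}\lfloor\beta^k\rfloor/k$. *)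

theory Defs
  imports Complex_Main "HOL-Library.Z2"
begin

section \<open>Braid words and the braid group B_n\<close>

text \<open>A braid word on n strands is a list of nonzero integers; the letter i (i>0)
  stands for sigma_i and -i for sigma_i inverse, with 1 <= |i| <= n-1.\<close>

definition valid_word :: "nat \<Rightarrow> int list \<Rightarrow> bool" where
  "valid_word n w \<longleftrightarrow> (\<forall>x\<in>set w. x \<noteq> 0 \<and> \<bar>x\<bar> < int n)"

text \<open>Equality in the Artin braid group B_n, as the congruence on words generated
  by free cancellation, far commutation and the braid relation.\<close>

inductive braid_eq :: "nat \<Rightarrow> int list \<Rightarrow> int list \<Rightarrow> bool" for n where
  refl: "braid_eq n u u"
| sym: "braid_eq n u v \<Longrightarrow> braid_eq n v u"
| trans: "braid_eq n u v \<Longrightarrow> braid_eq n v x \<Longrightarrow> braid_eq n u x"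
| ctx: "braid_eq n u v \<Longrightarrow> braid_eq n (a @ u @ b) (a @ v @ b)"
| cancel: "i \<noteq> 0 \<Longrightarrow> \<bar>i\<bar> < int n \<Longrightarrow> braid_eq n [i, -i] []"
| far_comm: "1 \<le> i \<Longrightarrow> i + 1 < j \<Longrightarrow> j < int n \<Longrightarrow> braid_eq n [i, j] [j, i]"
| braid_rel: "1 \<le> i \<Longrightarrow> i + 1 < int n \<Longrightarrow> braid_eq n [i, i+1, i] [i+1, i, i+1]"

definition winv :: "int list \<Rightarrow> int list" where
  "winv w = rev (map uminus w)"

definition wpow :: "int list \<Rightarrow> nat \<Rightarrow> int list" where
  "wpow w k = concat (replicate k w)"

definition wzpow :: "int list \<Rightarrow> int \<Rightarrow> int list" where
  "wzpow w m = (if m \<ge> 0 then wpow w (nat m) else wpow (winv w) (nat (- m)))"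

text \<open>The full twist Delta^2 = (sigma_1 ... sigma_{n-1})^n.\<close>
definition full_twist :: "nat \<Rightarrow> int list" where
  "full_twist n = wpow (map int [1..<n]) n"

section \<open>Dehornoy order and fractional Dehn twist coefficient\<close>

text \<open>beta > 1: beta has a word containing no sigma_j^{+-1} with j < i, at least one
  sigma_i and no sigma_i^{-1}.\<close>
definition dehornoy_pos :: "nat \<Rightarrow> int list \<Rightarrow> bool" where
  "dehornoy_pos n w \<longleftrightarrow> (\<exists>u i. braid_eq n w u \<and> valid_word n u \<and> 1 \<le> i \<and> i < int n \<and>
      (\<forall>x\<in>set u. i \<le> \<bar>x\<bar>) \<and> i \<in> set u \<and> - i \<notin> set u)"

definition dehornoy_less :: "nat \<Rightarrow> int list \<Rightarrow> int list \<Rightarrow> bool" where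
  "dehornoy_less n a b \<longleftrightarrow> dehornoy_pos n (winv a @ b)"

definition dehornoy_le :: "nat \<Rightarrow> int list \<Rightarrow> int list \<Rightarrow> bool" where
  "dehornoy_le n a b \<longleftrightarrow> dehornoy_less n a b \<or> braid_eq n a b"

definition braid_floor :: "nat \<Rightarrow> int list \<Rightarrow> int" where
  "braid_floor n w = (THE m. dehornoy_le n (wzpow (full_twist n) m) w \<and>
                            dehornoy_less n w (wzpow (full_twist n) (m + 1)))"

definition fdtc :: "nat \<Rightarrow> int list \<Rightarrow> real" where
  "fdtc n w = lim (\<lambda>k. real_of_int (braid_floor n (wpow w k)) / real k)"

section \<open>Closure is a knot\<close>

text \<open>Permutation induced by a braid word on strand positions 0..n-1
  (sigma_i swaps positions i-1 and i).\<close>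
definition braid_perm :: "int list \<Rightarrow> nat \<Rightarrow> nat" where
  "braid_perm w = foldr (\<lambda>x f. f \<circ> (\<lambda>q. if q = nat \<bar>x\<bar> - 1 then nat \<bar>x\<bar> else if q = nat \<bar>x\<bar> then nat \<bar>x\<bar> - 1 else q)) w id"

definition closure_is_knot :: "nat \<Rightarrow> int list \<Rightarrow> bool" where
  "closure_is_knot n w \<longleftrightarrow> (\<forall>p<n. \<exists>k. (braid_perm w ^^ k) 0 = p)"

section \<open>Khovanov complex of a closed braid diagram\<close>

text \<open>Points of the closed braid diagram: (t,p) with level t <= length w and position
  p < n. Crossing number t (0-based, letter w!t) lies between levels t and t+1;
  level length w is joined back to level 0 by the closing arcs. A Kauffman state is a
  bool list s (True = 1-resolution). The oriented resolution of a crossing is the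
  vertical (identity) smoothing; it is the 0-resolution at a positive crossing and the
  1-resolution at a negative crossing.\<close>

definition diagram_points :: "nat \<Rightarrow> int list \<Rightarrow> (nat \<times> nat) set" where
  "diagram_points n w = {(t, p). t \<le> length w \<and> p < n}"

definition crossing_edges :: "nat \<Rightarrow> int \<Rightarrow> nat \<Rightarrow> bool \<Rightarrow> ((nat \<times> nat) \<times> (nat \<times> nat)) set" where
  "crossing_edges n x t vert =
     (let i = nat \<bar>x\<bar> in
      {((t, p), (t + 1, p)) | p. p < n \<and> p \<noteq> i - 1 \<and> p \<noteq> i} \<union>
      (if vert then {((t, i - 1), (t + 1, i - 1)), ((t, i), (t + 1, i))}
       else {((t, i - 1), (t, i)), ((t + 1, i - 1), (t + 1, i))}))"

definition resolution_edges :: "nat \<Rightarrow> int list \<Rightarrow> bool list \<Rightarrow> ((nat \<times> nat) \<times> (nat \<times> nat)) set" where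
  "resolution_edges n w s =
     {((length w, p), (0, p)) | p. p < n} \<union>
     (\<Union>t<length w. crossing_edges n (w ! t) t (s ! t = (w ! t < 0)))"

text \<open>The circles of the resolution: connected components, each a set of points.\<close>
definition circles :: "nat \<Rightarrow> int list \<Rightarrow> bool list \<Rightarrow> (nat \<times> nat) set set" where
  "circles n w s = diagram_points n w //
      ((resolution_edges n w s \<union> (resolution_edges n w s)\<inverse>)\<^sup>*)"

text \<open>Generators of the Khovanov complex: a state together with the set of circles
  labelled v_+ (the remaining circles are labelled v_-).\<close>
type_synonym kh_gen = "bool list \<times> (nat \<times> nat) set set"

definition kh_gens :: "nat \<Rightarrow> int list \<Rightarrow> kh_gen set" where
  "kh_gens n w = {(s, P). length s = length w \<and> P \<subseteq> circles n w s}"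

text \<open>Total p-degree (number of v_+ minus number of v_-) on a set A of circles.\<close>
definition pdeg :: "(nat \<times> nat) set set \<Rightarrow> (nat \<times> nat) set set \<Rightarrow> int" where
  "pdeg A P = int (card (A \<inter> P)) - int (card (A - P))"

text \<open>Matrix coefficient of the Khovanov differential from g to g'. Along the edge
  changing crossing c from 0 to 1, the circles not involved are kept with their labels;
  the merge/split maps m and Delta are exactly: coefficient 1 iff the p-degree of the new
  circles equals that of the old circles minus 1. The sign is (-1)^(number of 1's
  before c).\<close>
definition kh_dcoef :: "nat \<Rightarrow> int list \<Rightarrow> kh_gen \<Rightarrow> kh_gen \<Rightarrow> int" where
  "kh_dcoef n w g g' =
     (case g of (s, P) \<Rightarrow> case g' of (s', P') \<Rightarrow>
       (\<Sum>c<length w.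
          (let C = circles n w s; C' = circles n w s'; A = C - C'; B = C' - C in
           if \<not> s ! c \<and> s' = s[c := True] \<and> P \<inter> (C \<inter> C') = P' \<inter> (C \<inter> C')
              \<and> pdeg B P' = pdeg A P - 1
           then (-1) ^ card {j. j < c \<and> s ! j} else 0)))"

text \<open>A chain (function on generators with values in a ring 'a) lies in the image of
  the differential iff it is a boundary.\<close>
definition kh_is_boundary :: "'a::comm_ring_1 itself \<Rightarrow> nat \<Rightarrow> int list \<Rightarrow> (kh_gen \<Rightarrow> 'a) \<Rightarrow> bool" where
  "kh_is_boundary R n w z \<longleftrightarrow>
     (\<exists>x :: kh_gen \<Rightarrow> 'a. \<forall>g'\<in>kh_gens n w.
        (\<Sum>g\<in>kh_gens n w. x g * of_int (kh_dcoef n w g g')) = z g')"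

definition oriented_state :: "int list \<Rightarrow> bool list" where
  "oriented_state w = map (\<lambda>x. x < 0) w"

text \<open>Plamenevskaya's cycle: oriented resolution, every circle labelled v_-.\<close>
definition psi_chain :: "int list \<Rightarrow> kh_gen \<Rightarrow> 'a::comm_ring_1" where
  "psi_chain w g = (if g = (oriented_state w, {}) then 1 else 0)"

text \<open>psi(beta-hat) is nonzero in Kh with coefficients in 'a.\<close>
definition psi_nonzero :: "'a::comm_ring_1 itself \<Rightarrow> nat \<Rightarrow> int list \<Rightarrow> bool" where
  "psi_nonzero R n w \<longleftrightarrow> \<not> kh_is_boundary R n w (psi_chain w :: kh_gen \<Rightarrow> 'a)"

section \<open>Reduced version over Z/2\<close>

text \<open>Marked point (0,0). The reduced complex is the quotient by the subcomplex
  spanned by generators labelling the marked circle v_-; so a chain is a boundary in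
  the reduced complex iff it agrees with a boundary on all generators labelling the
  marked circle v_+.\<close>
definition marked_plus :: "kh_gen \<Rightarrow> bool" where
  "marked_plus g \<longleftrightarrow> (\<exists>c\<in>snd g. (0, 0) \<in> c)"

definition psi'_gen :: "nat \<Rightarrow> int list \<Rightarrow> kh_gen" where
  "psi'_gen n w = (oriented_state w, {c \<in> circles n w (oriented_state w). (0, 0) \<in> c})"

definition psi'_nonzero :: "nat \<Rightarrow> int list \<Rightarrow> bool" where
  "psi'_nonzero n w \<longleftrightarrow>
     \<not> (\<exists>x :: kh_gen \<Rightarrow> bit. \<forall>g'\<in>kh_gens n w. marked_plus g' \<longrightarrow>
          (\<Sum>g\<in>kh_gens n w. x g * of_int (kh_dcoef n w g g')) =
          (if g' = psi'_gen n w then 1 else 0))"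

end

theory Submission
  imports Defs "HOL-Combinatorics.Cycles"
begin

text \<open>\<open>\<psi>\<close> is not a boundary as soon as a cocycle of the dual complex takes the value 1 on it; a diagram
  with such a cocycle is called detected. A dual cochain in a given state is recorded as a function of all
  finite sets \<open>T\<close> of diagram points: its value on the generator with label \<open>v\<^sub>-\<close> on the circles through
  \<open>T\<close> and \<open>v\<^sub>+\<close> on the others, and 0 if \<open>T\<close> meets a circle twice. In this form the dual of a merge is
  the identity and the dual of a split at \<open>a\<close>, \<open>b\<close> is a sum of two insertions. Being detected is
  invariant under braid relations and conjugation, and it survives the insertion of positive crossings and the
  deletion of negative ones.

  Up to conjugation a 3-braid is \<open>\<Delta>\<^sup>2\<^sup>m w\<close> with \<open>w\<close> a word in \<open>\<sigma>\<^sub>1\<close> and \<open>\<sigma>\<^sub>2\<close> inverse, or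
  \<open>\<Delta>\<^sup>2\<^sup>m \<sigma>\<^sub>2\<^sup>j\<close> with \<open>j \<ge> 0\<close>, or \<open>\<Delta>\<^sup>2\<^sup>m\<close> times one of \<open>\<Delta>\<close>, \<open>\<Delta> \<sigma>\<^sub>1\<close>, \<open>\<sigma>\<^sub>2 \<sigma>\<^sub>1\<close>; the twist
  coefficients are \<open>m\<close>, \<open>m\<close> and \<open>m + 1/2\<close>, \<open>m + 2/3\<close>, \<open>m + 1/3\<close>. If the coefficient exceeds 1, the braid is
  therefore conjugate to a positive one, or to \<open>\<Delta>\<^sup>2\<^sup>m w\<close> with \<open>m \<ge> 2\<close>, and the latter arises by inserting
  positive crossings from \<open>\<Delta>\<^sup>4 \<sigma>\<^sub>2\<^sup>-\<^sup>k\<close>. For \<open>k = 9\<close> this braid is quasipositive. For \<open>k \<ge> 9\<close> one more crossing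
  \<open>\<sigma>\<^sub>2\<close> inverse costs nothing: in its other resolution the turn-back can be pushed through the whole word,
  and this shows that the cohomology obstructing the extension of the cocycle vanishes.\<close>

text \<open>A cocycle with value 1 on the cycle \<psi> rules out a primitive over every commutative
  ring at once; composed with multiplication by \<open>v_-\<close> at the marked point it also
  settles the reduced class. Labels are read at points instead of circles so that diagrams that
  differ inside a disc can be compared by restricting cochains to the points outside. No plane
  topology enters: in every state the middle column can be run downwards and the outer columns
  upwards, so the circles are the orbits of a permutation, and a change of resolution multiplies it
  by a transposition, which joins two orbits or cuts one.

  The exponent 9 is where two bounds meet. The square of the full twist is \<open>base\<close> times
  s2^4, so the family is \<open>base\<close> followed by k - 4 letters -2. With five such letters a
  quasipositive expression exists. The obstruction to a further one lives in states with as many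
  1-resolutions as there are negative letters. There cohomology vanishes from 5 on: the bound starts
  at 1 and rises by one for each of the four pairs of letters of \<open>base\<close> that the
  turn-back passes. So from five negative letters on the cocycle extends.\<close>

section \<open>Dual cochains as functions of point sets\<close>

type_synonym ('p, 'a) dual = "'p set \<Rightarrow> 'a"

text \<open>The transpose of multiplication by \<open>v_-\<close> on the circle through
  \<open>p\<close>, which takes \<open>v_+\<close> to \<open>v_-\<close> and \<open>v_-\<close> to
  0. In the ring Z[X]/X^2, with \<open>v_-\<close> as X, this is multiplication by X.\<close>

definition mulX :: "'p \<Rightarrow> ('p, 'a::comm_ring_1) dual \<Rightarrow> ('p, 'a) dual" where
  "mulX p \<phi> = (\<lambda>T. if p \<in> T then 0 else \<phi> (insert p T))"

text \<open>With \<open>R\<close> the partition into circles, this says that \<phi> is really a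
  function of labelled circles: multiplication by X may be carried out at any point of a circle. The
  set \<open>U\<close> permits the same statement for the points outside a disc only.\<close>

definition Inv :: "'p set \<Rightarrow> 'p rel \<Rightarrow> ('p, 'a::comm_ring_1) dual \<Rightarrow> bool" where
  "Inv U R \<phi> \<longleftrightarrow> (\<forall>p\<in>U. \<forall>q\<in>U. (p, q) \<in> R \<longrightarrow> (\<forall>T\<subseteq>U. mulX p \<phi> T = mulX q \<phi> T))"

text \<open>The transpose of the saddle map into the state with partition \<open>R\<close>. If
  \<open>a\<close> and \<open>b\<close> are connected after the saddle, it was a merge; otherwise it
  was a split, and the two summands come from the two terms of the image of
  \<open>v_+\<close>.\<close>

definition dsad :: "'p rel \<Rightarrow> 'p \<Rightarrow> 'p \<Rightarrow> ('p, 'a::comm_ring_1) dual \<Rightarrow> ('p, 'a) dual" where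
  "dsad R a b \<phi> = (if (a, b) \<in> R then \<phi> else (\<lambda>T. mulX a \<phi> T + mulX b \<phi> T))"

text \<open>The value 0 is right when \<open>h\<close> identifies two points of \<open>T\<close>:
  they are then two labels \<open>v_-\<close> on one circle, and X^2 = 0.\<close>

definition pb :: "('p \<Rightarrow> 'p) \<Rightarrow> ('p, 'a::comm_ring_1) dual \<Rightarrow> ('p, 'a) dual" where
  "pb h \<phi> = (\<lambda>T. if inj_on h T then \<phi> (h ` T) else 0)"

lemma mulX_commute: "mulX p (mulX q \<phi>) = mulX q (mulX p \<phi>)"
  by (auto simp: mulX_def fun_eq_iff insert_commute)

lemma mulX_self [simp]: "mulX p (mulX p \<phi>) = (\<lambda>_. 0)"
  by (auto simp: mulX_def)

lemma mulX_add: "mulX p (\<lambda>T. \<phi> T + \<psi> T) = (\<lambda>T. mulX p \<phi> T + mulX p \<psi> T)"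
  by (auto simp: mulX_def)

lemma mulX_uminus: "mulX p (\<lambda>T. - \<phi> T) = (\<lambda>T. - mulX p \<phi> T)"
  by (auto simp: mulX_def)

lemma mulX_zero [simp]: "mulX p (\<lambda>T. 0) = (\<lambda>T. 0)"
  by (auto simp: mulX_def)

lemma dsad_add: "dsad R a b (\<lambda>T. \<phi> T + \<psi> T) = (\<lambda>T. dsad R a b \<phi> T + dsad R a b \<psi> T)"
  by (auto simp: dsad_def mulX_add algebra_simps)

lemma dsad_uminus: "dsad R a b (\<lambda>T. - \<phi> T) = (\<lambda>T. - dsad R a b \<phi> T)"
  by (auto simp: dsad_def mulX_uminus)

lemma dsad_zero [simp]: "dsad R a b (\<lambda>T. 0) = (\<lambda>T. 0)"
  by (auto simp: dsad_def)

lemma mulX_dsad: "mulX p (dsad R a b \<phi>) = dsad R a b (mulX p \<phi>)"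
  by (simp add: dsad_def mulX_add mulX_commute[of p])

lemma InvD: "Inv UNIV R \<phi> \<Longrightarrow> (p, q) \<in> R \<Longrightarrow> mulX p \<phi> = mulX q \<phi>"
  by (auto simp: Inv_def)

lemma InvI: "(\<And>p q. (p, q) \<in> R \<Longrightarrow> mulX p \<phi> = mulX q \<phi>) \<Longrightarrow> Inv UNIV R \<phi>"
  by (auto simp: Inv_def)

lemma Inv_add: "Inv U R \<phi> \<Longrightarrow> Inv U R \<psi> \<Longrightarrow> Inv U R (\<lambda>T. \<phi> T + \<psi> T)"
  by (auto simp: Inv_def mulX_add)

lemma Inv_uminus: "Inv U R \<phi> \<Longrightarrow> Inv U R (\<lambda>T. - \<phi> T)"
  by (auto simp: Inv_def mulX_uminus)

lemma Inv_zero [simp]: "Inv U R (\<lambda>T. 0)"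
  by (auto simp: Inv_def)

lemma Inv_mulX: "Inv UNIV R \<phi> \<Longrightarrow> Inv UNIV R (mulX p \<phi>)"
  by (rule InvI) (metis InvD mulX_commute)

text \<open>Compare the two multiplications at \<open>T - {p}\<close>: the one at \<open>q\<close>
  gives 0, because \<open>q\<close> is already in the set.\<close>

lemma Inv_vanish:
  assumes "Inv UNIV R \<phi>" "(p, q) \<in> R" "p \<in> T" "q \<in> T" "p \<noteq> q"
  shows "\<phi> T = 0"
proof -
  have "mulX p \<phi> (T - {p}) = mulX q \<phi> (T - {p})" using assms(1,2) by (simp add: InvD)
  then show ?thesis using assms by (simp add: mulX_def insert_absorb)
qed

lemma dsad_cong:
  assumes "equiv UNIV R" "Inv UNIV R \<phi>" "(a, a') \<in> R" "(b, b') \<in> R"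
  shows "dsad R a b \<phi> = dsad R a' b' \<phi>"
proof -
  have "(a, b) \<in> R \<longleftrightarrow> (a', b') \<in> R"
    using assms by (meson equivE symE transE)
  moreover have "mulX a \<phi> = mulX a' \<phi>" "mulX b \<phi> = mulX b' \<phi>" using assms by (auto intro: InvD)
  ultimately show ?thesis by (simp add: dsad_def)
qed

section \<open>Merges and splits of a partition\<close>

definition join :: "'p rel \<Rightarrow> 'p \<Rightarrow> 'p \<Rightarrow> 'p rel" where
  "join R a b = R \<union> {(x, y). (x, a) \<in> R \<and> (b, y) \<in> R} \<union> {(x, y). (x, b) \<in> R \<and> (a, y) \<in> R}"

text \<open>The third possibility, one circle turning into one circle, is left out; for diagrams
  \<open>saddle_orb\<close> excludes it.\<close>

definition saddle :: "'p rel \<Rightarrow> 'p rel \<Rightarrow> 'p \<Rightarrow> 'p \<Rightarrow> bool" where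
  "saddle R R' a b \<longleftrightarrow> equiv UNIV R \<and> equiv UNIV R' \<and>
     ((a, b) \<notin> R \<and> R' = join R a b \<or> (a, b) \<notin> R' \<and> R = join R' a b)"

lemma joinI: "equiv UNIV R \<Longrightarrow> (a, b) \<in> join R a b"
  by (auto simp: join_def equiv_def refl_on_def)

lemma Inv_dsad:
  assumes "saddle R R' a b" "Inv UNIV R' \<phi>"
  shows "Inv UNIV R (dsad R' a b \<phi>)"
proof (cases "(a, b) \<in> R'")
  case True
  then have "R' = join R a b" using assms(1) by (auto simp: saddle_def)
  then have "R \<subseteq> R'" by (auto simp: join_def)
  then show ?thesis using True assms(2) by (auto simp: dsad_def intro!: InvI dest: InvD)
next
  case False
  then have R: "R = join R' a b" using assms(1) joinI[of R a b] unfolding saddle_def by metis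
  have sym: "sym R'" using assms(1) by (auto simp: saddle_def equiv_def)
  \<comment> \<open>On the circle that is about to split, one of the two summands dies by X^2 = 0
    and the other is the same product whichever side \<open>p\<close> lies on.\<close>
  have A: "mulX p (dsad R' a b \<phi>) = mulX a (mulX b \<phi>)" if "(p, a) \<in> R' \<or> (p, b) \<in> R'" for p
  proof -
    have "mulX p \<phi> = mulX a \<phi> \<or> mulX p \<phi> = mulX b \<phi>"
      using that InvD[OF assms(2)] by blast
    then show ?thesis unfolding mulX_dsad using False mulX_commute[of b a \<phi>] by (auto simp: dsad_def)
  qed
  show ?thesis
  proof (rule InvI)
    fix p q assume "(p, q) \<in> R"
    then consider "(p, q) \<in> R'" | "(p, a) \<in> R'" "(b, q) \<in> R'" | "(p, b) \<in> R'" "(a, q) \<in> R'"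
      using R by (auto simp: join_def)
    then show "mulX p (dsad R' a b \<phi>) = mulX q (dsad R' a b \<phi>)"
    proof cases
      case 1 then show ?thesis by (simp only: mulX_dsad InvD[OF assms(2) 1])
    next
      case 2 then show ?thesis using A[of p] A[of q] symD[OF sym] by simp
    next
      case 3 then show ?thesis using A[of p] A[of q] symD[OF sym] by simp
    qed
  qed
qed

text \<open>If neither saddle changes its type when the other one is performed, both sides expand to
  the same terms. A change of type always affects both saddles together (\<open>ms\<close>: merge,
  then split; \<open>sm\<close>: split, then merge). Then \<open>a\<close>, \<open>b\<close> lie on
  the same pair of circles as \<open>c\<close>, \<open>d\<close> in some order, and the sums of two
  multiplications agree.\<close>

lemma dsad_square:
  assumes s1: "saddle R00 R10 a b" and s2: "saddle R01 R11 a b"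
    and s3: "saddle R00 R01 c d" and s4: "saddle R10 R11 c d"
    and inv: "Inv UNIV R11 \<phi>"
  shows "dsad R10 a b (dsad R11 c d \<phi>) = dsad R01 c d (dsad R11 a b \<phi>)"
proof -
  note eqs = s1[unfolded saddle_def] s2[unfolded saddle_def] s3[unfolded saddle_def] s4[unfolded saddle_def]
  have sy: "sym R11" "sym R00" using eqs by (auto simp: equiv_def)
  have j: "\<And>R a b. equiv UNIV R \<Longrightarrow> (a, b) \<in> join R a b" by (rule joinI)
  have ab: "(a, b) \<in> R00 \<longleftrightarrow> (a, b) \<notin> R10" "(a, b) \<in> R01 \<longleftrightarrow> (a, b) \<notin> R11"
    "(c, d) \<in> R00 \<longleftrightarrow> (c, d) \<notin> R01" "(c, d) \<in> R10 \<longleftrightarrow> (c, d) \<notin> R11"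
    using eqs j by metis+
  have sub: "(a,b) \<in> R10 \<Longrightarrow> R10 = join R00 a b" "(a,b) \<in> R11 \<Longrightarrow> R11 = join R01 a b"
     "(a,b) \<notin> R10 \<Longrightarrow> R00 = join R10 a b" "(a,b) \<notin> R11 \<Longrightarrow> R01 = join R11 a b"
     "(c,d) \<in> R01 \<Longrightarrow> R01 = join R00 c d" "(c,d) \<in> R11 \<Longrightarrow> R11 = join R10 c d"
     "(c,d) \<notin> R01 \<Longrightarrow> R00 = join R01 c d" "(c,d) \<notin> R11 \<Longrightarrow> R10 = join R11 c d"
    using eqs j by metis+
  have mono: "\<And>R a b. R \<subseteq> join R a b" by (auto simp: join_def)
  consider (same) "(a, b) \<in> R10 \<longleftrightarrow> (a, b) \<in> R11" "(c, d) \<in> R01 \<longleftrightarrow> (c, d) \<in> R11"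
    | (ms) "(a, b) \<in> R10" "(a, b) \<notin> R11" "(c, d) \<in> R01" "(c, d) \<notin> R11"
    | (sm) "(a, b) \<notin> R10" "(a, b) \<in> R11" "(c, d) \<notin> R01" "(c, d) \<in> R11"
  proof -
    have i: "(a, b) \<in> R10 \<and> (a, b) \<notin> R11 \<Longrightarrow> (c, d) \<in> R01 \<and> (c, d) \<notin> R11"
      using ab sub(6,7) mono[of R10 c d] mono[of R01 c d] by blast
    have ii: "(a, b) \<notin> R10 \<and> (a, b) \<in> R11 \<Longrightarrow> (c, d) \<notin> R01 \<and> (c, d) \<in> R11"
      using ab sub(5,8) mono[of R00 c d] mono[of R11 c d] by blast
    have iii: "(c, d) \<in> R01 \<and> (c, d) \<notin> R11 \<Longrightarrow> (a, b) \<in> R10 \<and> (a, b) \<notin> R11"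
      using ab sub(2,3) mono[of R01 a b] mono[of R10 a b] by blast
    have iv: "(c, d) \<notin> R01 \<and> (c, d) \<in> R11 \<Longrightarrow> (a, b) \<notin> R10 \<and> (a, b) \<in> R11"
      using ab sub(1,4) mono[of R00 a b] mono[of R11 a b] by blast
    show ?thesis using that i ii iii iv by blast
  qed
  then show ?thesis
  proof cases
    case same
    then show ?thesis
      by (simp add: dsad_def mulX_add mulX_commute[of a] mulX_commute[of b] add_ac)
  next
    case ms
    have 1: "R10 = join R11 c d" "(a, b) \<in> R10" using sub ms by auto
    then have "(a, c) \<in> R11 \<and> (d, b) \<in> R11 \<or> (a, d) \<in> R11 \<and> (c, b) \<in> R11"
      using ms(2) by (auto simp: join_def)
    then have "mulX a \<phi> = mulX c \<phi> \<and> mulX d \<phi> = mulX b \<phi> \<or> mulX a \<phi> = mulX d \<phi> \<and> mulX c \<phi> = mulX b \<phi>"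
      using InvD[OF inv] by blast
    then show ?thesis using ms by (auto simp: dsad_def)
  next
    case sm
    have 1: "R11 = join R10 c d" using sub sm by auto
    then have "(a, c) \<in> R10 \<and> (d, b) \<in> R10 \<or> (a, d) \<in> R10 \<and> (c, b) \<in> R10"
      using sm(1,2) by (auto simp: join_def)
    then have "(a, c) \<in> R11 \<and> (d, b) \<in> R11 \<or> (a, d) \<in> R11 \<and> (c, b) \<in> R11"
      using 1 by (auto simp: join_def)
    then have "mulX a \<phi> = mulX c \<phi> \<and> mulX d \<phi> = mulX b \<phi> \<or> mulX a \<phi> = mulX d \<phi> \<and> mulX c \<phi> = mulX b \<phi>"
      using InvD[OF inv] by blast
    then show ?thesis using sm by (auto simp: dsad_def)
  qed
qed

lemma mulX_pb: "mulX p (pb h \<phi>) = pb h (mulX (h p) \<phi>)"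
proof
  fix T show "mulX p (pb h \<phi>) T = pb h (mulX (h p) \<phi>) T"
    by (auto simp: mulX_def pb_def inj_on_insert) 
qed

lemma pb_id: "(\<And>p. p \<in> T \<Longrightarrow> h p = p) \<Longrightarrow> pb h \<phi> T = \<phi> T"
  by (simp add: pb_def inj_on_def)

lemma pb_add: "pb h (\<lambda>T. \<phi> T + \<psi> T) = (\<lambda>T. pb h \<phi> T + pb h \<psi> T)"
  by (auto simp: pb_def)

lemma pb_uminus: "pb h (\<lambda>T. - \<phi> T) = (\<lambda>T. - pb h \<phi> T)"
  by (auto simp: pb_def)

lemma pb_zero [simp]: "pb h (\<lambda>T. 0) = (\<lambda>T. 0)"
  by (auto simp: pb_def)

text \<open>Points may slide along their circles. If two points of \<open>T\<close> share a circle,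
  both sides are 0. Otherwise the sliding points stay on different circles and never collide, so
  they can be moved one at a time, each by one use of invariance; finiteness of \<open>T\<close> is
  what this induction runs on.\<close>

lemma Inv_pb_eq:
  assumes "finite T" "equiv UNIV R" "Inv UNIV R \<phi>" "\<And>p. p \<in> T \<Longrightarrow> (p, h p) \<in> R"
  shows "pb h \<phi> T = \<phi> T"
proof (cases "\<exists>p\<in>T. \<exists>q\<in>T. p \<noteq> q \<and> (p, q) \<in> R")
  case True
  then obtain p q where pq: "p \<in> T" "q \<in> T" "p \<noteq> q" "(p, q) \<in> R" by auto
  then have z: "\<phi> T = 0" using assms Inv_vanish by metis
  have "(h p, h q) \<in> R" using pq assms by (meson equivE symE transE)
  moreover have "inj_on h T \<Longrightarrow> h p \<noteq> h q" using pq by (meson inj_onD)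
  ultimately have "inj_on h T \<Longrightarrow> \<phi> (h ` T) = 0" using pq Inv_vanish[OF assms(3)] by (metis imageI)
  then show ?thesis using z by (simp add: pb_def)
next
  case False
  have sep: "p = q" if "p \<in> T" "q \<in> T" "(p, q) \<in> R" for p q using False that by auto
  have tr: "\<And>x y z. (x,y) \<in> R \<Longrightarrow> (y,z) \<in> R \<Longrightarrow> (x,z) \<in> R" and sy: "\<And>x y. (x,y) \<in> R \<Longrightarrow> (y,x) \<in> R"
    using assms(2) by (meson equivE symE transE)+
  have inj: "inj_on h T"
  proof (rule inj_onI)
    fix p q assume "p \<in> T" "q \<in> T" "h p = h q"
    then show "p = q" using sep assms(4) tr sy by metis
  qed
  have "\<phi> (h ` A \<union> (T - A)) = \<phi> T" if "finite A" "A \<subseteq> T" for A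
    using that
  proof (induction A rule: finite_induct)
    case empty then show ?case by simp
  next
    case (insert a A)
    let ?S = "h ` A \<union> (T - insert a A)"
    have a: "a \<in> T" "(a, h a) \<in> R" using insert assms(4) by auto
    have na: "a \<notin> ?S"
    proof
      assume "a \<in> ?S" then obtain b where "b \<in> A" "a = h b" using insert.hyps by auto
      then show False using sep[of b a] insert assms(4)[of b] a by auto
    qed
    have nh: "h a \<notin> ?S"
    proof
      assume "h a \<in> ?S"
      then consider b where "b \<in> A" "h a = h b" | "h a \<in> T" "h a \<noteq> a" by auto
      then show False
      proof cases
        case 1 then show ?thesis using inj insert a by (metis inj_onD insert_subset subsetD)
      next
        case 2 then show ?thesis using sep a by metis
      qed
    qed
    have "mulX a \<phi> ?S = mulX (h a) \<phi> ?S" using InvD[OF assms(3) a(2)] by simp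
    then have "\<phi> (insert a ?S) = \<phi> (insert (h a) ?S)" using na nh by (simp only: mulX_def if_False)
    moreover have "insert a ?S = h ` A \<union> (T - A)" using a insert.hyps by auto
    moreover have "insert (h a) ?S = h ` insert a A \<union> (T - insert a A)" by auto
    moreover have "\<phi> (h ` A \<union> (T - A)) = \<phi> T" using insert.IH insert.prems by blast
    ultimately show ?case by metis
  qed
  from this[OF assms(1)] inj show ?thesis by (simp add: pb_def)
qed

definition covers :: "'p set \<Rightarrow> 'p rel \<Rightarrow> bool" where
  "covers U R \<longleftrightarrow> (\<forall>p. \<exists>q\<in>U. (p, q) \<in> R)"

definition retr :: "'p set \<Rightarrow> 'p rel \<Rightarrow> 'p \<Rightarrow> 'p" where
  "retr U R p = (if p \<in> U then p else SOME q. q \<in> U \<and> (p, q) \<in> R)"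

text \<open>A function known only on subsets of \<open>U\<close> is extended by sliding every point
  along its circle into \<open>U\<close>.\<close>

definition ext :: "'p set \<Rightarrow> 'p rel \<Rightarrow> ('p, 'a::comm_ring_1) dual \<Rightarrow> ('p, 'a) dual" where
  "ext U R \<phi> = pb (retr U R) \<phi>"

lemma retr: assumes "covers U R" "equiv UNIV R" shows "retr U R p \<in> U" "(p, retr U R p) \<in> R"
proof -
  obtain q where q: "q \<in> U \<and> (p, q) \<in> R" using assms unfolding covers_def by blast
  have "(p, p) \<in> R" using assms by (meson UNIV_I equivE refl_onD)
  with someI[of "\<lambda>q. q \<in> U \<and> (p, q) \<in> R", OF q]
  show "retr U R p \<in> U" "(p, retr U R p) \<in> R" by (auto simp: retr_def)
qed

lemma ext_on: "T \<subseteq> U \<Longrightarrow> ext U R \<phi> T = \<phi> T"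
  by (auto simp: ext_def retr_def intro!: pb_id)

lemma Inv_ext:
  assumes "covers U R" "equiv UNIV R" "Inv U R \<phi>"
  shows "Inv UNIV R (ext U R \<phi>)"
proof (rule InvI)
  fix p q assume pq: "(p, q) \<in> R"
  let ?h = "retr U R"
  have h: "(?h p, ?h q) \<in> R" using pq retr(2)[OF assms(1,2)] assms(2) by (meson equivE symE transE)
  show "mulX p (ext U R \<phi>) = mulX q (ext U R \<phi>)"
  proof
    fix T
    have "?h ` T \<subseteq> U" using retr(1)[OF assms(1,2)] by auto
    then show "mulX p (ext U R \<phi>) T = mulX q (ext U R \<phi>) T"
      using assms(3) h retr(1)[OF assms(1,2)] unfolding ext_def mulX_pb by (auto simp: pb_def Inv_def)
  qed
qed

text \<open>Sliding all points into \<open>U\<close> recovers both functions from their values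
  there. This is how identities between cochains are later verified outside a disc only.\<close>

lemma Inv_det:
  assumes "covers U R" "equiv UNIV R" "Inv UNIV R \<phi>" "Inv UNIV R \<psi>"
    and "\<And>T. finite T \<Longrightarrow> T \<subseteq> U \<Longrightarrow> \<phi> T = \<psi> T" and "finite T"
  shows "\<phi> T = \<psi> T"
proof -
  let ?h = "retr U R"
  have "\<phi> T = pb ?h \<phi> T" using Inv_pb_eq[OF assms(6,2,3)] retr(2)[OF assms(1,2)] by metis
  also have "\<dots> = pb ?h \<psi> T"
  proof -
    have "?h ` T \<subseteq> U" using retr(1)[OF assms(1,2)] by auto
    then show ?thesis using assms(5)[of "?h ` T"] assms(6) by (simp add: pb_def)
  qed
  also have "\<dots> = \<psi> T" using Inv_pb_eq[OF assms(6,2,4)] retr(2)[OF assms(1,2)] by metis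
  finally show ?thesis .
qed

section \<open>Orbits of a permutation and transpositions\<close>

definition orb :: "('p \<Rightarrow> 'p) \<Rightarrow> 'p rel" where
  "orb f = {(x, y). \<exists>n. (f ^^ n) x = y}"

lemma equiv_orb:
  assumes "permutation f"
  shows "equiv UNIV (orb f)"
proof -
  obtain N where N: "N > 0" "f ^^ N = id" using permutation_is_nilpotent[OF assms] by auto
  have "refl (orb f)" by (auto simp: orb_def refl_on_def intro: exI[of _ 0])
  moreover have "sym (orb f)"
  proof (rule symI)
    fix x y assume "(x, y) \<in> orb f"
    then obtain n where n: "(f ^^ n) x = y" by (auto simp: orb_def)
    have "(f ^^ (N * n - n)) y = (f ^^ (N * n)) x"
    proof -
      have "N * n = (N * n - n) + n" using N by (simp add: Suc_leI)
      then have "f ^^ (N * n) = f ^^ (N * n - n) \<circ> f ^^ n" by (metis funpow_add)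
      then show ?thesis using n by simp
    qed
    also have "\<dots> = x" using N by (simp add: funpow_mult[symmetric])
    finally show "(y, x) \<in> orb f" by (auto simp: orb_def)
  qed
  moreover have "trans (orb f)"
  proof (rule transI)
    fix x y z assume "(x, y) \<in> orb f" "(y, z) \<in> orb f"
    then obtain n m where "(f ^^ n) x = y" "(f ^^ m) y = z" by (auto simp: orb_def)
    then have "(f ^^ (m + n)) x = z" by (simp add: funpow_add)
    then show "(x, z) \<in> orb f" by (auto simp: orb_def)
  qed
  ultimately show ?thesis by (simp add: equiv_def)
qed

lemma orb_step: "(x, f x) \<in> orb f"
  by (auto simp: orb_def intro: exI[of _ 1])

lemma orb_subset:
  assumes "equiv UNIV R" "\<And>x. (x, f x) \<in> R"
  shows "orb f \<subseteq> R"
proof -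
  have "(x, (f ^^ n) x) \<in> R" for x n
  proof (induction n)
    case 0 show ?case using assms(1) by (auto simp: equiv_def refl_on_def)
  next
    case (Suc n) then show ?case using assms by (auto simp: equiv_def intro: transD)
  qed
  then show ?thesis by (auto simp: orb_def)
qed

text \<open>As long as the path of \<open>b\<close> under \<open>f\<close> avoids \<open>a\<close>
  and \<open>b\<close>, the transposition does not act on it; only the first step, from
  \<open>a\<close>, is redirected.\<close>

lemma funpow_swap_eq:
  assumes "\<And>k. 0 < k \<Longrightarrow> k < n \<Longrightarrow> (f ^^ k) b \<noteq> a \<and> (f ^^ k) b \<noteq> b"
    and "0 < m" "m \<le> n"
  shows "((f \<circ> transpose a b) ^^ m) a = (f ^^ m) b"
  using assms(2,3)
proof (induction m)
  case (Suc m)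
  show ?case
  proof (cases "m = 0")
    case False
    then have "((f \<circ> transpose a b) ^^ m) a = (f ^^ m) b" using Suc.IH Suc.prems by linarith
    moreover have "(f ^^ m) b \<noteq> a \<and> (f ^^ m) b \<noteq> b" using assms(1)[of m] False Suc by simp
    moreover have "((f \<circ> transpose a b) ^^ Suc m) a = f (transpose a b (((f \<circ> transpose a b) ^^ m) a))"
      by (simp only: funpow.simps comp_apply)
    moreover have "(f ^^ Suc m) b = f ((f ^^ m) b)" by simp
    ultimately show ?thesis by (metis transpose_apply_other)
  qed simp
qed simp

text \<open>Take the first return of \<open>b\<close> to {a, b} under \<open>f\<close>. The new
  permutation started at \<open>a\<close> follows this path. If \<open>a\<close> and
  \<open>b\<close> shared an orbit, the return is at \<open>a\<close>, which closes up an orbit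
  without \<open>b\<close>; if not, it is at \<open>b\<close>, which links the two.\<close>

lemma orb_transpose_iff:
  assumes f: "permutation f" and ab: "a \<noteq> b"
  shows "(a, b) \<in> orb (f \<circ> transpose a b) \<longleftrightarrow> (a, b) \<notin> orb f"
proof -
  let ?g = "f \<circ> transpose a b"
  obtain N where N: "N > 0" "f ^^ N = id" using permutation_is_nilpotent[OF f] by auto
  define P where "P = (\<lambda>k. 0 < k \<and> ((f ^^ k) b = a \<or> (f ^^ k) b = b))"
  have ex: "P N" using N by (simp add: P_def)
  define m where "m = (LEAST k. P k)"
  have m: "P m" using ex by (auto simp: m_def intro: LeastI)
  have min: "\<not> P k" if "k < m" for k using that not_less_Least unfolding m_def by blast
  have g: "(?g ^^ k) a = (f ^^ k) b" if "0 < k" "k \<le> m" for k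
    by (rule funpow_swap_eq[OF _ that]) (use min in \<open>auto simp: P_def\<close>)
  have eqv: "equiv UNIV (orb f)" using equiv_orb[OF f] .
  show ?thesis
  proof (cases "(a, b) \<in> orb f")
    case True
    have "(f ^^ m) b = a"
    proof (rule ccontr)
      assume "(f ^^ m) b \<noteq> a"
      then have mb: "(f ^^ m) b = b" "0 < m" using m by (auto simp: P_def)
      from True eqv have "(b, a) \<in> orb f" by (auto simp: equiv_def dest: symD)
      then obtain n where n: "(f ^^ n) b = a" by (auto simp: orb_def)
      then have "(f ^^ (n mod m)) b = a" using mb(1) by (metis funpow_mod_eq)
      moreover have "n mod m \<noteq> 0" using calculation ab by (metis funpow_0)
      ultimately have "P (n mod m)" by (simp add: P_def)
      then show False using min mb(2) by simp
    qed
    then have ga: "(?g ^^ m) a = a" "0 < m" using g m by (auto simp: P_def)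
    have "(?g ^^ n) a \<noteq> b" for n
    proof
      assume "(?g ^^ n) a = b"
      then have nm: "(?g ^^ (n mod m)) a = b" using ga(1) by (metis funpow_mod_eq)
      show False
      proof (cases "n mod m = 0")
        case True then show ?thesis using nm ab by simp
      next
        case False
        then have "(f ^^ (n mod m)) b = b" using nm g[of "n mod m"] ga(2) by simp
        then have "P (n mod m)" using False by (simp add: P_def)
        then show ?thesis using min ga(2) by simp
      qed
    qed
    then show ?thesis using True by (auto simp: orb_def)
  next
    case False
    have "(f ^^ m) b \<noteq> a"
    proof
      assume "(f ^^ m) b = a"
      then have "(b, a) \<in> orb f" by (auto simp: orb_def)
      then show False using False eqv by (auto simp: equiv_def dest: symD)
    qed
    then have "(f ^^ m) b = b" "0 < m" using m by (auto simp: P_def)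
    then have "(?g ^^ m) a = b" using g by simp
    then show ?thesis using False by (auto simp: orb_def)
  qed
qed

lemma equiv_join:
  assumes "equiv UNIV R" shows "equiv UNIV (join R a b)"
proof -
  have tr: "\<And>x y z. (x,y) \<in> R \<Longrightarrow> (y,z) \<in> R \<Longrightarrow> (x,z) \<in> R" and sy: "\<And>x y. (x,y) \<in> R \<Longrightarrow> (y,x) \<in> R"
    and rf: "\<And>x. (x, x) \<in> R"
    using assms by (meson UNIV_I equivE refl_onD symE transE)+
  have "refl (join R a b)" using rf by (auto simp: refl_on_def join_def)
  moreover have "sym (join R a b)" using sy by (auto simp: sym_def join_def)
  moreover have "trans (join R a b)"
  proof (rule transI)
    fix x y z assume "(x, y) \<in> join R a b" "(y, z) \<in> join R a b"
    then have 1: "(x, y) \<in> R \<or> (x, a) \<in> R \<and> (b, y) \<in> R \<or> (x, b) \<in> R \<and> (a, y) \<in> R"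
      and 2: "(y, z) \<in> R \<or> (y, a) \<in> R \<and> (b, z) \<in> R \<or> (y, b) \<in> R \<and> (a, z) \<in> R"
      by (auto simp: join_def)
    from 1 2 have "(x, z) \<in> R \<or> (x, a) \<in> R \<and> (b, z) \<in> R \<or> (x, b) \<in> R \<and> (a, z) \<in> R"
      by (elim disjE conjE) (meson tr sy)+
    then show "(x, z) \<in> join R a b" by (auto simp: join_def)
  qed
  ultimately show ?thesis by (simp add: equiv_def)
qed

lemma orb_transpose_subset:
  assumes f: "permutation f"
  shows "orb (f \<circ> transpose a b) \<subseteq> join (orb f) a b"
proof (rule orb_subset)
  show "equiv UNIV (join (orb f) a b)" by (rule equiv_join[OF equiv_orb[OF f]])
  have rf: "\<And>x. (x, x) \<in> orb f" using equiv_orb[OF f] by (auto simp: equiv_def refl_on_def)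
  fix x show "(x, (f \<circ> transpose a b) x) \<in> join (orb f) a b"
    using orb_step[of _ f] rf by (cases "x = a"; cases "x = b") (auto simp: join_def)
qed

text \<open>A transposition joins two cycles or cuts one. Since it is its own inverse,
  \<open>orb_transpose_subset\<close> applies in both directions, and together with
  \<open>orb_transpose_iff\<close> it determines the new partition.\<close>

lemma saddle_orb:
  assumes f: "permutation f" and ab: "a \<noteq> b"
  shows "saddle (orb f) (orb (f \<circ> transpose a b)) a b"
proof -
  let ?g = "f \<circ> transpose a b"
  have g: "permutation ?g" using f by (simp add: permutation_compose permutation_swap_id)
  have gf: "?g \<circ> transpose a b = f" by (simp add: o_assoc[symmetric])
  have e: "equiv UNIV (orb f)" "equiv UNIV (orb ?g)" using equiv_orb f g by auto
  have s1: "orb ?g \<subseteq> join (orb f) a b" using orb_transpose_subset[OF f] .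
  have s2: "orb f \<subseteq> join (orb ?g) a b" using orb_transpose_subset[OF g, of a b] gf by simp
  have abs: "join R a b \<subseteq> S" if "equiv UNIV S" "R \<subseteq> S" "(a, b) \<in> S" for R S :: "'a rel"
  proof -
    have tr: "\<And>x y z. (x,y) \<in> S \<Longrightarrow> (y,z) \<in> S \<Longrightarrow> (x,z) \<in> S" and sy: "\<And>x y. (x,y) \<in> S \<Longrightarrow> (y,x) \<in> S"
      using that(1) by (meson equivE symE transE)+
    show ?thesis unfolding join_def using that(2) by (auto intro: tr[OF subsetD[OF that(2)] tr[OF that(3)]] tr[OF subsetD[OF that(2)] tr[OF sy[OF that(3)]]])
  qed
  have absorb: "join R a b = R" if "equiv UNIV R" "(a, b) \<in> R" for R :: "'a rel"
    using abs[OF that(1) order_refl that(2)] by (auto simp: join_def)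
  show ?thesis
  proof (cases "(a, b) \<in> orb f")
    case True
    then have n: "(a, b) \<notin> orb ?g" using orb_transpose_iff[OF f ab] by simp
    have "orb ?g \<subseteq> orb f" using s1 absorb[OF e(1) True] by simp
    then have "orb f = join (orb ?g) a b" using s2 abs[OF e(1) _ True] by blast
    then show ?thesis using n e by (simp add: saddle_def)
  next
    case False
    then have y: "(a, b) \<in> orb ?g" using orb_transpose_iff[OF f ab] by simp
    have "orb f \<subseteq> orb ?g" using s2 absorb[OF e(2) y] by simp
    then have "orb ?g = join (orb f) a b" using s1 abs[OF e(2) _ y] by blast
    then show ?thesis using False e by (simp add: saddle_def)
  qed
qed

lemma saddle_sym: "saddle R R' a b \<Longrightarrow> saddle R' R a b"
  by (auto simp: saddle_def)

section \<open>Planar states of closed three-braids\<close>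

type_synonym pt = "nat \<times> nat"

text \<open>A state is the list of its slices: \<open>0\<close> stands for three vertical strands, \<open>i > 0\<close> for the turn-backs
  that join positions \<open>i - 1\<close> and \<open>i\<close>.\<close>

definition slice_edges :: "nat \<Rightarrow> nat \<Rightarrow> pt rel" where
  "slice_edges t i = {((t, p), (t + 1, p)) | p. p < 3 \<and> (i = 0 \<or> p \<noteq> i - 1 \<and> p \<noteq> i)} \<union>
     (if i = 0 then {} else {((t, i - 1), (t, i)), ((t + 1, i - 1), (t + 1, i))})"

definition flat_edges :: "nat list \<Rightarrow> pt rel" where
  "flat_edges z = {((length z, p), (0, p)) | p. p < 3} \<union> (\<Union>t<length z. slice_edges t (z ! t))"

definition conn :: "nat list \<Rightarrow> pt rel" where
  "conn z = (flat_edges z \<union> (flat_edges z)\<inverse>)\<^sup>*"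

definition flat :: "nat list \<Rightarrow> bool" where
  "flat z \<longleftrightarrow> set z \<subseteq> {0, 1, 2}"

lemma equiv_conn: "equiv UNIV (conn z)"
  unfolding conn_def equiv_def
  by (simp add: refl_rtrancl sym_rtrancl trans_rtrancl sym_Un_converse)

lemma conn_refl [simp]: "(p, p) \<in> conn z"
  by (simp add: conn_def)

lemma conn_sym: "(p, q) \<in> conn z \<Longrightarrow> (q, p) \<in> conn z"
  using equiv_conn by (meson equivE symE)

lemma conn_trans: "(p, q) \<in> conn z \<Longrightarrow> (q, r) \<in> conn z \<Longrightarrow> (p, r) \<in> conn z"
  using equiv_conn by (meson equivE transE)

lemma conn_edge: "(p, q) \<in> flat_edges z \<Longrightarrow> (p, q) \<in> conn z"
  by (auto simp: conn_def)

lemma conn_hom: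
  assumes "(p, q) \<in> conn z" "\<And>x y. (x, y) \<in> flat_edges z \<Longrightarrow> (h x, h y) \<in> conn z'"
  shows "(h p, h q) \<in> conn z'"
  using assms(1) unfolding conn_def
proof (induction rule: rtrancl_induct)
  case base then show ?case by simp
next
  case (step y z)
  then have "(h y, h z) \<in> conn z'" using assms(2) conn_sym by blast
  then show ?case using step.IH conn_trans unfolding conn_def by blast
qed

text \<open>One step along a circle, to higher levels in columns 0 and 2 and to lower levels in
  column 1. Every turn-back joins column 1 to an outer column, so this orientation is consistent in
  all states simultaneously.\<close>

definition nxt :: "nat list \<Rightarrow> pt \<Rightarrow> pt" where
  "nxt z = (\<lambda>(t, p).
     if t > length z \<or> p \<ge> 3 then (t, p)
     else if p = 1 then
       (if t = 0 then (length z, 1) else if z ! (t - 1) = 0 then (t - 1, 1) else (t, 2 * (z ! (t - 1) - 1)))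
     else (if t = length z then (0, p) else if z ! t \<noteq> 0 \<and> p = 2 * (z ! t - 1) then (t, 1) else (t + 1, p)))"

definition prv :: "nat list \<Rightarrow> pt \<Rightarrow> pt" where
  "prv z = (\<lambda>(t, p).
     if t > length z \<or> p \<ge> 3 then (t, p)
     else if p = 1 then
       (if t = length z then (0, 1) else if z ! t = 0 then (t + 1, 1) else (t, 2 * (z ! t - 1)))
     else (if t = 0 then (length z, p) else if z ! (t - 1) \<noteq> 0 \<and> p = 2 * (z ! (t - 1) - 1) then (t, 1) else (t - 1, p)))"

lemma flat_nth: "flat z \<Longrightarrow> t < length z \<Longrightarrow> z ! t = 0 \<or> z ! t = 1 \<or> z ! t = 2"
  by (auto simp: flat_def dest!: nth_mem)

lemma prv_nxt: assumes "flat z" shows "prv z (nxt z x) = x"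
proof -
  obtain t p where x: "x = (t, p)" by (cases x)
  have f: "t < length z \<Longrightarrow> z ! t = 0 \<or> z ! t = 1 \<or> z ! t = 2"
    "0 < t \<Longrightarrow> t \<le> length z \<Longrightarrow> z ! (t - 1) = 0 \<or> z ! (t - 1) = 1 \<or> z ! (t - 1) = 2"
    using flat_nth[OF assms] by auto
  consider "t > length z \<or> p \<ge> 3" | "t \<le> length z" "p = 1" | "t \<le> length z" "p = 0 \<or> p = 2" by linarith
  then show ?thesis
  proof cases
    case 1 then show ?thesis by (auto simp: x nxt_def prv_def)
  next
    case 2
    show ?thesis
    proof (cases t)
      case 0 then show ?thesis using 2 by (simp add: x nxt_def prv_def)
    next
      case (Suc u)
      then show ?thesis using 2 f(2) by (auto simp: x nxt_def prv_def)
    qed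
  next
    case 3
    show ?thesis
    proof (cases "t = length z")
      case True then show ?thesis using 3 by (auto simp: x nxt_def prv_def)
    next
      case False
      then have "t < length z" using 3 by simp
      with f(1) consider "z ! t = 0" | "z ! t = 1" | "z ! t = 2" by metis
      then show ?thesis using 3 \<open>t < length z\<close>
        by cases (cases "t = 0"; auto simp: x nxt_def prv_def)+
    qed
  qed
qed

lemma permutation_nxt: assumes "flat z" shows "permutation (nxt z)"
proof -
  have "inj (nxt z)" using prv_nxt[OF assms] by (metis injI)
  moreover have fin: "finite {x. nxt z x \<noteq> x}"
  proof (rule finite_subset[of _ "{..length z} \<times> {..<3}"])
    have "nxt z x = x" if "x \<notin> {..length z} \<times> {..<3}" for x
      using that by (cases x) (auto simp: nxt_def)
    then show "{x. nxt z x \<noteq> x} \<subseteq> {..length z} \<times> {..<3}" by blast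
  qed simp
  moreover have "surj (nxt z)"
  proof -
    let ?S = "{..length z} \<times> {..<3::nat}"
    have "nxt z ` ?S \<subseteq> ?S"
    proof
      fix y assume "y \<in> nxt z ` ?S"
      then obtain t p where tp: "t \<le> length z" "p < 3" "y = nxt z (t, p)" by auto
      have f: "t < length z \<Longrightarrow> z ! t = 0 \<or> z ! t = 1 \<or> z ! t = 2"
        "0 < t \<Longrightarrow> z ! (t - 1) = 0 \<or> z ! (t - 1) = 1 \<or> z ! (t - 1) = 2"
        using flat_nth[OF assms] tp by auto
      show "y \<in> ?S"
      proof (cases "p = 1")
        case True then show ?thesis using tp f(2) by (auto simp: nxt_def)
      next
        case False then show ?thesis using tp by (auto simp: nxt_def)
      qed
    qed
    then have S: "nxt z ` ?S = ?S"
      using \<open>inj (nxt z)\<close> by (intro endo_inj_surj) (auto intro: inj_on_subset)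
    have "y \<in> range (nxt z)" for y
    proof (cases "y \<in> ?S")
      case True then show ?thesis using S by blast
    next
      case False then have "nxt z y = y" by (cases y) (auto simp: nxt_def)
      then show ?thesis by (metis rangeI)
    qed
    then show ?thesis by blast
  qed
  ultimately show ?thesis by (simp add: permutation bij_def)
qed

text \<open>The outer column that turn-back \<open>i\<close> joins to column 1; \<open>od i\<close>
  is the other outer column, whose strand runs past it.\<close>

abbreviation (input) ev :: "nat \<Rightarrow> nat" where "ev i \<equiv> 2 * (i - 1)"
abbreviation (input) od :: "nat \<Rightarrow> nat" where "od i \<equiv> 4 - 2 * i"

lemma conn_close: "p < 3 \<Longrightarrow> ((length z, p), (0, p)) \<in> conn z"
  by (rule conn_edge) (auto simp: flat_edges_def)

lemma conn_slice:
  assumes "t < length z" "e \<in> slice_edges t (z ! t)"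
  shows "e \<in> conn z"
  using assms by (cases e) (auto simp: flat_edges_def intro!: conn_edge)

lemma conn_blank: "t < length z \<Longrightarrow> z ! t = 0 \<Longrightarrow> p < 3 \<Longrightarrow> ((t, p), (Suc t, p)) \<in> conn z"
  by (rule conn_slice) (auto simp: slice_edges_def)

lemma conn_turn:
  assumes "t < length z" "z ! t = i" "i = 1 \<or> i = 2"
  shows "((t, ev i), (t, 1)) \<in> conn z" "((Suc t, ev i), (Suc t, 1)) \<in> conn z"
    "((t, od i), (Suc t, od i)) \<in> conn z"
proof -
  have "((t, i - 1), (t, i)) \<in> conn z" "((Suc t, i - 1), (Suc t, i)) \<in> conn z"
    using assms by (auto simp: slice_edges_def intro!: conn_slice)
  then show "((t, ev i), (t, 1)) \<in> conn z" "((Suc t, ev i), (Suc t, 1)) \<in> conn z"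
    using assms(3) conn_sym by auto
  show "((t, od i), (Suc t, od i)) \<in> conn z"
    using assms by (intro conn_slice) (auto simp: slice_edges_def)
qed

lemma slice_edge_cases:
  assumes "(x, y) \<in> slice_edges t i" "i = 0 \<or> i = 1 \<or> i = 2"
  obtains (blank) p where "i = 0" "p < 3" "x = (t, p)" "y = (Suc t, p)"
  | (low) "i = 1 \<or> i = 2" "{x, y} = {(t, ev i), (t, 1)}"
  | (up) "i = 1 \<or> i = 2" "{x, y} = {(Suc t, ev i), (Suc t, 1)}"
  | (thru) "i = 1 \<or> i = 2" "x = (t, od i)" "y = (Suc t, od i)"
proof -
  consider "i = 0" | "i = 1" | "i = 2" using assms(2) by metis
  then show thesis
  proof cases
    case 1 then show ?thesis using assms(1) blank by (auto simp: slice_edges_def)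
  next
    case 2
    then have "x = (t, 0) \<and> y = (t, 1) \<or> x = (Suc t, 0) \<and> y = (Suc t, 1) \<or> (\<exists>p. x = (t, p) \<and> y = (Suc t, p) \<and> p < 3 \<and> p \<noteq> 0 \<and> p \<noteq> 1)"
      using assms(1) by (auto simp: slice_edges_def)
    moreover have "p = 2" if "p < 3" "p \<noteq> 0" "p \<noteq> 1" for p :: nat using that by linarith
    ultimately show ?thesis using low up thru 2 by auto
  next
    case 3
    then have "x = (t, 1) \<and> y = (t, 2) \<or> x = (Suc t, 1) \<and> y = (Suc t, 2) \<or> (\<exists>p. x = (t, p) \<and> y = (Suc t, p) \<and> p < 3 \<and> p \<noteq> 1 \<and> p \<noteq> 2)"
      using assms(1) by (auto simp: slice_edges_def)
    moreover have "p = 0" if "p < 3" "p \<noteq> 1" "p \<noteq> 2" for p :: nat using that by linarith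
    ultimately show ?thesis using low up thru 3 by auto
  qed
qed

lemma flat_edge_cases:
  assumes "(x, y) \<in> flat_edges z" "flat z"
  obtains (close) p where "p < 3" "x = (length z, p)" "y = (0, p)"
  | (slice) t where "t < length z" "(x, y) \<in> slice_edges t (z ! t)"
  using assms(1) unfolding flat_edges_def by blast

lemma conn_eq_orb:
  assumes "flat z" shows "conn z = orb (nxt z)"
proof
  note e = equiv_orb[OF permutation_nxt[OF assms]]
  have st: "(x, nxt z x) \<in> orb (nxt z)" "(nxt z x, x) \<in> orb (nxt z)" for x
    using orb_step[of x "nxt z"] e by (auto simp: equiv_def dest: symD)
  have edge: "(x, y) \<in> orb (nxt z)" if "(x, y) \<in> flat_edges z" for x y
    using that assms
  proof (cases rule: flat_edge_cases)
    case (close p)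
    then have "nxt z x = y \<or> nxt z y = x" by (auto simp: nxt_def)
    then show ?thesis using st by metis
  next
    case (slice t)
    note zt = flat_nth[OF assms slice(1)]
    from slice(2) zt show ?thesis
    proof (cases rule: slice_edge_cases)
      case (blank p)
      then have "nxt z x = y \<or> nxt z y = x" using slice(1) by (cases "p = 1") (simp_all add: nxt_def)
      then show ?thesis using st by metis
    next
      case low
      then have "nxt z (t, ev (z ! t)) = (t, 1)" using slice(1) by (elim disjE) (simp_all add: nxt_def)
      then have "nxt z x = y \<or> nxt z y = x" using low by (auto simp: doubleton_eq_iff)
      then show ?thesis using st by metis
    next
      case up
      then have "nxt z (Suc t, 1) = (Suc t, ev (z ! t))" using slice(1) by (elim disjE) (simp_all add: nxt_def)
      then have "nxt z x = y \<or> nxt z y = x" using up by (auto simp: doubleton_eq_iff)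
      then show ?thesis using st by metis
    next
      case thru
      then have "nxt z x = y" using slice(1) by (elim disjE) (simp_all add: nxt_def)
      then show ?thesis using st by metis
    qed
  qed
  show "conn z \<subseteq> orb (nxt z)"
  proof (rule subrelI)
    fix p q assume "(p, q) \<in> conn z"
    then show "(p, q) \<in> orb (nxt z)" unfolding conn_def
    proof (induction rule: rtrancl_induct)
      case base then show ?case using e by (meson UNIV_I equivE refl_onD)
    next
      case (step y w)
      then have "(y, w) \<in> orb (nxt z)" using edge e by (meson UnE converseD equivE symE)
      then show ?case using step.IH e by (meson equivE transE)
    qed
  qed
  show "orb (nxt z) \<subseteq> conn z"
  proof (rule orb_subset[OF equiv_conn])
    fix x :: pt obtain t p where x: "x = (t, p)" by (cases x)
    consider "t > length z \<or> p \<ge> 3" | "t \<le> length z" "p = 1" | "t \<le> length z" "p = 0 \<or> p = 2" by linarith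
    then show "(x, nxt z x) \<in> conn z"
    proof cases
      case 1 then show ?thesis by (auto simp: x nxt_def)
    next
      case 2
      show ?thesis
      proof (cases t)
        case 0 then show ?thesis using 2 conn_sym[OF conn_close[of 1 z]] by (simp add: x nxt_def)
      next
        case (Suc u)
        then show ?thesis using 2 flat_nth[OF assms, of u] conn_blank[of u z 1] conn_turn(2)[of u z]
          by (auto simp: x nxt_def intro: conn_sym)
      qed
    next
      case 3
      show ?thesis
      proof (cases "t = length z")
        case True then show ?thesis using 3 conn_close[of p z] by (auto simp: x nxt_def)
      next
        case False
        then have t: "t < length z" using 3 by simp
        with flat_nth[OF assms t] consider "z ! t = 0" | "z ! t = 1" | "z ! t = 2" by metis
        then show ?thesis using 3 t conn_blank[of t z p] conn_turn[of t z]
          by cases (auto simp: x nxt_def)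
      qed
    qed
  qed
qed

lemma flat_append [simp]: "flat (y @ z) \<longleftrightarrow> flat y \<and> flat z"
  by (auto simp: flat_def)

lemma flat_Cons [simp]: "flat (i # z) \<longleftrightarrow> (i = 0 \<or> i = 1 \<or> i = 2) \<and> flat z"
  by (auto simp: flat_def)

lemma flat_Nil [simp]: "flat []"
  by (auto simp: flat_def)

text \<open>Exactly two points have their successor changed by the turn-back: the lower end of the
  rising strand and the upper end of the descending strand. Their successors are exchanged, which is
  the orientability of the saddle.\<close>

lemma nxt_turn:
  assumes "flat (y @ 0 # z)" "i = 1 \<or> i = 2"
  shows "nxt (y @ i # z) = nxt (y @ 0 # z) \<circ> transpose (length y, ev i) (Suc (length y), 1)"
proof
  fix x :: pt obtain t p where x: "x = (t, p)" by (cases x)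
  let ?a = "(length y, ev i)" and ?b = "(Suc (length y), 1::nat)"
  have ne: "?a \<noteq> ?b" by simp
  consider (a) "x = ?a" | (b) "x = ?b" | (o) "x \<noteq> ?a" "x \<noteq> ?b" by blast
  then show "nxt (y @ i # z) x = (nxt (y @ 0 # z) \<circ> transpose ?a ?b) x"
  proof cases
    case a then show ?thesis using assms(2) by (auto simp: nxt_def)
  next
    case b then show ?thesis using assms(2) by (auto simp: nxt_def)
  next
    case o
    have n: "(y @ i # z) ! k = (y @ 0 # z) ! k" if "k \<noteq> length y" for k
      using that by (auto simp: nth_append nth_Cons' split: if_splits)
    have "nxt (y @ i # z) x = nxt (y @ 0 # z) x"
    proof (cases "p = 1")
      case True
      then have "t = 0 \<or> t - 1 \<noteq> length y" using o x by auto
      then show ?thesis using True n[of "t - 1"] by (auto simp: x nxt_def)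
    next
      case False
      show ?thesis
      proof (cases "t = length y")
        case True then show ?thesis using False o assms(2) by (auto simp: x nxt_def)
      next
        case neq: False
        then show ?thesis using False n[of t] by (auto simp: x nxt_def)
      qed
    qed
    then show ?thesis using o by simp
  qed
qed

lemma saddle_conn0:
  assumes "flat (y @ 0 # z)" "i = 1 \<or> i = 2"
  shows "saddle (conn (y @ 0 # z)) (conn (y @ i # z)) (length y, ev i) (Suc (length y), 1)"
proof -
  have "flat (y @ i # z)" using assms by auto
  then show ?thesis
    unfolding conn_eq_orb[OF assms(1)] conn_eq_orb[OF \<open>flat (y @ i # z)\<close>] nxt_turn[OF assms]
    by (intro saddle_orb permutation_nxt assms) simp
qed

lemma saddle_conn:
  assumes "flat y" "flat z" "i = 1 \<or> i = 2" "s = 0 \<and> s' = i \<or> s = i \<and> s' = 0"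
  shows "saddle (conn (y @ s # z)) (conn (y @ s' # z)) (length y, ev i) (Suc (length y), 1)"
  using saddle_conn0[of y z i] assms saddle_sym by auto

section \<open>The dual differential, one crossing at a time\<close>

definition sl :: "int \<Rightarrow> bool \<Rightarrow> nat" where
  "sl x b = (if b = (x < 0) then 0 else nat \<bar>x\<bar>)"

fun zs :: "int list \<Rightarrow> bool list \<Rightarrow> nat list" where
  "zs (x # v) (b # r) = sl x b # zs v r"
| "zs _ _ = []"

lemma length_zs [simp]: "length r = length v \<Longrightarrow> length (zs v r) = length v"
  by (induction v r rule: zs.induct) auto

lemma valid_word_Cons [simp]: "valid_word 3 (x # v) \<longleftrightarrow> (nat \<bar>x\<bar> = 1 \<or> nat \<bar>x\<bar> = 2) \<and> valid_word 3 v"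
  by (auto simp: valid_word_def)

lemma valid_word_append [simp]: "valid_word n (u @ v) \<longleftrightarrow> valid_word n u \<and> valid_word n v"
  by (auto simp: valid_word_def)

lemma valid_word_Nil [simp]: "valid_word n []"
  by (auto simp: valid_word_def)

lemma flat_zs [simp]: "valid_word 3 v \<Longrightarrow> flat (zs v r)"
  by (induction v r rule: zs.induct) (auto simp: sl_def)

lemma sl_alt: "sl x False = 0 \<and> sl x True = nat \<bar>x\<bar> \<or> sl x False = nat \<bar>x\<bar> \<and> sl x True = 0"
  by (auto simp: sl_def)

type_synonym 'a cochain = "bool list \<Rightarrow> (pt, 'a) dual"

text \<open>The list \<open>f\<close> holds the slices of a fixed initial part of the diagram, so that one crossing after the other
  can be moved from the word \<open>v\<close> into \<open>f\<close>.\<close>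

fun dD :: "nat list \<Rightarrow> int list \<Rightarrow> 'a::comm_ring_1 cochain \<Rightarrow> 'a cochain" where
  "dD f (x # v) \<chi> (b # r) = (\<lambda>T. if b then - dD (f @ [sl x True]) v (\<lambda>r. \<chi> (True # r)) r T
     else dD (f @ [sl x False]) v (\<lambda>r. \<chi> (False # r)) r T +
       dsad (conn (f @ sl x True # zs v r)) (length f, ev (nat \<bar>x\<bar>)) (Suc (length f), 1) (\<chi> (True # r)) T)"
| "dD f _ \<chi> _ = (\<lambda>T. 0)"

definition coch :: "nat list \<Rightarrow> int list \<Rightarrow> 'a::comm_ring_1 cochain \<Rightarrow> bool" where
  "coch f v \<chi> \<longleftrightarrow> (\<forall>r. length r = length v \<longrightarrow> Inv UNIV (conn (f @ zs v r)) (\<chi> r))"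

lemma coch_Cons: "coch f (x # v) \<chi> \<longleftrightarrow>
    coch (f @ [sl x False]) v (\<lambda>r. \<chi> (False # r)) \<and> coch (f @ [sl x True]) v (\<lambda>r. \<chi> (True # r))"
proof -
  have "(\<forall>r. length r = length (x # v) \<longrightarrow> Q r) \<longleftrightarrow>
    (\<forall>r. length r = length v \<longrightarrow> Q (False # r)) \<and> (\<forall>r. length r = length v \<longrightarrow> Q (True # r))" for Q
  proof (safe, goal_cases)
    case (3 r) then show ?case by (cases r; cases "hd r") auto
  qed auto
  then show ?thesis unfolding coch_def by simp
qed

lemma coch_add: "coch f v \<chi> \<Longrightarrow> coch f v \<eta> \<Longrightarrow> coch f v (\<lambda>r T. \<chi> r T + \<eta> r T)"
  by (simp add: coch_def Inv_add)

lemma coch_uminus: "coch f v \<chi> \<Longrightarrow> coch f v (\<lambda>r T. - \<chi> r T)"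
  by (simp add: coch_def Inv_uminus)

lemma coch_zero [simp]: "coch f v (\<lambda>r T. 0)"
  by (simp add: coch_def)

lemma coch_mulX: "coch f v \<chi> \<Longrightarrow> coch f v (\<lambda>r. mulX p (\<chi> r))"
  by (simp add: coch_def Inv_mulX)

lemma dD_add: "dD f v (\<lambda>r T. \<chi> r T + \<eta> r T) r = (\<lambda>T. dD f v \<chi> r T + dD f v \<eta> r T)"
proof (induction f v \<chi> r arbitrary: \<eta> rule: dD.induct)
  case (1 f x v \<chi> b r)
  then show ?case by (cases b) (auto simp: dsad_add fun_eq_iff)
qed auto

lemma dD_uminus: "dD f v (\<lambda>r T. - \<chi> r T) r = (\<lambda>T. - dD f v \<chi> r T)"
  by (induction f v \<chi> r rule: dD.induct) (auto simp: dsad_uminus)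

lemma dD_zero [simp]: "dD f v (\<lambda>r T. 0) r = (\<lambda>T. 0)"
proof (induction v arbitrary: f r)
  case (Cons x v) then show ?case by (cases r) auto
qed simp

lemma dD_mulX: "dD f v (\<lambda>r. mulX p (\<chi> r)) r = mulX p (dD f v \<chi> r)"
proof (induction f v \<chi> r rule: dD.induct)
  case (1 f x v \<chi> b r)
  then show ?case
    by (cases b) (simp_all only: dD.simps if_True if_False simp_thms mulX_uminus mulX_add mulX_dsad)
qed auto

lemma Inv_dD:
  assumes "coch f v \<chi>" "flat f" "valid_word 3 v" "length r = length v"
  shows "Inv UNIV (conn (f @ zs v r)) (dD f v \<chi> r)"
  using assms
proof (induction f v \<chi> r rule: dD.induct)
  case (1 f x v \<chi> b r)
  have s: "sl x c = 0 \<or> sl x c = 1 \<or> sl x c = 2" for c using 1(4) 1(5) by (auto simp: sl_def)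
  have sad: "saddle (conn (f @ sl x False # zs v r)) (conn (f @ sl x True # zs v r)) (length f, ev (nat \<bar>x\<bar>)) (Suc (length f), 1)"
    using 1(4,5) sl_alt[of x] by (intro saddle_conn) auto
  show ?case
  proof (cases b)
    case True
    then show ?thesis using 1(1)[OF True] 1(3-6) s by (simp add: coch_Cons Inv_uminus)
  next
    case False
    have "Inv UNIV (conn (f @ sl x True # zs v r)) (\<chi> (True # r))"
      using 1(3,6) unfolding coch_def by (auto dest!: spec[of _ "True # r"])
    from Inv_dsad[OF sad this] have "Inv UNIV (conn (f @ zs (x # v) (b # r)))
      (dsad (conn (f @ sl x True # zs v r)) (length f, ev (nat \<bar>x\<bar>)) (Suc (length f), 1) (\<chi> (True # r)))"
      using False by simp
    moreover have "Inv UNIV (conn (f @ zs (x # v) (b # r))) (dD (f @ [sl x False]) v (\<lambda>r. \<chi> (False # r)) r)"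
      using False 1(2)[OF False] 1(3-6) s by (simp add: coch_Cons)
    ultimately show ?thesis using False by (simp only: dD.simps if_False Inv_add simp_thms)
  qed
qed auto

lemma coch_dD: "coch f v \<chi> \<Longrightarrow> flat f \<Longrightarrow> valid_word 3 v \<Longrightarrow> coch f v (dD f v \<chi>)"
  by (simp add: coch_def Inv_dD)

lemma dsad_local:
  assumes "\<And>T. T \<subseteq> U \<Longrightarrow> \<phi> T = \<psi> T" "a \<in> U" "b \<in> U" "(a, b) \<in> R \<longleftrightarrow> (a, b) \<in> R'" "T \<subseteq> U"
  shows "dsad R a b \<phi> T = dsad R' a b \<psi> T"
  using assms by (simp add: dsad_def mulX_def)

text \<open>All saddles of \<open>v\<close> take place at levels from \<open>length f1\<close> on,
  hence at points of \<open>U\<close>. So neither the values on sets leaving \<open>U\<close> nor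
  the connections of other points can influence the result there.\<close>

lemma dD_local:
  assumes "length f1 = length f2" "\<And>t p. t \<ge> length f1 \<Longrightarrow> p < 3 \<Longrightarrow> (t, p) \<in> U"
    and "\<And>y p q. flat y \<Longrightarrow> length y = length v \<Longrightarrow> p \<in> U \<Longrightarrow> q \<in> U \<Longrightarrow> (p, q) \<in> conn (f1 @ y) \<longleftrightarrow> (p, q) \<in> conn (f2 @ y)"
    and "\<And>r T. length r = length v \<Longrightarrow> T \<subseteq> U \<Longrightarrow> \<chi> r T = \<eta> r T"
    and "valid_word 3 v" "length r = length v" "T \<subseteq> U"
  shows "dD f1 v \<chi> r T = dD f2 v \<eta> r T"
  using assms
proof (induction f1 v \<chi> r arbitrary: f2 \<eta> rule: dD.induct)
  case (1 f x v \<chi> b r)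
  have s: "sl x c = 0 \<or> sl x c = 1 \<or> sl x c = 2" for c using 1(7) by (auto simp: sl_def)
  have len: "length r = length v" using 1(8) by simp
  have c: "(p, q) \<in> conn (f @ sl x c # y) \<longleftrightarrow> (p, q) \<in> conn (f2 @ sl x c # y)"
    if "flat y" "length y = length v" "p \<in> U" "q \<in> U" for c y p q
    using 1(5)[of "sl x c # y" p q] that s by simp
  have i: "dD (f @ [sl x c]) v (\<lambda>r. \<chi> (c # r)) r T = dD (f2 @ [sl x c]) v (\<lambda>r. \<eta> (c # r)) r T"
    if "b = c" for c
  proof (cases c)
    case True
    show ?thesis using that True 1(3-9) len c
      by (simp only:) (rule 1(1), auto)
  next
    case False
    show ?thesis using that False 1(3-9) len c
      by (simp only:) (rule 1(2), auto)
  qed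
  have "dsad (conn (f @ sl x True # zs v r)) (length f, ev (nat \<bar>x\<bar>)) (Suc (length f), 1) (\<chi> (True # r)) T
      = dsad (conn (f2 @ sl x True # zs v r)) (length f, ev (nat \<bar>x\<bar>)) (Suc (length f), 1) (\<eta> (True # r)) T"
    using 1(4,6,7,9) len c[of "zs v r" _ _ True]
    by (intro dsad_local[where U = U]) auto
  then show ?case using i[of True] i[of False] 1(3) by simp
qed auto

text \<open>A saddle in the fixed part commutes with each saddle of \<open>v\<close> by
  \<open>dsad_square\<close>. No sign appears, because \<open>dD f v\<close> counts only the
  1-resolutions of \<open>v\<close>; so such a saddle is a map of complexes.\<close>

lemma dD_dsad:
  assumes "coch (g @ s' # h) v \<chi>" "flat g" "flat h" "i = 1 \<or> i = 2" "s = 0 \<and> s' = i \<or> s = i \<and> s' = 0"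
    "valid_word 3 v" "length r = length v"
    and ab: "a = (length g, ev i)" "b = (Suc (length g), 1)"
  shows "dD (g @ s # h) v (\<lambda>r. dsad (conn (g @ s' # h @ zs v r)) a b (\<chi> r)) r =
    dsad (conn (g @ s' # h @ zs v r)) a b (dD (g @ s' # h) v \<chi> r)"
  using assms(1-7)
proof (induction v arbitrary: h \<chi> r)
  case (Cons x v)
  obtain c r' where r: "r = c # r'" "length r' = length v" using Cons.prems by (cases r) auto
  have s: "sl x c = 0 \<or> sl x c = 1 \<or> sl x c = 2" for c using Cons.prems by (auto simp: sl_def)
  have i: "dD (g @ s # h @ [sl x c]) v (\<lambda>r. dsad (conn (g @ s' # h @ sl x c # zs v r)) a b (\<chi> (c # r))) r' =
    dsad (conn (g @ s' # h @ sl x c # zs v r')) a b (dD (g @ s' # h @ [sl x c]) v (\<lambda>r. \<chi> (c # r)) r')" for c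
    using Cons.IH[of "h @ [sl x c]" "\<lambda>r. \<chi> (c # r)" r'] Cons.prems s[of c] r
    by (cases c) (simp_all add: coch_Cons)
  have val: "flat (zs v r')" "nat \<bar>x\<bar> = 1 \<or> nat \<bar>x\<bar> = 2" using Cons.prems by auto
  show ?case
  proof (cases c)
    case True
    then show ?thesis using i[of True] by (simp add: r dsad_uminus)
  next
    case False
    let ?c = "(length (g @ s # h), ev (nat \<bar>x\<bar>))" and ?d = "(Suc (length (g @ s # h)), 1::nat)"
    have "dsad (conn (g @ s' # h @ sl x False # zs v r')) a b (dsad (conn (g @ s' # h @ sl x True # zs v r')) ?c ?d (\<chi> (True # r'))) =
        dsad (conn (g @ s # h @ sl x True # zs v r')) ?c ?d (dsad (conn (g @ s' # h @ sl x True # zs v r')) a b (\<chi> (True # r')))"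
    proof (rule dsad_square)
      show "saddle (conn (g @ s # h @ sl x False # zs v r')) (conn (g @ s' # h @ sl x False # zs v r')) a b"
        "saddle (conn (g @ s # h @ sl x True # zs v r')) (conn (g @ s' # h @ sl x True # zs v r')) a b"
        unfolding ab by (rule saddle_conn; use Cons.prems s val in auto)+
      show "saddle (conn (g @ s # h @ sl x False # zs v r')) (conn (g @ s # h @ sl x True # zs v r')) ?c ?d"
        using saddle_conn[of "g @ s # h" "zs v r'" "nat \<bar>x\<bar>" "sl x False" "sl x True"] Cons.prems val sl_alt[of x]
        by auto
      show "saddle (conn (g @ s' # h @ sl x False # zs v r')) (conn (g @ s' # h @ sl x True # zs v r')) ?c ?d"
        using saddle_conn[of "g @ s' # h" "zs v r'" "nat \<bar>x\<bar>" "sl x False" "sl x True"] Cons.prems val sl_alt[of x]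
        by auto
      show "Inv UNIV (conn (g @ s' # h @ sl x True # zs v r')) (\<chi> (True # r'))"
        using Cons.prems(1) r by (auto simp: coch_def dest!: spec[of _ "True # r'"])
    qed
    then show ?thesis using i[of False] False by (simp add: r dsad_add)
  qed
qed auto

lemma dsad_pb:
  assumes "(a, b) \<in> R \<longleftrightarrow> (h a, h b) \<in> R'"
  shows "dsad R a b (pb h \<phi>) = pb h (dsad R' (h a) (h b) \<phi>)"
  using assms by (simp add: dsad_def mulX_pb pb_add)

lemma dD_pb:
  assumes "\<And>t p. p < 3 \<Longrightarrow> h (length f1 + t, p) = (length f2 + t, p)"
    and "\<And>y p q. flat y \<Longrightarrow> length y = length v \<Longrightarrow> (p, q) \<in> conn (f1 @ y) \<longleftrightarrow> (h p, h q) \<in> conn (f2 @ y)"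
    and "valid_word 3 v" "length r = length v"
  shows "dD f1 v (\<lambda>r. pb h (\<chi> r)) r = pb h (dD f2 v \<chi> r)"
  using assms
proof (induction v arbitrary: f1 f2 \<chi> r)
  case (Cons x v)
  obtain c r' where r: "r = c # r'" "length r' = length v" using Cons.prems by (cases r) auto
  have s: "sl x c = 0 \<or> sl x c = 1 \<or> sl x c = 2" for c using Cons.prems by (auto simp: sl_def)
  have co: "(p, q) \<in> conn (f1 @ sl x c # y) \<longleftrightarrow> (h p, h q) \<in> conn (f2 @ sl x c # y)"
    if "flat y" "length y = length v" for c y p q
    using Cons.prems(2)[of "sl x c # y" p q] that s by simp
  have i: "dD (f1 @ [sl x c]) v (\<lambda>r. pb h (\<chi> (c # r))) r' = pb h (dD (f2 @ [sl x c]) v (\<lambda>r. \<chi> (c # r)) r')" for c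
  proof (rule Cons.IH)
    fix t p :: nat assume "p < 3"
    then show "h (length (f1 @ [sl x c]) + t, p) = (length (f2 @ [sl x c]) + t, p)"
      using Cons.prems(1)[of p "Suc t"] by simp
  next
    fix y p q assume "flat y" "length y = length v"
    then show "(p, q) \<in> conn ((f1 @ [sl x c]) @ y) \<longleftrightarrow> (h p, h q) \<in> conn ((f2 @ [sl x c]) @ y)"
      using co by simp
  qed (use Cons.prems r in auto)
  have c: "h (length f1, ev (nat \<bar>x\<bar>)) = (length f2, ev (nat \<bar>x\<bar>))" "h (Suc (length f1), 1) = (Suc (length f2), 1)"
    using Cons.prems(1)[of "ev (nat \<bar>x\<bar>)" 0] Cons.prems(1)[of 1 1] Cons.prems(3) by auto
  have "dsad (conn (f1 @ sl x True # zs v r')) (length f1, ev (nat \<bar>x\<bar>)) (Suc (length f1), 1) (pb h (\<chi> (True # r'))) =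
     pb h (dsad (conn (f2 @ sl x True # zs v r')) (length f2, ev (nat \<bar>x\<bar>)) (Suc (length f2), 1) (\<chi> (True # r')))"
    using dsad_pb[OF co[of "zs v r'" "(length f1, ev (nat \<bar>x\<bar>))" "(Suc (length f1), 1)" True]] Cons.prems(3) r c
    by simp
  then show ?case using i[of True] i[of False] by (cases c) (simp_all add: r pb_uminus pb_add)
qed auto

section \<open>Local moves of flat words\<close>

text \<open>Reduces each of the following isotopies to the edges inside the disc; \<open>h\<close>
  says where the interior points go.\<close>

lemma conn_local_hom:
  assumes pq: "(p, q) \<in> conn (g @ l1 @ z)" and fl: "flat (g @ l1 @ z)" and len: "length l1 = length l2"
    and h: "\<And>t p. t \<le> length g \<or> t \<ge> length g + length l1 \<Longrightarrow> h (t, p) = (t, p)"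
    and loc: "\<And>t x y. t < length l1 \<Longrightarrow> (x, y) \<in> slice_edges (length g + t) (l1 ! t) \<Longrightarrow> (h x, h y) \<in> conn (g @ l2 @ z)"
  shows "(h p, h q) \<in> conn (g @ l2 @ z)"
proof (rule conn_hom[OF pq])
  fix x y assume "(x, y) \<in> flat_edges (g @ l1 @ z)"
  then show "(h x, h y) \<in> conn (g @ l2 @ z)" using fl
  proof (cases rule: flat_edge_cases)
    case (close p)
    then show ?thesis using h[of "length (g @ l1 @ z)" p] h[of 0 p] conn_close[of p "g @ l2 @ z"] len by simp
  next
    case (slice t)
    show ?thesis
    proof (cases "length g \<le> t \<and> t < length g + length l1")
      case True
      then have t: "t - length g < length l1" "length g + (t - length g) = t" by auto
      then have "(g @ l1 @ z) ! t = l1 ! (t - length g)" using True by (auto simp: nth_append)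
      then show ?thesis using loc[OF t(1), of x y] slice t(2) by simp
    next
      case False
      have lev: "fst x = t \<or> fst x = Suc t" "fst y = t \<or> fst y = Suc t"
        using slice(2) by (auto simp: slice_edges_def split: if_splits)
      have "h x = x" "h y = y" using h[of "fst x" "snd x"] h[of "fst y" "snd y"] lev False by auto
      moreover have "(g @ l2 @ z) ! t = (g @ l1 @ z) ! t" using False len by (auto simp: nth_append)
      ultimately show ?thesis using slice conn_slice[of t "g @ l2 @ z" "(x, y)"] len by simp
    qed
  qed
qed

lemma slice_rel:
  assumes "(x, y) \<in> slice_edges t i" "i = 0 \<or> i = 1 \<or> i = 2" "equiv UNIV R"
    and "\<And>p. i = 0 \<Longrightarrow> p < 3 \<Longrightarrow> (h (t, p), h (Suc t, p)) \<in> R"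
    and "i \<noteq> 0 \<Longrightarrow> (h (t, ev i), h (t, 1)) \<in> R" "i \<noteq> 0 \<Longrightarrow> (h (Suc t, ev i), h (Suc t, 1)) \<in> R"
    and "i \<noteq> 0 \<Longrightarrow> (h (t, od i), h (Suc t, od i)) \<in> R"
  shows "(h x, h y) \<in> R"
  using assms(1,2)
proof (cases rule: slice_edge_cases)
  case low then show ?thesis using assms(5) assms(3) by (auto simp: doubleton_eq_iff equiv_def dest: symD)
next
  case up then show ?thesis using assms(6) assms(3) by (auto simp: doubleton_eq_iff equiv_def dest: symD)
qed (use assms in auto)

text \<open>The class of a point turns chains of connections into equational reasoning.\<close>

definition cl :: "nat list \<Rightarrow> pt \<Rightarrow> pt set" where
  "cl z p = conn z `` {p}"

lemma conn_iff_cl: "(p, q) \<in> conn z \<longleftrightarrow> cl z p = cl z q"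
  unfolding cl_def using equiv_class_eq_iff[OF equiv_conn, of p q z] by simp

lemma cl_blank: "t < length z \<Longrightarrow> z ! t = 0 \<Longrightarrow> p < 3 \<Longrightarrow> cl z (Suc t, p) = cl z (t, p)"
  using conn_blank conn_iff_cl by metis

lemma cl_turn:
  assumes "t < length z" "z ! t = i" "i = 1 \<or> i = 2"
  shows "cl z (t, ev i) = cl z (t, 1)" "cl z (Suc t, ev i) = cl z (Suc t, 1)" "cl z (Suc t, od i) = cl z (t, od i)"
  using conn_turn[OF assms] conn_iff_cl by metis+

text \<open>The complement of the interior of a disc that occupies \<open>k\<close> slices from
  level \<open>m\<close> on; its two boundary levels count as outside.\<close>

abbreviation (input) outer :: "nat \<Rightarrow> nat \<Rightarrow> pt set" where
  "outer m k \<equiv> {(t, p). t \<le> m \<or> t \<ge> m + k \<or> p \<ge> 3}"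

lemma lt3: "p < 3 \<longleftrightarrow> p = 0 \<or> p = 1 \<or> p = (2::nat)"
  by auto

lemma conn_slide1:
  assumes "(p, q) \<in> conn (g @ 0 # i # z)" "flat g" "flat z" "i = 1 \<or> i = 2"
    and "p \<in> outer (length g) 2" "q \<in> outer (length g) 2"
  shows "(p, q) \<in> conn (g @ i # 0 # z)"
proof -
  let ?m = "length g" and ?z = "g @ i # 0 # z"
  let ?h = "\<lambda>(t, p). if t = Suc ?m \<and> p < 3 then (?m, p) else (t, p)"
  have F: "cl ?z (?m, ev i) = cl ?z (?m, 1)" "cl ?z (Suc ?m, ev i) = cl ?z (Suc ?m, 1)"
    "cl ?z (Suc ?m, od i) = cl ?z (?m, od i)"
    "p < 3 \<Longrightarrow> cl ?z (Suc (Suc ?m), p) = cl ?z (Suc ?m, p)" for p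
    using cl_turn[of ?m ?z i] cl_blank[of "Suc ?m" ?z p] assms(4) by (auto simp: nth_append)
  have "(?h p, ?h q) \<in> conn (g @ [i, 0] @ z)"
  proof (rule conn_local_hom[where ?l1.0 = "[0, i]" and h = ?h and p = p and q = q])
    fix t x y assume t: "t < length [0, i]" "(x, y) \<in> slice_edges (length g + t) ([0, i] ! t)"
    from t(1) consider "t = 0" | "t = 1" by fastforce
    then have "(?h x, ?h y) \<in> conn ?z"
    proof cases
      case 1 show ?thesis by (rule slice_rel[OF t(2) _ equiv_conn]) (use 1 F assms(4) in \<open>auto simp: conn_iff_cl\<close>)
    next
      case 2 show ?thesis by (rule slice_rel[OF t(2) _ equiv_conn]) (use 2 F assms(4) in \<open>auto simp: conn_iff_cl\<close>)
    qed
    then show "(?h x, ?h y) \<in> conn (g @ [i, 0] @ z)" by simp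
  qed (use assms in auto)
  then show ?thesis using assms(5,6) by (auto split: if_splits)
qed

lemma conn_slide2:
  assumes "(p, q) \<in> conn (g @ i # 0 # z)" "flat g" "flat z" "i = 1 \<or> i = 2"
    and "p \<in> outer (length g) 2" "q \<in> outer (length g) 2"
  shows "(p, q) \<in> conn (g @ 0 # i # z)"
proof -
  let ?m = "length g" and ?z = "g @ 0 # i # z"
  let ?h = "\<lambda>(t, p). if t = Suc ?m \<and> p < 3 then (Suc (Suc ?m), p) else (t, p)"
  have F: "cl ?z (Suc ?m, ev i) = cl ?z (Suc ?m, 1)" "cl ?z (Suc (Suc ?m), ev i) = cl ?z (Suc (Suc ?m), 1)"
    "cl ?z (Suc (Suc ?m), od i) = cl ?z (Suc ?m, od i)"
    "p < 3 \<Longrightarrow> cl ?z (Suc ?m, p) = cl ?z (?m, p)" for p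
    using cl_turn[of "Suc ?m" ?z i] cl_blank[of ?m ?z p] assms(4) by (auto simp: nth_append)
  have "(?h p, ?h q) \<in> conn (g @ [0, i] @ z)"
  proof (rule conn_local_hom[where ?l1.0 = "[i, 0]" and h = ?h and p = p and q = q])
    fix t x y assume t: "t < length [i, 0]" "(x, y) \<in> slice_edges (length g + t) ([i, 0] ! t)"
    from t(1) consider "t = 0" | "t = 1" by fastforce
    then have "(?h x, ?h y) \<in> conn ?z"
    proof cases
      case 1 show ?thesis by (rule slice_rel[OF t(2) _ equiv_conn]) (use 1 F assms(4) in \<open>auto simp: conn_iff_cl\<close>)
    next
      case 2 show ?thesis by (rule slice_rel[OF t(2) _ equiv_conn]) (use 2 F assms(4) in \<open>auto simp: conn_iff_cl\<close>)
    qed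
    then show "(?h x, ?h y) \<in> conn (g @ [0, i] @ z)" by simp
  qed (use assms in auto)
  then show ?thesis using assms(5,6) by (auto split: if_splits)
qed

lemma conn_slide:
  assumes "flat g" "flat z" "i = 1 \<or> i = 2" "p \<in> outer (length g) 2" "q \<in> outer (length g) 2"
  shows "(p, q) \<in> conn (g @ 0 # i # z) \<longleftrightarrow> (p, q) \<in> conn (g @ i # 0 # z)"
  using conn_slide1[of p q g i z] conn_slide2[of p q g i z] assms by (intro iffI) simp_all

lemma conn_circle1:
  assumes "(p, q) \<in> conn (g @ i # i # z)" "flat g" "flat z" "i = 1 \<or> i = 2"
    and "p \<in> outer (length g) 2" "q \<in> outer (length g) 2"
  shows "(p, q) \<in> conn (g @ 0 # i # z)"
proof -
  let ?m = "length g" and ?z = "g @ 0 # i # z"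
  let ?h = "\<lambda>(t, p). if t = Suc ?m \<and> p < 3 then (?m, p) else (t, p)"
  have F: "cl ?z (Suc ?m, ev i) = cl ?z (Suc ?m, 1)" "cl ?z (Suc (Suc ?m), ev i) = cl ?z (Suc (Suc ?m), 1)"
    "cl ?z (Suc (Suc ?m), od i) = cl ?z (Suc ?m, od i)"
    "p < 3 \<Longrightarrow> cl ?z (Suc ?m, p) = cl ?z (?m, p)" for p
    using cl_turn[of "Suc ?m" ?z i] cl_blank[of ?m ?z p] assms(4) by (auto simp: nth_append)
  have "(?h p, ?h q) \<in> conn (g @ [0, i] @ z)"
  proof (rule conn_local_hom[where ?l1.0 = "[i, i]" and h = ?h and p = p and q = q])
    fix t x y assume t: "t < length [i, i]" "(x, y) \<in> slice_edges (length g + t) ([i, i] ! t)"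
    from t(1) consider "t = 0" | "t = 1" by fastforce
    then have "(?h x, ?h y) \<in> conn ?z"
    proof cases
      case 1 show ?thesis by (rule slice_rel[OF t(2) _ equiv_conn]) (use 1 F assms(4) in \<open>auto simp: conn_iff_cl\<close>)
    next
      case 2 show ?thesis by (rule slice_rel[OF t(2) _ equiv_conn]) (use 2 F assms(4) in \<open>auto simp: conn_iff_cl\<close>)
    qed
    then show "(?h x, ?h y) \<in> conn (g @ [0, i] @ z)" by simp
  qed (use assms in auto)
  then show ?thesis using assms(5,6) by (auto split: if_splits)
qed

lemma conn_circle2:
  assumes "(p, q) \<in> conn (g @ 0 # i # z)" "flat g" "flat z" "i = 1 \<or> i = 2"
    and "p \<in> outer (length g) 2" "q \<in> outer (length g) 2"
  shows "(p, q) \<in> conn (g @ i # i # z)"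
proof -
  let ?m = "length g" and ?z = "g @ i # i # z"
  let ?h = "\<lambda>(t, p). if t = Suc ?m \<and> p < 3 then (?m, p) else (t, p)"
  have F: "cl ?z (?m, ev i) = cl ?z (?m, 1)" "cl ?z (Suc ?m, od i) = cl ?z (?m, od i)"
    "cl ?z (Suc (Suc ?m), ev i) = cl ?z (Suc (Suc ?m), 1)" "cl ?z (Suc (Suc ?m), od i) = cl ?z (Suc ?m, od i)"
    using cl_turn[of "Suc ?m" ?z i] cl_turn[of ?m ?z i] assms(4) by (auto simp: nth_append)
  have "(?h p, ?h q) \<in> conn (g @ [i, i] @ z)"
  proof (rule conn_local_hom[where ?l1.0 = "[0, i]" and h = ?h and p = p and q = q])
    fix t x y assume t: "t < length [0, i]" "(x, y) \<in> slice_edges (length g + t) ([0, i] ! t)"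
    from t(1) consider "t = 0" | "t = 1" by fastforce
    then have "(?h x, ?h y) \<in> conn ?z"
    proof cases
      case 1 show ?thesis by (rule slice_rel[OF t(2) _ equiv_conn]) (use 1 F assms(4) in \<open>auto simp: conn_iff_cl\<close>)
    next
      case 2 show ?thesis by (rule slice_rel[OF t(2) _ equiv_conn]) (use 2 F assms(4) in \<open>auto simp: conn_iff_cl\<close>)
    qed
    then show "(?h x, ?h y) \<in> conn (g @ [i, i] @ z)" by simp
  qed (use assms in auto)
  then show ?thesis using assms(5,6) by (auto split: if_splits)
qed

text \<open>Between two equal turn-backs lies a closed circle, invisible from outside; what remains
  is one turn-back. This is the Temperley-Lieb relation for the square of a generator.\<close>

lemma conn_circle:
  assumes "flat g" "flat z" "i = 1 \<or> i = 2" "p \<in> outer (length g) 2" "q \<in> outer (length g) 2"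
  shows "(p, q) \<in> conn (g @ i # i # z) \<longleftrightarrow> (p, q) \<in> conn (g @ 0 # i # z)"
  using conn_circle1[of p q g i z] conn_circle2[of p q g i z] assms by (intro iffI) simp_all

lemma conn_zigzag1:
  assumes "(p, q) \<in> conn (g @ i # j # i # z)" "flat g" "flat z" "i = 1 \<and> j = 2 \<or> i = 2 \<and> j = 1"
    and "p \<in> outer (length g) 3" "q \<in> outer (length g) 3"
  shows "(p, q) \<in> conn (g @ i # 0 # 0 # z)"
proof -
  let ?m = "length g" and ?z = "g @ i # 0 # 0 # z"
  \<comment> \<open>All six interior points lie on the single strand that enters in column
    \<open>od i\<close>, so one point of that strand can represent them all.\<close>
  let ?h = "\<lambda>(t, p). if (t = Suc ?m \<or> t = Suc (Suc ?m)) \<and> p < 3 then (?m, od i) else (t, p)"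
  have F: "cl ?z (?m, ev i) = cl ?z (?m, 1)" "cl ?z (Suc ?m, ev i) = cl ?z (Suc ?m, 1)"
    "cl ?z (Suc ?m, od i) = cl ?z (?m, od i)"
    "p < 3 \<Longrightarrow> cl ?z (Suc (Suc (Suc ?m)), p) = cl ?z (Suc ?m, p)" for p
    using cl_turn[of ?m ?z i] cl_blank[of "Suc ?m" ?z p] cl_blank[of "Suc (Suc ?m)" ?z p] assms(4) by (auto simp: nth_append)
  have "(?h p, ?h q) \<in> conn (g @ [i, 0, 0] @ z)"
  proof (rule conn_local_hom[where ?l1.0 = "[i, j, i]" and h = ?h and p = p and q = q])
    fix t x y assume t: "t < length [i, j, i]" "(x, y) \<in> slice_edges (length g + t) ([i, j, i] ! t)"
    from t(1) consider "t = 0" | "t = 1" | "t = 2" by fastforce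
    then have "(?h x, ?h y) \<in> conn ?z"
    proof cases
      case 1 show ?thesis by (rule slice_rel[OF t(2) _ equiv_conn]) (use 1 F assms(4) in \<open>auto simp: conn_iff_cl\<close>)
    next
      case 2 show ?thesis by (rule slice_rel[OF t(2) _ equiv_conn]) (use 2 F assms(4) in \<open>auto simp: conn_iff_cl\<close>)
    next
      case 3 show ?thesis by (rule slice_rel[OF t(2) _ equiv_conn]) (use 3 F assms(4) in \<open>auto simp: conn_iff_cl numeral_eq_Suc\<close>)
    qed
    then show "(?h x, ?h y) \<in> conn (g @ [i, 0, 0] @ z)" by simp
  qed (use assms in auto)
  then show ?thesis using assms(5,6) by (auto split: if_splits)
qed

lemma conn_zigzag2:
  assumes "(p, q) \<in> conn (g @ i # 0 # 0 # z)" "flat g" "flat z" "i = 1 \<and> j = 2 \<or> i = 2 \<and> j = 1"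
    and "p \<in> outer (length g) 3" "q \<in> outer (length g) 3"
  shows "(p, q) \<in> conn (g @ i # j # i # z)"
proof -
  let ?m = "length g" and ?z = "g @ i # j # i # z"
  let ?h = "\<lambda>(t, p). if (t = Suc ?m \<or> t = Suc (Suc ?m)) \<and> p < 3 then (Suc (Suc (Suc ?m)), p) else (t, p)"
  have F: "cl ?z (?m, ev i) = cl ?z (?m, 1)" "cl ?z (Suc (Suc (Suc ?m)), ev i) = cl ?z (Suc (Suc (Suc ?m)), 1)"
    "cl ?z (Suc (Suc (Suc ?m)), od i) = cl ?z (?m, od i)"
    using cl_turn[of ?m ?z i] cl_turn[of "Suc ?m" ?z j] cl_turn[of "Suc (Suc ?m)" ?z i] assms(4)
    by (auto simp: nth_append)
  have "(?h p, ?h q) \<in> conn (g @ [i, j, i] @ z)"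
  proof (rule conn_local_hom[where ?l1.0 = "[i, 0, 0]" and h = ?h and p = p and q = q])
    fix t x y assume t: "t < length [i, 0, 0]" "(x, y) \<in> slice_edges (length g + t) ([i, 0, 0] ! t)"
    from t(1) consider "t = 0" | "t = 1" | "t = 2" by fastforce
    then have "(?h x, ?h y) \<in> conn ?z"
    proof cases
      case 1 show ?thesis by (rule slice_rel[OF t(2) _ equiv_conn]) (use 1 F assms(4) in \<open>auto simp: conn_iff_cl\<close>)
    next
      case 2 show ?thesis by (rule slice_rel[OF t(2) _ equiv_conn]) (use 2 F assms(4) in \<open>auto simp: conn_iff_cl\<close>)
    next
      case 3 show ?thesis by (rule slice_rel[OF t(2) _ equiv_conn]) (use 3 F assms(4) in \<open>auto simp: conn_iff_cl numeral_eq_Suc\<close>)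
    qed
    then show "(?h x, ?h y) \<in> conn (g @ [i, j, i] @ z)" by simp
  qed (use assms in auto)
  then show ?thesis using assms(5,6) by (auto split: if_splits)
qed

text \<open>The other Temperley-Lieb relation: the strand that zigzags through the three turn-backs
  is pulled straight.\<close>

lemma conn_zigzag:
  assumes "flat g" "flat z" "i = 1 \<and> j = 2 \<or> i = 2 \<and> j = 1" "p \<in> outer (length g) 3" "q \<in> outer (length g) 3"
  shows "(p, q) \<in> conn (g @ i # j # i # z) \<longleftrightarrow> (p, q) \<in> conn (g @ i # 0 # 0 # z)"
  using conn_zigzag1[of p q g i j z] conn_zigzag2[of p q g i z j] assms by (intro iffI) simp_all

text \<open>Points in columns \<open>p \<ge> 3\<close> belong to no diagram; keeping them fixed makes the following maps
  reflect connectivity everywhere.\<close>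

definition drop_level :: "nat \<Rightarrow> pt \<Rightarrow> pt" where
  "drop_level n = (\<lambda>(t, p). if t \<le> n \<or> p \<ge> 3 then (t, p) else (t - 1, p))"

definition add_level :: "nat \<Rightarrow> pt \<Rightarrow> pt" where
  "add_level n = (\<lambda>(t, p). if t < n \<or> p \<ge> 3 then (t, p) else (Suc t, p))"

lemma slice_edges_lt3: "((t', p), (u, q)) \<in> slice_edges t i \<Longrightarrow> i = 0 \<or> i = 1 \<or> i = 2 \<Longrightarrow>
   p < 3 \<and> q < 3 \<and> (t' = t \<or> t' = Suc t) \<and> (u = t \<or> u = Suc t)"
  by (cases "i = 0") (auto simp: slice_edges_def)

lemma slice_edges_shift: "((t', p), (u, q)) \<in> slice_edges t i \<Longrightarrow> ((Suc t', p), (Suc u, q)) \<in> slice_edges (Suc t) i"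
  by (cases "i = 0") (auto simp: slice_edges_def)

lemma conn_drop:
  assumes "flat f" "flat z"
  shows "(p, q) \<in> conn (f @ 0 # z) \<longleftrightarrow> (drop_level (length f) p, drop_level (length f) q) \<in> conn (f @ z)"
    and "(p, q) \<in> conn (f @ z) \<longleftrightarrow> (add_level (length f) p, add_level (length f) q) \<in> conn (f @ 0 # z)"
proof -
  let ?n = "length f"
  have fl: "flat (f @ 0 # z)" "flat (f @ z)" using assms by auto
  have d: "(drop_level ?n x, drop_level ?n y) \<in> conn (f @ z)" if "(x, y) \<in> conn (f @ 0 # z)" for x y
  proof (rule conn_hom[OF that])
    fix x y assume "(x, y) \<in> flat_edges (f @ 0 # z)"
    then show "(drop_level ?n x, drop_level ?n y) \<in> conn (f @ z)" using fl(1)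
    proof (cases rule: flat_edge_cases)
      case (close p) then show ?thesis using conn_close[of p "f @ z"] by (auto simp: drop_level_def)
    next
      case (slice t)
      note zt = flat_nth[OF fl(1) slice(1)]
      obtain a p b q where xy: "x = (a, p)" "y = (b, q)" by (cases x, cases y)
      note lt = slice_edges_lt3[OF slice(2)[unfolded xy] zt]
      consider "t < ?n" | "t = ?n" | t' where "t = Suc (?n + t')" by (metis less_imp_Suc_add nat_neq_iff)
      then show ?thesis
      proof cases
        case 1
        then have "drop_level ?n x = x" "drop_level ?n y = y" using lt by (auto simp: xy drop_level_def)
        then show ?thesis using slice 1 conn_slice[of t "f @ z" "(x, y)"] by (simp add: nth_append)
      next
        case 2
        then show ?thesis using slice(2) by (auto simp: nth_append slice_edges_def drop_level_def)
      next
        case 3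
        have "((a - 1, p), (b - 1, q)) \<in> slice_edges (?n + t') (z ! t')"
          using slice(2) 3 by (auto simp: xy nth_append slice_edges_def split: if_splits)
        moreover have "drop_level ?n x = (a - 1, p)" "drop_level ?n y = (b - 1, q)" using lt 3 by (auto simp: xy drop_level_def)
        ultimately show ?thesis using slice(1) 3 conn_slice[of "?n + t'" "f @ z"] by (simp add: nth_append)
      qed
    qed
  qed
  have a: "(add_level ?n x, add_level ?n y) \<in> conn (f @ 0 # z)" if "(x, y) \<in> conn (f @ z)" for x y
  proof (rule conn_hom[OF that])
    have blank: "((?n, p), (Suc ?n, p)) \<in> conn (f @ 0 # z)" if "p < 3" for p
      using conn_blank[of ?n "f @ 0 # z" p] that by (simp add: nth_append)
    have up: "((a, p), add_level ?n (a, p)) \<in> conn (f @ 0 # z)" if "a \<le> ?n" for a p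
      using that blank[of p] by (auto simp: add_level_def)
    fix x y assume "(x, y) \<in> flat_edges (f @ z)"
    then show "(add_level ?n x, add_level ?n y) \<in> conn (f @ 0 # z)" using fl(2)
    proof (cases rule: flat_edge_cases)
      case (close p)
      have "((Suc (length (f @ z)), p), (0, p)) \<in> conn (f @ 0 # z)" using conn_close[of p "f @ 0 # z"] close by simp
      moreover have "add_level ?n x = (Suc (length (f @ z)), p)" using close by (simp add: add_level_def)
      ultimately show ?thesis using close(3) conn_trans[OF _ up[of 0 p]] by simp
    next
      case (slice t)
      note zt = flat_nth[OF fl(2) slice(1)]
      obtain a p b q where xy: "x = (a, p)" "y = (b, q)" by (cases x, cases y)
      note lt = slice_edges_lt3[OF slice(2)[unfolded xy] zt]
      show ?thesis
      proof (cases "t < ?n")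
        case True
        then have "(x, y) \<in> conn (f @ 0 # z)"
          using slice conn_slice[of t "f @ 0 # z" "(x, y)"] by (simp add: nth_append)
        moreover have "(x, add_level ?n x) \<in> conn (f @ 0 # z)" "(y, add_level ?n y) \<in> conn (f @ 0 # z)"
          using up[of a p] up[of b q] lt True by (auto simp: xy)
        ultimately show ?thesis by (meson conn_sym conn_trans)
      next
        case False
        then have "add_level ?n x = (Suc a, p)" "add_level ?n y = (Suc b, q)" using lt by (auto simp: xy add_level_def)
        moreover have "((Suc a, p), (Suc b, q)) \<in> conn (f @ 0 # z)"
          using slice(1) False slice_edges_shift[OF slice(2)[unfolded xy]]
          by (intro conn_slice[of "Suc t"]) (auto simp: nth_append Suc_diff_le)
        ultimately show ?thesis by simp
      qed
    qed
  qed
  have ad: "(p, add_level ?n (drop_level ?n p)) \<in> conn (f @ 0 # z)" for p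
  proof -
    obtain a b where p: "p = (a, b)" by (cases p)
    show ?thesis
    proof (cases "a = ?n \<and> b < 3")
      case True
      then show ?thesis using conn_blank[of ?n "f @ 0 # z" b] by (simp add: p add_level_def drop_level_def nth_append)
    next
      case False
      then have "add_level ?n (drop_level ?n p) = p" by (auto simp: p add_level_def drop_level_def)
      then show ?thesis by simp
    qed
  qed
  have da: "drop_level ?n (add_level ?n p) = p" for p by (cases p) (auto simp: add_level_def drop_level_def)
  show "(p, q) \<in> conn (f @ 0 # z) \<longleftrightarrow> (drop_level ?n p, drop_level ?n q) \<in> conn (f @ z)"
  proof
    assume "(drop_level ?n p, drop_level ?n q) \<in> conn (f @ z)"
    from a[OF this] show "(p, q) \<in> conn (f @ 0 # z)" by (meson ad conn_sym conn_trans)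
  qed (rule d)
  show "(p, q) \<in> conn (f @ z) \<longleftrightarrow> (add_level ?n p, add_level ?n q) \<in> conn (f @ 0 # z)"
    using d a da by metis
qed

section \<open>Restriction to the points outside a disc\<close>

lemma conn_closed:
  assumes "(p, q) \<in> conn z" "\<And>x y. (x, y) \<in> flat_edges z \<Longrightarrow> x \<in> C \<longleftrightarrow> y \<in> C"
  shows "p \<in> C \<longleftrightarrow> q \<in> C"
  using assms(1) unfolding conn_def
  by (induction rule: rtrancl_induct) (use assms(2) in blast)+

lemma covers2:
  assumes "s1 = 0 \<or> s2 = 0"
  shows "covers (outer (length g) 2) (conn (g @ s1 # s2 # y))"
proof -
  let ?z = "g @ s1 # s2 # y"
  have "\<exists>q\<in>outer (length g) 2. (p, q) \<in> conn ?z" for p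
  proof (cases "p \<in> outer (length g) 2")
    case True then show ?thesis by (intro bexI[of _ p]) auto
  next
    case False
    then obtain b where p: "p = (Suc (length g), b)" "b < 3" by (cases p) auto
    from assms show ?thesis
    proof
      assume "s1 = 0"
      then have "((length g, b), p) \<in> conn ?z" using conn_blank[of "length g" ?z b] p by (simp add: nth_append)
      then show ?thesis by (intro bexI[of _ "(length g, b)"]) (auto intro: conn_sym)
    next
      assume "s2 = 0"
      then have "(p, (Suc (Suc (length g)), b)) \<in> conn ?z" using conn_blank[of "Suc (length g)" ?z b] p by (simp add: nth_append)
      then show ?thesis by (intro bexI[of _ "(Suc (Suc (length g)), b)"]) auto
    qed
  qed
  then show ?thesis by (simp add: covers_def)
qed

text \<open>Two fixed parts that look alike from \<open>U\<close> under every completion. The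
  condition is not symmetric: every circle over \<open>f'\<close> must be seen from
  \<open>U\<close>, whereas \<open>f\<close> may contain a hidden one.\<close>

definition same_outer :: "pt set \<Rightarrow> nat list \<Rightarrow> nat list \<Rightarrow> bool" where
  "same_outer U f f' \<longleftrightarrow> length f = length f' \<and> flat f \<and> flat f' \<and>
     (\<forall>t p. length f \<le> t \<longrightarrow> p < 3 \<longrightarrow> (t, p) \<in> U) \<and>
     (\<forall>y. flat y \<longrightarrow> covers U (conn (f' @ y)) \<and>
       (\<forall>p\<in>U. \<forall>q\<in>U. (p, q) \<in> conn (f @ y) \<longleftrightarrow> (p, q) \<in> conn (f' @ y)))"

text \<open>If \<open>f\<close> has a hidden circle, sets inside \<open>U\<close> do not meet it, so
  the part of the cochain with that circle labelled \<open>v_+\<close> is what gets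
  transferred.\<close>

definition tr :: "pt set \<Rightarrow> nat list \<Rightarrow> int list \<Rightarrow> 'a::comm_ring_1 cochain \<Rightarrow> 'a cochain" where
  "tr U f v \<chi> = (\<lambda>r. ext U (conn (f @ zs v r)) (\<chi> r))"

lemma tr_on: "T \<subseteq> U \<Longrightarrow> tr U f v \<chi> r T = \<chi> r T"
  by (simp add: tr_def ext_on)

lemma coch_tr:
  assumes "same_outer U f f'" "coch f v \<chi>" "valid_word 3 v"
  shows "coch f' v (tr U f' v \<chi>)"
  unfolding coch_def tr_def
proof (intro allI impI)
  fix r :: "bool list" assume r: "length r = length v"
  have y: "flat (zs v r)" using assms(3) by simp
  have "Inv UNIV (conn (f @ zs v r)) (\<chi> r)" using assms(2) r by (simp add: coch_def)
  then have "Inv U (conn (f' @ zs v r)) (\<chi> r)" using assms(1) y unfolding same_outer_def Inv_def by auto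
  then show "Inv UNIV (conn (f' @ zs v r)) (ext U (conn (f' @ zs v r)) (\<chi> r))"
    using assms(1) y by (intro Inv_ext equiv_conn) (auto simp: same_outer_def)
qed

lemma dD_tr:
  assumes "same_outer U f f'" "valid_word 3 v" "length r = length v" "T \<subseteq> U"
  shows "dD f' v (tr U f' v \<chi>) r T = dD f v \<chi> r T"
  by (rule dD_local[where U = U]) (use assms in \<open>auto simp: same_outer_def tr_on\<close>)

lemma coch_det:
  assumes "covers U (conn (f @ zs v r))" "coch f v \<chi>" "coch f v \<eta>" "length r = length v"
    and "\<And>T. finite T \<Longrightarrow> T \<subseteq> U \<Longrightarrow> \<chi> r T = \<eta> r T" "finite T"
  shows "\<chi> r T = \<eta> r T"
  by (rule Inv_det[OF assms(1) equiv_conn]) (use assms in \<open>auto simp: coch_def\<close>)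

text \<open>The fixed part \<open>f\<close> is \<open>f'\<close> together with one closed circle
  through \<open>q\<close> that no point of \<open>U\<close> lies on.\<close>

definition circle_outer :: "pt set \<Rightarrow> pt \<Rightarrow> nat list \<Rightarrow> nat list \<Rightarrow> bool" where
  "circle_outer U q f f' \<longleftrightarrow> same_outer U f f' \<and> q \<notin> U \<and>
     (\<forall>y. flat y \<longrightarrow> covers (insert q U) (conn (f @ y)) \<and> (\<forall>p\<in>U. (p, q) \<notin> conn (f @ y)))"

text \<open>Over \<open>f\<close> the complex is the tensor product of the complex over
  \<open>f'\<close> with the rank two module of the extra circle; \<alpha> is the component for its
  label \<open>v_+\<close> and \<beta> the one for \<open>v_-\<close>.\<close>

definition circ :: "pt set \<Rightarrow> pt \<Rightarrow> nat list \<Rightarrow> int list \<Rightarrow> 'a::comm_ring_1 cochain \<Rightarrow> 'a cochain \<Rightarrow> 'a cochain" where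
  "circ U q f v \<alpha> \<beta> = (\<lambda>r. ext (insert q U) (conn (f @ zs v r)) (\<lambda>T. if q \<in> T then \<beta> r (T - {q}) else \<alpha> r T))"

lemma circ_plus: "T \<subseteq> U \<Longrightarrow> q \<notin> U \<Longrightarrow> circ U q f v \<alpha> \<beta> r T = \<alpha> r T"
  unfolding circ_def by (subst ext_on) auto

lemma circ_minus: "T \<subseteq> U \<Longrightarrow> q \<notin> U \<Longrightarrow> mulX q (circ U q f v \<alpha> \<beta> r) T = \<beta> r T"
  unfolding circ_def mulX_def by (subst ext_on) (auto simp: Diff_insert_absorb)

lemma coch_circ:
  assumes c: "circle_outer U q f f'" and ab: "coch f' v \<alpha>" "coch f' v \<beta>" and v: "valid_word 3 v"
  shows "coch f v (circ U q f v \<alpha> \<beta>)"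
  unfolding coch_def circ_def
proof (intro allI impI)
  fix r :: "bool list" assume r: "length r = length v"
  let ?R = "conn (f @ zs v r)" and ?R' = "conn (f' @ zs v r)"
  let ?\<phi> = "\<lambda>T. if q \<in> T then \<beta> r (T - {q}) else \<alpha> r T"
  have y: "flat (zs v r)" using v by simp
  have inv: "Inv UNIV ?R' (\<alpha> r)" "Inv UNIV ?R' (\<beta> r)" using ab r by (auto simp: coch_def)
  have sep1: "\<And>p. p \<in> U \<Longrightarrow> (p, q) \<notin> ?R"
    and eq: "\<And>p p'. p \<in> U \<Longrightarrow> p' \<in> U \<Longrightarrow> (p, p') \<in> ?R \<longleftrightarrow> (p, p') \<in> ?R'"
    using c y by (auto simp: circle_outer_def same_outer_def)
  have sep: "\<And>p. p \<in> U \<Longrightarrow> (p, q) \<notin> ?R \<and> (q, p) \<notin> ?R" using sep1 conn_sym by metis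
  have "Inv (insert q U) ?R ?\<phi>"
    unfolding Inv_def
  proof (intro ballI impI allI)
    fix p p' T assume p: "p \<in> insert q U" "p' \<in> insert q U" "(p, p') \<in> ?R" and T: "T \<subseteq> insert q U"
    show "mulX p ?\<phi> T = mulX p' ?\<phi> T"
    proof (cases "p = q \<or> p' = q")
      case True then have "p = p'" using p sep by (metis insertE)
      then show ?thesis by simp
    next
      case False
      then have pq: "p \<noteq> q" "p' \<noteq> q" "(p, p') \<in> ?R'" using p eq by auto
      have "mulX s ?\<phi> T = (if q \<in> T then mulX s (\<beta> r) (T - {q}) else mulX s (\<alpha> r) T)" if "s \<noteq> q" for s
        using that by (auto simp: mulX_def insert_Diff_if)
      then show ?thesis using pq InvD[OF inv(1) pq(3)] InvD[OF inv(2) pq(3)] by simp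
    qed
  qed
  then show "Inv UNIV ?R (ext (insert q U) ?R ?\<phi>)"
    using c y by (intro Inv_ext equiv_conn) (auto simp: circle_outer_def)
qed

text \<open>No crossing of \<open>v\<close> touches the extra circle, so the differential acts on
  the two components separately.\<close>

lemma dD_circle:
  assumes c: "circle_outer U q f f'" and v: "valid_word 3 v" "length r = length v" "T \<subseteq> U"
  shows "(\<And>r T. length r = length v \<Longrightarrow> T \<subseteq> U \<Longrightarrow> \<chi> r T = \<alpha> r T) \<Longrightarrow> dD f v \<chi> r T = dD f' v \<alpha> r T"
    and "(\<And>r T. length r = length v \<Longrightarrow> T \<subseteq> U \<Longrightarrow> mulX q (\<chi> r) T = \<beta> r T) \<Longrightarrow> mulX q (dD f v \<chi> r) T = dD f' v \<beta> r T"
proof -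
  have s: "same_outer U f f'" using c by (simp add: circle_outer_def)
  show "dD f v \<chi> r T = dD f' v \<alpha> r T" if "\<And>r T. length r = length v \<Longrightarrow> T \<subseteq> U \<Longrightarrow> \<chi> r T = \<alpha> r T"
    by (rule dD_local[where U = U]) (use s v that in \<open>auto simp: same_outer_def\<close>)
  show "mulX q (dD f v \<chi> r) T = dD f' v \<beta> r T"
    if "\<And>r T. length r = length v \<Longrightarrow> T \<subseteq> U \<Longrightarrow> mulX q (\<chi> r) T = \<beta> r T"
    unfolding dD_mulX[symmetric]
    by (rule dD_local[where U = U]) (use s v that in \<open>auto simp: same_outer_def\<close>)
qed

lemma circle_det:
  assumes c: "circle_outer U q f f'" and "coch f v \<chi>" "coch f v \<eta>" "valid_word 3 v" "length r = length v"
    and plus: "\<And>T. finite T \<Longrightarrow> T \<subseteq> U \<Longrightarrow> \<chi> r T = \<eta> r T"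
    and minus: "\<And>T. finite T \<Longrightarrow> T \<subseteq> U \<Longrightarrow> mulX q (\<chi> r) T = mulX q (\<eta> r) T"
    and "finite T"
  shows "\<chi> r T = \<eta> r T"
proof (rule coch_det[where U = "insert q U"])
  show "covers (insert q U) (conn (f @ zs v r))" using c assms(4) by (simp add: circle_outer_def)
  fix T assume T: "finite T" "T \<subseteq> insert q U"
  show "\<chi> r T = \<eta> r T"
  proof (cases "q \<in> T")
    case True
    then have "\<chi> r T = mulX q (\<chi> r) (T - {q})" "\<eta> r T = mulX q (\<eta> r) (T - {q})"
      by (auto simp: mulX_def insert_absorb)
    then show ?thesis using minus[of "T - {q}"] T by auto
  next
    case False then show ?thesis using plus T by auto
  qed
qed (use assms in auto)

lemma circle_outer2:
  assumes "flat g" "i = 1 \<or> i = 2"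
  shows "circle_outer (outer (length g) 2) (Suc (length g), 1) (g @ [i, i]) (g @ [0, i])"
    and "circle_outer (outer (length g) 2) (Suc (length g), 1) (g @ [i, i]) (g @ [i, 0])"
proof -
  let ?m = "length g" and ?U = "outer (length g) 2"
  have sep: "(p, (Suc ?m, 1)) \<notin> conn (g @ i # i # y)" if "p \<in> ?U" "flat y" for p y
  proof
    \<comment> \<open>The points of the small circle between the two turn-backs; no edge leaves this
      set.\<close>
    let ?C = "{(Suc ?m, ev i), (Suc ?m, 1)}" and ?z = "g @ i # i # y"
    assume "(p, (Suc ?m, 1)) \<in> conn ?z"
    then have "p \<in> ?C \<longleftrightarrow> (Suc ?m, 1) \<in> ?C"
    proof (rule conn_closed)
      have fl: "flat ?z" using assms that by auto
      fix x y' assume "(x, y') \<in> flat_edges ?z"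
      then show "x \<in> ?C \<longleftrightarrow> y' \<in> ?C" using fl
      proof (cases rule: flat_edge_cases)
        case (close p) then show ?thesis by auto
      next
        case (slice t)
        obtain a b c d where xy: "x = (a, b)" "y' = (c, d)" by (cases x, cases y')
        note lt = slice_edges_lt3[OF slice(2)[unfolded xy] flat_nth[OF fl slice(1)]]
        consider "t = ?m" | "t = Suc ?m" | "t \<noteq> ?m" "t \<noteq> Suc ?m" by blast
        then show ?thesis
        proof cases
          case 3 then show ?thesis using lt by (auto simp: xy)
        qed (use slice(2) assms(2) in \<open>auto simp: nth_append slice_edges_def\<close>)
      qed
    qed
    then show False using that assms(2) by auto
  qed
  have cov: "covers (insert (Suc ?m, 1) ?U) (conn (g @ i # i # y))" for y
  proof -
    let ?z = "g @ i # i # y"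
    have F: "((?m, od i), (Suc ?m, od i)) \<in> conn ?z" "((Suc ?m, ev i), (Suc ?m, 1)) \<in> conn ?z"
      using conn_turn[of ?m ?z i] assms(2) by (auto simp: nth_append)
    have "\<exists>q\<in>insert (Suc ?m, 1) ?U. (p, q) \<in> conn ?z" for p
    proof (cases "p \<in> insert (Suc ?m, 1) ?U")
      case True then show ?thesis by (intro bexI[of _ p]) auto
    next
      case False
      then obtain b where b: "p = (Suc ?m, b)" "b < 3" "b \<noteq> 1" by (cases p) auto
      then consider "b = ev i" | "b = od i" using assms(2) by fastforce
      then show ?thesis
      proof cases
        case 1 then show ?thesis using F(2) b by (intro bexI[of _ "(Suc ?m, 1)"]) auto
      next
        case 2 then show ?thesis using conn_sym[OF F(1)] b by (intro bexI[of _ "(?m, od i)"]) auto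
      qed
    qed
    then show ?thesis by (simp add: covers_def)
  qed
  show "circle_outer ?U (Suc ?m, 1) (g @ [i, i]) (g @ [0, i])"
    using assms sep cov conn_circle[OF assms(1) _ assms(2)] covers2[of 0 i g]
    by (auto simp: circle_outer_def same_outer_def)
  show "circle_outer ?U (Suc ?m, 1) (g @ [i, i]) (g @ [i, 0])"
    using assms sep cov conn_circle[OF assms(1) _ assms(2)] conn_slide[OF assms(1) _ assms(2)] covers2[of i 0 g]
    by (auto simp: circle_outer_def same_outer_def)
qed

section \<open>Detecting cocycles\<close>

definition cocycle :: "nat list \<Rightarrow> int list \<Rightarrow> 'a::comm_ring_1 cochain \<Rightarrow> bool" where
  "cocycle f v \<chi> \<longleftrightarrow> coch f v \<chi> \<and> (\<forall>r. length r = length v \<longrightarrow> (\<forall>T. finite T \<longrightarrow> dD f v \<chi> r T = 0))"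

text \<open>One point on each of the three circles of the oriented resolution, so the value there is
  the value on the all-\<open>v_-\<close> generator.\<close>

definition T0 :: "pt set" where
  "T0 = {(0, 0), (0, 1), (0, 2)}"

definition detected :: "'a::comm_ring_1 itself \<Rightarrow> nat list \<Rightarrow> int list \<Rightarrow> bool" where
  "detected R f v \<longleftrightarrow> (\<exists>\<chi> :: 'a cochain. cocycle f v \<chi> \<and> \<chi> (oriented_state v) T0 = 1)"

definition glue :: "'a::comm_ring_1 cochain \<Rightarrow> 'a cochain \<Rightarrow> 'a cochain" where
  "glue \<chi>0 \<chi>1 = (\<lambda>s. case s of [] \<Rightarrow> (\<lambda>T. 0) | b # r \<Rightarrow> if b then \<chi>1 r else \<chi>0 r)"

lemma glue_simps [simp]: "glue \<chi>0 \<chi>1 (True # r) = \<chi>1 r" "glue \<chi>0 \<chi>1 (False # r) = \<chi>0 r"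
  by (auto simp: glue_def)

lemma all_length_Cons: "(\<forall>r. length r = length (x # v) \<longrightarrow> Q r) \<longleftrightarrow>
    (\<forall>r. length r = length v \<longrightarrow> Q (False # r)) \<and> (\<forall>r. length r = length v \<longrightarrow> Q (True # r))"
proof (safe, goal_cases)
  case (3 r) then show ?case by (cases r; cases "hd r") auto
qed auto

text \<open>The complex of \<open>x # v\<close> is the mapping cone of the saddle between the
  complexes of the two resolutions of \<open>x\<close>.\<close>

lemma cocycle_Cons:
  "cocycle f (x # v) \<chi> \<longleftrightarrow>
     coch (f @ [sl x False]) v (\<lambda>r. \<chi> (False # r)) \<and> cocycle (f @ [sl x True]) v (\<lambda>r. \<chi> (True # r)) \<and>
     (\<forall>r T. length r = length v \<longrightarrow> finite T \<longrightarrow> dD (f @ [sl x False]) v (\<lambda>r. \<chi> (False # r)) r T +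
       dsad (conn (f @ sl x True # zs v r)) (length f, ev (nat \<bar>x\<bar>)) (Suc (length f), 1) (\<chi> (True # r)) T = 0)"
  unfolding cocycle_def coch_Cons all_length_Cons dD.simps if_True if_False neg_equal_0_iff_equal simp_thms by blast

lemma cocycleD: "cocycle f v \<chi> \<Longrightarrow> length r = length v \<Longrightarrow> finite T \<Longrightarrow> dD f v \<chi> r T = 0"
  by (simp add: cocycle_def)

lemma cocycle_coch: "cocycle f v \<chi> \<Longrightarrow> coch f v \<chi>"
  by (simp add: cocycle_def)

lemma dsad_finite_cong: "(\<And>T. finite T \<Longrightarrow> \<phi> T = \<psi> T) \<Longrightarrow> finite T \<Longrightarrow> dsad R a b \<phi> T = dsad R a b \<psi> T"
  by (simp add: dsad_def mulX_def)

lemma dsad_finite_zero: "(\<And>T. finite T \<Longrightarrow> \<phi> T = 0) \<Longrightarrow> finite T \<Longrightarrow> dsad R a b \<phi> T = 0"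
  by (simp add: dsad_def mulX_def)

lemma coch_dsad:
  assumes "coch (g @ s' # h) v \<chi>" "flat g" "flat h" "i = 1 \<or> i = 2" "s = 0 \<and> s' = i \<or> s = i \<and> s' = 0"
    "valid_word 3 v" "a = (length g, ev i)" "b = (Suc (length g), 1)"
  shows "coch (g @ s # h) v (\<lambda>r. dsad (conn (g @ s' # h @ zs v r)) a b (\<chi> r))"
  unfolding coch_def
proof (intro allI impI)
  fix r :: "bool list" assume "length r = length v"
  then have "Inv UNIV (conn (g @ s' # h @ zs v r)) (\<chi> r)" using assms(1) by (simp add: coch_def)
  moreover have "saddle (conn (g @ s # h @ zs v r)) (conn (g @ s' # h @ zs v r)) a b"
    unfolding assms(7,8) by (rule saddle_conn) (use assms in auto)
  ultimately show "Inv UNIV (conn ((g @ s # h) @ zs v r)) (dsad (conn (g @ s' # h @ zs v r)) a b (\<chi> r))"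
    using Inv_dsad by fastforce
qed

lemma cocycle_dsad:
  assumes "cocycle (g @ s' # h) v \<chi>" "flat g" "flat h" "i = 1 \<or> i = 2" "s = 0 \<and> s' = i \<or> s = i \<and> s' = 0"
    "valid_word 3 v" "a = (length g, ev i)" "b = (Suc (length g), 1)"
  shows "cocycle (g @ s # h) v (\<lambda>r. dsad (conn (g @ s' # h @ zs v r)) a b (\<chi> r))"
  unfolding cocycle_def
proof (intro conjI allI impI)
  show "coch (g @ s # h) v (\<lambda>r. dsad (conn (g @ s' # h @ zs v r)) a b (\<chi> r))"
    using assms by (intro coch_dsad) (auto simp: cocycle_def)
  fix r :: "bool list" and T :: "pt set" assume "length r = length v" "finite T"
  then show "dD (g @ s # h) v (\<lambda>r. dsad (conn (g @ s' # h @ zs v r)) a b (\<chi> r)) r T = 0"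
    by (simp only: dD_dsad[OF cocycle_coch[OF assms(1)] assms(2-6) _ assms(7,8)] cocycleD[OF assms(1)] dsad_finite_zero)
qed

lemma Inv_pb: "(\<And>p q. (p, q) \<in> R \<Longrightarrow> (h p, h q) \<in> R') \<Longrightarrow> Inv UNIV R' \<phi> \<Longrightarrow> Inv UNIV R (pb h \<phi>)"
  by (rule InvI) (simp only: mulX_pb, metis InvD)

lemma cocycle_pb:
  assumes "cocycle f2 v \<chi>" and h: "\<And>t p. p < 3 \<Longrightarrow> h (length f1 + t, p) = (length f2 + t, p)"
    and c: "\<And>y p q. flat y \<Longrightarrow> length y = length v \<Longrightarrow> (p, q) \<in> conn (f1 @ y) \<longleftrightarrow> (h p, h q) \<in> conn (f2 @ y)"
    and "valid_word 3 v"
  shows "cocycle f1 v (\<lambda>r. pb h (\<chi> r))"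
  unfolding cocycle_def coch_def
proof (intro conjI allI impI)
  fix r :: "bool list" assume r: "length r = length v"
  show "Inv UNIV (conn (f1 @ zs v r)) (pb h (\<chi> r))"
    using assms(1,4) c[of "zs v r"] r by (intro Inv_pb[where R' = "conn (f2 @ zs v r)"]) (auto simp: cocycle_def coch_def)
  fix T :: "pt set" assume "finite T"
  then show "dD f1 v (\<lambda>r. pb h (\<chi> r)) r T = 0"
    using cocycleD[OF assms(1) r] by (simp only: dD_pb[OF h c assms(4) r]) (simp add: pb_def)
qed

lemma cocycle_drop:
  assumes "cocycle f v \<chi>" "flat f" "valid_word 3 v"
  shows "cocycle (f @ [0]) v (\<lambda>r. pb (drop_level (length f)) (\<chi> r))"
proof (rule cocycle_pb[OF assms(1)])
  show "(p, q) \<in> conn ((f @ [0]) @ y) \<longleftrightarrow> (drop_level (length f) p, drop_level (length f) q) \<in> conn (f @ y)"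
    if "flat y" for y p q using conn_drop(1)[OF assms(2) that, of p q] by simp
qed (simp_all add: drop_level_def assms)

lemma cocycle_add:
  assumes "cocycle (f @ [0]) v \<chi>" "flat f" "valid_word 3 v"
  shows "cocycle f v (\<lambda>r. pb (add_level (length f)) (\<chi> r))"
proof (rule cocycle_pb[OF assms(1)])
  show "(p, q) \<in> conn (f @ y) \<longleftrightarrow> (add_level (length f) p, add_level (length f) q) \<in> conn ((f @ [0]) @ y)"
    if "flat y" for y p q using conn_drop(2)[OF assms(2) that, of p q] by simp
qed (simp_all add: add_level_def assms)

lemma length_oriented [simp]: "length (oriented_state v) = length v"
  by (simp add: oriented_state_def)

lemma detected_blank:
  assumes "flat f" "valid_word 3 v"
  shows "detected R (f @ [0]) v \<longleftrightarrow> detected R f v"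
proof
  assume "detected R f v"
  then obtain \<chi> :: "'a cochain" where \<chi>: "cocycle f v \<chi>" "\<chi> (oriented_state v) T0 = 1" by (auto simp: detected_def)
  have "pb (drop_level (length f)) (\<chi> (oriented_state v)) T0 = 1"
    using \<chi>(2) by (subst pb_id) (auto simp: T0_def drop_level_def)
  then show "detected R (f @ [0]) v" unfolding detected_def using cocycle_drop[OF \<chi>(1) assms] by blast
next
  assume "detected R (f @ [0]) v"
  then obtain \<chi> :: "'a cochain" where \<chi>: "cocycle (f @ [0]) v \<chi>" "\<chi> (oriented_state v) T0 = 1" by (auto simp: detected_def)
  have "pb (add_level (length f)) (\<chi> (oriented_state v)) T0 = \<chi> (oriented_state v) T0"
  proof (rule Inv_pb_eq[OF _ equiv_conn])
    show "Inv UNIV (conn ((f @ [0]) @ zs v (oriented_state v))) (\<chi> (oriented_state v))"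
      using \<chi>(1) by (simp add: cocycle_def coch_def)
    fix p assume "p \<in> T0"
    then obtain b where "p = (0, b)" "b < 3" by (auto simp: T0_def)
    then show "(p, add_level (length f) p) \<in> conn ((f @ [0]) @ zs v (oriented_state v))"
      using conn_blank[of 0 "(f @ [0]) @ zs v (oriented_state v)" b] by (cases f) (auto simp: add_level_def)
  qed (simp add: T0_def)
  then show "detected R f v" unfolding detected_def using \<chi>(2) cocycle_add[OF \<chi>(1) assms] by metis
qed

lemma oriented_Cons: "oriented_state (x # v) = (x < 0) # oriented_state v"
  by (simp add: oriented_state_def)

text \<open>The dual differential leads from the 1-resolution of \<open>x\<close> to its
  0-resolution, which is the oriented one for a positive crossing. Hence extension by 0 to the
  1-resolution keeps a cocycle closed.\<close>

lemma detected_insert_pos: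
  assumes "detected R [] v" "valid_word 3 (x # v)" "x > 0"
  shows "detected R [] (x # v)"
proof -
  have "detected R [0] v" using assms detected_blank[of "[]" v R] by simp
  then obtain \<chi> :: "'a cochain" where \<chi>: "cocycle [0] v \<chi>" "\<chi> (oriented_state v) T0 = 1"
    unfolding detected_def by blast
  have "cocycle [] (x # v) (glue \<chi> (\<lambda>r T. 0))"
    unfolding cocycle_Cons using \<chi>(1) assms(3) by (auto simp: sl_def cocycle_def)
  then show ?thesis using \<chi>(2) assms(3) unfolding detected_def
    by (intro exI[of _ "glue \<chi> (\<lambda>r T. 0)"]) (simp add: oriented_Cons)
qed

text \<open>Dually, a cocycle stays closed when restricted to the 1-resolution of \<open>x\<close>,
  and this is the oriented one for a negative crossing.\<close>

lemma detected_delete_neg: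
  assumes "detected R [] (x # v)" "valid_word 3 (x # v)" "x < 0"
  shows "detected R [] v"
proof -
  obtain \<chi> :: "'a cochain" where \<chi>: "cocycle [] (x # v) \<chi>" "\<chi> (oriented_state (x # v)) T0 = 1"
    using assms(1) by (auto simp: detected_def)
  have "cocycle [0] v (\<lambda>r. \<chi> (True # r))" using \<chi>(1) assms(3) by (simp add: cocycle_Cons sl_def)
  then have "detected R [0] v" unfolding detected_def using \<chi>(2) assms(3)
    by (intro exI[of _ "\<lambda>r. \<chi> (True # r)"]) (simp add: oriented_Cons)
  then show ?thesis using detected_blank[of "[]" v R] assms(2) by simp
qed

lemma sl_int [simp]: "i > 0 \<Longrightarrow> sl (int i) b = (if b then i else 0)"
    "i > 0 \<Longrightarrow> sl (- int i) b = (if b then 0 else i)"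
  by (auto simp: sl_def)

lemma cocycle_Cons2:
  "cocycle f (x1 # x2 # v) \<chi> \<longleftrightarrow>
     coch (f @ [sl x1 False, sl x2 False]) v (\<lambda>r. \<chi> (False # False # r)) \<and>
     coch (f @ [sl x1 False, sl x2 True]) v (\<lambda>r. \<chi> (False # True # r)) \<and>
     coch (f @ [sl x1 True, sl x2 False]) v (\<lambda>r. \<chi> (True # False # r)) \<and>
     coch (f @ [sl x1 True, sl x2 True]) v (\<lambda>r. \<chi> (True # True # r)) \<and>
     (\<forall>r. length r = length v \<longrightarrow> (\<forall>T. finite T \<longrightarrow>
        dD (f @ [sl x1 False, sl x2 False]) v (\<lambda>r. \<chi> (False # False # r)) r T +
          dsad (conn (f @ sl x1 False # sl x2 True # zs v r)) (Suc (length f), ev (nat \<bar>x2\<bar>)) (Suc (Suc (length f)), 1) (\<chi> (False # True # r)) T +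
          dsad (conn (f @ sl x1 True # sl x2 False # zs v r)) (length f, ev (nat \<bar>x1\<bar>)) (Suc (length f), 1) (\<chi> (True # False # r)) T = 0 \<and>
        dsad (conn (f @ sl x1 True # sl x2 True # zs v r)) (length f, ev (nat \<bar>x1\<bar>)) (Suc (length f), 1) (\<chi> (True # True # r)) T
          = dD (f @ [sl x1 False, sl x2 True]) v (\<lambda>r. \<chi> (False # True # r)) r T \<and>
        dD (f @ [sl x1 True, sl x2 False]) v (\<lambda>r. \<chi> (True # False # r)) r T +
          dsad (conn (f @ sl x1 True # sl x2 True # zs v r)) (Suc (length f), ev (nat \<bar>x2\<bar>)) (Suc (Suc (length f)), 1) (\<chi> (True # True # r)) T = 0 \<and>
        dD (f @ [sl x1 True, sl x2 True]) v (\<lambda>r. \<chi> (True # True # r)) r T = 0))"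
proof -
  have 1: "(- a + b = 0) = (b = a)" for a b :: 'a by (metis add.commute eq_neg_iff_add_eq_0 minus_minus neg_equal_iff_equal)
  show ?thesis
    unfolding cocycle_def coch_Cons all_length_Cons
    unfolding dD.simps if_True if_False neg_equal_0_iff_equal simp_thms
      append_assoc append_Cons append_Nil zs.simps length_append list.size add_Suc_right add_0_right One_nat_def 1
    by (simp only: all_conj_distrib imp_conjR conj_assoc)
qed

lemma dsad_connected: "(a, b) \<in> R \<Longrightarrow> dsad R a b \<phi> = \<phi>"
  by (simp add: dsad_def)

lemma conn_turn_blank:
  assumes "i = 1 \<or> i = 2"
  shows "((Suc (length g), ev i), (Suc (Suc (length g)), 1)) \<in> conn (g @ i # 0 # y)"
    and "((length g, ev i), (Suc (length g), 1)) \<in> conn (g @ 0 # i # y)"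
proof -
  let ?z = "g @ i # 0 # y" and ?n = "length g"
  have "((Suc ?n, ev i), (Suc ?n, 1)) \<in> conn ?z" "((Suc ?n, 1), (Suc (Suc ?n), 1)) \<in> conn ?z"
    using conn_turn(2)[of ?n ?z i] conn_blank[of "Suc ?n" ?z 1] assms by (auto simp: nth_append)
  then show "((Suc ?n, ev i), (Suc (Suc ?n), 1)) \<in> conn ?z" by (rule conn_trans)
  let ?z = "g @ 0 # i # y"
  have "((?n, ev i), (Suc ?n, ev i)) \<in> conn ?z" "((Suc ?n, ev i), (Suc ?n, 1)) \<in> conn ?z"
    using conn_turn(1)[of "Suc ?n" ?z i] conn_blank[of ?n ?z "ev i"] assms by (auto simp: nth_append)
  then show "((?n, ev i), (Suc ?n, 1)) \<in> conn ?z" by (rule conn_trans)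
qed

lemma zs_oriented: "zs v (oriented_state v) = replicate (length v) 0"
  by (induction v) (auto simp: oriented_state_def sl_def)

lemma conn_blanks:
  assumes "\<And>t. m \<le> t \<Longrightarrow> t < length z \<Longrightarrow> z ! t = 0" "m \<le> length z" "p < 3"
  shows "((m, p), (0, p)) \<in> conn z"
proof -
  have "((m, p), (m + k, p)) \<in> conn z" if "m + k \<le> length z" for k
    using that
  proof (induction k)
    case (Suc k)
    then have "((m + k, p), (Suc (m + k), p)) \<in> conn z" using assms by (intro conn_blank) auto
    then show ?case using Suc conn_trans by auto
  qed simp
  from this[of "length z - m"] assms(2) have "((m, p), (length z, p)) \<in> conn z" by simp
  then show ?thesis using conn_close[OF assms(3)] conn_trans by blast
qed

text \<open>In a state with a single turn-back the two strands it joins form one circle, on which the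
  label \<open>v_- \<otimes> v_-\<close> has no merge.\<close>

lemma dsad_T0:
  assumes "Inv UNIV (conn (replicate k 0 @ i # replicate l 0)) \<phi>" "i = 1 \<or> i = 2"
  shows "dsad (conn (replicate k 0 @ i # replicate l 0)) (k, ev i) (Suc k, 1) \<phi> T0 = 0"
proof -
  let ?z = "replicate k 0 @ i # replicate l 0"
  have n: "?z ! t = (if t = k then i else 0)" if "t < length ?z" for t
    using that by (auto simp: nth_append nth_Cons')
  have up: "((0, p), (t, p)) \<in> conn ?z" if "t \<le> k" "p < 3" for t p
    using that
  proof (induction t)
    case (Suc t)
    then have "((t, p), (Suc t, p)) \<in> conn ?z" using n by (intro conn_blank) auto
    then show ?case using Suc conn_trans by auto
  qed simp
  have e: "((k, ev i), (k, 1)) \<in> conn ?z" using conn_turn(1)[of k ?z i] assms(2) by (simp add: nth_append)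
  have 0: "((0, ev i), (0, 1)) \<in> conn ?z"
    using conn_trans[OF conn_trans[OF up[of k "ev i"] e] conn_sym[OF up[of k 1]]] assms(2) by auto
  have s: "((Suc k, 1), (0, 1)) \<in> conn ?z" using n by (intro conn_blanks) auto
  have "((k, ev i), (Suc k, 1)) \<in> conn ?z"
    using conn_trans[OF conn_trans[OF e conn_sym[OF up[of k 1]]] conn_sym[OF s]] by simp
  then have "dsad (conn ?z) (k, ev i) (Suc k, 1) \<phi> T0 = \<phi> T0" by (simp add: dsad_connected)
  also have "\<phi> T0 = 0"
    by (rule Inv_vanish[OF assms(1) 0]) (use assms(2) in \<open>auto simp: T0_def\<close>)
  finally show ?thesis .
qed

section \<open>Cancelling and inserting inverse letters\<close>

lemma detected_blank2: "valid_word 3 v \<Longrightarrow> detected R [0, 0] v \<longleftrightarrow> detected R [] v"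
  using detected_blank[of "[0]" v R] detected_blank[of "[]" v R] by simp

text \<open>The oriented state has slices \<open>[0, 0]\<close> and component
  \<open>\<chi>01\<close>, whose coboundary comes from \<open>\<chi>11\<close> over
  \<open>[i, 0]\<close>. The saddle from \<open>[i, i]\<close> to \<open>[i, 0]\<close> merges the
  small circle and is the identity on dual cochains, so the \<open>v_+\<close> part \<alpha> of
  \<open>\<chi>10\<close> has coboundary \<open>- \<chi>11\<close>. Adding the saddle image of
  \<alpha> closes \<open>\<chi>01\<close>, and by \<open>dsad_T0\<close> this does not change the
  value at \<open>T0\<close>.\<close>

lemma detected_cancel1:
  assumes "detected R [] (int i # - int i # v)" "i = 1 \<or> i = 2" "valid_word 3 v"
  shows "detected R [] v"
proof -
  obtain \<chi> :: "'a cochain" where \<chi>: "cocycle [] (int i # - int i # v) \<chi>"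
    and one: "\<chi> (oriented_state (int i # - int i # v)) T0 = 1"
    using assms(1) unfolding detected_def by blast
  have i0: "i > 0" "nat \<bar>int i\<bar> = i" "nat \<bar>- int i\<bar> = i" using assms(2) by auto
  let ?U = "outer 0 2"
  note E = \<chi>[unfolded cocycle_Cons2, simplified i0 sl_int[OF i0(1)] if_True if_False append_Nil list.size]
  define \<chi>01 where "\<chi>01 = (\<lambda>r. \<chi> (False # True # r))"
  define \<chi>10 where "\<chi>10 = (\<lambda>r. \<chi> (True # False # r))"
  define \<chi>11 where "\<chi>11 = (\<lambda>r. \<chi> (True # True # r))"
  have c: "coch [0, 0] v \<chi>01" "coch [i, i] v \<chi>10" "coch [i, 0] v \<chi>11"
    and E01: "\<And>r T. length r = length v \<Longrightarrow> finite T \<Longrightarrow> dsad (conn (i # 0 # zs v r)) (0, ev i) (Suc 0, 1) (\<chi>11 r) T = dD [0, 0] v \<chi>01 r T"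
    and E10: "\<And>r T. length r = length v \<Longrightarrow> finite T \<Longrightarrow> dD [i, i] v \<chi>10 r T + dsad (conn (i # 0 # zs v r)) (Suc 0, ev i) (Suc (Suc 0), 1) (\<chi>11 r) T = 0"
    using E unfolding \<chi>01_def \<chi>10_def \<chi>11_def by simp_all
  have co: "circle_outer ?U (Suc 0, 1) [i, i] [i, 0]" using circle_outer2(2)[of "[]" i] assms(2) by simp
  then have so: "same_outer ?U [i, i] [i, 0]" by (simp add: circle_outer_def)
  define \<alpha> where "\<alpha> = tr ?U [i, 0] v \<chi>10"
  have fi: "flat [i, 0]" using assms(2) by auto
  have \<alpha>: "coch [i, 0] v \<alpha>" unfolding \<alpha>_def by (rule coch_tr[OF so c(2) assms(3)])
  have D\<alpha>: "dD [i, 0] v \<alpha> r T = - \<chi>11 r T" if r: "length r = length v" and T: "finite T" for r T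
  proof (rule coch_det[where U = ?U and v = v and f = "[i, 0]"])
    show "covers ?U (conn ([i, 0] @ zs v r))" using covers2[of i 0 "[]"] by simp
    show "coch [i, 0] v (dD [i, 0] v \<alpha>)" using coch_dD[OF \<alpha> fi assms(3)] .
    show "coch [i, 0] v (\<lambda>r T. - \<chi>11 r T)" by (rule coch_uminus[OF c(3)])
    fix T assume T: "finite T" "T \<subseteq> ?U"
    have "dD [i, 0] v \<alpha> r T = dD [i, i] v \<chi>10 r T" unfolding \<alpha>_def by (rule dD_tr[OF so assms(3) r T(2)])
    moreover have "dsad (conn (i # 0 # zs v r)) (Suc 0, ev i) (Suc (Suc 0), 1) (\<chi>11 r) = \<chi>11 r"
      using conn_turn_blank(1)[OF assms(2), of "[]"] by (intro dsad_connected) simp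
    ultimately show "dD [i, 0] v \<alpha> r T = - \<chi>11 r T" using E10[OF r T(1)] by (simp add: eq_neg_iff_add_eq_0)
  qed (use r T in auto)
  define \<rho> where "\<rho> = (\<lambda>r T. \<chi>01 r T + dsad (conn (i # 0 # zs v r)) (0, ev i) (Suc 0, 1) (\<alpha> r) T)"
  have F: "dD [0, 0] v (\<lambda>r. dsad (conn (i # 0 # zs v r)) (0, ev i) (Suc 0, 1) (\<alpha> r)) r =
      dsad (conn (i # 0 # zs v r)) (0, ev i) (Suc 0, 1) (dD [i, 0] v \<alpha> r)" if "length r = length v" for r
    using dD_dsad[of "[]" i "[0]" v \<alpha> i 0 r] \<alpha> assms that by simp
  have G: "coch [0, 0] v (\<lambda>r. dsad (conn (i # 0 # zs v r)) (0, ev i) (Suc 0, 1) (\<alpha> r))"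
    using coch_dsad[of "[]" i "[0]" v \<alpha> i 0] \<alpha> assms by simp
  have "cocycle [0, 0] v \<rho>"
    unfolding cocycle_def
  proof (intro conjI allI impI)
    show "coch [0, 0] v \<rho>" unfolding \<rho>_def by (rule coch_add[OF c(1) G])
    fix r :: "bool list" and T :: "pt set" assume r: "length r = length v" and T: "finite T"
    have "dsad (conn (i # 0 # zs v r)) (0, ev i) (Suc 0, 1) (dD [i, 0] v \<alpha> r) T = dsad (conn (i # 0 # zs v r)) (0, ev i) (Suc 0, 1) (\<lambda>T. - \<chi>11 r T) T"
      by (rule dsad_finite_cong[OF D\<alpha>[OF r] T])
    then show "dD [0, 0] v \<rho> r T = 0"
      unfolding \<rho>_def dD_add F[OF r] using E01[OF r T] by (simp add: dsad_uminus)
  qed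
  moreover have "\<rho> (oriented_state v) T0 = 1"
  proof -
    have "Inv UNIV (conn (i # 0 # zs v (oriented_state v))) (\<alpha> (oriented_state v))"
      using \<alpha> by (simp add: coch_def)
    then have "dsad (conn (i # 0 # zs v (oriented_state v))) (0, ev i) (Suc 0, 1) (\<alpha> (oriented_state v)) T0 = 0"
      using dsad_T0[of 0 i "Suc (length v)"] assms(2) by (simp add: zs_oriented)
    then show ?thesis using one i0(1) by (simp add: \<rho>_def \<chi>01_def oriented_Cons)
  qed
  ultimately have "detected R [0, 0] v" unfolding detected_def by blast
  then show ?thesis by (simp add: detected_blank2[OF assms(3)])
qed

lemma detected_cancel2:
  assumes "detected R [] (- int i # int i # v)" "i = 1 \<or> i = 2" "valid_word 3 v"
  shows "detected R [] v"
proof -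
  obtain \<chi> :: "'a cochain" where \<chi>: "cocycle [] (- int i # int i # v) \<chi>"
    and one: "\<chi> (oriented_state (- int i # int i # v)) T0 = 1"
    using assms(1) unfolding detected_def by blast
  have i0: "i > 0" "nat \<bar>int i\<bar> = i" "nat \<bar>- int i\<bar> = i" using assms(2) by auto
  let ?U = "outer 0 2"
  note E = \<chi>[unfolded cocycle_Cons2, simplified i0 sl_int[OF i0(1)] if_True if_False append_Nil list.size]
  define \<chi>01 where "\<chi>01 = (\<lambda>r. \<chi> (False # True # r))"
  define \<chi>10 where "\<chi>10 = (\<lambda>r. \<chi> (True # False # r))"
  define \<chi>11 where "\<chi>11 = (\<lambda>r. \<chi> (True # True # r))"
  have c: "coch [0, 0] v \<chi>10" "coch [i, i] v \<chi>01" "coch [0, i] v \<chi>11"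
    and E01: "\<And>r T. length r = length v \<Longrightarrow> finite T \<Longrightarrow> dsad (conn (0 # i # zs v r)) (0, ev i) (Suc 0, 1) (\<chi>11 r) T = dD [i, i] v \<chi>01 r T"
    and E10: "\<And>r T. length r = length v \<Longrightarrow> finite T \<Longrightarrow> dD [0, 0] v \<chi>10 r T + dsad (conn (0 # i # zs v r)) (Suc 0, ev i) (Suc (Suc 0), 1) (\<chi>11 r) T = 0"
    using E unfolding \<chi>01_def \<chi>10_def \<chi>11_def by simp_all
  have co: "circle_outer ?U (Suc 0, 1) [i, i] [0, i]" using circle_outer2(1)[of "[]" i] assms(2) by simp
  then have so: "same_outer ?U [i, i] [0, i]" by (simp add: circle_outer_def)
  define \<alpha> where "\<alpha> = tr ?U [0, i] v \<chi>01"
  have fi: "flat [0, i]" using assms(2) by auto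
  have \<alpha>: "coch [0, i] v \<alpha>" unfolding \<alpha>_def by (rule coch_tr[OF so c(2) assms(3)])
  have D\<alpha>: "dD [0, i] v \<alpha> r T = \<chi>11 r T" if r: "length r = length v" and T: "finite T" for r T
  proof (rule coch_det[where U = ?U and v = v and f = "[0, i]"])
    show "covers ?U (conn ([0, i] @ zs v r))" using covers2[of 0 i "[]"] by simp
    show "coch [0, i] v (dD [0, i] v \<alpha>)" using coch_dD[OF \<alpha> fi assms(3)] .
    show "coch [0, i] v \<chi>11" by (rule c(3))
    fix T assume T: "finite T" "T \<subseteq> ?U"
    have "dD [0, i] v \<alpha> r T = dD [i, i] v \<chi>01 r T" unfolding \<alpha>_def by (rule dD_tr[OF so assms(3) r T(2)])
    moreover have "dsad (conn (0 # i # zs v r)) (0, ev i) (Suc 0, 1) (\<chi>11 r) = \<chi>11 r"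
      using conn_turn_blank(2)[OF assms(2), of "[]"] by (intro dsad_connected) simp
    ultimately show "dD [0, i] v \<alpha> r T = \<chi>11 r T" using E01[OF r T(1)] by simp
  qed (use r T in auto)
  let ?S = "\<lambda>r. dsad (conn (0 # i # zs v r)) (Suc 0, ev i) (Suc (Suc 0), 1)"
  define \<rho> where "\<rho> = (\<lambda>r T. \<chi>10 r T + ?S r (\<alpha> r) T)"
  have F: "dD [0, 0] v (\<lambda>r. ?S r (\<alpha> r)) r = ?S r (dD [0, i] v \<alpha> r)" if "length r = length v" for r
    using dD_dsad[of "[0]" i "[]" v \<alpha> i 0 r] \<alpha> assms that by simp
  have G: "coch [0, 0] v (\<lambda>r. ?S r (\<alpha> r))"
    using coch_dsad[of "[0]" i "[]" v \<alpha> i 0] \<alpha> assms by simp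
  have "cocycle [0, 0] v \<rho>"
    unfolding cocycle_def
  proof (intro conjI allI impI)
    show "coch [0, 0] v \<rho>" unfolding \<rho>_def by (rule coch_add[OF c(1) G])
    fix r :: "bool list" and T :: "pt set" assume r: "length r = length v" and T: "finite T"
    have "?S r (dD [0, i] v \<alpha> r) T = ?S r (\<chi>11 r) T"
      by (rule dsad_finite_cong[OF D\<alpha>[OF r] T])
    then show "dD [0, 0] v \<rho> r T = 0"
      unfolding \<rho>_def dD_add F[OF r] using E10[OF r T] by simp
  qed
  moreover have "\<rho> (oriented_state v) T0 = 1"
  proof -
    have "Inv UNIV (conn (0 # i # zs v (oriented_state v))) (\<alpha> (oriented_state v))"
      using \<alpha> by (simp add: coch_def)
    then have "?S (oriented_state v) (\<alpha> (oriented_state v)) T0 = 0"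
      using dsad_T0[of "Suc 0" i "length v"] assms(2) by (simp add: zs_oriented)
    then show ?thesis using one i0(1) by (simp add: \<rho>_def \<chi>10_def oriented_Cons)
  qed
  ultimately have "detected R [0, 0] v" unfolding detected_def by blast
  then show ?thesis by (simp add: detected_blank2[OF assms(3)])
qed

lemma cocycle_circ:
  assumes c: "circle_outer U q f f'" and \<beta>: "cocycle f' v \<beta>" and v: "valid_word 3 v"
  shows "cocycle f v (circ U q f v (\<lambda>r T. 0) \<beta>)"
  unfolding cocycle_def
proof (intro conjI allI impI)
  let ?\<chi> = "circ U q f v (\<lambda>r T. 0) \<beta>"
  have fl: "flat f" and q: "q \<notin> U" using c by (auto simp: circle_outer_def same_outer_def)
  show co: "coch f v ?\<chi>" by (rule coch_circ[OF c _ cocycle_coch[OF \<beta>] v]) simp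
  fix r :: "bool list" and T :: "pt set" assume r: "length r = length v" and T: "finite T"
  show "dD f v ?\<chi> r T = 0"
  proof (rule circle_det[OF c coch_dD[OF co fl v] coch_zero v r _ _ T])
    fix T assume T: "finite T" "T \<subseteq> U"
    have "dD f v ?\<chi> r T = dD f' v (\<lambda>r T. 0) r T"
      by (rule dD_circle(1)[OF c v r T(2)]) (rule circ_plus[OF _ q])
    then show "dD f v ?\<chi> r T = 0" by simp
    have "mulX q (dD f v ?\<chi> r) T = dD f' v \<beta> r T"
      by (rule dD_circle(2)[OF c v r T(2)]) (rule circ_minus[OF _ q])
    then show "mulX q (dD f v ?\<chi> r) T = mulX q (\<lambda>T. 0) T" by (simp add: cocycleD[OF \<beta> r T(1)])
  qed
qed

text \<open>Besides \<rho> in the oriented state only the state with the small circle is used. Its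
  cochain is 0 for the label \<open>v_+\<close>, and for \<open>v_-\<close> it is the negative
  saddle image of \<rho>. Splitting off the circle reads off just the \<open>v_-\<close> component
  there, so the two contributions over \<open>[0, i]\<close> cancel.\<close>

lemma detected_insert1:
  assumes "detected R [] v" "i = 1 \<or> i = 2" "valid_word 3 v"
  shows "detected R [] (int i # - int i # v)"
proof -
  have "detected R [0, 0] v" using assms by (simp add: detected_blank2)
  then obtain \<rho> :: "'a cochain" where \<rho>: "cocycle [0, 0] v \<rho>" "\<rho> (oriented_state v) T0 = 1"
    unfolding detected_def by blast
  have i0: "i > 0" "nat \<bar>int i\<bar> = i" "nat \<bar>- int i\<bar> = i" using assms(2) by auto
  let ?U = "outer 0 2" and ?q = "(Suc 0, 1) :: pt"
  let ?S = "\<lambda>r. dsad (conn (0 # 0 # zs v r)) (Suc 0, ev i) (Suc (Suc 0), 1)"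
  have co: "circle_outer ?U ?q [i, i] [0, i]" using circle_outer2(1)[of "[]" i] assms(2) by simp
  define \<beta> where "\<beta> = (\<lambda>r T. - ?S r (\<rho> r) T)"
  have S: "cocycle [0, i] v (\<lambda>r. ?S r (\<rho> r))"
    using cocycle_dsad[of "[0]" 0 "[]" v \<rho> i i] \<rho>(1) assms by simp
  then have \<beta>: "cocycle [0, i] v \<beta>" unfolding \<beta>_def cocycle_def by (simp add: dD_uminus coch_uminus)
  define \<chi>10 where "\<chi>10 = circ ?U ?q [i, i] v (\<lambda>r T. 0) \<beta>"
  have \<chi>10: "cocycle [i, i] v \<chi>10" unfolding \<chi>10_def by (rule cocycle_circ[OF co \<beta> assms(3)])
  let ?\<chi> = "glue (glue (\<lambda>r T. 0) \<rho>) (glue \<chi>10 (\<lambda>r T. 0))"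
  let ?V = "\<lambda>r. dsad (conn (i # i # zs v r)) (0, ev i) (Suc 0, 1)"
  have key: "?S r (\<rho> r) T + ?V r (\<chi>10 r) T = 0" if r: "length r = length v" and T: "finite T" for r T
  proof (rule coch_det[where U = ?U and f = "[0, i]" and v = v and \<chi> = "\<lambda>r T. ?S r (\<rho> r) T + ?V r (\<chi>10 r) T" and \<eta> = "\<lambda>r T. 0"])
    show "covers ?U (conn ([0, i] @ zs v r))" using covers2[of 0 i "[]"] by simp
    have "coch [0, i] v (\<lambda>r. ?V r (\<chi>10 r))"
      using coch_dsad[of "[]" i "[i]" v \<chi>10 i 0] cocycle_coch[OF \<chi>10] assms by auto
    then show "coch [0, i] v (\<lambda>r T. ?S r (\<rho> r) T + ?V r (\<chi>10 r) T)"
      by (intro coch_add cocycle_coch[OF S])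
    fix T assume T: "finite T" "T \<subseteq> ?U"
    have "((0, ev i), ?q) \<notin> conn ([i, i] @ zs v r)" using co assms(3) unfolding circle_outer_def by auto
    then have "?V r (\<chi>10 r) T = mulX (0, ev i) (\<chi>10 r) T + mulX ?q (\<chi>10 r) T" by (simp add: dsad_def)
    also have "mulX (0, ev i) (\<chi>10 r) T = 0"
      unfolding mulX_def \<chi>10_def using T(2) circ_plus[of "insert (0, ev i) T" ?U ?q "[i, i]" v "\<lambda>r T. 0" \<beta> r] by simp
    also have "mulX ?q (\<chi>10 r) T = \<beta> r T" unfolding \<chi>10_def using T(2) by (intro circ_minus) auto
    finally show "?S r (\<rho> r) T + ?V r (\<chi>10 r) T = 0" by (simp add: \<beta>_def)
  qed (use r T in auto)
  have "cocycle [] (int i # - int i # v) ?\<chi>"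
    unfolding cocycle_Cons2 using key \<rho>(1) \<chi>10 i0 by (simp add: cocycle_def)
  moreover have "?\<chi> (oriented_state (int i # - int i # v)) T0 = 1"
    using \<rho>(2) i0(1) by (simp add: oriented_Cons)
  ultimately show ?thesis unfolding detected_def by blast
qed

lemma detected_insert2:
  assumes "detected R [] v" "i = 1 \<or> i = 2" "valid_word 3 v"
  shows "detected R [] (- int i # int i # v)"
proof -
  have "detected R [0, 0] v" using assms by (simp add: detected_blank2)
  then obtain \<rho> :: "'a cochain" where \<rho>: "cocycle [0, 0] v \<rho>" "\<rho> (oriented_state v) T0 = 1"
    unfolding detected_def by blast
  have i0: "i > 0" "nat \<bar>int i\<bar> = i" "nat \<bar>- int i\<bar> = i" using assms(2) by auto
  let ?U = "outer 0 2" and ?q = "(Suc 0, 1) :: pt"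
  let ?S = "\<lambda>r. dsad (conn (0 # 0 # zs v r)) (0, ev i) (Suc 0, 1)"
  have co: "circle_outer ?U ?q [i, i] [i, 0]" using circle_outer2(2)[of "[]" i] assms(2) by simp
  define \<beta> where "\<beta> = (\<lambda>r T. - ?S r (\<rho> r) T)"
  have S: "cocycle [i, 0] v (\<lambda>r. ?S r (\<rho> r))"
    using cocycle_dsad[of "[]" 0 "[0]" v \<rho> i i] \<rho>(1) assms by simp
  then have \<beta>: "cocycle [i, 0] v \<beta>" unfolding \<beta>_def cocycle_def by (simp add: dD_uminus coch_uminus)
  define \<chi>01 where "\<chi>01 = circ ?U ?q [i, i] v (\<lambda>r T. 0) \<beta>"
  have \<chi>01: "cocycle [i, i] v \<chi>01" unfolding \<chi>01_def by (rule cocycle_circ[OF co \<beta> assms(3)])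
  let ?\<chi> = "glue (glue (\<lambda>r T. 0) \<chi>01) (glue \<rho> (\<lambda>r T. 0))"
  let ?V = "\<lambda>r. dsad (conn (i # i # zs v r)) (Suc 0, ev i) (Suc (Suc 0), 1)"
  have key: "?V r (\<chi>01 r) T + ?S r (\<rho> r) T = 0" if r: "length r = length v" and T: "finite T" for r T
  proof (rule coch_det[where U = ?U and f = "[i, 0]" and v = v and \<chi> = "\<lambda>r T. ?V r (\<chi>01 r) T + ?S r (\<rho> r) T" and \<eta> = "\<lambda>r T. 0"])
    show "covers ?U (conn ([i, 0] @ zs v r))" using covers2[of i 0 "[]"] by simp
    have "coch [i, 0] v (\<lambda>r. ?V r (\<chi>01 r))"
      using coch_dsad[of "[i]" i "[]" v \<chi>01 i 0] cocycle_coch[OF \<chi>01] assms by auto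
    then show "coch [i, 0] v (\<lambda>r T. ?V r (\<chi>01 r) T + ?S r (\<rho> r) T)"
      by (intro coch_add cocycle_coch[OF S])
    fix T assume T: "finite T" "T \<subseteq> ?U"
    have e: "((Suc 0, ev i), ?q) \<in> conn (i # i # zs v r)"
      using conn_turn(2)[of 0 "i # i # zs v r" i] assms(2) by simp
    have inv: "Inv UNIV (conn (i # i # zs v r)) (\<chi>01 r)" using cocycle_coch[OF \<chi>01] r by (simp add: coch_def)
    have "((Suc (Suc 0), 1), ?q) \<notin> conn ([i, i] @ zs v r)" using co assms(3) unfolding circle_outer_def by auto
    then have "(?q, (Suc (Suc 0), 1)) \<notin> conn (i # i # zs v r)" using conn_sym by auto
    then have "?V r (\<chi>01 r) T = mulX ?q (\<chi>01 r) T + mulX (Suc (Suc 0), 1) (\<chi>01 r) T"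
      using dsad_cong[OF equiv_conn inv e conn_refl, of "(Suc (Suc 0), 1)"] by (simp add: dsad_def)
    also have "mulX (Suc (Suc 0), 1) (\<chi>01 r) T = 0"
      unfolding mulX_def \<chi>01_def using T(2) circ_plus[of "insert (Suc (Suc 0), 1) T" ?U ?q "[i, i]" v "\<lambda>r T. 0" \<beta> r] by simp
    also have "mulX ?q (\<chi>01 r) T = \<beta> r T" unfolding \<chi>01_def using T(2) by (intro circ_minus) auto
    finally show "?V r (\<chi>01 r) T + ?S r (\<rho> r) T = 0" by (simp add: \<beta>_def)
  qed (use r T in auto)
  have "cocycle [] (- int i # int i # v) ?\<chi>"
    unfolding cocycle_Cons2 using key \<rho>(1) \<chi>01 i0 by (simp add: cocycle_def)
  moreover have "?\<chi> (oriented_state (- int i # int i # v)) T0 = 1"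
    using \<rho>(2) i0(1) by (simp add: oriented_Cons)
  ultimately show ?thesis unfolding detected_def by blast
qed

lemma covers3I:
  assumes "\<And>p. p < 3 \<Longrightarrow> \<exists>q. q < 3 \<and> (((Suc n, p), (n, q)) \<in> conn z \<or> ((Suc n, p), (Suc (Suc (Suc n)), q)) \<in> conn z)"
    and "\<And>p. p < 3 \<Longrightarrow> \<exists>q. q < 3 \<and> (((Suc (Suc n), p), (n, q)) \<in> conn z \<or> ((Suc (Suc n), p), (Suc (Suc (Suc n)), q)) \<in> conn z)"
  shows "covers (outer n 3) (conn z)"
proof -
  have "\<exists>q\<in>outer n 3. (p, q) \<in> conn z" for p
  proof (cases "p \<in> outer n 3")
    case True then show ?thesis by (intro bexI[of _ p]) auto
  next
    case False
    obtain a b where p: "p = (a, b)" by (cases p)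
    with False have "\<not> a \<le> n" "\<not> n + 3 \<le> a" "\<not> 3 \<le> b" by auto
    then have b: "b < 3" "p = (Suc n, b) \<or> p = (Suc (Suc n), b)" unfolding p by auto
    then obtain q where "(p, (n, q)) \<in> conn z \<or> (p, (Suc (Suc (Suc n)), q)) \<in> conn z"
      using assms(1)[OF b(1)] assms(2)[OF b(1)] by metis
    then show ?thesis
    proof
      assume "(p, (n, q)) \<in> conn z" then show ?thesis by (intro bexI[of _ "(n, q)"]) auto
    next
      assume "(p, (Suc (Suc (Suc n)), q)) \<in> conn z"
      then show ?thesis by (intro bexI[of _ "(Suc (Suc (Suc n)), q)"]) auto
    qed
  qed
  then show ?thesis by (simp add: covers_def)
qed

lemma covers3:
  assumes ij: "i = 1 \<and> j = 2 \<or> i = 2 \<and> j = 1"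
    and l: "l \<in> {[i, 0, 0], [0, i, 0], [0, 0, i], [i, j, 0], [0, i, j], [i, j, i]}"
  shows "covers (outer (length g) 3) (conn (g @ l @ y))"
proof (rule covers3I)
  let ?n = "length g" and ?z = "g @ l @ y"
  have len: "length l = 3" using l by auto
  have n: "?z ! ?n = l ! 0" "?z ! Suc ?n = l ! 1" "?z ! Suc (Suc ?n) = l ! 2"
      "?n < length ?z" "Suc ?n < length ?z" "Suc (Suc ?n) < length ?z"
    using len by (auto simp: nth_append)
  have B: "l ! 0 = 0 \<Longrightarrow> p < 3 \<Longrightarrow> cl ?z (Suc ?n, p) = cl ?z (?n, p)"
    "l ! 1 = 0 \<Longrightarrow> p < 3 \<Longrightarrow> cl ?z (Suc (Suc ?n), p) = cl ?z (Suc ?n, p)"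
    "l ! 2 = 0 \<Longrightarrow> p < 3 \<Longrightarrow> cl ?z (Suc (Suc (Suc ?n)), p) = cl ?z (Suc (Suc ?n), p)" for p
    using cl_blank[of ?n ?z p] cl_blank[of "Suc ?n" ?z p] cl_blank[of "Suc (Suc ?n)" ?z p] n by metis+
  have T: "l ! 0 = k \<Longrightarrow> cl ?z (Suc ?n, ev k) = cl ?z (Suc ?n, 1) \<and> cl ?z (Suc ?n, od k) = cl ?z (?n, od k)"
    "l ! 1 = k \<Longrightarrow> cl ?z (Suc ?n, ev k) = cl ?z (Suc ?n, 1) \<and> cl ?z (Suc (Suc ?n), ev k) = cl ?z (Suc (Suc ?n), 1) \<and>
      cl ?z (Suc (Suc ?n), od k) = cl ?z (Suc ?n, od k)"
    "l ! 2 = k \<Longrightarrow> cl ?z (Suc (Suc ?n), ev k) = cl ?z (Suc (Suc ?n), 1) \<and>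
      cl ?z (Suc (Suc (Suc ?n)), od k) = cl ?z (Suc (Suc ?n), od k)" if "k = 1 \<or> k = 2" for k
    using cl_turn[of ?n ?z k] cl_turn[of "Suc ?n" ?z k] cl_turn[of "Suc (Suc ?n)" ?z k] n that by metis+
  have T1: "l ! 0 = 1 \<Longrightarrow> cl ?z (Suc ?n, 0) = cl ?z (Suc ?n, 1) \<and> cl ?z (Suc ?n, 2) = cl ?z (?n, 2)"
    "l ! 0 = 2 \<Longrightarrow> cl ?z (Suc ?n, 2) = cl ?z (Suc ?n, 1) \<and> cl ?z (Suc ?n, 0) = cl ?z (?n, 0)"
    "l ! 1 = 1 \<Longrightarrow> cl ?z (Suc ?n, 0) = cl ?z (Suc ?n, 1) \<and> cl ?z (Suc (Suc ?n), 0) = cl ?z (Suc (Suc ?n), 1) \<and> cl ?z (Suc (Suc ?n), 2) = cl ?z (Suc ?n, 2)"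
    "l ! 1 = 2 \<Longrightarrow> cl ?z (Suc ?n, 2) = cl ?z (Suc ?n, 1) \<and> cl ?z (Suc (Suc ?n), 2) = cl ?z (Suc (Suc ?n), 1) \<and> cl ?z (Suc (Suc ?n), 0) = cl ?z (Suc ?n, 0)"
    "l ! 2 = 1 \<Longrightarrow> cl ?z (Suc (Suc ?n), 0) = cl ?z (Suc (Suc ?n), 1) \<and> cl ?z (Suc (Suc (Suc ?n)), 2) = cl ?z (Suc (Suc ?n), 2)"
    "l ! 2 = 2 \<Longrightarrow> cl ?z (Suc (Suc ?n), 2) = cl ?z (Suc (Suc ?n), 1) \<and> cl ?z (Suc (Suc (Suc ?n)), 0) = cl ?z (Suc (Suc ?n), 0)"
    using T[of 1] T[of 2] by simp_all
  define L1 where "L1 = (\<lambda>p. \<exists>q. q < 3 \<and> (((Suc ?n, p), (?n, q)) \<in> conn ?z \<or> ((Suc ?n, p), (Suc (Suc (Suc ?n)), q)) \<in> conn ?z))"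
  define L2 where "L2 = (\<lambda>p. \<exists>q. q < 3 \<and> (((Suc (Suc ?n), p), (?n, q)) \<in> conn ?z \<or> ((Suc (Suc ?n), p), (Suc (Suc (Suc ?n)), q)) \<in> conn ?z))"
  have I: "cl ?z (Suc ?n, p) = cl ?z (?n, q) \<Longrightarrow> q < 3 \<Longrightarrow> L1 p"
    "cl ?z (Suc ?n, p) = cl ?z (Suc (Suc (Suc ?n)), q) \<Longrightarrow> q < 3 \<Longrightarrow> L1 p"
    "cl ?z (Suc (Suc ?n), p) = cl ?z (?n, q) \<Longrightarrow> q < 3 \<Longrightarrow> L2 p"
    "cl ?z (Suc (Suc ?n), p) = cl ?z (Suc (Suc (Suc ?n)), q) \<Longrightarrow> q < 3 \<Longrightarrow> L2 p" for p q
    unfolding L1_def L2_def conn_iff_cl by blast+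
  have lt: "(0::nat) < 3" "(1::nat) < 3" "(2::nat) < 3" and od: "od i < 3" "od j < 3" using ij by auto
  have "L1 0 \<and> L1 1 \<and> L1 2 \<and> L2 0 \<and> L2 1 \<and> L2 2"
  proof -
    consider "l ! 0 = 0" "l ! 1 = 0" | "l ! 1 = 0" "l ! 2 = 0" | "l ! 0 = 0" "l ! 2 = 0"
      | "l ! 0 = i" "l ! 1 = j" "l ! 2 = 0" | "l ! 0 = 0" "l ! 1 = i" "l ! 2 = j" | "l ! 0 = i" "l ! 1 = j" "l ! 2 = i"
      using l by auto
    then show ?thesis
    proof cases
      case 1 then show ?thesis using B I lt by metis
    next
      case 2 then show ?thesis using B I lt by metis
    next
      case 3 then show ?thesis using B I lt by metis
    next
      case 4
      then have "cl ?z (Suc ?n, 0) = cl ?z (?n, od i)" "cl ?z (Suc ?n, 1) = cl ?z (?n, od i)" "cl ?z (Suc ?n, 2) = cl ?z (?n, od i)"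
        using ij T1(1-4) by (elim disjE conjE; simp)+
      then show ?thesis using 4 B(3) I(1) I(4) lt od by metis
    next
      case 5
      then have "cl ?z (Suc (Suc ?n), 0) = cl ?z (Suc (Suc (Suc ?n)), od j)" "cl ?z (Suc (Suc ?n), 1) = cl ?z (Suc (Suc (Suc ?n)), od j)"
        "cl ?z (Suc (Suc ?n), 2) = cl ?z (Suc (Suc (Suc ?n)), od j)"
        using ij T1(3-6) by (elim disjE conjE; simp)+
      then show ?thesis using 5 B(1) I(1) I(4) lt od by metis
    next
      case 6
      then have "cl ?z (Suc ?n, 0) = cl ?z (?n, od i)" "cl ?z (Suc ?n, 1) = cl ?z (?n, od i)" "cl ?z (Suc ?n, 2) = cl ?z (?n, od i)"
        "cl ?z (Suc (Suc ?n), 0) = cl ?z (Suc (Suc (Suc ?n)), od i)" "cl ?z (Suc (Suc ?n), 1) = cl ?z (Suc (Suc (Suc ?n)), od i)"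
        "cl ?z (Suc (Suc ?n), 2) = cl ?z (Suc (Suc (Suc ?n)), od i)"
        using ij T1 by (elim disjE conjE; simp)+
      then show ?thesis using I(1) I(4) lt od by metis
    qed
  qed
  then have "L1 p \<and> L2 p" if "p < 3" for p using that by (auto simp: lt3)
  then show "\<And>p. p < 3 \<Longrightarrow> \<exists>q. q < 3 \<and> (((Suc ?n, p), (?n, q)) \<in> conn ?z \<or> ((Suc ?n, p), (Suc (Suc (Suc ?n)), q)) \<in> conn ?z)"
    "\<And>p. p < 3 \<Longrightarrow> \<exists>q. q < 3 \<and> (((Suc (Suc ?n), p), (?n, q)) \<in> conn ?z \<or> ((Suc (Suc ?n), p), (Suc (Suc (Suc ?n)), q)) \<in> conn ?z)"
    unfolding L1_def L2_def by blast+
qed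

lemma conn_outer3:
  assumes ij: "i = 1 \<and> j = 2 \<or> i = 2 \<and> j = 1" and "flat g" "flat y" "p \<in> outer (length g) 3" "q \<in> outer (length g) 3"
  shows "l \<in> {[i, 0, 0], [0, i, 0], [0, 0, i], [i, j, i], [i, 0, i]} \<Longrightarrow> (p, q) \<in> conn (g @ l @ y) \<longleftrightarrow> (p, q) \<in> conn (g @ i # 0 # 0 # y)"
    and "l \<in> {[i, j, 0], [0, i, j]} \<Longrightarrow> (p, q) \<in> conn (g @ l @ y) \<longleftrightarrow> (p, q) \<in> conn (g @ i # j # 0 # y)"
proof -
  have i: "i = 1 \<or> i = 2" "j = 1 \<or> j = 2" using ij by auto
  have pq: "p \<in> outer (length g) 2" "q \<in> outer (length g) 2" "p \<in> outer (length (g @ [k])) 2" "q \<in> outer (length (g @ [k])) 2" for k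
    using assms(4,5) by auto
  have a: "(p, q) \<in> conn (g @ 0 # i # 0 # y) \<longleftrightarrow> (p, q) \<in> conn (g @ i # 0 # 0 # y)"
    by (rule conn_slide[OF assms(2) _ i(1) pq(1,2)]) (use assms(3) in simp)
  have b: "(p, q) \<in> conn (g @ 0 # 0 # i # y) \<longleftrightarrow> (p, q) \<in> conn (g @ 0 # i # 0 # y)"
    using conn_slide[OF _ assms(3) i(1) pq(3,4), of 0] assms(2) by simp
  have c: "(p, q) \<in> conn (g @ i # j # i # y) \<longleftrightarrow> (p, q) \<in> conn (g @ i # 0 # 0 # y)"
    by (rule conn_zigzag[OF assms(2,3) ij assms(4,5)])
  have d: "(p, q) \<in> conn (g @ i # 0 # i # y) \<longleftrightarrow> (p, q) \<in> conn (g @ i # i # 0 # y)"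
    using conn_slide[OF _ assms(3) i(1) pq(3,4), of i] assms(2) i by auto
  have e: "(p, q) \<in> conn (g @ i # i # 0 # y) \<longleftrightarrow> (p, q) \<in> conn (g @ 0 # i # 0 # y)"
    by (rule conn_circle[OF assms(2) _ i(1) pq(1,2)]) (use assms(3) in simp)
  have f: "(p, q) \<in> conn (g @ 0 # i # j # y) \<longleftrightarrow> (p, q) \<in> conn (g @ i # 0 # j # y)"
    by (rule conn_slide[OF assms(2) _ i(1) pq(1,2)]) (use assms(3) i in auto)
  have g: "(p, q) \<in> conn (g @ i # 0 # j # y) \<longleftrightarrow> (p, q) \<in> conn (g @ i # j # 0 # y)"
    using conn_slide[OF _ assms(3) i(2) pq(3,4), of i] assms(2) i by auto
  show "l \<in> {[i, 0, 0], [0, i, 0], [0, 0, i], [i, j, i], [i, 0, i]} \<Longrightarrow> (p, q) \<in> conn (g @ l @ y) \<longleftrightarrow> (p, q) \<in> conn (g @ i # 0 # 0 # y)"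
    using a b c d e by (elim insertE emptyE) simp_all
  show "l \<in> {[i, j, 0], [0, i, j]} \<Longrightarrow> (p, q) \<in> conn (g @ l @ y) \<longleftrightarrow> (p, q) \<in> conn (g @ i # j # 0 # y)"
    using f g by (elim insertE emptyE) simp_all
qed

lemma same_outer3:
  assumes ij: "i = 1 \<and> j = 2 \<or> i = 2 \<and> j = 1" and "flat g"
  shows "l \<in> {[i, 0, 0], [0, i, 0], [0, 0, i], [i, j, i], [i, 0, i]} \<Longrightarrow> l' \<in> {[i, 0, 0], [0, i, 0], [0, 0, i], [i, j, i]} \<Longrightarrow>
      same_outer (outer (length g) 3) (g @ l) (g @ l')"
    and "l \<in> {[i, j, 0], [0, i, j]} \<Longrightarrow> l' \<in> {[i, j, 0], [0, i, j]} \<Longrightarrow> same_outer (outer (length g) 3) (g @ l) (g @ l')"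
proof -
  show "same_outer (outer (length g) 3) (g @ l) (g @ l')"
    if l: "l \<in> {[i, 0, 0], [0, i, 0], [0, 0, i], [i, j, i], [i, 0, i]}" and l': "l' \<in> {[i, 0, 0], [0, i, 0], [0, 0, i], [i, j, i]}"
  proof -
    have "length l = 3" "length l' = 3" "flat l" "flat l'" using l l' ij by auto
    moreover have "(p, q) \<in> conn (g @ l @ y) \<longleftrightarrow> (p, q) \<in> conn (g @ l' @ y)"
      if "flat y" "p \<in> outer (length g) 3" "q \<in> outer (length g) 3" for p q y
      using conn_outer3(1)[OF ij assms(2) that l] conn_outer3(1)[OF ij assms(2) that, of l'] l' by blast
    moreover have "covers (outer (length g) 3) (conn (g @ l' @ y))" for y
      by (rule covers3[OF ij]) (use l' in auto)
    ultimately show ?thesis using assms(2) unfolding same_outer_def by auto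
  qed
  show "same_outer (outer (length g) 3) (g @ l) (g @ l')"
    if l: "l \<in> {[i, j, 0], [0, i, j]}" and l': "l' \<in> {[i, j, 0], [0, i, j]}"
  proof -
    have "length l = 3" "length l' = 3" "flat l" "flat l'" using l l' ij by auto
    moreover have "(p, q) \<in> conn (g @ l @ y) \<longleftrightarrow> (p, q) \<in> conn (g @ l' @ y)"
      if "flat y" "p \<in> outer (length g) 3" "q \<in> outer (length g) 3" for p q y
      using conn_outer3(2)[OF ij assms(2) that l] conn_outer3(2)[OF ij assms(2) that l'] by blast
    moreover have "covers (outer (length g) 3) (conn (g @ l' @ y))" for y
      by (rule covers3[OF ij]) (use l' in auto)
    ultimately show ?thesis using assms(2) unfolding same_outer_def by auto
  qed
qed

lemma circle_outer3:
  assumes ij: "i = 1 \<and> j = 2 \<or> i = 2 \<and> j = 1" and "flat g"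
    and l': "l' \<in> {[i, 0, 0], [0, i, 0], [0, 0, i], [i, j, i]}"
  shows "circle_outer (outer (length g) 3) (Suc (length g), 1) (g @ [i, 0, i]) (g @ l')"
proof -
  let ?m = "length g" and ?U = "outer (length g) 3"
  have i: "i = 1 \<or> i = 2" using ij by auto
  have sep: "(p, (Suc ?m, 1)) \<notin> conn (g @ i # 0 # i # y)" if "p \<in> ?U" "flat y" for p y
  proof
    let ?C = "{(Suc ?m, ev i), (Suc ?m, 1), (Suc (Suc ?m), ev i), (Suc (Suc ?m), 1)}" and ?z = "g @ i # 0 # i # y"
    assume "(p, (Suc ?m, 1)) \<in> conn ?z"
    then have "p \<in> ?C \<longleftrightarrow> (Suc ?m, 1) \<in> ?C"
    proof (rule conn_closed)
      have fl: "flat ?z" using assms that i by auto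
      fix x y' assume "(x, y') \<in> flat_edges ?z"
      then show "x \<in> ?C \<longleftrightarrow> y' \<in> ?C" using fl
      proof (cases rule: flat_edge_cases)
        case (close p) then show ?thesis by auto
      next
        case (slice t)
        obtain a b c d where xy: "x = (a, b)" "y' = (c, d)" by (cases x, cases y')
        note lt = slice_edges_lt3[OF slice(2)[unfolded xy] flat_nth[OF fl slice(1)]]
        consider "t = ?m" | "t = Suc ?m" | "t = Suc (Suc ?m)" | "t \<noteq> ?m" "t \<noteq> Suc ?m" "t \<noteq> Suc (Suc ?m)" by blast
        then show ?thesis
        proof cases
          case 4 then show ?thesis using lt by (auto simp: xy)
        qed (use slice(2) i in \<open>auto simp: nth_append slice_edges_def\<close>)
      qed
    qed
    then show False using that i by auto
  qed
  have cov: "covers (insert (Suc ?m, 1) ?U) (conn (g @ i # 0 # i # y))" for y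
  proof -
    let ?z = "g @ i # 0 # i # y" and ?q = "(Suc ?m, 1)"
    have F: "((Suc ?m, od i), (?m, od i)) \<in> conn ?z" "((Suc ?m, ev i), ?q) \<in> conn ?z"
      using conn_turn[of ?m ?z i] i conn_sym[of "(?m, od i)" "(Suc ?m, od i)" ?z] by (auto simp: nth_append)
    have B: "((Suc (Suc ?m), b), (Suc ?m, b)) \<in> conn ?z" if "b < 3" for b
      using conn_sym[OF conn_blank[of "Suc ?m" ?z b]] that by (simp add: nth_append)
    have l1: "\<exists>q\<in>insert ?q ?U. ((Suc ?m, b), q) \<in> conn ?z" if "b < 3" for b
    proof -
      have "b = 1 \<or> b = ev i \<or> b = od i" using i that by (elim disjE) auto
      then consider "b = 1" | "b = ev i" | "b = od i" by blast
      then show ?thesis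
      proof cases
        case 1 then show ?thesis by (intro bexI[of _ ?q]) auto
      next
        case 2 then show ?thesis using F(2) by (intro bexI[of _ ?q]) auto
      next
        case 3 then show ?thesis using F(1) by (intro bexI[of _ "(?m, od i)"]) auto
      qed
    qed
    have "\<exists>q\<in>insert ?q ?U. (p, q) \<in> conn ?z" for p
    proof (cases "p \<in> ?U")
      case True then show ?thesis by (intro bexI[of _ p]) auto
    next
      case False
      obtain a b where p: "p = (a, b)" by (cases p)
      with False have "\<not> a \<le> ?m" "\<not> ?m + 3 \<le> a" "\<not> 3 \<le> b" by auto
      then have "p = (Suc ?m, b) \<or> p = (Suc (Suc ?m), b)" "b < 3" unfolding p by auto
      then have "(p, (Suc ?m, b)) \<in> conn ?z" using B[of b] by auto
      moreover obtain q where "q \<in> insert ?q ?U" "((Suc ?m, b), q) \<in> conn ?z" using l1[OF \<open>b < 3\<close>] by blast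
      ultimately show ?thesis using conn_trans by blast
    qed
    then show ?thesis by (simp add: covers_def)
  qed
  have "same_outer ?U (g @ [i, 0, i]) (g @ l')" by (rule same_outer3(1)[OF ij assms(2) _ l']) simp
  then show ?thesis using sep cov by (auto simp: circle_outer_def)
qed

section \<open>Vanishing of cohomology\<close>

definition ones :: "bool list \<Rightarrow> nat" where
  "ones r = length (filter (\<lambda>b. b) r)"

lemma ones_simps [simp]: "ones [] = 0" "ones (True # r) = Suc (ones r)" "ones (False # r) = ones r"
  by (auto simp: ones_def)

text \<open>The grading is the number of 1-resolutions of \<open>v\<close>, which the dual
  differential lowers by one. What is required is exactness in all degrees from \<open>k\<close>
  on.\<close>

definition acyclic_from :: "'a::comm_ring_1 itself \<Rightarrow> nat list \<Rightarrow> int list \<Rightarrow> nat \<Rightarrow> bool" where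
  "acyclic_from R f v k \<longleftrightarrow> (\<forall>\<chi> :: 'a cochain. cocycle f v \<chi> \<longrightarrow>
     (\<forall>r. length r = length v \<longrightarrow> ones r < k \<longrightarrow> \<chi> r = (\<lambda>T. 0)) \<longrightarrow>
     (\<exists>\<eta>. coch f v \<eta> \<and> (\<forall>r T. length r = length v \<longrightarrow> finite T \<longrightarrow> \<chi> r T = dD f v \<eta> r T)))"

lemma acyclic_Nil: "k > 0 \<Longrightarrow> acyclic_from R f [] k"
  unfolding acyclic_from_def by (intro allI impI exI[of _ "\<lambda>r T. 0"]) auto

lemma ext_zero [simp]: "ext U R (\<lambda>T. 0) = (\<lambda>T. 0)"
  by (simp add: ext_def)

lemma mulX_in: "a \<in> U \<Longrightarrow> T \<subseteq> U \<Longrightarrow> (\<And>T. T \<subseteq> U \<Longrightarrow> \<phi> T = \<psi> T) \<Longrightarrow> mulX a \<phi> T = mulX a \<psi> T"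
  by (simp add: mulX_def)

lemma mulX_finite: "finite T \<Longrightarrow> (\<And>T. finite T \<Longrightarrow> \<phi> T = \<psi> T) \<Longrightarrow> mulX a \<phi> T = mulX a \<psi> T"
  by (simp add: mulX_def)

text \<open>A turn-back followed by the inverse crossing of the same index is a curl, to be removed
  as in the first Reidemeister move. The 0-resolution splits off a circle; the merge into the
  1-resolution cancels half of it. The other half is a copy of the complex over
  \<open>[0, i]\<close> sitting in the 0-resolution, so the degree bound is unchanged.\<close>

lemma acyclic_curl:
  assumes V: "acyclic_from R (g @ [0, i]) v k" and i: "i = 1 \<or> i = 2" and g: "flat g" and v: "valid_word 3 v"
  shows "acyclic_from R (g @ [i]) (- int i # v) k"
  unfolding acyclic_from_def
proof (intro allI impI)
  fix \<chi> :: "'a cochain"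
  assume \<chi>: "cocycle (g @ [i]) (- int i # v) \<chi>"
    and supp: "\<forall>r. length r = length (- int i # v) \<longrightarrow> ones r < k \<longrightarrow> \<chi> r = (\<lambda>T. 0)"
  have i0: "i > 0" "nat \<bar>- int i\<bar> = i" using i by auto
  let ?n = "length g" and ?U = "outer (length g) 2"
  let ?q = "(Suc (length g), 1) :: pt" and ?u = "(Suc (Suc (length g)), 1) :: pt"
  let ?f = "g @ [i, i]" and ?f1 = "g @ [i, 0]" and ?f2 = "g @ [0, i]"
  define \<chi>0 where "\<chi>0 = (\<lambda>r. \<chi> (False # r))"
  define \<chi>1 where "\<chi>1 = (\<lambda>r. \<chi> (True # r))"
  have merge: "dsad (conn (g @ i # 0 # y)) (Suc ?n, ev i) ?u \<phi> = \<phi>" for y and \<phi> :: "(pt, 'a) dual"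
    using conn_turn_blank(1)[OF i, of g y] by (rule dsad_connected)
  have c: "coch ?f v \<chi>0" "coch ?f1 v \<chi>1"
    and E: "\<And>r T. length r = length v \<Longrightarrow> finite T \<Longrightarrow> dD ?f v \<chi>0 r T = - \<chi>1 r T"
    using \<chi> i0 unfolding cocycle_Cons \<chi>0_def \<chi>1_def
    by (auto simp: merge[simplified] cocycle_def eq_neg_iff_add_eq_0)
  have co: "circle_outer ?U ?q ?f ?f2" by (rule circle_outer2(1)[OF g i])
  then have so: "same_outer ?U ?f ?f2" and q: "?q \<notin> ?U" by (auto simp: circle_outer_def)
  have so1: "same_outer ?U ?f ?f1" using circle_outer2(2)[OF g i] by (simp add: circle_outer_def)
  have fl: "flat ?f" "flat ?f1" "flat ?f2" using g i by auto
  have u: "?u \<in> ?U" by simp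
  define \<alpha> where "\<alpha> = tr ?U ?f2 v \<chi>0"
  \<comment> \<open>The restriction of \<open>\<chi>0\<close> to the kernel of the merge, which is
    spanned by the differences of multiplication by X on the small circle and multiplication by X on
    the strand it merges with.\<close>
  define \<beta> where "\<beta> = (\<lambda>r T. tr ?U ?f2 v (\<lambda>r. mulX ?q (\<chi>0 r)) r T + - mulX ?u (\<alpha> r) T)"
  have \<alpha>: "coch ?f2 v \<alpha>" unfolding \<alpha>_def by (rule coch_tr[OF so c(1) v])
  have \<beta>: "coch ?f2 v \<beta>" unfolding \<beta>_def
    by (intro coch_add coch_uminus coch_mulX coch_tr[OF so _ v] \<alpha> c(1))
  have mq: "mulX ?q (\<phi> r) T = mulX ?u (\<phi> r) T" if "coch ?f1 v \<phi>" "length r = length v" for \<phi> :: "'a cochain" and r T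
  proof -
    have "Inv UNIV (conn (g @ i # 0 # zs v r)) (\<phi> r)" using that by (simp add: coch_def)
    moreover have "(?q, ?u) \<in> conn (g @ i # 0 # zs v r)"
      using conn_blank[of "Suc ?n" "g @ i # 0 # zs v r" 1] by (simp add: nth_append)
    ultimately show ?thesis by (simp only: InvD)
  qed
  have \<alpha>U: "\<And>r T. T \<subseteq> ?U \<Longrightarrow> \<alpha> r T = \<chi>0 r T" unfolding \<alpha>_def by (rule tr_on)
  have \<beta>U: "\<beta> r T = mulX ?q (\<chi>0 r) T - mulX ?u (\<chi>0 r) T" if "T \<subseteq> ?U" for r T
  proof -
    have "mulX ?u (\<alpha> r) T = mulX ?u (\<chi>0 r) T" by (rule mulX_in[OF u that \<alpha>U])
    moreover have "tr ?U ?f2 v (\<lambda>r. mulX ?q (\<chi>0 r)) r T = mulX ?q (\<chi>0 r) T" by (rule tr_on[OF that])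
    ultimately show ?thesis by (simp only: \<beta>_def diff_conv_add_uminus)
  qed
  have "cocycle ?f2 v \<beta>"
    unfolding cocycle_def
  proof (intro conjI allI impI \<beta>)
    fix r :: "bool list" and T :: "pt set" assume r: "length r = length v" and T: "finite T"
    show "dD ?f2 v \<beta> r T = 0"
    proof (rule coch_det[where U = ?U, OF _ coch_dD[OF \<beta> fl(3) v] coch_zero r _ T])
      show "covers ?U (conn (?f2 @ zs v r))" using covers2[of 0 i g] by simp
      fix T assume T: "finite T" "T \<subseteq> ?U"
      have "dD ?f2 v \<beta> r T = dD ?f2 v (tr ?U ?f2 v (\<lambda>r. mulX ?q (\<chi>0 r))) r T + - mulX ?u (dD ?f2 v \<alpha> r) T"
        unfolding \<beta>_def dD_add dD_uminus dD_mulX ..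
      also have "dD ?f2 v (tr ?U ?f2 v (\<lambda>r. mulX ?q (\<chi>0 r))) r T = mulX ?q (dD ?f v \<chi>0 r) T"
        unfolding dD_tr[OF so v r T(2)] dD_mulX ..
      also have "\<dots> = mulX ?q (\<lambda>T. - \<chi>1 r T) T" by (rule mulX_finite[OF T(1) E[OF r]])
      also have "\<dots> = - mulX ?u (\<chi>1 r) T" unfolding mulX_uminus mq[OF c(2) r] ..
      also have "mulX ?u (dD ?f2 v \<alpha> r) T = mulX ?u (dD ?f v \<chi>0 r) T"
        by (rule mulX_in[OF u T(2)]) (unfold \<alpha>_def, rule dD_tr[OF so v r])
      also have "\<dots> = mulX ?u (\<lambda>T. - \<chi>1 r T) T" by (rule mulX_finite[OF T(1) E[OF r]])
      finally show "dD ?f2 v \<beta> r T = 0" by (simp add: mulX_uminus)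
    qed
  qed
  moreover have "\<beta> r = (\<lambda>T. 0)" if "length r = length v" "ones r < k" for r
  proof -
    have "\<chi>0 r = (\<lambda>T. 0)" using supp that by (simp add: \<chi>0_def)
    then show ?thesis by (simp add: \<beta>_def \<alpha>_def tr_def)
  qed
  ultimately obtain \<theta> where \<theta>: "coch ?f2 v \<theta>" "\<And>r T. length r = length v \<Longrightarrow> finite T \<Longrightarrow> \<beta> r T = dD ?f2 v \<theta> r T"
    using V unfolding acyclic_from_def by blast
  \<comment> \<open>The merge turns \<open>\<eta>1\<close> into a cochain with the right
    \<open>v_+\<close> part; its \<open>v_-\<close> part is then off by exactly \<beta>, which the
    primitive \<theta> repairs on the circle.\<close>
  define \<eta>0 where "\<eta>0 = circ ?U ?q ?f v (\<lambda>r T. 0) \<theta>"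
  define \<eta>1 where "\<eta>1 = tr ?U ?f1 v \<chi>0"
  have \<eta>0: "coch ?f v \<eta>0" unfolding \<eta>0_def by (rule coch_circ[OF co coch_zero \<theta>(1) v])
  have \<eta>1: "coch ?f1 v \<eta>1" unfolding \<eta>1_def by (rule coch_tr[OF so1 c(1) v])
  have \<eta>1U: "\<And>r T. T \<subseteq> ?U \<Longrightarrow> \<eta>1 r T = \<chi>0 r T" unfolding \<eta>1_def by (rule tr_on)
  have s: "coch ?f v \<eta>1"
    using coch_dsad[of "g @ [i]" 0 "[]" v \<eta>1 i i "(Suc ?n, ev i)" ?u] \<eta>1 g i v merge by (auto simp: coch_def)
  have D0: "\<chi>0 r T = dD ?f v \<eta>0 r T + \<eta>1 r T" if r: "length r = length v" and T: "finite T" for r T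
  proof (rule circle_det[OF co c(1) _ v r _ _ T])
    show "coch ?f v (\<lambda>r T. dD ?f v \<eta>0 r T + \<eta>1 r T)" by (intro coch_add coch_dD[OF \<eta>0 fl(1) v] s)
    fix T assume T: "finite T" "T \<subseteq> ?U"
    have "dD ?f v \<eta>0 r T = dD ?f2 v (\<lambda>r T. 0) r T"
      unfolding \<eta>0_def by (rule dD_circle(1)[OF co v r T(2)]) (rule circ_plus[OF _ q])
    then show "\<chi>0 r T = dD ?f v \<eta>0 r T + \<eta>1 r T" using \<eta>1U[OF T(2)] by simp
    have "mulX ?q (dD ?f v \<eta>0 r) T = dD ?f2 v \<theta> r T"
      unfolding \<eta>0_def by (rule dD_circle(2)[OF co v r T(2)]) (rule circ_minus[OF _ q])
    also have "\<dots> = mulX ?q (\<chi>0 r) T - mulX ?u (\<chi>0 r) T" using \<theta>(2)[OF r T(1)] \<beta>U[OF T(2)] by simp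
    finally have 1: "mulX ?q (dD ?f v \<eta>0 r) T = mulX ?q (\<chi>0 r) T - mulX ?u (\<chi>0 r) T" .
    have "mulX ?q (\<eta>1 r) T = mulX ?u (\<chi>0 r) T"
      unfolding mq[OF \<eta>1 r] by (rule mulX_in[OF u T(2) \<eta>1U])
    then show "mulX ?q (\<chi>0 r) T = mulX ?q (\<lambda>T. dD ?f v \<eta>0 r T + \<eta>1 r T) T"
      unfolding mulX_add using 1 by simp
  qed
  have D1: "\<chi>1 r T = - dD ?f1 v \<eta>1 r T" if r: "length r = length v" and T: "finite T" for r T
  proof (rule coch_det[where U = ?U, OF _ c(2) coch_uminus[OF coch_dD[OF \<eta>1 fl(2) v]] r _ T])
    show "covers ?U (conn (?f1 @ zs v r))" using covers2[of i 0 g] by simp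
    fix T assume T: "finite T" "T \<subseteq> ?U"
    have "dD ?f1 v \<eta>1 r T = dD ?f v \<chi>0 r T" unfolding \<eta>1_def by (rule dD_tr[OF so1 v r T(2)])
    then show "\<chi>1 r T = - dD ?f1 v \<eta>1 r T" using E[OF r T(1)] by simp
  qed
  show "\<exists>\<eta>. coch (g @ [i]) (- int i # v) \<eta> \<and>
     (\<forall>r T. length r = length (- int i # v) \<longrightarrow> finite T \<longrightarrow> \<chi> r T = dD (g @ [i]) (- int i # v) \<eta> r T)"
  proof (intro exI[of _ "glue \<eta>0 \<eta>1"] conjI)
    show "coch (g @ [i]) (- int i # v) (glue \<eta>0 \<eta>1)" using \<eta>0 \<eta>1 i0 by (simp add: coch_Cons)
    have "\<forall>r. length r = length (- int i # v) \<longrightarrow> (\<forall>T. finite T \<longrightarrow> \<chi> r T = dD (g @ [i]) (- int i # v) (glue \<eta>0 \<eta>1) r T)"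
      unfolding all_length_Cons using D0 D1 i0 by (simp add: merge[simplified] \<chi>0_def \<chi>1_def)
    then show "\<forall>r T. length r = length (- int i # v) \<longrightarrow> finite T \<longrightarrow> \<chi> r T = dD (g @ [i]) (- int i # v) (glue \<eta>0 \<eta>1) r T"
      by blast
  qed
qed

lemma conn_zigzag_inner:
  assumes ij: "i = 1 \<and> j = 2 \<or> i = 2 \<and> j = 1"
  shows "((Suc (length g), ev j), (Suc (Suc (length g)), 1)) \<in> conn (g @ i # j # i # y)"
    and "((length g, od i), (Suc (length g), 1)) \<in> conn (g @ i # j # i # y)"
proof -
  let ?z = "g @ i # j # i # y" and ?n = "length g"
  have i: "i = 1 \<or> i = 2" "j = 1 \<or> j = 2" "ev i = od j" "ev j = od i" using ij by auto
  have F: "cl ?z (Suc ?n, ev i) = cl ?z (Suc ?n, 1)" "cl ?z (Suc ?n, od i) = cl ?z (?n, od i)"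
    "cl ?z (Suc ?n, ev j) = cl ?z (Suc ?n, 1)" "cl ?z (Suc (Suc ?n), od j) = cl ?z (Suc ?n, od j)"
    "cl ?z (Suc (Suc ?n), ev i) = cl ?z (Suc (Suc ?n), 1)"
    using cl_turn[of ?n ?z i] cl_turn[of "Suc ?n" ?z j] cl_turn[of "Suc (Suc ?n)" ?z i] i by (simp_all add: nth_append)
  show "((Suc ?n, ev j), (Suc (Suc ?n), 1)) \<in> conn ?z" using F i(3) unfolding conn_iff_cl by metis
  show "((?n, od i), (Suc ?n, 1)) \<in> conn ?z" using F i(4) unfolding conn_iff_cl by metis
qed

lemma circle_top:
  assumes "i = 1 \<or> i = 2"
  shows "((Suc (Suc (length g)), ev i), (Suc (length g), 1)) \<in> conn (g @ i # 0 # i # y)"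
proof -
  let ?z = "g @ i # 0 # i # y" and ?n = "length g"
  have "cl ?z (Suc ?n, ev i) = cl ?z (Suc ?n, 1)" "cl ?z (Suc (Suc ?n), ev i) = cl ?z (Suc ?n, ev i)"
    using cl_turn[of ?n ?z i] cl_blank[of "Suc ?n" ?z "ev i"] assms by (auto simp: nth_append)
  then show ?thesis by (simp add: conn_iff_cl)
qed

text \<open>The turn-back \<open>i\<close> is pushed through two positive crossings. Of the four
  states, the split out of \<open>[i, 0, 0]\<close> cancels one half of the circle state
  \<open>[i, 0, i]\<close>, and the merge into \<open>[i, j, i]\<close> cancels the other half. What
  survives is \<open>[i, j, 0]\<close>, where one crossing is 1-resolved; this raises the bound by
  one.\<close>

lemma acyclic_pass:
  assumes V: "acyclic_from R (g @ [i, j, 0]) v k" and ij: "i = 1 \<and> j = 2 \<or> i = 2 \<and> j = 1"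
    and g: "flat g" and v: "valid_word 3 v"
  shows "acyclic_from R (g @ [i]) (int j # int i # v) (Suc k)"
  unfolding acyclic_from_def
proof (intro allI impI)
  fix \<chi> :: "'a cochain"
  assume \<chi>: "cocycle (g @ [i]) (int j # int i # v) \<chi>"
    and supp: "\<forall>r. length r = length (int j # int i # v) \<longrightarrow> ones r < Suc k \<longrightarrow> \<chi> r = (\<lambda>T. 0)"
  have i: "i = 1 \<or> i = 2" and j: "j = 1 \<or> j = 2" using ij by auto
  have i0: "i > 0" "j > 0" "nat \<bar>int i\<bar> = i" "nat \<bar>int j\<bar> = j" using ij by auto
  let ?n = "length g" and ?U = "outer (length g) 3"
  let ?q = "(Suc (length g), 1) :: pt" and ?s = "(length g, od i) :: pt" and ?w = "(Suc (Suc (Suc (length g))), 1) :: pt"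
  let ?f00 = "g @ [i, 0, 0]" and ?f01 = "g @ [i, 0, i]" and ?f10 = "g @ [i, j, 0]" and ?f11 = "g @ [i, j, i]"
  define \<chi>00 where "\<chi>00 = (\<lambda>r. \<chi> (False # False # r))"
  define \<chi>01 where "\<chi>01 = (\<lambda>r. \<chi> (False # True # r))"
  define \<chi>10 where "\<chi>10 = (\<lambda>r. \<chi> (True # False # r))"
  define \<chi>11 where "\<chi>11 = (\<lambda>r. \<chi> (True # True # r))"
  define A :: "bool list \<Rightarrow> (pt, 'a) dual \<Rightarrow> (pt, 'a) dual" where "A = (\<lambda>r. dsad (conn (g @ i # 0 # i # zs v r)) (Suc (Suc ?n), ev i) ?w)"
  define F :: "bool list \<Rightarrow> (pt, 'a) dual \<Rightarrow> (pt, 'a) dual" where "F = (\<lambda>r. dsad (conn (g @ i # j # 0 # zs v r)) (Suc ?n, ev j) (Suc (Suc ?n), 1))"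
  define M :: "bool list \<Rightarrow> (pt, 'a) dual \<Rightarrow> (pt, 'a) dual" where "M = (\<lambda>r. dsad (conn (g @ i # j # i # zs v r)) (Suc ?n, ev j) (Suc (Suc ?n), 1))"
  define G :: "bool list \<Rightarrow> (pt, 'a) dual \<Rightarrow> (pt, 'a) dual" where "G = (\<lambda>r. dsad (conn (g @ i # j # i # zs v r)) (Suc (Suc ?n), ev i) ?w)"
  have M: "M r \<phi> = \<phi>" for r \<phi> unfolding M_def by (rule dsad_connected[OF conn_zigzag_inner(1)[OF ij]])
  have c: "coch ?f00 v \<chi>00" "coch ?f01 v \<chi>01" "coch ?f10 v \<chi>10" "coch ?f11 v \<chi>11"
    and E00: "\<And>r T. length r = length v \<Longrightarrow> finite T \<Longrightarrow> dD ?f00 v \<chi>00 r T + A r (\<chi>01 r) T + F r (\<chi>10 r) T = 0"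
    and E01: "\<And>r T. length r = length v \<Longrightarrow> finite T \<Longrightarrow> M r (\<chi>11 r) T = dD ?f01 v \<chi>01 r T"
    and E10: "\<And>r T. length r = length v \<Longrightarrow> finite T \<Longrightarrow> dD ?f10 v \<chi>10 r T + G r (\<chi>11 r) T = 0"
    using \<chi> i0 unfolding cocycle_Cons2 \<chi>00_def \<chi>01_def \<chi>10_def \<chi>11_def A_def F_def M_def G_def
    by simp_all
  have co: "circle_outer ?U ?q ?f01 ?f00" by (rule circle_outer3[OF ij g]) simp
  then have q: "?q \<notin> ?U" by (simp add: circle_outer_def)
  have so: "same_outer ?U ?f01 ?f11" by (rule same_outer3(1)[OF ij g]) auto
  have fl: "flat ?f00" "flat ?f01" "flat ?f10" "flat ?f11" using g i j by auto
  have sw: "?s \<in> ?U" "?w \<in> ?U" by simp_all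
  have cA: "coch ?f00 v (\<lambda>r. A r (\<phi> r))" if "coch ?f01 v \<phi>" for \<phi>
    using coch_dsad[of "g @ [i, 0]" i "[]" v \<phi> i 0] that g i v by (auto simp: A_def)
  have cF: "coch ?f00 v (\<lambda>r. F r (\<phi> r))" if "coch ?f10 v \<phi>" for \<phi>
    using coch_dsad[of "g @ [i]" j "[0]" v \<phi> j 0] that g i j v by (auto simp: F_def)
  have cG: "coch ?f10 v (\<lambda>r. G r (\<phi> r))" if "coch ?f11 v \<phi>" for \<phi>
    using coch_dsad[of "g @ [i, j]" i "[]" v \<phi> i 0] that g i j v by (auto simp: G_def)
  have cM: "coch ?f01 v \<phi>" if "coch ?f11 v \<phi>" for \<phi> :: "'a cochain"
  proof -
    have "coch ?f01 v (\<lambda>r. M r (\<phi> r))"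
      using coch_dsad[of "g @ [i]" j "[i]" v \<phi> j 0] that g i j v by (auto simp: M_def)
    then show ?thesis by (simp add: M)
  qed
  have dF: "dD ?f00 v (\<lambda>r. F r (\<phi> r)) r = F r (dD ?f10 v \<phi> r)" if "coch ?f10 v \<phi>" "length r = length v" for \<phi> r
    using dD_dsad[of "g @ [i]" j "[0]" v \<phi> j 0 r] that g i j v by (auto simp: F_def)
  have dG: "dD ?f10 v (\<lambda>r. G r (\<phi> r)) r = G r (dD ?f11 v \<phi> r)" if "coch ?f11 v \<phi>" "length r = length v" for \<phi> r
    using dD_dsad[of "g @ [i, j]" i "[]" v \<phi> i 0 r] that g i j v by (auto simp: G_def)
  have A: "A r (\<phi> r) T = mulX ?q (\<phi> r) T + mulX ?w (\<phi> r) T" if "coch ?f01 v \<phi>" "length r = length v" for \<phi> r T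
  proof -
    have inv: "Inv UNIV (conn (g @ i # 0 # i # zs v r)) (\<phi> r)" using that by (simp add: coch_def)
    have "(?w, ?q) \<notin> conn (?f01 @ zs v r)" using co v sw(2) unfolding circle_outer_def by (auto simp del: append_assoc)
    then have "(?q, ?w) \<notin> conn (g @ i # 0 # i # zs v r)" using conn_sym by auto
    then show ?thesis unfolding A_def dsad_cong[OF equiv_conn inv circle_top[OF i] conn_refl] by (simp add: dsad_def)
  qed
  have FG: "F r (G r (\<phi> r)) = A r (\<phi> r)" if "coch ?f11 v \<phi>" "length r = length v" for \<phi> r
  proof -
    have z: "flat (zs v r)" using v by simp
    have "F r (G r (\<phi> r)) = A r (M r (\<phi> r))"
      unfolding F_def G_def A_def M_def
    proof (rule dsad_square[where ?R00.0 = "conn (g @ i # 0 # 0 # zs v r)"])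
      show "saddle (conn (g @ i # 0 # 0 # zs v r)) (conn (g @ i # j # 0 # zs v r)) (Suc ?n, ev j) (Suc (Suc ?n), 1)"
        using saddle_conn[of "g @ [i]" "0 # zs v r" j 0 j] g i j z by auto
      show "saddle (conn (g @ i # 0 # i # zs v r)) (conn (g @ i # j # i # zs v r)) (Suc ?n, ev j) (Suc (Suc ?n), 1)"
        using saddle_conn[of "g @ [i]" "i # zs v r" j 0 j] g i j z by auto
      show "saddle (conn (g @ i # 0 # 0 # zs v r)) (conn (g @ i # 0 # i # zs v r)) (Suc (Suc ?n), ev i) ?w"
        using saddle_conn[of "g @ [i, 0]" "zs v r" i 0 i] g i j z by auto
      show "saddle (conn (g @ i # j # 0 # zs v r)) (conn (g @ i # j # i # zs v r)) (Suc (Suc ?n), ev i) ?w"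
        using saddle_conn[of "g @ [i, j]" "zs v r" i 0 i] g i j z by auto
      show "Inv UNIV (conn (g @ i # j # i # zs v r)) (\<phi> r)" using that by (simp add: coch_def)
    qed
    then show ?thesis by (simp add: M)
  qed
  define \<eta>11 where "\<eta>11 = tr ?U ?f11 v \<chi>01"
  have \<eta>11: "coch ?f11 v \<eta>11" unfolding \<eta>11_def by (rule coch_tr[OF so c(2) v])
  have \<eta>11U: "\<And>r T. T \<subseteq> ?U \<Longrightarrow> \<eta>11 r T = \<chi>01 r T" unfolding \<eta>11_def by (rule tr_on)
  have D11: "dD ?f11 v \<eta>11 r T = \<chi>11 r T" if r: "length r = length v" and T: "finite T" for r T
  proof (rule coch_det[where U = ?U, OF _ coch_dD[OF \<eta>11 fl(4) v] c(4) r _ T])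
    show "covers ?U (conn (?f11 @ zs v r))" using covers3[OF ij, of "[i, j, i]" g "zs v r"] by simp
    fix T assume T: "finite T" "T \<subseteq> ?U"
    have "dD ?f11 v \<eta>11 r T = dD ?f01 v \<chi>01 r T" unfolding \<eta>11_def by (rule dD_tr[OF so v r T(2)])
    then show "dD ?f11 v \<eta>11 r T = \<chi>11 r T" using E01[OF r T(1)] by (simp add: M)
  qed
  \<comment> \<open>Subtracting the saddle image of \<open>\<eta>11\<close> makes
    \<open>\<chi>10\<close> a cocycle. The overall sign is the one that \<open>dD\<close> carries
    behind a 1-resolution.\<close>
  define \<kappa> where "\<kappa> = (\<lambda>r T. - \<chi>10 r T + - G r (\<eta>11 r) T)"
  have \<kappa>: "coch ?f10 v \<kappa>" unfolding \<kappa>_def by (intro coch_add coch_uminus c(3) cG \<eta>11)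
  have "cocycle ?f10 v \<kappa>"
    unfolding cocycle_def
  proof (intro conjI \<kappa> allI impI)
    fix r :: "bool list" and T :: "pt set" assume r: "length r = length v" and T: "finite T"
    have "G r (dD ?f11 v \<eta>11 r) T = G r (\<chi>11 r) T" unfolding G_def by (rule dsad_finite_cong[OF D11[OF r] T])
    then have "dD ?f10 v \<kappa> r T = - (dD ?f10 v \<chi>10 r T + G r (\<chi>11 r) T)"
      unfolding \<kappa>_def dD_add dD_uminus dG[OF \<eta>11 r] by simp
    then show "dD ?f10 v \<kappa> r T = 0" using E10[OF r T] by simp
  qed
  moreover have "\<kappa> r = (\<lambda>T. 0)" if "length r = length v" "ones r < k" for r
  proof -
    have "\<chi>10 r = (\<lambda>T. 0)" "\<chi>01 r = (\<lambda>T. 0)" using supp that by (simp_all add: \<chi>10_def \<chi>01_def)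
    then show ?thesis by (simp add: \<kappa>_def \<eta>11_def tr_def G_def)
  qed
  ultimately obtain \<eta>10 where \<eta>10: "coch ?f10 v \<eta>10" "\<And>r T. length r = length v \<Longrightarrow> finite T \<Longrightarrow> \<kappa> r T = dD ?f10 v \<eta>10 r T"
    using V unfolding acyclic_from_def by blast
  \<comment> \<open>What \<open>\<chi>00\<close> still lacks. The split delivers the
    \<open>v_-\<close> component of the circle state, so \<theta> is placed there and the
    \<open>v_+\<close> component is left 0.\<close>
  define \<theta> where "\<theta> = (\<lambda>r T. \<chi>00 r T + - F r (\<eta>10 r) T)"
  have \<theta>: "coch ?f00 v \<theta>" unfolding \<theta>_def by (intro coch_add coch_uminus c(1) cF \<eta>10(1))
  define \<eta>01 where "\<eta>01 = circ ?U ?q ?f01 v (\<lambda>r T. 0) \<theta>"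
  have \<eta>01: "coch ?f01 v \<eta>01" unfolding \<eta>01_def by (rule coch_circ[OF co coch_zero \<theta> v])
  have cov0: "covers ?U (conn (?f00 @ zs v r))" for r using covers3[OF ij, of "[i, 0, 0]" g "zs v r"] by simp
  have R00: "\<chi>00 r T = A r (\<eta>01 r) T + F r (\<eta>10 r) T" if r: "length r = length v" and T: "finite T" for r T
  proof (rule coch_det[where U = ?U, OF cov0 c(1) _ r _ T])
    show "coch ?f00 v (\<lambda>r T. A r (\<eta>01 r) T + F r (\<eta>10 r) T)" by (intro coch_add cA \<eta>01 cF \<eta>10(1))
    fix T assume T: "finite T" "T \<subseteq> ?U"
    have "mulX ?q (\<eta>01 r) T = \<theta> r T" unfolding \<eta>01_def by (rule circ_minus[OF T(2) q])
    moreover have "mulX ?w (\<eta>01 r) T = mulX ?w (\<lambda>T. 0) T"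
      by (rule mulX_in[OF sw(2) T(2)]) (unfold \<eta>01_def, rule circ_plus[OF _ q])
    ultimately show "\<chi>00 r T = A r (\<eta>01 r) T + F r (\<eta>10 r) T" unfolding A[OF \<eta>01 r] \<theta>_def by simp
  qed
  have D\<theta>: "dD ?f00 v \<theta> r T = - A r (\<chi>01 r) T + A r (\<eta>11 r) T" if r: "length r = length v" and T: "finite T" for r T
  proof -
    have "F r (dD ?f10 v \<eta>10 r) T = F r (\<kappa> r) T" unfolding F_def by (rule dsad_finite_cong[OF _ T]) (simp add: \<eta>10(2) r)
    also have "\<dots> = - F r (\<chi>10 r) T + - F r (G r (\<eta>11 r)) T"
      unfolding \<kappa>_def F_def dsad_add dsad_uminus ..
    finally have "dD ?f00 v \<theta> r T = dD ?f00 v \<chi>00 r T + F r (\<chi>10 r) T + A r (\<eta>11 r) T"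
      unfolding \<theta>_def dD_add dD_uminus dF[OF \<eta>10(1) r] FG[OF \<eta>11 r] by simp
    moreover have "dD ?f00 v \<chi>00 r T + F r (\<chi>10 r) T = - A r (\<chi>01 r) T"
      using E00[OF r T] by (simp add: eq_neg_iff_add_eq_0 algebra_simps)
    ultimately show ?thesis by simp
  qed
  have R01: "\<chi>01 r T = - dD ?f01 v \<eta>01 r T + \<eta>11 r T" if r: "length r = length v" and T: "finite T" for r T
  proof (rule circle_det[OF co c(2) _ v r _ _ T])
    show "coch ?f01 v (\<lambda>r T. - dD ?f01 v \<eta>01 r T + \<eta>11 r T)"
      by (intro coch_add coch_uminus coch_dD[OF \<eta>01 fl(2) v] cM \<eta>11)
    fix T assume T: "finite T" "T \<subseteq> ?U"
    have "dD ?f01 v \<eta>01 r T = dD ?f00 v (\<lambda>r T. 0) r T"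
      unfolding \<eta>01_def by (rule dD_circle(1)[OF co v r T(2)]) (rule circ_plus[OF _ q])
    then show "\<chi>01 r T = - dD ?f01 v \<eta>01 r T + \<eta>11 r T" using \<eta>11U[OF T(2)] by simp
    have "mulX ?q (dD ?f01 v \<eta>01 r) T = dD ?f00 v \<theta> r T"
      unfolding \<eta>01_def by (rule dD_circle(2)[OF co v r T(2)]) (rule circ_minus[OF _ q])
    also have "\<dots> = - (mulX ?q (\<chi>01 r) T + mulX ?w (\<chi>01 r) T) + (mulX ?q (\<eta>11 r) T + mulX ?w (\<eta>11 r) T)"
      unfolding D\<theta>[OF r T(1)] A[OF c(2) r] A[OF cM[OF \<eta>11] r] ..
    also have "mulX ?w (\<eta>11 r) T = mulX ?w (\<chi>01 r) T" by (rule mulX_in[OF sw(2) T(2) \<eta>11U])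
    finally show "mulX ?q (\<chi>01 r) T = mulX ?q (\<lambda>T. - dD ?f01 v \<eta>01 r T + \<eta>11 r T) T"
      unfolding mulX_add mulX_uminus by simp
  qed
  have R10: "\<chi>10 r T = - (dD ?f10 v \<eta>10 r T + G r (\<eta>11 r) T)" if "length r = length v" "finite T" for r T
    unfolding \<eta>10(2)[OF that, symmetric] \<kappa>_def by simp
  let ?\<eta> = "glue (glue (\<lambda>r T. 0) \<eta>01) (glue \<eta>10 \<eta>11)"
  show "\<exists>\<eta>. coch (g @ [i]) (int j # int i # v) \<eta> \<and>
     (\<forall>r T. length r = length (int j # int i # v) \<longrightarrow> finite T \<longrightarrow> \<chi> r T = dD (g @ [i]) (int j # int i # v) \<eta> r T)"
  proof (intro exI[of _ ?\<eta>] conjI)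
    show "coch (g @ [i]) (int j # int i # v) ?\<eta>" using \<eta>01 \<eta>10(1) \<eta>11 i0 by (simp add: coch_Cons)
    have "\<forall>r. length r = length (int j # int i # v) \<longrightarrow> (\<forall>T. finite T \<longrightarrow> \<chi> r T = dD (g @ [i]) (int j # int i # v) ?\<eta> r T)"
      unfolding all_length_Cons
    proof (intro conjI allI impI)
      fix r :: "bool list" and T :: "pt set" assume r: "length r = length v" and T: "finite T"
      show "\<chi> (False # False # r) T = dD (g @ [i]) (int j # int i # v) ?\<eta> (False # False # r) T"
        using R00[OF r T] i0 by (simp add: \<chi>00_def A_def F_def)
      show "\<chi> (False # True # r) T = dD (g @ [i]) (int j # int i # v) ?\<eta> (False # True # r) T"
        using R01[OF r T] M[of r] i0 by (simp add: \<chi>01_def M_def)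
      show "\<chi> (True # False # r) T = dD (g @ [i]) (int j # int i # v) ?\<eta> (True # False # r) T"
        using R10[OF r T] i0 by (simp add: \<chi>10_def G_def)
      show "\<chi> (True # True # r) T = dD (g @ [i]) (int j # int i # v) ?\<eta> (True # True # r) T"
        using D11[OF r T] i0 by (simp add: \<chi>11_def)
    qed
    then show "\<forall>r T. length r = length (int j # int i # v) \<longrightarrow> finite T \<longrightarrow> \<chi> r T = dD (g @ [i]) (int j # int i # v) ?\<eta> r T"
      by blast
  qed
qed

lemma acyclic_blank:
  assumes "acyclic_from R f v k" "flat f" "valid_word 3 v"
  shows "acyclic_from R (f @ [0]) v k"
  unfolding acyclic_from_def
proof (intro allI impI)
  fix \<chi> :: "'a cochain"
  assume \<chi>: "cocycle (f @ [0]) v \<chi>" and supp: "\<forall>r. length r = length v \<longrightarrow> ones r < k \<longrightarrow> \<chi> r = (\<lambda>T. 0)"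
  let ?a = "add_level (length f)" and ?d = "drop_level (length f)"
  have "cocycle f v (\<lambda>r. pb ?a (\<chi> r))" by (rule cocycle_add[OF \<chi> assms(2,3)])
  moreover have "pb ?a (\<chi> r) = (\<lambda>T. 0)" if "length r = length v" "ones r < k" for r using supp that by simp
  ultimately obtain \<eta> where \<eta>: "coch f v \<eta>" "\<And>r T. length r = length v \<Longrightarrow> finite T \<Longrightarrow> pb ?a (\<chi> r) T = dD f v \<eta> r T"
    using assms(1) unfolding acyclic_from_def by blast
  have cd: "(p, q) \<in> conn ((f @ [0]) @ y) \<longleftrightarrow> (?d p, ?d q) \<in> conn (f @ y)" if "flat y" for y p q
    using conn_drop(1)[OF assms(2) that, of p q] by simp
  show "\<exists>\<eta>. coch (f @ [0]) v \<eta> \<and> (\<forall>r T. length r = length v \<longrightarrow> finite T \<longrightarrow> \<chi> r T = dD (f @ [0]) v \<eta> r T)"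
  proof (intro exI[of _ "\<lambda>r. pb ?d (\<eta> r)"] conjI allI impI)
    show "coch (f @ [0]) v (\<lambda>r. pb ?d (\<eta> r))"
      unfolding coch_def using \<eta>(1) cd assms(3)
      by (auto simp: coch_def simp del: append_assoc intro!: Inv_pb[where R' = "conn (f @ zs v r)" for r])
    fix r :: "bool list" and T :: "pt set" assume r: "length r = length v" and T: "finite T"
    have "dD (f @ [0]) v (\<lambda>r. pb ?d (\<eta> r)) r = pb ?d (dD f v \<eta> r)"
      by (rule dD_pb[OF _ cd assms(3) r]) (auto simp: drop_level_def)
    then have "dD (f @ [0]) v (\<lambda>r. pb ?d (\<eta> r)) r T = pb ?d (pb ?a (\<chi> r)) T"
      using \<eta>(2)[OF r] T by (simp add: pb_def)
    also have "\<dots> = pb (?a \<circ> ?d) (\<chi> r) T"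
      by (simp only: pb_def image_comp[symmetric] comp_inj_on_iff image_image) (auto simp: pb_def image_image comp_inj_on_iff[symmetric] inj_on_def)
    also have "\<dots> = \<chi> r T"
    proof (rule Inv_pb_eq[OF T equiv_conn])
      show "Inv UNIV (conn ((f @ [0]) @ zs v r)) (\<chi> r)" using \<chi> r by (simp add: cocycle_def coch_def)
      have "?d (?a (?d p)) = ?d p" for p by (cases p) (auto simp: add_level_def drop_level_def)
      then show "(p, (?a \<circ> ?d) p) \<in> conn ((f @ [0]) @ zs v r)" for p
        using cd[of "zs v r" p "(?a \<circ> ?d) p"] assms(3) by simp
    qed
    finally show "\<chi> r T = dD (f @ [0]) v (\<lambda>r. pb ?d (\<eta> r)) r T" by simp
  qed
qed

text \<open>The dual differential lowers the number of 1-resolutions by exactly one, so a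
  homogeneous component of a cocycle is again a cocycle.\<close>

lemma dD_truncate:
  "length r = length v \<Longrightarrow> dD f v (\<lambda>r. if ones r = k then \<chi> r else (\<lambda>T. 0)) r = (if Suc (ones r) = k then dD f v \<chi> r else (\<lambda>T. 0))"
proof (induction v arbitrary: f \<chi> r k)
  case (Cons x v)
  then obtain b r' where r: "r = b # r'" "length r' = length v" by (cases r) auto
  show ?case
  proof (cases b)
    case True
    show ?thesis
    proof (cases k)
      case 0 then show ?thesis using True by (simp add: r)
    next
      case (Suc k')
      then show ?thesis using True Cons.IH[OF r(2), of "f @ [sl x True]" k' "\<lambda>r. \<chi> (True # r)"] by (simp add: r)
    qed
  next
    case False
    then show ?thesis using Cons.IH[OF r(2), of "f @ [sl x False]" k "\<lambda>r. \<chi> (False # r)"] by (simp add: r)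
  qed
qed simp

lemma ones_oriented: "ones (oriented_state v) = length (filter (\<lambda>x. x < 0) v)"
  by (induction v) (auto simp: oriented_state_def ones_def)

text \<open>By the cone description, a cocycle extends over a new negative crossing once its saddle
  image has a primitive over the turn-back. Keeping only the component with as many 1-resolutions as
  the oriented state preserves the value at \<open>T0\<close> and puts the saddle image into the
  range where acyclicity applies.\<close>

lemma detected_neg_step:
  assumes "detected R [] v" "acyclic_from R [i] v k" "k \<le> length (filter (\<lambda>x. x < 0) v)"
    and i: "i = 1 \<or> i = 2" and v: "valid_word 3 v"
  shows "detected R [] (- int i # v)"
proof -
  let ?m = "length (filter (\<lambda>x. x < 0) v)"
  have i0: "i > 0" "nat \<bar>- int i\<bar> = i" using i by auto
  have "detected R [0] v" using assms(1) detected_blank[of "[]" v R] v by simp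
  then obtain \<psi> :: "'a cochain" where \<psi>: "cocycle [0] v \<psi>" "\<psi> (oriented_state v) T0 = 1"
    unfolding detected_def by blast
  define \<phi> where "\<phi> = (\<lambda>r. if ones r = ?m then \<psi> r else (\<lambda>T. 0))"
  have \<phi>: "cocycle [0] v \<phi>"
    using \<psi>(1) unfolding cocycle_def \<phi>_def by (simp add: dD_truncate coch_def)
  let ?S = "\<lambda>r. dsad (conn (0 # zs v r)) (0, ev i) (Suc 0, 1)"
  have "cocycle [i] v (\<lambda>r. ?S r (\<phi> r))" using cocycle_dsad[of "[]" 0 "[]" v \<phi> i i] \<phi> i v by simp
  moreover have "?S r (\<phi> r) = (\<lambda>T. 0)" if "length r = length v" "ones r < k" for r
    using that assms(3) by (simp add: \<phi>_def)
  ultimately obtain \<eta> where \<eta>: "coch [i] v \<eta>" "\<And>r T. length r = length v \<Longrightarrow> finite T \<Longrightarrow> ?S r (\<phi> r) T = dD [i] v \<eta> r T"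
    using assms(2) unfolding acyclic_from_def by blast
  have "cocycle [] (- int i # v) (glue (\<lambda>r T. - \<eta> r T) \<phi>)"
    unfolding cocycle_Cons using \<phi> coch_uminus[OF \<eta>(1)] \<eta>(2) i0 by (simp add: dD_uminus)
  moreover have "glue (\<lambda>r T. - \<eta> r T) \<phi> (oriented_state (- int i # v)) T0 = 1"
    using \<psi>(2) i0(1) by (simp add: oriented_Cons \<phi>_def ones_oriented)
  ultimately show ?thesis unfolding detected_def by blast
qed

section \<open>The third Reidemeister move\<close>

definition sd :: "int list \<Rightarrow> nat \<Rightarrow> nat \<Rightarrow> nat list \<Rightarrow> bool list \<Rightarrow> (pt, 'a::comm_ring_1) dual \<Rightarrow> (pt, 'a) dual" where
  "sd v t k l r = dsad (conn (l @ zs v r)) (t, ev k) (Suc t, 1)"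

lemma cocycle_Cons3:
  assumes "i > 0" "j > 0"
  shows "cocycle [] (int i # int j # int i # v) \<chi> \<longleftrightarrow>
     coch [0, 0, 0] v (\<lambda>r. \<chi> (False # False # False # r)) \<and> coch [0, 0, i] v (\<lambda>r. \<chi> (False # False # True # r)) \<and>
     coch [0, j, 0] v (\<lambda>r. \<chi> (False # True # False # r)) \<and> coch [0, j, i] v (\<lambda>r. \<chi> (False # True # True # r)) \<and>
     coch [i, 0, 0] v (\<lambda>r. \<chi> (True # False # False # r)) \<and> coch [i, 0, i] v (\<lambda>r. \<chi> (True # False # True # r)) \<and>
     coch [i, j, 0] v (\<lambda>r. \<chi> (True # True # False # r)) \<and> coch [i, j, i] v (\<lambda>r. \<chi> (True # True # True # r)) \<and>
     (\<forall>r. length r = length v \<longrightarrow> (\<forall>T. finite T \<longrightarrow>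
        dD [0, 0, 0] v (\<lambda>r. \<chi> (False # False # False # r)) r T + sd v (Suc (Suc 0)) i [0, 0, i] r (\<chi> (False # False # True # r)) T
          + sd v (Suc 0) j [0, j, 0] r (\<chi> (False # True # False # r)) T + sd v 0 i [i, 0, 0] r (\<chi> (True # False # False # r)) T = 0 \<and>
        - dD [0, 0, i] v (\<lambda>r. \<chi> (False # False # True # r)) r T + sd v (Suc 0) j [0, j, i] r (\<chi> (False # True # True # r)) T
          + sd v 0 i [i, 0, i] r (\<chi> (True # False # True # r)) T = 0 \<and>
        - (dD [0, j, 0] v (\<lambda>r. \<chi> (False # True # False # r)) r T + sd v (Suc (Suc 0)) i [0, j, i] r (\<chi> (False # True # True # r)) T)
          + sd v 0 i [i, j, 0] r (\<chi> (True # True # False # r)) T = 0 \<and>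
        dD [0, j, i] v (\<lambda>r. \<chi> (False # True # True # r)) r T + sd v 0 i [i, j, i] r (\<chi> (True # True # True # r)) T = 0 \<and>
        dD [i, 0, 0] v (\<lambda>r. \<chi> (True # False # False # r)) r T + sd v (Suc (Suc 0)) i [i, 0, i] r (\<chi> (True # False # True # r)) T
          + sd v (Suc 0) j [i, j, 0] r (\<chi> (True # True # False # r)) T = 0 \<and>
        - dD [i, 0, i] v (\<lambda>r. \<chi> (True # False # True # r)) r T + sd v (Suc 0) j [i, j, i] r (\<chi> (True # True # True # r)) T = 0 \<and>
        dD [i, j, 0] v (\<lambda>r. \<chi> (True # True # False # r)) r T + sd v (Suc (Suc 0)) i [i, j, i] r (\<chi> (True # True # True # r)) T = 0 \<and>
        dD [i, j, i] v (\<lambda>r. \<chi> (True # True # True # r)) r T = 0))"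
proof -
  have n: "nat \<bar>int i\<bar> = i" "nat \<bar>int j\<bar> = j" by auto
  show ?thesis
    unfolding cocycle_def coch_Cons all_length_Cons sd_def
    unfolding dD.simps if_True if_False neg_equal_0_iff_equal simp_thms minus_minus
      append_assoc append_Cons append_Nil zs.simps length_append list.size add_Suc_right add_0_right One_nat_def
      sl_int(1)[OF assms(1)] sl_int(1)[OF assms(2)] n
    by (simp only: all_conj_distrib imp_conjR conj_assoc if_True if_False simp_thms)
qed

lemma covers_blank3: "covers (outer 0 3) (conn (0 # 0 # 0 # y))"
proof -
  let ?z = "0 # 0 # 0 # y"
  have "((0, p), (1, p)) \<in> conn ?z" "((1, p), (2, p)) \<in> conn ?z" if "p < 3" for p
    using conn_blank[of 0 ?z p] conn_blank[of 1 ?z p] that by (auto simp: numeral_2_eq_2)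
  then have "((Suc 0, p), (0, p)) \<in> conn ?z" "((Suc (Suc 0), p), (0, p)) \<in> conn ?z" if "p < 3" for p
    using that conn_sym conn_trans by (metis One_nat_def numeral_2_eq_2)+
  then show ?thesis by (intro covers3I) auto
qed

text \<open>Every saddle occurring in the two words can be moved to the boundary of the disc.\<close>

lemma corners:
  assumes ij: "i = 1 \<and> j = 2 \<or> i = 2 \<and> j = 1"
  shows "((Suc 0, 1), (3, 1)) \<in> conn (i # 0 # 0 # y)"
    "((Suc 0, ev i), (0, ev i)) \<in> conn (0 # i # 0 # y)" "((Suc (Suc 0), 1), (3, 1)) \<in> conn (0 # i # 0 # y)"
    "((Suc (Suc 0), ev i), (0, ev i)) \<in> conn (0 # 0 # i # y)"
    "((Suc 0, ev j), (0, ev j)) \<in> conn (i # j # 0 # y)" "((Suc (Suc 0), 1), (3, 1)) \<in> conn (i # j # 0 # y)"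
    "((Suc 0, 1), (3, ev i)) \<in> conn (i # j # 0 # y)"
    "((Suc (Suc 0), ev j), (0, ev j)) \<in> conn (0 # i # j # y)" "((Suc 0, ev i), (0, ev i)) \<in> conn (0 # i # j # y)"
    "((Suc (Suc 0), 1), (3, ev i)) \<in> conn (0 # i # j # y)"
proof -
  have i: "i = 1 \<or> i = 2" "j = 1 \<or> j = 2" "ev i = od j" "ev j = od i" "ev i < 3" "ev j < 3" "od i < 3" "od j < 3" using ij by auto
  have B: "t < length z \<Longrightarrow> z ! t = 0 \<Longrightarrow> p < 3 \<Longrightarrow> cl z (Suc t, p) = cl z (t, p)" for t z p by (rule cl_blank)
  have 3: "3 = Suc (Suc (Suc 0))" by simp
  show "((Suc 0, 1), (3, 1)) \<in> conn (i # 0 # 0 # y)"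
    using cl_blank[of 1 "i # 0 # 0 # y" 1] cl_blank[of 2 "i # 0 # 0 # y" 1] by (simp add: conn_iff_cl numeral_2_eq_2 3)
  show "((Suc 0, ev i), (0, ev i)) \<in> conn (0 # i # 0 # y)"
    using cl_blank[of 0 "0 # i # 0 # y" "ev i"] i(5) by (simp add: conn_iff_cl)
  show "((Suc (Suc 0), 1), (3, 1)) \<in> conn (0 # i # 0 # y)"
    using cl_blank[of 2 "0 # i # 0 # y" 1] by (simp add: conn_iff_cl numeral_2_eq_2 3)
  show "((Suc (Suc 0), ev i), (0, ev i)) \<in> conn (0 # 0 # i # y)"
    using cl_blank[of 0 "0 # 0 # i # y" "ev i"] cl_blank[of 1 "0 # 0 # i # y" "ev i"] i(5) by (simp add: conn_iff_cl numeral_2_eq_2)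
  let ?z = "i # j # 0 # y"
  have F: "cl ?z (Suc 0, ev i) = cl ?z (Suc 0, 1)" "cl ?z (Suc 0, od i) = cl ?z (0, od i)"
    "cl ?z (Suc (Suc 0), od j) = cl ?z (Suc 0, od j)" "p < 3 \<Longrightarrow> cl ?z (3, p) = cl ?z (Suc (Suc 0), p)" for p
    using cl_turn[of 0 ?z i] cl_turn[of 1 ?z j] cl_blank[of 2 ?z p] i by (simp_all add: numeral_2_eq_2 3)
  show "((Suc 0, ev j), (0, ev j)) \<in> conn ?z" using F(2) i(4) by (simp add: conn_iff_cl)
  show "((Suc (Suc 0), 1), (3, 1)) \<in> conn ?z" using F(4)[of 1] by (simp add: conn_iff_cl)
  show "((Suc 0, 1), (3, ev i)) \<in> conn ?z" using F(1) F(3) F(4)[of "ev i"] i(3,5) unfolding conn_iff_cl by metis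
  let ?z = "0 # i # j # y"
  have F: "cl ?z (Suc (Suc 0), ev i) = cl ?z (Suc (Suc 0), 1)" "cl ?z (Suc (Suc 0), od i) = cl ?z (Suc 0, od i)"
    "cl ?z (3, od j) = cl ?z (Suc (Suc 0), od j)" "p < 3 \<Longrightarrow> cl ?z (Suc 0, p) = cl ?z (0, p)" for p
    using cl_turn[of 1 ?z i] cl_turn[of 2 ?z j] cl_blank[of 0 ?z p] i by (simp_all add: numeral_2_eq_2 3)
  show "((Suc (Suc 0), ev j), (0, ev j)) \<in> conn ?z" using F(2) F(4)[of "od i"] i(4,7) unfolding conn_iff_cl by metis
  show "((Suc 0, ev i), (0, ev i)) \<in> conn ?z" using F(4)[of "ev i"] i(5) by (simp add: conn_iff_cl)
  show "((Suc (Suc 0), 1), (3, ev i)) \<in> conn ?z" using F(1) F(3) i(3) unfolding conn_iff_cl by metis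
qed

text \<open>The two saddles may take place at different spots inside the disc. Once their ends are
  slid to common points \<open>a\<close>, \<open>b\<close> outside, only values and connections
  outside matter, and these agree.\<close>

lemma dsad_tr:
  assumes so: "same_outer U f f'" and \<phi>: "coch f v \<phi>" and \<psi>: "coch f' v \<psi>" and eq: "\<And>r T. T \<subseteq> U \<Longrightarrow> \<psi> r T = \<phi> r T"
    and v: "valid_word 3 v" and r: "length r = length v" and T: "T \<subseteq> U" and ab: "a \<in> U" "b \<in> U"
    and 1: "(a1, a) \<in> conn (f @ zs v r)" "(b1, b) \<in> conn (f @ zs v r)"
    and 2: "(a2, a) \<in> conn (f' @ zs v r)" "(b2, b) \<in> conn (f' @ zs v r)"
  shows "dsad (conn (f' @ zs v r)) a2 b2 (\<psi> r) T = dsad (conn (f @ zs v r)) a1 b1 (\<phi> r) T"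
proof -
  have "Inv UNIV (conn (f @ zs v r)) (\<phi> r)" "Inv UNIV (conn (f' @ zs v r)) (\<psi> r)"
    using \<phi> \<psi> r by (auto simp: coch_def)
  then have "dsad (conn (f @ zs v r)) a1 b1 (\<phi> r) = dsad (conn (f @ zs v r)) a b (\<phi> r)"
    "dsad (conn (f' @ zs v r)) a2 b2 (\<psi> r) = dsad (conn (f' @ zs v r)) a b (\<psi> r)"
    using dsad_cong[OF equiv_conn] 1 2 by blast+
  moreover have "(a, b) \<in> conn (f' @ zs v r) \<longleftrightarrow> (a, b) \<in> conn (f @ zs v r)"
    using so v ab unfolding same_outer_def by auto
  ultimately show ?thesis using dsad_local[of U "\<psi> r" "\<phi> r" a b] eq ab T by metis
qed

lemma coch_sd:
  assumes "coch (g @ s' # h) v \<chi>" "flat g" "flat h" "i = 1 \<or> i = 2" "s = 0 \<and> s' = i \<or> s = i \<and> s' = 0" "valid_word 3 v"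
  shows "coch (g @ s # h) v (\<lambda>r. sd v (length g) i (g @ s' # h) r (\<chi> r))"
  using coch_dsad[OF assms HOL.refl HOL.refl] by (simp add: sd_def)

lemma dD_sd:
  assumes "coch (g @ s' # h) v \<chi>" "flat g" "flat h" "i = 1 \<or> i = 2" "s = 0 \<and> s' = i \<or> s = i \<and> s' = 0" "valid_word 3 v"
    "length r = length v"
  shows "dD (g @ s # h) v (\<lambda>r. sd v (length g) i (g @ s' # h) r (\<chi> r)) r = sd v (length g) i (g @ s' # h) r (dD (g @ s' # h) v \<chi> r)"
  using dD_dsad[OF assms HOL.refl HOL.refl] by (simp add: sd_def)

lemma sd_square:
  assumes \<phi>: "coch (g @ i # h @ j # k) v \<phi>" and fl: "flat g" "flat h" "flat k" and i: "i = 1 \<or> i = 2" and j: "j = 1 \<or> j = 2"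
    and v: "valid_word 3 v" "length r = length v" and n: "n = Suc (length g + length h)"
  shows "sd v (length g) i (g @ i # h @ 0 # k) r (sd v n j (g @ i # h @ j # k) r (\<phi> r)) =
         sd v n j (g @ 0 # h @ j # k) r (sd v (length g) i (g @ i # h @ j # k) r (\<phi> r))"
  unfolding sd_def n
proof (rule dsad_square[where ?R00.0 = "conn ((g @ 0 # h @ 0 # k) @ zs v r)"])
  let ?y = "zs v r"
  have y: "flat ?y" using v by simp
  show "saddle (conn ((g @ 0 # h @ 0 # k) @ ?y)) (conn ((g @ i # h @ 0 # k) @ ?y)) (length g, ev i) (Suc (length g), 1)"
    using saddle_conn[of g "h @ 0 # k @ ?y" i 0 i] fl i y by auto
  show "saddle (conn ((g @ 0 # h @ j # k) @ ?y)) (conn ((g @ i # h @ j # k) @ ?y)) (length g, ev i) (Suc (length g), 1)"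
    using saddle_conn[of g "h @ j # k @ ?y" i 0 i] fl i j y by auto
  show "saddle (conn ((g @ 0 # h @ 0 # k) @ ?y)) (conn ((g @ 0 # h @ j # k) @ ?y)) (Suc (length g + length h), ev j) (Suc (Suc (length g + length h)), 1)"
    using saddle_conn[of "g @ 0 # h" "k @ ?y" j 0 j] fl i j y by auto
  show "saddle (conn ((g @ i # h @ 0 # k) @ ?y)) (conn ((g @ i # h @ j # k) @ ?y)) (Suc (length g + length h), ev j) (Suc (Suc (length g + length h)), 1)"
    using saddle_conn[of "g @ i # h" "k @ ?y" j 0 j] fl i j y by auto
  show "Inv UNIV (conn ((g @ i # h @ j # k) @ ?y)) (\<phi> r)" using \<phi> v(2) by (simp add: coch_def)
qed

lemma cocycle_tr:
  assumes so: "same_outer U f f'" and \<chi>: "cocycle f v \<chi>" and v: "valid_word 3 v"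
  shows "cocycle f' v (tr U f' v \<chi>)"
  unfolding cocycle_def
proof (intro conjI allI impI)
  show co: "coch f' v (tr U f' v \<chi>)" by (rule coch_tr[OF so cocycle_coch[OF \<chi>] v])
  have fl: "flat f'" using so by (simp add: same_outer_def)
  fix r :: "bool list" and T :: "pt set" assume r: "length r = length v" and T: "finite T"
  show "dD f' v (tr U f' v \<chi>) r T = 0"
  proof (rule coch_det[where U = U, OF _ coch_dD[OF co fl v] coch_zero r _ T])
    show "covers U (conn (f' @ zs v r))" using so v by (simp add: same_outer_def)
    fix T assume "finite T" "T \<subseteq> U"
    then show "dD f' v (tr U f' v \<chi>) r T = 0" using dD_tr[OF so v r, of T \<chi>] cocycleD[OF \<chi> r] by simp
  qed
qed

text \<open>The states of the two words are matched by isotopies of flat tangles: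
  \<open>[0, j, i]\<close> with \<open>[j, i, 0]\<close>, \<open>[i, j, 0]\<close> with
  \<open>[0, i, j]\<close>, and single turn-backs with single turn-backs of the same index. The
  circle state and the last state of the given cube are first eliminated by correcting their
  neighbours; in the new cube the last state gets 0 and the circle state a compensating
  term.\<close>

lemma detected_braid:
  assumes det: "detected R [] (int i # int j # int i # v)" and ij: "i = 1 \<and> j = 2 \<or> i = 2 \<and> j = 1" and v: "valid_word 3 v"
  shows "detected R [] (int j # int i # int j # v)"
proof -
  obtain \<chi> :: "'a cochain" where \<chi>: "cocycle [] (int i # int j # int i # v) \<chi>"
    and one: "\<chi> (oriented_state (int i # int j # int i # v)) T0 = 1"
    using det unfolding detected_def by blast
  have i: "i = 1 \<or> i = 2" and j: "j = 1 \<or> j = 2" and i0: "i > 0" "j > 0" using ij by auto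
  have ji: "j = 1 \<and> i = 2 \<or> j = 2 \<and> i = 1" using ij by auto
  let ?U = "outer 0 3" and ?q = "(Suc 0, 1) :: pt" and ?w = "(3, 1) :: pt" and ?u = "(0, ev i) :: pt"
  define A :: "nat list \<Rightarrow> bool list \<Rightarrow> (pt, 'a) dual \<Rightarrow> (pt, 'a) dual" where "A = sd v 0 i"
  define B :: "nat list \<Rightarrow> bool list \<Rightarrow> (pt, 'a) dual \<Rightarrow> (pt, 'a) dual" where "B = sd v (Suc 0) j"
  define C :: "nat list \<Rightarrow> bool list \<Rightarrow> (pt, 'a) dual \<Rightarrow> (pt, 'a) dual" where "C = sd v (Suc (Suc 0)) i"
  define A' :: "nat list \<Rightarrow> bool list \<Rightarrow> (pt, 'a) dual \<Rightarrow> (pt, 'a) dual" where "A' = sd v 0 j"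
  define B' :: "nat list \<Rightarrow> bool list \<Rightarrow> (pt, 'a) dual \<Rightarrow> (pt, 'a) dual" where "B' = sd v (Suc 0) i"
  define C' :: "nat list \<Rightarrow> bool list \<Rightarrow> (pt, 'a) dual \<Rightarrow> (pt, 'a) dual" where "C' = sd v (Suc (Suc 0)) j"
  have lin: "X l r (\<lambda>T. \<phi> T + \<psi> T) = (\<lambda>T. X l r \<phi> T + X l r \<psi> T)" "X l r (\<lambda>T. - \<phi> T) = (\<lambda>T. - X l r \<phi> T)" "X l r (\<lambda>T. 0) = (\<lambda>T. 0)"
    if "X \<in> {A, B, C, A', B', C'}" for X l r \<phi> \<psi>
    using that by (auto simp: A_def B_def C_def A'_def B'_def C'_def sd_def dsad_add dsad_uminus)
  have fin: "X l r \<phi> T = X l r \<psi> T" if "X \<in> {A, B, C, A', B', C'}" "\<And>T. finite T \<Longrightarrow> \<phi> T = \<psi> T" "finite T" for X l r \<phi> \<psi> T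
    using that(1) dsad_finite_cong[OF that(2,3)] by (auto simp: A_def B_def C_def A'_def B'_def C'_def sd_def)
  define c000 where "c000 = (\<lambda>r. \<chi> (False # False # False # r))"
  define c001 where "c001 = (\<lambda>r. \<chi> (False # False # True # r))"
  define c010 where "c010 = (\<lambda>r. \<chi> (False # True # False # r))"
  define c011 where "c011 = (\<lambda>r. \<chi> (False # True # True # r))"
  define c100 where "c100 = (\<lambda>r. \<chi> (True # False # False # r))"
  define c101 where "c101 = (\<lambda>r. \<chi> (True # False # True # r))"
  define c110 where "c110 = (\<lambda>r. \<chi> (True # True # False # r))"
  define c111 where "c111 = (\<lambda>r. \<chi> (True # True # True # r))"
  have c: "coch [0, 0, 0] v c000" "coch [0, 0, i] v c001" "coch [0, j, 0] v c010" "coch [0, j, i] v c011"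
    "coch [i, 0, 0] v c100" "coch [i, 0, i] v c101" "coch [i, j, 0] v c110" "coch [i, j, i] v c111"
    and E: "\<forall>r. length r = length v \<longrightarrow> (\<forall>T. finite T \<longrightarrow>
        dD [0, 0, 0] v c000 r T + C [0, 0, i] r (c001 r) T + B [0, j, 0] r (c010 r) T + A [i, 0, 0] r (c100 r) T = 0 \<and>
        - dD [0, 0, i] v c001 r T + B [0, j, i] r (c011 r) T + A [i, 0, i] r (c101 r) T = 0 \<and>
        - (dD [0, j, 0] v c010 r T + C [0, j, i] r (c011 r) T) + A [i, j, 0] r (c110 r) T = 0 \<and>
        dD [0, j, i] v c011 r T + A [i, j, i] r (c111 r) T = 0 \<and>
        dD [i, 0, 0] v c100 r T + C [i, 0, i] r (c101 r) T + B [i, j, 0] r (c110 r) T = 0 \<and>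
        - dD [i, 0, i] v c101 r T + B [i, j, i] r (c111 r) T = 0 \<and>
        dD [i, j, 0] v c110 r T + C [i, j, i] r (c111 r) T = 0 \<and>
        dD [i, j, i] v c111 r T = 0)"
    using \<chi>[unfolded cocycle_Cons3[OF i0]]
    unfolding c000_def c001_def c010_def c011_def c100_def c101_def c110_def c111_def A_def B_def C_def by blast+
  have E000: "dD [0, 0, 0] v c000 r T + C [0, 0, i] r (c001 r) T + B [0, j, 0] r (c010 r) T + A [i, 0, 0] r (c100 r) T = 0"
    and E001: "dD [0, 0, i] v c001 r T = B [0, j, i] r (c011 r) T + A [i, 0, i] r (c101 r) T"
    and E010: "dD [0, j, 0] v c010 r T = A [i, j, 0] r (c110 r) T - C [0, j, i] r (c011 r) T"
    and E011: "dD [0, j, i] v c011 r T = - A [i, j, i] r (c111 r) T"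
    and E100: "dD [i, 0, 0] v c100 r T = - C [i, 0, i] r (c101 r) T - B [i, j, 0] r (c110 r) T"
    and E101: "dD [i, 0, i] v c101 r T = B [i, j, i] r (c111 r) T"
    and E110: "dD [i, j, 0] v c110 r T = - C [i, j, i] r (c111 r) T"
    if "length r = length v" "finite T" for r T
  proof -
    have x: "- a + b + c = 0 \<Longrightarrow> a = b + c" "- (a + b) + c = 0 \<Longrightarrow> a = c - b" "a + b = 0 \<Longrightarrow> a = - b"
      "a + b + c = 0 \<Longrightarrow> a = - b - c" "- a + b = 0 \<Longrightarrow> a = b" for a b c :: 'a
      by (simp_all add: algebra_simps eq_neg_iff_add_eq_0 eq_iff_diff_eq_0[of a] neg_eq_iff_add_eq_0)
    note H = E[rule_format, OF that]
    note H1 = conjunct2[OF H] note H2 = conjunct2[OF H1] note H3 = conjunct2[OF H2] note H4 = conjunct2[OF H3]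
    note H5 = conjunct2[OF H4] note H6 = conjunct2[OF H5]
    show "dD [0, 0, 0] v c000 r T + C [0, 0, i] r (c001 r) T + B [0, j, 0] r (c010 r) T + A [i, 0, 0] r (c100 r) T = 0"
      by (rule conjunct1[OF H])
    show "dD [0, 0, i] v c001 r T = B [0, j, i] r (c011 r) T + A [i, 0, i] r (c101 r) T" by (rule x(1)[OF conjunct1[OF H1]])
    show "dD [0, j, 0] v c010 r T = A [i, j, 0] r (c110 r) T - C [0, j, i] r (c011 r) T" by (rule x(2)[OF conjunct1[OF H2]])
    show "dD [0, j, i] v c011 r T = - A [i, j, i] r (c111 r) T" by (rule x(3)[OF conjunct1[OF H3]])
    show "dD [i, 0, 0] v c100 r T = - C [i, 0, i] r (c101 r) T - B [i, j, 0] r (c110 r) T" by (rule x(4)[OF conjunct1[OF H4]])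
    show "dD [i, 0, i] v c101 r T = B [i, j, i] r (c111 r) T" by (rule x(5)[OF conjunct1[OF H5]])
    show "dD [i, j, 0] v c110 r T = - C [i, j, i] r (c111 r) T" by (rule x(3)[OF conjunct1[OF H6]])
  qed
  have M: "B [i, j, i] r \<phi> = \<phi>" for r \<phi>
    using conn_zigzag_inner(1)[OF ij, of "[]" "zs v r"] by (auto simp: B_def sd_def intro: dsad_connected)
  have co: "circle_outer ?U ?q [i, 0, i] [i, 0, 0]" using circle_outer3[OF ij, of "[]" "[i, 0, 0]"] by simp
  have so: "same_outer ?U [i, 0, i] [i, j, i]" using same_outer3(1)[OF ij, of "[]" "[i, 0, i]" "[i, j, i]"] by simp
  \<comment> \<open>The \<open>v_+\<close> part of the circle state. The merge into
    \<open>[i, j, i]\<close> is the identity on dual cochains, so the coboundary of \<alpha> is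
    \<open>c111\<close>, and its saddle images turn \<open>c110\<close> and \<open>c011\<close> into
    the cocycles \<mu> and \<nu>.\<close>
  define \<alpha> where "\<alpha> = tr ?U [i, j, i] v c101"
  have \<alpha>: "coch [i, j, i] v \<alpha>" unfolding \<alpha>_def by (rule coch_tr[OF so c(6) v])
  have \<alpha>U: "\<And>r T. T \<subseteq> ?U \<Longrightarrow> \<alpha> r T = c101 r T" unfolding \<alpha>_def by (rule tr_on)
  have \<alpha>': "coch [i, 0, i] v \<alpha>"
    using coch_sd[of "[i]" j "[i]" v \<alpha> j 0] \<alpha> i j v M by (auto simp: B_def[symmetric])
  have cA: "coch (0 # h) v (\<lambda>r. A (i # h) r (\<phi> r))" if "coch (i # h) v \<phi>" "flat h" for h \<phi>
    using coch_sd[of "[]" i h v \<phi> i 0] that i v by (simp add: A_def)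
  have cC: "coch [i, j, 0] v (\<lambda>r. C [i, j, i] r (\<phi> r))" if "coch [i, j, i] v \<phi>" for \<phi>
    using coch_sd[of "[i, j]" i "[]" v \<phi> i 0] that i j v by (auto simp: C_def)
  have D\<alpha>: "dD [i, j, i] v \<alpha> r T = c111 r T" if r: "length r = length v" and T: "finite T" for r T
  proof (rule coch_det[where U = ?U, OF _ coch_dD[OF \<alpha> _ v] c(8) r _ T])
    show "covers ?U (conn ([i, j, i] @ zs v r))" using covers3[OF ij, of "[i, j, i]" "[]" "zs v r"] by simp
    show "flat [i, j, i]" using i j by auto
    fix T assume T: "finite T" "T \<subseteq> ?U"
    have "dD [i, j, i] v \<alpha> r T = dD [i, 0, i] v c101 r T" unfolding \<alpha>_def by (rule dD_tr[OF so v r T(2)])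
    then show "dD [i, j, i] v \<alpha> r T = c111 r T" using E101[OF r T(1)] by (simp add: M)
  qed
  define \<mu> where "\<mu> = (\<lambda>r T. c110 r T + C [i, j, i] r (\<alpha> r) T)"
  define \<nu> where "\<nu> = (\<lambda>r T. c011 r T + A [i, j, i] r (\<alpha> r) T)"
  have \<mu>: "cocycle [i, j, 0] v \<mu>"
    unfolding cocycle_def
  proof (intro conjI allI impI)
    show "coch [i, j, 0] v \<mu>" unfolding \<mu>_def by (intro coch_add c(7) cC \<alpha>)
    fix r :: "bool list" and T :: "pt set" assume r: "length r = length v" and T: "finite T"
    have d: "dD [i, j, 0] v (\<lambda>r. C [i, j, i] r (\<alpha> r)) r = C [i, j, i] r (dD [i, j, i] v \<alpha> r)"
      using dD_sd[of "[i, j]" i "[]" v \<alpha> i 0 r] \<alpha> i j v r by (auto simp: C_def)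
    have "C [i, j, i] r (dD [i, j, i] v \<alpha> r) T = C [i, j, i] r (c111 r) T" by (rule fin[OF _ D\<alpha>[OF r] T]) simp
    then show "dD [i, j, 0] v \<mu> r T = 0" unfolding \<mu>_def dD_add d using E110[OF r T] by simp
  qed
  have \<nu>: "cocycle [0, j, i] v \<nu>"
    unfolding cocycle_def
  proof (intro conjI allI impI)
    show "coch [0, j, i] v \<nu>" unfolding \<nu>_def using cA[of "[j, i]" \<alpha>] \<alpha> i j by (intro coch_add c(4)) auto
    fix r :: "bool list" and T :: "pt set" assume r: "length r = length v" and T: "finite T"
    have d: "dD [0, j, i] v (\<lambda>r. A [i, j, i] r (\<alpha> r)) r = A [i, j, i] r (dD [i, j, i] v \<alpha> r)"
      using dD_sd[of "[]" i "[j, i]" v \<alpha> i 0 r] \<alpha> i j v r by (auto simp: A_def)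
    have "A [i, j, i] r (dD [i, j, i] v \<alpha> r) T = A [i, j, i] r (c111 r) T" by (rule fin[OF _ D\<alpha>[OF r] T]) simp
    then show "dD [0, j, i] v \<nu> r T = 0" unfolding \<nu>_def dD_add d using E011[OF r T] by simp
  qed
  have so1: "same_outer ?U l l'" if "l \<in> {[k, 0, 0], [0, k, 0], [0, 0, k]}" "l' \<in> {[k, 0, 0], [0, k, 0], [0, 0, k]}" "k = i \<or> k = j" for l l' k
    using that(3) same_outer3(1)[OF ij, of "[]" l l'] same_outer3(1)[OF ji, of "[]" l l'] that(1,2) by auto
  have so\<mu>: "same_outer ?U [i, j, 0] [0, i, j]" using same_outer3(2)[OF ij, of "[]" "[i, j, 0]" "[0, i, j]"] by simp
  have so\<nu>: "same_outer ?U [0, j, i] [j, i, 0]" using same_outer3(2)[OF ji, of "[]" "[0, j, i]" "[j, i, 0]"] by simp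
  define x010a where "x010a = tr ?U [0, i, 0] v c100"
  define x010b where "x010b = tr ?U [0, i, 0] v c001"
  \<comment> \<open>The old word has two states with a single turn-back \<open>i\<close>, the new
    one has only one, which receives the sum. The single old state with turn-back \<open>j\<close>
    goes to \<open>[0, 0, j]\<close>, and \<open>[j, 0, 0]\<close> is given the value 0.\<close>
  define x010 where "x010 = (\<lambda>r T. x010a r T + x010b r T)"
  define x001 where "x001 = tr ?U [0, 0, j] v c010"
  define x110 where "x110 = tr ?U [j, i, 0] v \<nu>"
  define x011 where "x011 = tr ?U [0, i, j] v \<mu>"
  \<comment> \<open>The choice balances the equation over \<open>[j, 0, 0]\<close>. Since both
    saddles out of the circle state read the same component, it also enters over
    \<open>[0, 0, j]\<close>, where \<open>sq3\<close> makes the remaining terms cancel.\<close>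
  define \<beta> where "\<beta> = (\<lambda>r T. - B' [j, i, 0] r (x110 r) T)"
  define x101 where "x101 = circ ?U ?q [j, 0, j] v (\<lambda>r T. 0) \<beta>"
  have x010a: "coch [0, i, 0] v x010a" unfolding x010a_def by (rule coch_tr[OF so1[of _ i] c(5) v]) auto
  have x010b: "coch [0, i, 0] v x010b" unfolding x010b_def by (rule coch_tr[OF so1[of _ i] c(2) v]) auto
  have x010: "coch [0, i, 0] v x010" unfolding x010_def by (intro coch_add x010a x010b)
  have x001: "coch [0, 0, j] v x001" unfolding x001_def by (rule coch_tr[OF so1[of _ j] c(3) v]) auto
  have x110: "cocycle [j, i, 0] v x110" unfolding x110_def by (rule cocycle_tr[OF so\<nu> \<nu> v])
  have x011: "cocycle [0, i, j] v x011" unfolding x011_def by (rule cocycle_tr[OF so\<mu> \<mu> v])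
  have cB': "coch [j, 0, 0] v (\<lambda>r. B' [j, i, 0] r (x110 r))"
    using coch_sd[of "[j]" i "[0]" v x110 i 0] cocycle_coch[OF x110] i j v by (auto simp: B'_def)
  have \<beta>: "cocycle [j, 0, 0] v \<beta>"
    unfolding cocycle_def
  proof (intro conjI allI impI)
    show "coch [j, 0, 0] v \<beta>" unfolding \<beta>_def by (intro coch_uminus cB')
    fix r :: "bool list" and T :: "pt set" assume r: "length r = length v" and T: "finite T"
    have "dD [j, 0, 0] v (\<lambda>r. B' [j, i, 0] r (x110 r)) r = B' [j, i, 0] r (dD [j, i, 0] v x110 r)"
      using dD_sd[of "[j]" i "[0]" v x110 i 0 r] cocycle_coch[OF x110] i j v r by (auto simp: B'_def)
    moreover have "B' [j, i, 0] r (dD [j, i, 0] v x110 r) T = B' [j, i, 0] r (\<lambda>T. 0) T"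
      by (rule fin[OF _ cocycleD[OF x110 r] T]) simp
    ultimately show "dD [j, 0, 0] v \<beta> r T = 0" unfolding \<beta>_def dD_uminus using lin(3)[of B'] by simp
  qed
  have co': "circle_outer ?U ?q [j, 0, j] [j, 0, 0]" using circle_outer3[OF ji, of "[]" "[j, 0, 0]"] by simp
  have q: "?q \<notin> ?U" by simp
  have x101: "cocycle [j, 0, j] v x101" unfolding x101_def by (rule cocycle_circ[OF co' \<beta> v])
  have circA: "A [i, 0, i] r (\<phi> r) T = mulX ?u (\<phi> r) T + mulX ?q (\<phi> r) T"
    and circC: "C [i, 0, i] r (\<phi> r) T = mulX ?q (\<phi> r) T + mulX ?w (\<phi> r) T"
    if "coch [i, 0, i] v \<phi>" "length r = length v" for \<phi> r T
  proof -
    have inv: "Inv UNIV (conn (i # 0 # i # zs v r)) (\<phi> r)" using that by (simp add: coch_def)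
    have n: "(?u, ?q) \<notin> conn ([i, 0, i] @ zs v r)" "(?w, ?q) \<notin> conn ([i, 0, i] @ zs v r)"
      using co v unfolding circle_outer_def by auto
    then show "A [i, 0, i] r (\<phi> r) T = mulX ?u (\<phi> r) T + mulX ?q (\<phi> r) T" by (simp add: A_def sd_def dsad_def)
    have "(?q, ?w) \<notin> conn (i # 0 # i # zs v r)" using n(2) conn_sym by auto
    moreover have "C [i, 0, i] r (\<phi> r) = dsad (conn (i # 0 # i # zs v r)) ?q ?w (\<phi> r)"
      unfolding C_def sd_def using dsad_cong[OF equiv_conn inv circle_top[OF i, of "[]", simplified] conn_refl, of ?w]
      by (simp add: numeral_3_eq_3)
    ultimately show "C [i, 0, i] r (\<phi> r) T = mulX ?q (\<phi> r) T + mulX ?w (\<phi> r) T" by (simp add: dsad_def)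
  qed
  have circA': "A' [j, 0, j] r (x101 r) T = \<beta> r T" and circC': "C' [j, 0, j] r (x101 r) T = \<beta> r T"
    if r: "length r = length v" and T: "T \<subseteq> ?U" for r T
  proof -
    have inv: "Inv UNIV (conn (j # 0 # j # zs v r)) (x101 r)" using cocycle_coch[OF x101] r by (simp add: coch_def)
    have n: "((0, ev j), ?q) \<notin> conn ([j, 0, j] @ zs v r)" "(?w, ?q) \<notin> conn ([j, 0, j] @ zs v r)"
      using co' v unfolding circle_outer_def by auto
    have m: "mulX ?q (x101 r) T = \<beta> r T" unfolding x101_def by (rule circ_minus[OF T q])
    have z: "mulX p (x101 r) T = 0" if "p \<in> ?U" for p
      using mulX_in[OF that T, of "x101 r" "\<lambda>T. 0"] circ_plus[OF _ q, of _ "[j, 0, j]" v "\<lambda>r T. 0" \<beta> r] by (simp add: x101_def)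
    show "A' [j, 0, j] r (x101 r) T = \<beta> r T" using n(1) m z[of "(0, ev j)"] by (simp add: A'_def sd_def dsad_def)
    have "(?q, ?w) \<notin> conn (j # 0 # j # zs v r)" using n(2) conn_sym by auto
    moreover have "C' [j, 0, j] r (x101 r) = dsad (conn (j # 0 # j # zs v r)) ?q ?w (x101 r)"
      unfolding C'_def sd_def using dsad_cong[OF equiv_conn inv circle_top[OF j, of "[]", simplified] conn_refl, of ?w]
      by (simp add: numeral_3_eq_3)
    ultimately show "C' [j, 0, j] r (x101 r) T = \<beta> r T" using m z[of ?w] by (simp add: dsad_def)
  qed
  have sq1: "B [i, j, 0] r (C [i, j, i] r (\<alpha> r)) = C [i, 0, i] r (\<alpha> r)" if r: "length r = length v" for r
  proof -
    have "B [i, j, 0] r (C [i, j, i] r (\<alpha> r)) = C [i, 0, i] r (B [i, j, i] r (\<alpha> r))"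
      using sd_square[of "[i]" j "[]" i "[]" v \<alpha> r "Suc (Suc 0)"] \<alpha> i j v r unfolding B_def C_def by simp
    then show ?thesis by (simp only: M)
  qed
  have sq2: "B [0, j, i] r (A [i, j, i] r (\<alpha> r)) = A [i, 0, i] r (\<alpha> r)" if r: "length r = length v" for r
  proof -
    have "A [i, 0, i] r (B [i, j, i] r (\<alpha> r)) = B [0, j, i] r (A [i, j, i] r (\<alpha> r))"
      unfolding A_def B_def
      by (rule sd_square[of "[]" i "[]" j "[i]" v \<alpha> r "Suc 0", unfolded append_Nil append_Cons list.size add_0])
        (use \<alpha> i j v r in simp_all)
    then show ?thesis by (simp only: M)
  qed
  have sq3: "A [i, j, 0] r (C [i, j, i] r (\<alpha> r)) = C [0, j, i] r (A [i, j, i] r (\<alpha> r))" if r: "length r = length v" for r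
    unfolding A_def C_def
    by (rule sd_square[of "[]" i "[j]" i "[]" v \<alpha> r "Suc (Suc 0)", unfolded append_Nil append_Cons list.size add_0])
      (use \<alpha> i j v r in simp_all)
  let ?\<chi> = "glue (glue (glue c000 x001) (glue x010 x011)) (glue (glue (\<lambda>r T. 0) x101) (glue x110 (\<lambda>r T. 0)))"
  note cor = corners[OF ij] corners[OF ji]
  have U: "(0, p) \<in> ?U" "(3, p) \<in> ?U" for p by simp_all
  have three: "Suc (Suc (Suc 0)) = 3" by simp
  have t1: "B' [0, i, 0] r (x010a r) T = A [i, 0, 0] r (c100 r) T"
    and t2: "B' [0, i, 0] r (x010b r) T = C [0, 0, i] r (c001 r) T"
    and t3: "C' [0, 0, j] r (x001 r) T = B [0, j, 0] r (c010 r) T"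
    and t4: "C' [0, i, j] r (x011 r) T = B [i, j, 0] r (\<mu> r) T"
    and t5: "A' [j, i, 0] r (x110 r) T = B [0, j, i] r (\<nu> r) T"
    and t6: "B' [0, i, j] r (x011 r) T = A [i, j, 0] r (\<mu> r) T"
    and t7: "B' [j, i, 0] r (x110 r) T = C [0, j, i] r (\<nu> r) T"
    if r: "length r = length v" and T: "T \<subseteq> ?U" for r T
  proof -
    show "B' [0, i, 0] r (x010a r) T = A [i, 0, 0] r (c100 r) T"
      unfolding A_def B'_def sd_def
      by (rule dsad_tr[OF so1[of _ i] c(5) x010a _ v r T U(1)[of "ev i"] U(2)[of 1]])
        (use cor in \<open>auto simp: x010a_def tr_on\<close>)
    show "B' [0, i, 0] r (x010b r) T = C [0, 0, i] r (c001 r) T"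
      unfolding C_def B'_def sd_def three
      by (rule dsad_tr[OF so1[of _ i] c(2) x010b _ v r T U(1)[of "ev i"] U(2)[of 1]])
        (use cor in \<open>auto simp: x010b_def tr_on\<close>)
    show "C' [0, 0, j] r (x001 r) T = B [0, j, 0] r (c010 r) T"
      unfolding C'_def B_def sd_def three
      by (rule dsad_tr[OF so1[of _ j] c(3) x001 _ v r T U(1)[of "ev j"] U(2)[of 1]])
        (use cor in \<open>auto simp: x001_def tr_on\<close>)
    show "C' [0, i, j] r (x011 r) T = B [i, j, 0] r (\<mu> r) T"
      unfolding C'_def B_def sd_def three
      by (rule dsad_tr[OF so\<mu> cocycle_coch[OF \<mu>] cocycle_coch[OF x011] _ v r T U(1)[of "ev j"] U(2)[of 1]])
        (use cor in \<open>auto simp: x011_def tr_on\<close>)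
    show "A' [j, i, 0] r (x110 r) T = B [0, j, i] r (\<nu> r) T"
      unfolding A'_def B_def sd_def three
      by (rule dsad_tr[OF so\<nu> cocycle_coch[OF \<nu>] cocycle_coch[OF x110] _ v r T U(1)[of "ev j"] U(2)[of "ev j"]])
        (use cor in \<open>auto simp: x110_def tr_on\<close>)
    show "B' [0, i, j] r (x011 r) T = A [i, j, 0] r (\<mu> r) T"
      unfolding B'_def A_def sd_def three
      by (rule dsad_tr[OF so\<mu> cocycle_coch[OF \<mu>] cocycle_coch[OF x011] _ v r T U(1)[of "ev i"] U(2)[of "ev i"]])
        (use cor in \<open>auto simp: x011_def tr_on\<close>)
    show "B' [j, i, 0] r (x110 r) T = C [0, j, i] r (\<nu> r) T"
      unfolding B'_def C_def sd_def three
      by (rule dsad_tr[OF so\<nu> cocycle_coch[OF \<nu>] cocycle_coch[OF x110] _ v r T U(1)[of "ev i"] U(2)[of 1]])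
        (use cor in \<open>auto simp: x110_def tr_on\<close>)
  qed
  have cC': "coch [0, 0, 0] v (\<lambda>r. C' [0, 0, j] r (x001 r))"
    using coch_sd[of "[0, 0]" j "[]" v x001 j 0] x001 j v unfolding C'_def by simp
  have cB'0: "coch [0, 0, 0] v (\<lambda>r. B' [0, i, 0] r (x010 r))"
    using coch_sd[of "[0]" i "[0]" v x010 i 0] x010 i v unfolding B'_def by simp
  have F000: "dD [0, 0, 0] v c000 r T + C' [0, 0, j] r (x001 r) T + B' [0, i, 0] r (x010 r) T = 0"
    if r: "length r = length v" and T: "finite T" for r T
  proof (rule coch_det[where U = ?U and f = "[0, 0, 0]" and v = v and \<eta> = "\<lambda>r T. 0"
        and \<chi> = "\<lambda>r T. dD [0, 0, 0] v c000 r T + C' [0, 0, j] r (x001 r) T + B' [0, i, 0] r (x010 r) T"])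
    show "covers ?U (conn ([0, 0, 0] @ zs v r))" using covers_blank3 by simp
    have "flat [0, 0, 0]" by simp
    from coch_dD[OF c(1) this v] show "coch [0, 0, 0] v (\<lambda>r T. dD [0, 0, 0] v c000 r T + C' [0, 0, j] r (x001 r) T + B' [0, i, 0] r (x010 r) T)"
      by (intro coch_add cC' cB'0)
    fix T assume T: "finite T" "T \<subseteq> ?U"
    have "B' [0, i, 0] r (x010 r) = (\<lambda>T. B' [0, i, 0] r (x010a r) T + B' [0, i, 0] r (x010b r) T)"
      unfolding x010_def by (rule lin(1)) simp
    then show "dD [0, 0, 0] v c000 r T + C' [0, 0, j] r (x001 r) T + B' [0, i, 0] r (x010 r) T = 0"
      using t1[OF r T(2)] t2[OF r T(2)] t3[OF r T(2)] E000[OF r T(1)] by (simp add: algebra_simps)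
  qed (use r T in auto)
  have F001: "- dD [0, 0, j] v x001 r T + B' [0, i, j] r (x011 r) T + A' [j, 0, j] r (x101 r) T = 0"
    if r: "length r = length v" and T: "finite T" for r T
  proof (rule coch_det[where U = ?U and f = "[0, 0, j]" and v = v and \<eta> = "\<lambda>r T. 0"
        and \<chi> = "\<lambda>r T. - dD [0, 0, j] v x001 r T + B' [0, i, j] r (x011 r) T + A' [j, 0, j] r (x101 r) T"])
    show "covers ?U (conn ([0, 0, j] @ zs v r))" using covers3[OF ji, of "[0, 0, j]" "[]" "zs v r"] by simp
    have 1: "coch [0, 0, j] v (\<lambda>r. B' [0, i, j] r (x011 r))"
      using coch_sd[of "[0]" i "[j]" v x011 i 0] cocycle_coch[OF x011] i j v unfolding B'_def by simp
    have 2: "coch [0, 0, j] v (\<lambda>r. A' [j, 0, j] r (x101 r))"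
      using coch_sd[of "[]" j "[0, j]" v x101 j 0] cocycle_coch[OF x101] i j v unfolding A'_def by simp
    have "flat [0, 0, j]" using j by simp
    from coch_dD[OF x001 this v] show "coch [0, 0, j] v (\<lambda>r T. - dD [0, 0, j] v x001 r T + B' [0, i, j] r (x011 r) T + A' [j, 0, j] r (x101 r) T)"
      by (intro coch_add coch_uminus 1 2)
    fix T assume T: "finite T" "T \<subseteq> ?U"
    have d: "dD [0, 0, j] v x001 r T = dD [0, j, 0] v c010 r T"
      unfolding x001_def by (rule dD_tr[OF so1[of _ j] v r T(2)]) auto
    have m: "A [i, j, 0] r (\<mu> r) = (\<lambda>T. A [i, j, 0] r (c110 r) T + A [i, j, 0] r (C [i, j, i] r (\<alpha> r)) T)"
      unfolding \<mu>_def by (rule lin(1)) simp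
    have n: "C [0, j, i] r (\<nu> r) = (\<lambda>T. C [0, j, i] r (c011 r) T + C [0, j, i] r (A [i, j, i] r (\<alpha> r)) T)"
      unfolding \<nu>_def by (rule lin(1)) simp
    show "- dD [0, 0, j] v x001 r T + B' [0, i, j] r (x011 r) T + A' [j, 0, j] r (x101 r) T = 0"
      unfolding d E010[OF r T(1)] t6[OF r T(2)] circA'[OF r T(2)] \<beta>_def t7[OF r T(2)] m n sq3[OF r] by simp
  qed (use r T in auto)
  have F010: "- (dD [0, i, 0] v x010 r T + C' [0, i, j] r (x011 r) T) + A' [j, i, 0] r (x110 r) T = 0"
    if r: "length r = length v" and T: "finite T" for r T
  proof (rule coch_det[where U = ?U and f = "[0, i, 0]" and v = v and \<eta> = "\<lambda>r T. 0"
        and \<chi> = "\<lambda>r T. - (dD [0, i, 0] v x010 r T + C' [0, i, j] r (x011 r) T) + A' [j, i, 0] r (x110 r) T"])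
    show "covers ?U (conn ([0, i, 0] @ zs v r))" using covers3[OF ij, of "[0, i, 0]" "[]" "zs v r"] by simp
    have 1: "coch [0, i, 0] v (\<lambda>r. C' [0, i, j] r (x011 r))"
      using coch_sd[of "[0, i]" j "[]" v x011 j 0] cocycle_coch[OF x011] i j v unfolding C'_def by simp
    have 2: "coch [0, i, 0] v (\<lambda>r. A' [j, i, 0] r (x110 r))"
      using coch_sd[of "[]" j "[i, 0]" v x110 j 0] cocycle_coch[OF x110] i j v unfolding A'_def by simp
    have "flat [0, i, 0]" using i by simp
    from coch_dD[OF x010 this v] show "coch [0, i, 0] v (\<lambda>r T. - (dD [0, i, 0] v x010 r T + C' [0, i, j] r (x011 r) T) + A' [j, i, 0] r (x110 r) T)"
      by (intro coch_add coch_uminus 1 2)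
    fix T assume T: "finite T" "T \<subseteq> ?U"
    have d1: "dD [0, i, 0] v x010a r T = dD [i, 0, 0] v c100 r T"
      unfolding x010a_def by (rule dD_tr[OF so1[of _ i] v r T(2)]) auto
    have d2: "dD [0, i, 0] v x010b r T = dD [0, 0, i] v c001 r T"
      unfolding x010b_def by (rule dD_tr[OF so1[of _ i] v r T(2)]) auto
    have m: "B [i, j, 0] r (\<mu> r) = (\<lambda>T. B [i, j, 0] r (c110 r) T + B [i, j, 0] r (C [i, j, i] r (\<alpha> r)) T)"
      unfolding \<mu>_def by (rule lin(1)) simp
    have n: "B [0, j, i] r (\<nu> r) = (\<lambda>T. B [0, j, i] r (c011 r) T + B [0, j, i] r (A [i, j, i] r (\<alpha> r)) T)"
      unfolding \<nu>_def by (rule lin(1)) simp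
    \<comment> \<open>The terms at the circle point \<open>?q\<close> occur in both saddles and
      cancel in the difference. At the boundary points \<open>?u\<close> and \<open>?w\<close>,
      which lie in \<open>?U\<close>, \<alpha> agrees with \<open>c101\<close>.\<close>
    have a: "mulX ?u (\<alpha> r) T = mulX ?u (c101 r) T" "mulX ?w (\<alpha> r) T = mulX ?w (c101 r) T"
      by (rule mulX_in[OF U(1) T(2) \<alpha>U], assumption, rule mulX_in[OF U(2) T(2) \<alpha>U], assumption)
    show "- (dD [0, i, 0] v x010 r T + C' [0, i, j] r (x011 r) T) + A' [j, i, 0] r (x110 r) T = 0"
      unfolding x010_def dD_add d1 d2 E100[OF r T(1)] E001[OF r T(1)] t4[OF r T(2)] t5[OF r T(2)] m n
        sq1[OF r] sq2[OF r] circA[OF c(6) r] circC[OF c(6) r] circA[OF \<alpha>' r] circC[OF \<alpha>' r] a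
      by (simp add: algebra_simps)
  qed (use r T in auto)
  have F100: "C' [j, 0, j] r (x101 r) T + B' [j, i, 0] r (x110 r) T = 0"
    if r: "length r = length v" and T: "finite T" for r T
  proof (rule coch_det[where U = ?U and f = "[j, 0, 0]" and v = v and \<eta> = "\<lambda>r T. 0"
        and \<chi> = "\<lambda>r T. C' [j, 0, j] r (x101 r) T + B' [j, i, 0] r (x110 r) T"])
    show "covers ?U (conn ([j, 0, 0] @ zs v r))" using covers3[OF ji, of "[j, 0, 0]" "[]" "zs v r"] by simp
    have 1: "coch [j, 0, 0] v (\<lambda>r. C' [j, 0, j] r (x101 r))"
      using coch_sd[of "[j, 0]" j "[]" v x101 j 0] cocycle_coch[OF x101] i j v unfolding C'_def by simp
    show "coch [j, 0, 0] v (\<lambda>r T. C' [j, 0, j] r (x101 r) T + B' [j, i, 0] r (x110 r) T)"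
      by (intro coch_add 1 cB')
    fix T assume T: "finite T" "T \<subseteq> ?U"
    show "C' [j, 0, j] r (x101 r) T + B' [j, i, 0] r (x110 r) T = 0"
      unfolding circC'[OF r T(2)] \<beta>_def by simp
  qed (use r T in auto)
  have "cocycle [] (int j # int i # int j # v) ?\<chi>"
    unfolding cocycle_Cons3[OF i0(2,1)] A'_def[symmetric] B'_def[symmetric] C'_def[symmetric] glue_simps
    using c(1) x001 x010 F000 F001 F010 F100 x011[unfolded cocycle_def] x110[unfolded cocycle_def] x101[unfolded cocycle_def]
    by (simp add: lin(3))
  moreover have "?\<chi> (oriented_state (int j # int i # int j # v)) T0 = 1"
    using one i0 by (simp add: oriented_Cons c000_def)
  ultimately show ?thesis unfolding detected_def by blast
qed

section \<open>Conjugation\<close>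

text \<open>Unwinds the recursion: the minus signs taken at 1-resolved crossings accumulate to the
  number of 1-resolutions before \<open>c\<close>, the sign of the Khovanov differential.\<close>

lemma dD_sum:
  assumes "length r = length v"
  shows "dD f v \<chi> r T = (\<Sum>c<length v. if r ! c then 0 else (- 1) ^ ones (take c r) *
    dsad (conn (f @ zs v (r[c := True]))) (length f + c, ev (nat \<bar>v ! c\<bar>)) (Suc (length f + c), 1) (\<chi> (r[c := True])) T)"
  using assms
proof (induction v arbitrary: f \<chi> r)
  case (Cons x v)
  then obtain b r' where r: "r = b # r'" "length r' = length v" by (cases r) auto
  show ?case
  proof (cases b)
    case True
    then show ?thesis
      using Cons.IH[OF r(2), of "f @ [sl x True]" "\<lambda>r. \<chi> (True # r)"]
      by (simp add: r sum.lessThan_Suc_shift sum_negf[symmetric] if_distrib del: sum.lessThan_Suc cong: if_cong)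
  next
    case False
    then show ?thesis
      using Cons.IH[OF r(2), of "f @ [sl x False]" "\<lambda>r. \<chi> (False # r)"]
      by (simp add: r sum.lessThan_Suc_shift add.commute del: sum.lessThan_Suc cong: if_cong)
  qed
qed simp

text \<open>The first slice becomes the last one. Its lower level 0 goes to \<open>n\<close>; its
  upper level 1 goes to 0, which the closing arcs identify with the top level
  \<open>n + 1\<close>.\<close>

definition roth :: "nat \<Rightarrow> pt \<Rightarrow> pt" where
  "roth n = (\<lambda>(t, p). if p \<ge> 3 \<or> t > Suc n then (t, p) else if t = 0 then (n, p) else (t - 1, p))"

definition rotk :: "nat \<Rightarrow> pt \<Rightarrow> pt" where
  "rotk n = (\<lambda>(t, p). if p \<ge> 3 \<or> t > Suc n then (t, p) else if t = Suc n then (1, p) else (Suc t, p))"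

lemma slice_edges_unshift: "((a, p), (b, q)) \<in> slice_edges (Suc t) i \<Longrightarrow> ((a - 1, p), (b - 1, q)) \<in> slice_edges t i"
  by (cases "i = 0") (auto simp: slice_edges_def)

lemma conn_rot:
  assumes "flat z" "s = 0 \<or> s = 1 \<or> s = 2" and n: "n = length z"
  shows "(p, q) \<in> conn (s # z) \<longleftrightarrow> (roth n p, roth n q) \<in> conn (z @ [s])"
proof -
  have fl: "flat (s # z)" "flat (z @ [s])" using assms by auto
  have cl1: "cl (z @ [s]) (Suc n, p) = cl (z @ [s]) (0, p)" if "p < 3" for p
    using conn_close[OF that, of "z @ [s]"] by (simp add: conn_iff_cl n)
  have cl2: "cl (s # z) (Suc n, p) = cl (s # z) (0, p)" if "p < 3" for p
    using conn_close[OF that, of "s # z"] by (simp add: conn_iff_cl n)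
  have last: "(x, y) \<in> slice_edges n s \<Longrightarrow> cl (z @ [s]) x = cl (z @ [s]) y" for x y
    using conn_slice[of n "z @ [s]" "(x, y)"] by (simp add: n conn_iff_cl nth_append)
  have first: "(x, y) \<in> slice_edges 0 s \<Longrightarrow> cl (s # z) x = cl (s # z) y" for x y
    using conn_slice[of 0 "s # z" "(x, y)"] by (simp add: conn_iff_cl)
  have h: "(roth n x, roth n y) \<in> conn (z @ [s])" if "(x, y) \<in> conn (s # z)" for x y
  proof (rule conn_hom[OF that])
    fix x y assume "(x, y) \<in> flat_edges (s # z)"
    then show "(roth n x, roth n y) \<in> conn (z @ [s])" using fl(1)
    proof (cases rule: flat_edge_cases)
      case (close p) then show ?thesis by (auto simp: roth_def n)
    next
      case (slice t)
      obtain a p b q where xy: "x = (a, p)" "y = (b, q)" by (cases x, cases y)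
      note lt = slice_edges_lt3[OF slice(2)[unfolded xy] flat_nth[OF fl(1) slice(1)]]
      show ?thesis
      proof (cases t)
        case 0
        have "((n + a, p), (n + b, q)) \<in> slice_edges n s"
          using slice(2) unfolding xy 0 by (cases "s = 0") (auto simp: slice_edges_def)
        then have "cl (z @ [s]) (n + a, p) = cl (z @ [s]) (n + b, q)" by (rule last)
        moreover have "cl (z @ [s]) (roth n (a, p)) = cl (z @ [s]) (n + a, p)" "cl (z @ [s]) (roth n (b, q)) = cl (z @ [s]) (n + b, q)"
          using lt 0 cl1 by (auto simp: roth_def)
        ultimately show ?thesis by (simp add: xy conn_iff_cl)
      next
        case (Suc u)
        then have u: "u < n" using slice(1) n by simp
        have "((a - 1, p), (b - 1, q)) \<in> slice_edges u (z ! u)" using slice_edges_unshift[of a p b q u "z ! u"] slice(2) Suc xy by simp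
        then have "((a - 1, p), (b - 1, q)) \<in> conn (z @ [s])" using u n by (intro conn_slice[of u]) (auto simp: nth_append)
        moreover have "roth n x = (a - 1, p)" "roth n y = (b - 1, q)" using lt Suc u by (auto simp: xy roth_def)
        ultimately show ?thesis by simp
      qed
    qed
  qed
  have k: "(rotk n x, rotk n y) \<in> conn (s # z)" if "(x, y) \<in> conn (z @ [s])" for x y
  proof (rule conn_hom[OF that])
    fix x y assume "(x, y) \<in> flat_edges (z @ [s])"
    then show "(rotk n x, rotk n y) \<in> conn (s # z)" using fl(2)
    proof (cases rule: flat_edge_cases)
      case (close p) then show ?thesis by (auto simp: rotk_def n)
    next
      case (slice t)
      obtain a p b q where xy: "x = (a, p)" "y = (b, q)" by (cases x, cases y)
      note lt = slice_edges_lt3[OF slice(2)[unfolded xy] flat_nth[OF fl(2) slice(1)]]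
      show ?thesis
      proof (cases "t = n")
        case True
        have "((a - n, p), (b - n, q)) \<in> slice_edges 0 s"
          using slice(2) unfolding xy True by (cases "s = 0") (auto simp: slice_edges_def n)
        then have "cl (s # z) (a - n, p) = cl (s # z) (b - n, q)" by (rule first)
        moreover have "cl (s # z) (rotk n (a, p)) = cl (s # z) (a - n, p)" "cl (s # z) (rotk n (b, q)) = cl (s # z) (b - n, q)"
          using lt True cl2 by (auto simp: rotk_def)
        ultimately show ?thesis by (simp add: xy conn_iff_cl)
      next
        case False
        then have u: "t < n" using slice(1) n by simp
        have "((a, p), (b, q)) \<in> slice_edges t (z ! t)" using slice(2) u n by (simp add: xy nth_append)
        from slice_edges_shift[OF this] have "((Suc a, p), (Suc b, q)) \<in> conn (s # z)" using u n by (intro conn_slice[of "Suc t"]) auto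
        moreover have "rotk n x = (Suc a, p)" "rotk n y = (Suc b, q)" using lt u by (auto simp: xy rotk_def)
        ultimately show ?thesis by simp
      qed
    qed
  qed
  have kh: "(p, rotk n (roth n p)) \<in> conn (s # z)" for p
  proof -
    obtain a b where p: "p = (a, b)" by (cases p)
    show ?thesis
    proof (cases "a = 0 \<and> b < 3")
      case True then show ?thesis using cl2[of b] by (simp add: p roth_def rotk_def conn_iff_cl)
    next
      case False then have "rotk n (roth n p) = p" by (auto simp: p roth_def rotk_def)
      then show ?thesis by simp
    qed
  qed
  show "(p, q) \<in> conn (s # z) \<longleftrightarrow> (roth n p, roth n q) \<in> conn (z @ [s])"
  proof
    assume "(roth n p, roth n q) \<in> conn (z @ [s])"
    from k[OF this] show "(p, q) \<in> conn (s # z)" by (meson kh conn_sym conn_trans)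
  qed (rule h)
qed

lemma zs_snoc: "length r = length u \<Longrightarrow> zs (u @ [x]) (r @ [b]) = zs u r @ [sl x b]"
  by (induction u r rule: zs.induct) auto

text \<open>The sign for moving a 1-resolved crossing past all the others, one factor -1 for each of
  their 1-resolutions.\<close>

definition eps :: "bool \<Rightarrow> bool list \<Rightarrow> 'a::comm_ring_1" where
  "eps b r = (if b \<and> odd (ones r) then - 1 else 1)"

lemma ones_update: "c < length r \<Longrightarrow> \<not> r ! c \<Longrightarrow> ones (r[c := True]) = Suc (ones r)"
proof (induction r arbitrary: c)
  case (Cons a r) then show ?case by (cases c; cases a) auto
qed simp

lemma dsad_scale: "dsad R a b (\<lambda>T. k * \<phi> T) T = k * dsad R a b \<phi> T"
  by (simp add: dsad_def mulX_def distrib_left)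

lemma Inv_scale: "Inv U R \<phi> \<Longrightarrow> Inv U R (\<lambda>T. k * \<phi> T)"
proof -
  have "mulX p (\<lambda>T. k * \<phi> T) T = k * mulX p \<phi> T" for p T by (simp add: mulX_def)
  then show "Inv U R \<phi> \<Longrightarrow> Inv U R (\<lambda>T. k * \<phi> T)" by (auto simp: Inv_def)
qed

text \<open>Rotating a crossing may change the value at \<open>T0\<close> by the sign
  \<open>eps\<close>.\<close>

lemma detectedI:
  fixes \<chi> :: "'a::comm_ring_1 cochain" and R :: "'a itself"
  assumes "cocycle f v \<chi>" "\<chi> (oriented_state v) T0 = 1 \<or> \<chi> (oriented_state v) T0 = - 1"
  shows "detected R f v"
proof (cases "\<chi> (oriented_state v) T0 = 1")
  case True then show ?thesis using assms(1) unfolding detected_def by blast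
next
  case False
  have "cocycle f v (\<lambda>r T. - \<chi> r T)" using assms(1) by (simp add: cocycle_def coch_uminus dD_uminus)
  then show ?thesis using assms(2) False unfolding detected_def by (intro exI[of _ "\<lambda>r T. - \<chi> r T"]) auto
qed

lemma detected_rot1:
  assumes det: "detected R [] (u @ [x])" and v: "valid_word 3 (x # u)"
  shows "detected R [] (x # u)"
proof -
  obtain \<psi> :: "'a cochain" where \<psi>: "cocycle [] (u @ [x]) \<psi>" "\<psi> (oriented_state (u @ [x])) T0 = 1"
    using det unfolding detected_def by blast
  let ?n = "length u"
  let ?h = "roth ?n"
  have sx: "sl x b = 0 \<or> sl x b = 1 \<or> sl x b = 2" for b using v by (auto simp: sl_def)
  have xv: "nat \<bar>x\<bar> = 1 \<or> nat \<bar>x\<bar> = 2" using v by simp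
  have rot: "(p, q) \<in> conn (sl x b # zs u r) \<longleftrightarrow> (?h p, ?h q) \<in> conn (zs u r @ [sl x b])" if "length r = ?n" for b r p q
    by (rule conn_rot) (use that v sx in auto)
  define \<chi> :: "'a cochain" where "\<chi> = (\<lambda>s. case s of [] \<Rightarrow> (\<lambda>T. 0) | b # r \<Rightarrow> (\<lambda>T. eps b r * pb ?h (\<psi> (r @ [b])) T))"
  have \<chi>: "\<chi> (b # r) = (\<lambda>T. eps b r * pb ?h (\<psi> (r @ [b])) T)" for b r by (simp add: \<chi>_def)
  have inv: "Inv UNIV (conn (zs u r @ [sl x b])) (\<psi> (r @ [b]))" if "length r = ?n" for b r
    using cocycle_coch[OF \<psi>(1)] that unfolding coch_def by (auto simp: zs_snoc dest!: spec[of _ "r @ [b]"])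
  have co: "Inv UNIV (conn (sl x b # zs u r)) (\<chi> (b # r))" if "length r = ?n" for b r
    unfolding \<chi> by (intro Inv_scale Inv_pb[OF _ inv[OF that]]) (use rot[OF that] in blast)
  have D: "dD [] (x # u) \<chi> (b # r) T = eps b r * pb ?h (dD [] (u @ [x]) \<psi> (r @ [b])) T" if r: "length r = ?n" for b r T
  proof -
    let ?S = "\<lambda>c. dsad (conn (zs u (r[c := True]) @ [sl x b])) (c, ev (nat \<bar>u ! c\<bar>)) (Suc c, 1) (\<psi> (r[c := True] @ [b]))"
    let ?E = "dsad (conn (zs u r @ [sl x True])) (?n, ev (nat \<bar>x\<bar>)) (Suc ?n, 1) (\<psi> (r @ [True]))"
    have uc: "nat \<bar>u ! c\<bar> = 1 \<or> nat \<bar>u ! c\<bar> = 2" if "c < ?n" for c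
      using v that by (auto simp: valid_word_def dest!: bspec[of _ _ "u ! c"])
    have "dD [] (u @ [x]) \<psi> (r @ [b]) T' = (\<Sum>c<?n. if r ! c then 0 else (- 1) ^ ones (take c r) * ?S c T') +
       (if b then 0 else (- 1) ^ ones r * ?E T')" for T'
    proof -
      let ?t = "\<lambda>c. if (r @ [b]) ! c then 0 else (- 1) ^ ones (take c (r @ [b])) * dsad (conn ([] @ zs (u @ [x]) ((r @ [b])[c := True])))
          (length ([] :: nat list) + c, ev (nat \<bar>(u @ [x]) ! c\<bar>)) (Suc (length ([] :: nat list) + c), 1) (\<psi> ((r @ [b])[c := True])) T'"
      have "dD [] (u @ [x]) \<psi> (r @ [b]) T' = (\<Sum>c<length (u @ [x]). ?t c)" by (rule dD_sum) (simp add: r)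
      also have "\<dots> = (\<Sum>c<?n. ?t c) + ?t ?n" by (simp only: length_append list.size add_0 add_Suc_right add_0_right sum.lessThan_Suc)
      also have "(\<Sum>c<?n. ?t c) = (\<Sum>c<?n. if r ! c then 0 else (- 1) ^ ones (take c r) * ?S c T')"
        by (rule sum.cong[OF HOL.refl]) (use r in \<open>simp add: nth_append list_update_append zs_snoc\<close>)
      also have "?t ?n = (if b then 0 else (- 1) ^ ones r * ?E T')"
        using r by (simp add: nth_append zs_snoc list_update_append)
      finally show ?thesis .
    qed
    then have 1: "pb ?h (dD [] (u @ [x]) \<psi> (r @ [b])) T = (\<Sum>c<?n. if r ! c then 0 else (- 1) ^ ones (take c r) * pb ?h (?S c) T) +
       (if b then 0 else (- 1) ^ ones r * pb ?h ?E T)"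
      by (simp add: pb_def cong: if_cong)
    have t: "dsad (conn (sl x b # zs u (r[c := True]))) (Suc c, ev (nat \<bar>u ! c\<bar>)) (Suc (Suc c), 1) (\<chi> (b # r[c := True])) T =
       eps b (r[c := True]) * pb ?h (?S c) T" if "c < ?n" for c
    proof -
      have "?h (Suc c, ev (nat \<bar>u ! c\<bar>)) = (c, ev (nat \<bar>u ! c\<bar>))" "?h (Suc (Suc c), 1) = (Suc c, 1)"
        using that uc[OF that] by (auto simp: roth_def)
      then show ?thesis unfolding \<chi> dsad_scale
        using dsad_pb[OF rot[of "r[c := True]" "(Suc c, ev (nat \<bar>u ! c\<bar>))" "(Suc (Suc c), 1)" b], of "\<psi> (r[c := True] @ [b])"] r by simp
    qed
    have e: "dsad (conn (sl x True # zs u r)) (0, ev (nat \<bar>x\<bar>)) (Suc 0, 1) (\<chi> (True # r)) T = eps True r * pb ?h ?E T"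
    proof -
      have hh: "?h (0, ev (nat \<bar>x\<bar>)) = (?n, ev (nat \<bar>x\<bar>))" "?h (Suc 0, 1) = (0, 1)" using xv by (auto simp: roth_def)
      \<comment> \<open>The shift puts the upper end of this saddle at level 0; the closing arc
        carries it back to the top of the last slice.\<close>
      have "((0, 1), (Suc ?n, 1)) \<in> conn (zs u r @ [sl x True])"
        using conn_sym[OF conn_close[of 1 "zs u r @ [sl x True]"]] r by simp
      then have "dsad (conn (zs u r @ [sl x True])) (?n, ev (nat \<bar>x\<bar>)) (0, 1) (\<psi> (r @ [True])) = ?E"
        by (intro dsad_cong[OF equiv_conn inv[OF r] conn_refl])
      then show ?thesis unfolding \<chi> dsad_scale
        using dsad_pb[OF rot[OF r, of "(0, ev (nat \<bar>x\<bar>))" "(Suc 0, 1)" True], of "\<psi> (r @ [True])"] hh by simp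
    qed
    have "dD [] (x # u) \<chi> (b # r) T = (if b then 0 else dsad (conn (sl x True # zs u r)) (0, ev (nat \<bar>x\<bar>)) (Suc 0, 1) (\<chi> (True # r)) T) +
       (\<Sum>c<?n. if r ! c then 0 else (- 1) ^ ones (b # take c r) *
         dsad (conn (sl x b # zs u (r[c := True]))) (Suc c, ev (nat \<bar>u ! c\<bar>)) (Suc (Suc c), 1) (\<chi> (b # r[c := True])) T)"
    proof -
      let ?t = "\<lambda>c. if (b # r) ! c then 0 else (- 1) ^ ones (take c (b # r)) * dsad (conn ([] @ zs (x # u) ((b # r)[c := True])))
          (length ([] :: nat list) + c, ev (nat \<bar>(x # u) ! c\<bar>)) (Suc (length ([] :: nat list) + c), 1) (\<chi> ((b # r)[c := True])) T"
      have "dD [] (x # u) \<chi> (b # r) T = (\<Sum>c<length (x # u). ?t c)" by (rule dD_sum) (simp add: r)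
      also have "\<dots> = ?t 0 + (\<Sum>c<?n. ?t (Suc c))" by (simp only: list.size add_0 add_Suc_right add_0_right sum.lessThan_Suc_shift)
      also have "?t 0 = (if b then 0 else dsad (conn (sl x True # zs u r)) (0, ev (nat \<bar>x\<bar>)) (Suc 0, 1) (\<chi> (True # r)) T)"
        by simp
      finally show ?thesis by (simp cong: if_cong)
    qed
    also have "(\<Sum>c<?n. if r ! c then 0 else (- 1) ^ ones (b # take c r) *
         dsad (conn (sl x b # zs u (r[c := True]))) (Suc c, ev (nat \<bar>u ! c\<bar>)) (Suc (Suc c), 1) (\<chi> (b # r[c := True])) T) =
       (\<Sum>c<?n. eps b r * (if r ! c then 0 else (- 1) ^ ones (take c r) * pb ?h (?S c) T))"
    proof (rule sum.cong[OF HOL.refl])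
      fix c assume "c \<in> {..<?n}" then have c: "c < ?n" by simp
      \<comment> \<open>Resolving one more crossing flips \<open>eps\<close>, which offsets the
        additional sign that a 1-resolved \<open>x\<close> contributes from the front.\<close>
      have "\<not> r ! c \<Longrightarrow> ones (r[c := True]) = Suc (ones r)" using ones_update c r by simp
      then show "(if r ! c then 0 else (- 1) ^ ones (b # take c r) *
         dsad (conn (sl x b # zs u (r[c := True]))) (Suc c, ev (nat \<bar>u ! c\<bar>)) (Suc (Suc c), 1) (\<chi> (b # r[c := True])) T) =
         eps b r * (if r ! c then 0 else (- 1) ^ ones (take c r) * pb ?h (?S c) T)"
        unfolding t[OF c] by (cases b) (auto simp: eps_def)
    qed
    also have "\<dots> = eps b r * (\<Sum>c<?n. if r ! c then 0 else (- 1) ^ ones (take c r) * pb ?h (?S c) T)"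
      by (simp add: sum_distrib_left)
    also have "(if b then 0 else dsad (conn (sl x True # zs u r)) (0, ev (nat \<bar>x\<bar>)) (Suc 0, 1) (\<chi> (True # r)) T) =
       eps b r * (if b then 0 else (- 1) ^ ones r * pb ?h ?E T)"
      unfolding e by (cases b) (auto simp: eps_def uminus_power_if)
    finally show ?thesis unfolding 1 by (simp add: algebra_simps)
  qed
  have "cocycle [] (x # u) \<chi>"
    unfolding cocycle_def
  proof (intro conjI allI impI)
    show "coch [] (x # u) \<chi>" unfolding coch_def all_length_Cons using co by simp
    fix s :: "bool list" and T :: "pt set" assume s: "length s = length (x # u)" and T: "finite T"
    then obtain b r where br: "s = b # r" "length r = ?n" by (cases s) auto
    have "pb ?h (dD [] (u @ [x]) \<psi> (r @ [b])) T = 0"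
      using cocycleD[OF \<psi>(1), of "r @ [b]" "?h ` T"] br(2) T by (simp add: pb_def)
    then show "dD [] (x # u) \<chi> s T = 0" unfolding br(1) D[OF br(2)] by simp
  qed
  moreover have "\<chi> (oriented_state (x # u)) T0 = 1 \<or> \<chi> (oriented_state (x # u)) T0 = - 1"
  proof -
    let ?o = "oriented_state u @ [x < 0]"
    have o: "oriented_state (u @ [x]) = ?o" by (simp add: oriented_state_def)
    have "pb ?h (\<psi> ?o) T0 = \<psi> ?o T0"
    proof (rule Inv_pb_eq[OF _ equiv_conn inv])
      fix p assume "p \<in> T0"
      then obtain b where p: "p = (0, b)" "b < 3" by (auto simp: T0_def)
      have "((?n, b), (0, b)) \<in> conn (zs u (oriented_state u) @ [sl x (x < 0)])"
        by (rule conn_blanks) (use p in \<open>auto simp: zs_oriented nth_append sl_def\<close>)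
      then show "(p, ?h p) \<in> conn (zs u (oriented_state u) @ [sl x (x < 0)])"
        using p conn_sym by (simp add: roth_def)
    qed (auto simp: T0_def)
    then show ?thesis using \<psi>(2) unfolding o oriented_Cons \<chi> by (simp add: eps_def)
  qed
  ultimately show ?thesis by (rule detectedI)
qed

lemma detected_rotate:
  assumes "detected R [] (a @ b)" "valid_word 3 (a @ b)"
  shows "detected R [] (b @ a)"
  using assms
proof (induction b arbitrary: a rule: rev_induct)
  case (snoc x b)
  then have "detected R [] ((x # a) @ b)" using detected_rot1[of R "a @ b" x] by simp
  then show ?case using snoc.IH[of "x # a"] snoc.prems(2) by simp
qed simp

section \<open>Comparison with the Khovanov complex\<close>

lemma zs_nth: "length s = length w \<Longrightarrow> t < length w \<Longrightarrow> zs w s ! t = sl (w ! t) (s ! t)"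
proof (induction w arbitrary: s t)
  case (Cons x w) then show ?case by (cases s; cases t) auto
qed simp

lemma crossing_edges_eq:
  assumes "nat \<bar>x\<bar> = 1 \<or> nat \<bar>x\<bar> = 2"
  shows "crossing_edges 3 x t (b = (x < 0)) = slice_edges t (sl x b)"
proof -
  have "{((t, p), (t + 1, p)) | p. p < 3 \<and> p \<noteq> i - 1 \<and> p \<noteq> i} \<union> {((t, i - 1), (t + 1, i - 1)), ((t, i), (t + 1, i))} =
      {((t, p), (t + 1, p)) | p. p < 3}" if "i = 1 \<or> i = 2" for i :: nat
    using that by (elim disjE) auto
  moreover have "x \<noteq> 0" using assms by auto
  ultimately show ?thesis
    using assms by (cases "b = (x < 0)") (simp_all add: crossing_edges_def slice_edges_def sl_def Let_def)
qed

lemma resolution_edges_eq: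
  assumes "valid_word 3 w" "length s = length w"
  shows "resolution_edges 3 w s = flat_edges (zs w s)"
proof -
  have "crossing_edges 3 (w ! t) t (s ! t = (w ! t < 0)) = slice_edges t (zs w s ! t)" if "t < length w" for t
  proof -
    have "nat \<bar>w ! t\<bar> = 1 \<or> nat \<bar>w ! t\<bar> = 2"
      using assms(1) that by (auto simp: valid_word_def dest!: bspec[of _ _ "w ! t"])
    then show ?thesis using crossing_edges_eq zs_nth[OF assms(2) that] by simp
  qed
  then show ?thesis unfolding resolution_edges_def flat_edges_def using assms(2) by simp
qed

lemma circles_eq:
  assumes "valid_word 3 w" "length s = length w"
  shows "circles 3 w s = diagram_points 3 w // conn (zs w s)"
  unfolding circles_def conn_def resolution_edges_eq[OF assms] ..

definition rep :: "'p set \<Rightarrow> 'p" where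
  "rep X = (SOME p. p \<in> X)"

lemma rep_class:
  assumes "equiv UNIV R" "X \<in> S // R"
  shows "rep X \<in> X" "X = R `` {rep X}"
proof -
  obtain x where x: "X = R `` {x}" using assms(2) by (auto elim: quotientE)
  have "x \<in> X" using assms(1) x by (auto simp: equiv_def refl_on_def)
  then show r: "rep X \<in> X" unfolding rep_def by (rule someI)
  then have "(x, rep X) \<in> R" using x by simp
  from equiv_class_eq[OF assms(1) this] show "X = R `` {rep X}" using x by simp
qed

lemma rep_eq_iff:
  assumes "equiv UNIV R" "X \<in> S // R" "Y \<in> S // R" "(rep X, rep Y) \<in> R"
  shows "X = Y"
proof -
  have "X = R `` {rep X}" by (rule rep_class(2)[OF assms(1,2)])
  also have "\<dots> = R `` {rep Y}" by (rule equiv_class_eq[OF assms(1,4)])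
  also have "\<dots> = Y" by (rule rep_class(2)[OF assms(1,3), symmetric])
  finally show ?thesis .
qed

text \<open>A split is a merge read backwards.\<close>

lemma quotient_join:
  assumes e: "equiv UNIV R" and ab: "(a, b) \<notin> R" "a \<in> S" "b \<in> S"
  defines "A \<equiv> R `` {a}" and "B \<equiv> R `` {b}"
  shows "S // R = (S // R - {A, B}) \<union> {A, B}" "A \<noteq> B" "A \<notin> S // join R a b" "B \<notin> S // join R a b" "A \<union> B \<notin> S // R"
    "S // join R a b = (S // R - {A, B}) \<union> {A \<union> B}"
proof -
  have tr: "\<And>x y z. (x,y) \<in> R \<Longrightarrow> (y,z) \<in> R \<Longrightarrow> (x,z) \<in> R" and sy: "\<And>x y. (x,y) \<in> R \<Longrightarrow> (y,x) \<in> R"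
    and rf: "\<And>x. (x, x) \<in> R"
    using e by (meson UNIV_I equivE refl_onD symE transE)+
  have AB: "A \<in> S // R" "B \<in> S // R" using ab by (auto simp: A_def B_def quotientI)
  then show "S // R = (S // R - {A, B}) \<union> {A, B}" by auto
  have in_AB: "a \<in> A" "b \<in> B" "b \<notin> A" "a \<notin> B" using ab rf sy by (auto simp: A_def B_def)
  then show "A \<noteq> B" by auto
  have cls: "join R a b `` {x} = (if x \<in> A \<union> B then A \<union> B else R `` {x})" for x
  proof (cases "x \<in> A \<union> B")
    case True
    then have "(x, a) \<in> R \<or> (x, b) \<in> R" using sy by (auto simp: A_def B_def)
    then have "y \<in> join R a b `` {x} \<longleftrightarrow> y \<in> A \<union> B" for y
      unfolding join_def A_def B_def using tr[of x a y] tr[of x b y] tr[of a x y] tr[of b x y] sy[of x a] sy[of x b] by blast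
    then show ?thesis using True by auto
  next
    case False
    then have "(x, a) \<notin> R" "(x, b) \<notin> R" using sy by (auto simp: A_def B_def)
    then show ?thesis using False by (auto simp: join_def)
  qed
  have dis: "R `` {x} \<noteq> A \<union> B" for x
  proof
    assume "R `` {x} = A \<union> B"
    then have "(x, a) \<in> R" "(x, b) \<in> R" using in_AB by auto
    then show False using tr sy ab(1) by blast
  qed
  then show "A \<union> B \<notin> S // R" by (auto elim!: quotientE)
  have other: "x \<notin> A \<union> B \<Longrightarrow> R `` {x} \<noteq> A \<and> R `` {x} \<noteq> B" for x using rf[of x] by auto
  have nj: "X \<notin> S // join R a b" if X: "X = A \<or> X = B" for X
  proof
    assume "X \<in> S // join R a b"
    then obtain x where x: "X = join R a b `` {x}" by (auto elim: quotientE)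
    show False
    proof (cases "x \<in> A \<union> B")
      case True then have "X = A \<union> B" using x cls[of x] by simp
      then have "a \<in> X" "b \<in> X" using in_AB by auto
      then show False using X in_AB by auto
    next
      case False then have "X = R `` {x}" using x cls[of x] by simp
      then show False using X other[OF False] by auto
    qed
  qed
  show "A \<notin> S // join R a b" "B \<notin> S // join R a b" using nj by blast+
  show "S // join R a b = (S // R - {A, B}) \<union> {A \<union> B}"
  proof
    show "S // join R a b \<subseteq> (S // R - {A, B}) \<union> {A \<union> B}"
    proof
      fix X assume "X \<in> S // join R a b"
      then obtain x where x: "x \<in> S" "X = join R a b `` {x}" by (auto elim: quotientE)
      show "X \<in> (S // R - {A, B}) \<union> {A \<union> B}"
        unfolding x(2) cls using other[of x] x(1) by (auto simp: quotientI)
    qed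
    show "(S // R - {A, B}) \<union> {A \<union> B} \<subseteq> S // join R a b"
    proof
      fix X assume "X \<in> (S // R - {A, B}) \<union> {A \<union> B}"
      then consider "X = A \<union> B" | x where "x \<in> S" "X = R `` {x}" "X \<noteq> A" "X \<noteq> B" by (auto elim: quotientE)
      then show "X \<in> S // join R a b"
      proof cases
        case 1 then have "X = join R a b `` {a}" using cls[of a] in_AB by simp
        then show ?thesis using ab by (simp add: quotientI)
      next
        case 2
        have "x \<notin> A \<union> B" using 2 equiv_class_eq[OF e] by (auto simp: A_def B_def)
        then have "X = join R a b `` {x}" using cls[of x] 2 by simp
        then show ?thesis using 2 by (simp add: quotientI)
      qed
    qed
  qed
qed

lemma pdeg_one: "pdeg {D} P = (if D \<in> P then 1 else - 1)"
  by (cases "D \<in> P") (simp_all add: pdeg_def insert_Diff_if)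

lemma pdeg_two: "A \<noteq> B \<Longrightarrow> pdeg {A, B} P = (if A \<in> P then 1 else - 1) + (if B \<in> P then 1 else - 1)"
proof -
  assume "A \<noteq> B"
  have "{A, B} \<inter> P = (if A \<in> P then {A} else {}) \<union> (if B \<in> P then {B} else {})" by auto
  moreover have "{A, B} - P = (if A \<in> P then {} else {A}) \<union> (if B \<in> P then {} else {B})" by auto
  ultimately show ?thesis using \<open>A \<noteq> B\<close> unfolding pdeg_def by (cases "A \<in> P"; cases "B \<in> P") simp_all
qed

lemma insert_equiv:
  assumes "Inv UNIV R \<phi>" "(p, q) \<in> R" "p \<notin> S" "q \<notin> S"
  shows "\<phi> (insert p S) = \<phi> (insert q S)"
proof -
  have "mulX p \<phi> S = mulX q \<phi> S" using InvD[OF assms(1,2)] by simp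
  then show ?thesis using assms(3,4) by (simp only: mulX_def if_False)
qed

lemma subsets_one:
  assumes "D \<notin> K"
  shows "P' \<subseteq> K \<union> {D} \<and> P \<inter> K = P' \<inter> K \<longleftrightarrow> P' = P \<inter> K \<or> P' = insert D (P \<inter> K)"
proof
  assume h: "P' \<subseteq> K \<union> {D} \<and> P \<inter> K = P' \<inter> K"
  show "P' = P \<inter> K \<or> P' = insert D (P \<inter> K)" using h by (cases "D \<in> P'") blast+
qed (use assms in blast)

lemma subsets_two:
  assumes "A \<notin> K" "B \<notin> K"
  shows "P' \<subseteq> K \<union> {A, B} \<and> P \<inter> K = P' \<inter> K \<longleftrightarrow>
    P' = P \<inter> K \<or> P' = insert A (P \<inter> K) \<or> P' = insert B (P \<inter> K) \<or> P' = insert A (insert B (P \<inter> K))"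
proof
  assume h: "P' \<subseteq> K \<union> {A, B} \<and> P \<inter> K = P' \<inter> K"
  show "P' = P \<inter> K \<or> P' = insert A (P \<inter> K) \<or> P' = insert B (P \<inter> K) \<or> P' = insert A (insert B (P \<inter> K))"
    using h by (cases "A \<in> P'"; cases "B \<in> P'") blast+
qed (use assms in blast)

text \<open>The degree condition picks out precisely the terms of the merge map: two
  \<open>v_+\<close> give \<open>v_+\<close>, a mixed pair gives \<open>v_-\<close>, two
  \<open>v_-\<close> give nothing.\<close>

lemma merge_cond:
  assumes "D \<notin> K"
  shows "{P'. P' \<subseteq> K \<union> {D} \<and> P \<inter> K = P' \<inter> K \<and> (if D \<in> P' then 1 else - 1 :: int) = (if A \<in> P then 1 else - 1) + (if B \<in> P then 1 else - 1) - 1} =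
    (if A \<in> P \<and> B \<in> P then {insert D (P \<inter> K)} else if A \<in> P \<or> B \<in> P then {P \<inter> K} else {})"
proof -
  have n: "D \<notin> P \<inter> K" "D \<in> insert D (P \<inter> K)" using assms by auto
  have "(P' \<subseteq> K \<union> {D} \<and> P \<inter> K = P' \<inter> K \<and> (if D \<in> P' then 1 else - 1 :: int) = x) \<longleftrightarrow>
    P' = P \<inter> K \<and> x = - 1 \<or> P' = insert D (P \<inter> K) \<and> x = 1" for P' x
    unfolding conj_assoc[symmetric] subsets_one[OF assms] using n by auto
  then show ?thesis by (cases "A \<in> P"; cases "B \<in> P") auto
qed

text \<open>For the split map it leaves the two mixed labellings as images of \<open>v_+\<close>,
  and the labelling by two \<open>v_-\<close> as the image of \<open>v_-\<close>.\<close>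

lemma split_cond:
  assumes "A \<notin> K" "B \<notin> K" "A \<noteq> B"
  shows "{P'. P' \<subseteq> K \<union> {A, B} \<and> P \<inter> K = P' \<inter> K \<and> (if A \<in> P' then 1 else - 1) + (if B \<in> P' then 1 else - 1 :: int) = (if D \<in> P then 1 else - 1) - 1} =
    (if D \<in> P then {insert A (P \<inter> K), insert B (P \<inter> K)} else {P \<inter> K})"
proof -
  have n: "A \<notin> P \<inter> K" "B \<notin> P \<inter> K" using assms by auto
  have "(P' \<subseteq> K \<union> {A, B} \<and> P \<inter> K = P' \<inter> K \<and> (if A \<in> P' then 1 else - 1) + (if B \<in> P' then 1 else - 1 :: int) = x) \<longleftrightarrow>
    P' = P \<inter> K \<and> x = - 2 \<or> (P' = insert A (P \<inter> K) \<or> P' = insert B (P \<inter> K)) \<and> x = 0 \<or> P' = insert A (insert B (P \<inter> K)) \<and> x = 2" for P' x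
    unfolding conj_assoc[symmetric] subsets_two[OF assms(1,2)] using n assms(3) by auto
  then show ?thesis by (cases "D \<in> P") auto
qed

text \<open>The comparison along one edge of the cube. A cochain is evaluated at one representative
  for each circle labelled \<open>v_-\<close>; invariance allows the representatives chosen before
  and after the saddle to differ.\<close>

lemma dcoef_sum:
  fixes \<phi> :: "(pt, 'a::comm_ring_1) dual"
  assumes sad: "saddle R R' a b" and inv: "Inv UNIV R' \<phi>" and ab: "a \<in> S" "b \<in> S" and P: "P \<subseteq> C" "finite C'"
    and C: "C = S // R" "C' = S // R'"
  shows "(\<Sum>P'\<in>{P'. P' \<subseteq> C' \<and> P \<inter> (C \<inter> C') = P' \<inter> (C \<inter> C') \<and> pdeg (C' - C) P' = pdeg (C - C') P - 1}. \<phi> (rep ` (C' - P'))) =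
    dsad R' a b \<phi> (rep ` (C - P))"
proof -
  have e: "equiv UNIV R" "equiv UNIV R'" using sad by (auto simp: saddle_def)
  note join = joinI[OF e(1), of a b] joinI[OF e(2), of a b]
  have repC: "X \<in> C \<Longrightarrow> rep X \<in> X" "X \<in> C' \<Longrightarrow> rep X \<in> X" for X using rep_class(1) e C by blast+
  show ?thesis
  proof (cases "(a, b) \<in> R'")
    case True
    then have nab: "(a, b) \<notin> R" and R': "R' = join R a b" using sad join by (auto simp: saddle_def)
    define A where "A = R `` {a}" define B where "B = R `` {b}" define D where "D = A \<union> B" define K where "K = C - {A, B}"
    note q = quotient_join[OF e(1) nab ab, folded A_def B_def R' C, folded D_def K_def]
    have CK: "C = K \<union> {A, B}" "C' = K \<union> {D}" "A \<noteq> B" "A \<notin> K" "B \<notin> K" "D \<notin> K" "C \<inter> C' = K" "C' - C = {D}" "C - C' = {A, B}"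
      using q by (auto simp: K_def)
    let ?PK = "P \<inter> K" and ?S = "rep ` (K - P)"
    have RR: "(x, y) \<in> R \<Longrightarrow> (x, y) \<in> R'" for x y using R' by (auto simp: join_def)
    have tr: "\<And>x y z. (x,y) \<in> R' \<Longrightarrow> (y,z) \<in> R' \<Longrightarrow> (x,z) \<in> R'" and sy: "\<And>x y. (x,y) \<in> R' \<Longrightarrow> (y,x) \<in> R'"
      using e(2) by (meson equivE symE transE)+
    have inD: "x \<in> D \<Longrightarrow> (a, x) \<in> R'" for x unfolding D_def A_def B_def using RR tr[OF True] by blast
    have DD: "x \<in> D \<Longrightarrow> y \<in> D \<Longrightarrow> (x, y) \<in> R'" for x y using inD tr sy by blast
    have rA: "rep A \<in> D" "rep B \<in> D" "rep D \<in> D" using repC(1)[of A] repC(1)[of B] repC(2)[of D] CK by (auto simp: D_def)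
    have Dcls: "D = R' `` {x}" if "x \<in> D" for x
    proof -
      have "D \<in> S // R'" using CK(2) C(2) by auto
      from rep_class[OF e(2) this] equiv_class_eq[OF e(2) DD[OF rA(3) that]] show ?thesis by simp
    qed
    have SD: "x \<notin> ?S" if "x \<in> D" for x
    proof
      assume "x \<in> ?S" then obtain X where X: "X \<in> K" "x = rep X" by auto
      then have "X \<in> S // R'" using CK(2) C(2) by auto
      then have "X = R' `` {x}" using rep_class(2)[OF e(2)] X(2) by simp
      then show False using Dcls[OF that] X(1) CK(6) by simp
    qed
    have ds: "dsad R' a b \<phi> = \<phi>" using True by (simp add: dsad_def)
    have cond: "{P'. P' \<subseteq> C' \<and> P \<inter> (C \<inter> C') = P' \<inter> (C \<inter> C') \<and> pdeg (C' - C) P' = pdeg (C - C') P - 1} =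
      (if A \<in> P \<and> B \<in> P then {insert D ?PK} else if A \<in> P \<or> B \<in> P then {?PK} else {})"
      unfolding CK(7-9) unfolding pdeg_one pdeg_two[OF CK(3)] CK(2) by (rule merge_cond[OF CK(6)])
    show ?thesis
    proof (cases "A \<in> P \<and> B \<in> P")
      case T: True
      then have "C' - insert D ?PK = K - P" "C - P = K - P" unfolding CK(1,2) using CK(6) by blast+
      then show ?thesis unfolding cond if_P[OF T] ds by simp
    next
      case F: False
      show ?thesis
      proof (cases "A \<in> P \<or> B \<in> P")
        case True
        obtain E where E: "E = A \<or> E = B" "C - P = insert E (K - P)"
        proof (cases "A \<in> P")
          case T: True
          then have "C - P = insert B (K - P)" unfolding CK(1) using F by blast
          then show ?thesis using that by blast
        next
          case False
          then have "C - P = insert A (K - P)" unfolding CK(1) using True by blast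
          then show ?thesis using that by blast
        qed
        have D': "C' - ?PK = insert D (K - P)" unfolding CK(2) using CK(6) by blast
        have rE: "rep E \<in> D" using E(1) rA by auto
        have "\<phi> (insert (rep D) ?S) = \<phi> (insert (rep E) ?S)"
          by (rule insert_equiv[OF inv DD[OF rA(3) rE] SD[OF rA(3)] SD[OF rE]])
        then show ?thesis unfolding cond if_not_P[OF F] if_P[OF True] ds E(2) by (simp add: D')
      next
        case False
        \<comment> \<open>Both merging circles carry \<open>v_-\<close>: their two representatives
          are distinct points of one circle after the merge, so \<phi> vanishes, as the empty sum
          requires.\<close>
        have "(rep A, rep A) \<in> R" using e(1) by (meson UNIV_I equivE refl_onD)
        moreover have "A \<in> S // R" "B \<in> S // R" using CK(1) C(1) by blast+
        ultimately have "rep A \<noteq> rep B" using rep_eq_iff[OF e(1), of A S B] CK(3) by metis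
        moreover have "A \<in> C - P" "B \<in> C - P" unfolding CK(1) using False by blast+
        ultimately have "\<phi> (rep ` (C - P)) = 0"
          by (intro Inv_vanish[OF inv DD[OF rA(1,2)]] imageI)
        then show ?thesis unfolding cond if_not_P[OF F] if_not_P[OF False] ds by simp
      qed
    qed
  next
    case False
    then have R: "R = join R' a b" using sad join by (auto simp: saddle_def)
    define A where "A = R' `` {a}" define B where "B = R' `` {b}" define D where "D = A \<union> B" define K where "K = C' - {A, B}"
    note q = quotient_join[OF e(2) False ab, folded A_def B_def R C, folded D_def K_def]
    have CK: "C' = K \<union> {A, B}" "C = K \<union> {D}" "A \<noteq> B" "A \<notin> K" "B \<notin> K" "D \<notin> K" "C \<inter> C' = K" "C' - C = {A, B}" "C - C' = {D}"
      using q by (auto simp: K_def)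
    let ?PK = "P \<inter> K" and ?S = "rep ` (K - P)"
    have rf: "(x, x) \<in> R'" for x using e(2) by (meson UNIV_I equivE refl_onD)
    have aA: "a \<in> A" "b \<in> B" using rf by (auto simp: A_def B_def)
    have rA: "rep A \<in> A" "rep B \<in> B" "rep D \<in> A \<or> rep D \<in> B" using repC(2)[of A] repC(2)[of B] repC(1)[of D] CK by (auto simp: D_def)
    have sy: "\<And>x y. (x,y) \<in> R' \<Longrightarrow> (y,x) \<in> R'" using e(2) by (meson equivE symE)
    have SA: "x \<notin> ?S" if "x \<in> A \<or> x \<in> B" for x
    proof
      assume "x \<in> ?S" then obtain X where X: "X \<in> K" "x = rep X" by auto
      then have "X \<in> S // R'" using CK(1) C(2) by auto
      then have "X = R' `` {x}" using rep_class(2)[OF e(2)] X(2) by simp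
      moreover have "R' `` {x} = A \<or> R' `` {x} = B"
        using that
      proof
        assume "x \<in> A" then have "(a, x) \<in> R'" by (simp add: A_def)
        from equiv_class_eq[OF e(2) this] show ?thesis unfolding A_def by simp
      next
        assume "x \<in> B" then have "(b, x) \<in> R'" by (simp add: B_def)
        from equiv_class_eq[OF e(2) this] show ?thesis unfolding B_def by simp
      qed
      ultimately show False using X(1) CK(4,5) by metis
    qed
    have dis: "x \<in> A \<Longrightarrow> y \<in> B \<Longrightarrow> x \<noteq> y" for x y
      using False e(2) unfolding A_def B_def by (metis Image_singleton_iff equivE symE transE)
    have AA: "x \<in> A \<Longrightarrow> y \<in> A \<Longrightarrow> (x, y) \<in> R'" "x \<in> B \<Longrightarrow> y \<in> B \<Longrightarrow> (x, y) \<in> R'" for x y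
      using e(2) unfolding A_def B_def by (metis Image_singleton_iff equivE symE transE)+
    have ds: "dsad R' a b \<phi> T = mulX a \<phi> T + mulX b \<phi> T" for T using False by (simp add: dsad_def)
    have cond: "{P'. P' \<subseteq> C' \<and> P \<inter> (C \<inter> C') = P' \<inter> (C \<inter> C') \<and> pdeg (C' - C) P' = pdeg (C - C') P - 1} =
      (if D \<in> P then {insert A ?PK, insert B ?PK} else {?PK})"
      unfolding CK(7-9) unfolding pdeg_one pdeg_two[OF CK(3)] CK(1) by (rule split_cond[OF CK(4,5,3)])
    show ?thesis
    proof (cases "D \<in> P")
      case True
      then have "C - P = K - P" "C' - insert A ?PK = insert B (K - P)" "C' - insert B ?PK = insert A (K - P)" "insert A ?PK \<noteq> insert B ?PK"
        unfolding CK(1,2) using CK(3-6) by blast+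
      moreover have "\<phi> (insert a ?S) = \<phi> (insert (rep A) ?S)"
        by (rule insert_equiv[OF inv AA(1)[OF aA(1) rA(1)]]) (use SA aA rA in auto)
      moreover have "\<phi> (insert b ?S) = \<phi> (insert (rep B) ?S)"
        by (rule insert_equiv[OF inv AA(2)[OF aA(2) rA(2)]]) (use SA aA rA in auto)
      ultimately show ?thesis unfolding cond if_P[OF True] ds using SA[of a] SA[of b] aA by (simp add: mulX_def)
    next
      case DP: False
      then have CP: "C - P = insert D (K - P)" "C' - ?PK = insert A (insert B (K - P))"
        unfolding CK(1,2) using CK(3-6) by blast+
      let ?T = "insert (rep D) ?S"
      \<comment> \<open>The representative of the circle to be split lies on one of its halves.
        Inserting a second point on that half gives 0; inserting a point on the other half leaves
        one \<open>v_-\<close> on each.\<close>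
      have goal: "mulX a \<phi> ?T + mulX b \<phi> ?T = \<phi> (insert (rep A) (insert (rep B) ?S))"
      proof (cases "rep D \<in> A")
        case True
        have "mulX a \<phi> ?T = 0"
        proof (cases "a \<in> ?T")
          case F: False
          have "\<phi> (insert a ?T) = 0" by (rule Inv_vanish[OF inv AA(1)[OF aA(1) True]]) (use F in auto)
          then show ?thesis by (simp add: mulX_def)
        qed (simp add: mulX_def)
        moreover have "mulX b \<phi> ?T = \<phi> (insert b ?T)" using SA[of b] aA dis[OF True aA(2)] by (auto simp: mulX_def)
        moreover have "\<phi> (insert b ?T) = \<phi> (insert (rep B) ?T)"
          by (rule insert_equiv[OF inv AA(2)[OF aA(2) rA(2)]]) (use SA aA rA dis[OF True aA(2)] dis[OF True rA(2)] in auto)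
        moreover have "\<phi> (insert (rep D) (insert (rep B) ?S)) = \<phi> (insert (rep A) (insert (rep B) ?S))"
          by (rule insert_equiv[OF inv AA(1)[OF True rA(1)]]) (use SA True rA dis[OF True rA(2)] dis[OF rA(1,2)] in auto)
        ultimately show ?thesis by (simp add: insert_commute)
      next
        case notA: False
        then have True: "rep D \<in> B" using rA by auto
        have "mulX b \<phi> ?T = 0"
        proof (cases "b \<in> ?T")
          case F: False
          have "\<phi> (insert b ?T) = 0" by (rule Inv_vanish[OF inv AA(2)[OF aA(2) True]]) (use F in auto)
          then show ?thesis by (simp add: mulX_def)
        qed (simp add: mulX_def)
        moreover have "mulX a \<phi> ?T = \<phi> (insert a ?T)" using SA[of a] aA dis[OF aA(1) True] by (auto simp: mulX_def)
        moreover have "\<phi> (insert a ?T) = \<phi> (insert (rep A) ?T)"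
          by (rule insert_equiv[OF inv AA(1)[OF aA(1) rA(1)]]) (use SA aA rA dis[OF aA(1) True] dis[OF rA(1) True] in auto)
        moreover have "\<phi> (insert (rep D) (insert (rep A) ?S)) = \<phi> (insert (rep B) (insert (rep A) ?S))"
          by (rule insert_equiv[OF inv AA(2)[OF True rA(2)]]) (use SA True rA dis[OF rA(1) True] dis[OF rA(1,2)] in auto)
        ultimately show ?thesis by (simp add: insert_commute)
      qed
      show ?thesis unfolding cond if_not_P[OF DP] ds CP(1) using goal CP(2) by simp
    qed
  qed
qed

lemma card_before: "length s = n \<Longrightarrow> c \<le> n \<Longrightarrow> card {j. j < c \<and> s ! j} = ones (take c s)"
proof (induction c)
  case (Suc c)
  have "{j. j < Suc c \<and> s ! j} = (if s ! c then insert c {j. j < c \<and> s ! j} else {j. j < c \<and> s ! j})"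
    by (auto simp: less_Suc_eq)
  then have "card {j. j < Suc c \<and> s ! j} = card {j. j < c \<and> s ! j} + (if s ! c then 1 else 0)" by simp
  also have "\<dots> = ones (take (Suc c) s)" using Suc by (simp add: take_Suc_conv_app_nth ones_def)
  finally show ?case .
qed (simp add: ones_def)

lemma finite_circles:
  assumes "valid_word 3 w" "length s = length w"
  shows "finite (circles 3 w s)"
proof -
  have fin: "finite (diagram_points 3 w)"
    by (rule finite_subset[of _ "{..length w} \<times> {..<3}"]) (auto simp: diagram_points_def)
  have "diagram_points 3 w // R = (\<lambda>x. R `` {x}) ` diagram_points 3 w" for R by (auto simp: quotient_def)
  then show ?thesis unfolding circles_eq[OF assms] using fin by simp
qed

lemma finite_gens: assumes "valid_word 3 w" shows "finite (kh_gens 3 w)"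
proof -
  have "kh_gens 3 w \<subseteq> Sigma {s. length s = length w} (\<lambda>s. Pow (circles 3 w s))" by (auto simp: kh_gens_def)
  moreover have "finite {s :: bool list. length s = length w}" using finite_lists_length_eq[of "UNIV :: bool set" "length w"] by simp
  moreover have "finite (Sigma {s. length s = length w} (\<lambda>s. Pow (circles 3 w s)))"
    by (rule finite_SigmaI[OF calculation(2)]) (simp add: finite_circles[OF assms])
  ultimately show ?thesis using finite_subset by blast
qed

definition evalg :: "int list \<Rightarrow> 'a::comm_ring_1 cochain \<Rightarrow> kh_gen \<Rightarrow> 'a" where
  "evalg w \<chi> g = \<chi> (fst g) (rep ` (circles 3 w (fst g) - snd g))"

text \<open>Shows that \<open>dD\<close> is the transpose of the Khovanov differential under the
  pairing \<open>evalg\<close>; the edges of the cube are treated one by one with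
  \<open>dcoef_sum\<close>.\<close>

lemma sum_dcoef:
  fixes \<chi> :: "'a::comm_ring_1 cochain"
  assumes w: "valid_word 3 w" and \<chi>: "coch [] w \<chi>" and g: "(s, P) \<in> kh_gens 3 w"
  shows "(\<Sum>g'\<in>kh_gens 3 w. of_int (kh_dcoef 3 w (s, P) g') * evalg w \<chi> g') = dD [] w \<chi> s (rep ` (circles 3 w s - P))"
proof -
  let ?G = "kh_gens 3 w" and ?n = "length w" and ?C = "\<lambda>s. circles 3 w s"
  have s: "length s = ?n" and P: "P \<subseteq> ?C s" using g by (auto simp: kh_gens_def)
  define q where "q = (\<lambda>c P'. P \<inter> (?C s \<inter> ?C (s[c := True])) = P' \<inter> (?C s \<inter> ?C (s[c := True])) \<and>
    pdeg (?C (s[c := True]) - ?C s) P' = pdeg (?C s - ?C (s[c := True])) P - 1)"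
  let ?t = "\<lambda>c g'. (if \<not> s ! c \<and> fst g' = s[c := True] \<and> q c (snd g') then (- 1) ^ card {j. j < c \<and> s ! j} else 0)"
  have d: "kh_dcoef 3 w (s, P) g' = (\<Sum>c<?n. ?t c g')" for g'
  proof -
    obtain s' P' where g': "g' = (s', P')" by (cases g')
    show ?thesis unfolding g' kh_dcoef_def prod.case fst_conv snd_conv Let_def q_def
      by (rule sum.cong[OF HOL.refl]) (simp cong: conj_cong)
  qed
  have "(\<Sum>g'\<in>?G. of_int (kh_dcoef 3 w (s, P) g') * evalg w \<chi> g') = (\<Sum>g'\<in>?G. \<Sum>c<?n. of_int (?t c g') * evalg w \<chi> g')"
    unfolding d of_int_sum sum_distrib_right ..
  also have "\<dots> = (\<Sum>c<?n. \<Sum>g'\<in>?G. of_int (?t c g') * evalg w \<chi> g')" by (rule sum.swap)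
  also have "\<dots> = (\<Sum>c<?n. if s ! c then 0 else (- 1) ^ ones (take c s) *
    dsad (conn ([] @ zs w (s[c := True]))) (length ([] :: nat list) + c, ev (nat \<bar>w ! c\<bar>)) (Suc (length ([] :: nat list) + c), 1) (\<chi> (s[c := True])) (rep ` (?C s - P)))"
  proof (rule sum.cong[OF HOL.refl])
    fix c assume "c \<in> {..<?n}" then have c: "c < ?n" by simp
    let ?s' = "s[c := True]"
    have s': "length ?s' = ?n" using s by simp
    show "(\<Sum>g'\<in>?G. of_int (?t c g') * evalg w \<chi> g') = (if s ! c then 0 else (- 1) ^ ones (take c s) *
      dsad (conn ([] @ zs w ?s')) (length ([] :: nat list) + c, ev (nat \<bar>w ! c\<bar>)) (Suc (length ([] :: nat list) + c), 1) (\<chi> ?s') (rep ` (?C s - P)))"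
    proof (cases "s ! c")
      case True then show ?thesis by simp
    next
      case False
      let ?S = "{P'. P' \<subseteq> ?C ?s' \<and> q c P'}"
      have sub: "Pair ?s' ` ?S \<subseteq> ?G" using s' by (auto simp: kh_gens_def)
      have "(\<Sum>g'\<in>?G. of_int (?t c g') * evalg w \<chi> g') = (\<Sum>g'\<in>Pair ?s' ` ?S. of_int (?t c g') * evalg w \<chi> g')"
      proof (rule sum.mono_neutral_right[OF finite_gens[OF w] sub], rule ballI)
        fix g' assume g': "g' \<in> ?G - Pair ?s' ` ?S"
        then have "\<not> (fst g' = ?s' \<and> q c (snd g'))" by (cases g') (auto simp: kh_gens_def)
        then show "of_int (?t c g') * evalg w \<chi> g' = 0" by auto
      qed
      also have "\<dots> = (\<Sum>P'\<in>?S. of_int (?t c (?s', P')) * evalg w \<chi> (?s', P'))"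
        by (subst sum.reindex) (auto simp: inj_on_def)
      also have "\<dots> = (\<Sum>P'\<in>?S. (- 1) ^ ones (take c s) * \<chi> ?s' (rep ` (?C ?s' - P')))"
        by (rule sum.cong[OF HOL.refl]) (use False card_before[OF s, of c] c in \<open>simp add: evalg_def\<close>)
      also have "\<dots> = (- 1) ^ ones (take c s) * (\<Sum>P'\<in>?S. \<chi> ?s' (rep ` (?C ?s' - P')))"
        by (rule sum_distrib_left[symmetric])
      also have "(\<Sum>P'\<in>?S. \<chi> ?s' (rep ` (?C ?s' - P'))) =
        dsad (conn (zs w ?s')) (c, ev (nat \<bar>w ! c\<bar>)) (Suc c, 1) (\<chi> ?s') (rep ` (?C s - P))"
        unfolding q_def
      proof (rule dcoef_sum[where R = "conn (zs w s)" and S = "diagram_points 3 w"])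
        have wc: "nat \<bar>w ! c\<bar> = 1 \<or> nat \<bar>w ! c\<bar> = 2"
          using w c by (auto simp: valid_word_def dest!: bspec[of _ _ "w ! c"])
        let ?z = "zs w s"
        have z': "zs w ?s' = ?z[c := sl (w ! c) True]"
          by (rule nth_equalityI) (use s c in \<open>auto simp: zs_nth nth_list_update\<close>)
        have z: "?z = take c ?z @ sl (w ! c) False # drop (Suc c) ?z"
          using id_take_nth_drop[of c ?z] zs_nth[OF s c] False s c by simp
        have z2: "zs w ?s' = take c ?z @ sl (w ! c) True # drop (Suc c) ?z"
          unfolding z' using s c by (simp add: upd_conv_take_nth_drop)
        have "flat (take c ?z)" "flat (drop (Suc c) ?z)" using flat_zs[OF w, of s] by (auto simp: flat_def dest: in_set_takeD in_set_dropD)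
        then have "saddle (conn (take c ?z @ sl (w ! c) False # drop (Suc c) ?z)) (conn (take c ?z @ sl (w ! c) True # drop (Suc c) ?z))
            (length (take c ?z), ev (nat \<bar>w ! c\<bar>)) (Suc (length (take c ?z)), 1)"
          by (rule saddle_conn[OF _ _ wc sl_alt])
        then show "saddle (conn (zs w s)) (conn (zs w ?s')) (c, ev (nat \<bar>w ! c\<bar>)) (Suc c, 1)"
          unfolding z2 z[symmetric] using s c by simp
        show "Inv UNIV (conn (zs w ?s')) (\<chi> ?s')" using \<chi> s' by (simp add: coch_def)
        show "(c, ev (nat \<bar>w ! c\<bar>)) \<in> diagram_points 3 w" "(Suc c, 1) \<in> diagram_points 3 w" using c wc by (auto simp: diagram_points_def)
        show "?C s = diagram_points 3 w // conn (zs w s)" "?C ?s' = diagram_points 3 w // conn (zs w ?s')"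
          by (rule circles_eq[OF w], use s in simp)+
        show "P \<subseteq> ?C s" by (rule P)
        show "finite (?C ?s')" by (rule finite_circles[OF w s'])
      qed
      finally show ?thesis using False by simp
    qed
  qed
  also have "\<dots> = dD [] w \<chi> s (rep ` (?C s - P))" by (rule dD_sum[symmetric]) (rule s)
  finally show ?thesis .
qed

lemma boundary_pairing:
  fixes \<chi> :: "'a::comm_ring_1 cochain"
  assumes w: "valid_word 3 w" and \<chi>: "cocycle [] w \<chi>"
  shows "(\<Sum>g'\<in>kh_gens 3 w. (\<Sum>g\<in>kh_gens 3 w. x g * of_int (kh_dcoef 3 w g g')) * evalg w \<chi> g') = 0"
proof -
  let ?G = "kh_gens 3 w"
  have "(\<Sum>g'\<in>?G. (\<Sum>g\<in>?G. x g * of_int (kh_dcoef 3 w g g')) * evalg w \<chi> g') =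
    (\<Sum>g'\<in>?G. \<Sum>g\<in>?G. x g * (of_int (kh_dcoef 3 w g g') * evalg w \<chi> g'))"
    unfolding sum_distrib_right mult.assoc ..
  also have "\<dots> = (\<Sum>g\<in>?G. \<Sum>g'\<in>?G. x g * (of_int (kh_dcoef 3 w g g') * evalg w \<chi> g'))" by (rule sum.swap)
  also have "\<dots> = (\<Sum>g\<in>?G. x g * (\<Sum>g'\<in>?G. of_int (kh_dcoef 3 w g g') * evalg w \<chi> g'))"
    unfolding sum_distrib_left ..
  also have "\<dots> = 0"
  proof (rule sum.neutral, rule ballI)
    fix g assume g: "g \<in> ?G"
    obtain s P where sP: "g = (s, P)" by (cases g)
    have s: "length s = length w" using g sP by (simp add: kh_gens_def)
    have "(\<Sum>g'\<in>?G. of_int (kh_dcoef 3 w g g') * evalg w \<chi> g') = dD [] w \<chi> s (rep ` (circles 3 w s - P))"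
      unfolding sP by (rule sum_dcoef[OF w cocycle_coch[OF \<chi>] g[unfolded sP]])
    also have "\<dots> = 0" by (rule cocycleD[OF \<chi> s]) (simp add: finite_circles[OF w s])
    finally show "x g * (\<Sum>g'\<in>?G. of_int (kh_dcoef 3 w g g') * evalg w \<chi> g') = 0" by simp
  qed
  finally show ?thesis .
qed

lemma circles_oriented:
  assumes "valid_word 3 w"
  shows "circles 3 w (oriented_state w) = (\<lambda>p. conn (replicate (length w) 0) `` {p}) ` T0"
proof -
  let ?R = "conn (replicate (length w) 0)"
  have c: "circles 3 w (oriented_state w) = (\<lambda>p. ?R `` {p}) ` diagram_points 3 w"
    unfolding circles_eq[OF assms length_oriented] zs_oriented quotient_def by blast
  have eq: "?R `` {(t, p)} = ?R `` {(0, p)}" if "t \<le> length w" "p < 3" for t p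
    by (rule equiv_class_eq[OF equiv_conn]) (rule conn_blanks, use that in auto)
  have "(\<lambda>p. ?R `` {p}) ` diagram_points 3 w \<subseteq> (\<lambda>p. ?R `` {p}) ` T0"
  proof (rule image_subsetI)
    fix x assume "x \<in> diagram_points 3 w"
    then obtain t p where x: "x = (t, p)" "t \<le> length w" "p < 3" unfolding diagram_points_def by blast
    have "(0, p) \<in> T0" using x(3) by (auto simp: T0_def lt3)
    then show "?R `` {x} \<in> (\<lambda>p. ?R `` {p}) ` T0" unfolding x(1) eq[OF x(2,3)] by (rule imageI)
  qed
  moreover have "T0 \<subseteq> diagram_points 3 w" by (auto simp: T0_def diagram_points_def)
  ultimately show ?thesis unfolding c by blast
qed

lemma conn_blanks_snd:
  assumes "(p, q) \<in> conn (replicate n 0)"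
  shows "snd p = snd q"
proof -
  have "p \<in> {x. snd x = snd p} \<longleftrightarrow> q \<in> {x. snd x = snd p}"
  proof (rule conn_closed[OF assms])
    fix x y assume "(x, y) \<in> flat_edges (replicate n 0)"
    then have "snd x = snd y" by (auto simp: flat_edges_def slice_edges_def)
    then show "x \<in> {x. snd x = snd p} \<longleftrightarrow> y \<in> {x. snd x = snd p}" by simp
  qed
  then show ?thesis by simp
qed

lemma oriented_rep:
  assumes "Inv UNIV (conn (replicate n 0)) \<phi>" "A \<subseteq> T0"
  shows "\<phi> (rep ` (\<lambda>p. conn (replicate n 0) `` {p}) ` A) = \<phi> A"
proof -
  let ?R = "conn (replicate n 0)"
  define h where "h = (\<lambda>p. rep (?R `` {p}))"
  have h: "(p, h p) \<in> ?R" for p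
    using rep_class(1)[OF equiv_conn quotientI[OF UNIV_I], of "replicate n 0" p] unfolding h_def by simp
  have inj: "inj_on h A"
  proof (rule inj_onI)
    fix p q assume pq: "p \<in> A" "q \<in> A" "h p = h q"
    then have "snd p = snd q" using conn_blanks_snd[OF h, of p] conn_blanks_snd[OF h, of q] by simp
    moreover have "fst p = 0" "fst q = 0" using pq(1,2) assms(2) by (auto simp: T0_def)
    ultimately show "p = q" by (simp add: prod_eq_iff)
  qed
  have "finite A" using assms(2) by (rule finite_subset) (simp add: T0_def)
  then have "pb h \<phi> A = \<phi> A" by (rule Inv_pb_eq[OF _ equiv_conn assms(1)]) (rule h)
  then show ?thesis using inj unfolding pb_def h_def image_image by simp
qed

theorem psi_nonzero_detected:
  fixes R :: "'a::comm_ring_1 itself"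
  assumes "detected R [] w" "valid_word 3 w"
  shows "psi_nonzero R 3 w"
proof -
  obtain \<chi> :: "'a cochain" where \<chi>: "cocycle [] w \<chi>" "\<chi> (oriented_state w) T0 = 1"
    using assms(1) unfolding detected_def by blast
  let ?g = "(oriented_state w, {}) :: kh_gen"
  have g: "?g \<in> kh_gens 3 w" by (simp add: kh_gens_def)
  have inv: "Inv UNIV (conn (replicate (length w) 0)) (\<chi> (oriented_state w))"
    using cocycle_coch[OF \<chi>(1)] unfolding coch_def by (metis append_Nil length_oriented zs_oriented)
  have ev: "evalg w \<chi> ?g = 1"
    using oriented_rep[OF inv subset_refl] \<chi>(2) unfolding evalg_def fst_conv snd_conv Diff_empty circles_oriented[OF assms(2)] by simp
  have "False" if x: "\<forall>g'\<in>kh_gens 3 w. (\<Sum>g\<in>kh_gens 3 w. x g * of_int (kh_dcoef 3 w g g')) = (psi_chain w g' :: 'a)" for x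
  proof -
    have "0 = (\<Sum>g'\<in>kh_gens 3 w. psi_chain w g' * evalg w \<chi> g')"
      using boundary_pairing[OF assms(2) \<chi>(1), of x] x by simp
    also have "\<dots> = (\<Sum>g'\<in>kh_gens 3 w. if g' = ?g then evalg w \<chi> ?g else 0)"
      by (rule sum.cong[OF HOL.refl]) (simp add: psi_chain_def)
    also have "\<dots> = 1" using g finite_gens[OF assms(2)] by (simp add: ev)
    finally show False by simp
  qed
  then show ?thesis unfolding psi_nonzero_def kh_is_boundary_def by blast
qed

text \<open>Multiplying the detecting cocycle by X at the marked point makes it vanish wherever the
  marked circle carries \<open>v_-\<close>, because X^2 = 0, so it descends to the quotient complex.
  On the reduced generator it takes the value that the original cocycle has on \<psi>.\<close>

theorem psi'_nonzero_detected:
  assumes "detected TYPE(bit) [] w" "valid_word 3 w"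
  shows "psi'_nonzero 3 w"
proof -
  obtain \<chi> :: "bit cochain" where \<chi>: "cocycle [] w \<chi>" "\<chi> (oriented_state w) T0 = 1"
    using assms(1) unfolding detected_def by blast
  let ?o = "oriented_state w" and ?R = "conn (replicate (length w) 0)"
  define \<eta> :: "bit cochain" where "\<eta> = (\<lambda>r. mulX (0, 0) (\<chi> r))"
  have "dD [] w \<eta> r T = 0" if "length r = length w" "finite T" for r T
    unfolding \<eta>_def dD_mulX using cocycleD[OF \<chi>(1) that(1), of "insert (0,0) T"] that(2) by (simp add: mulX_def)
  moreover have ceta: "coch [] w \<eta>" unfolding \<eta>_def by (rule coch_mulX[OF cocycle_coch[OF \<chi>(1)]])
  ultimately have \<eta>: "cocycle [] w \<eta>" unfolding cocycle_def by blast
  define g where "g = psi'_gen 3 w"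
  have g: "g \<in> kh_gens 3 w" by (auto simp: g_def psi'_gen_def kh_gens_def)
  have inv: "Inv UNIV ?R (\<eta> ?o)"
    using ceta unfolding coch_def by (metis append_Nil length_oriented zs_oriented)
  have sn: "(0,0) \<in> ?R `` {p} \<longleftrightarrow> p = (0,0)" if "p \<in> T0" for p
    using conn_blanks_snd[of p "(0,0)" "length w"] that by (auto simp: T0_def)
  have "circles 3 w ?o - {c \<in> circles 3 w ?o. (0, 0) \<in> c} = (\<lambda>p. ?R `` {p}) ` {(0,1),(0,2)}"
  proof -
    have "(\<lambda>p. ?R `` {p}) ` T0 - {c \<in> (\<lambda>p. ?R `` {p}) ` T0. (0, 0) \<in> c} = (\<lambda>p. ?R `` {p}) ` {p \<in> T0. (0,0) \<notin> ?R `` {p}}" by blast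
    also have "{p \<in> T0. (0,0) \<notin> ?R `` {p}} = {p \<in> T0. p \<noteq> (0,0)}" using sn by blast
    also have "\<dots> = {(0,1),(0,2)}" by (auto simp: T0_def)
    finally show ?thesis unfolding circles_oriented[OF assms(2)] .
  qed
  then have "evalg w \<eta> g = \<eta> ?o (rep ` (\<lambda>p. ?R `` {p}) ` {(0,1),(0,2)})"
    unfolding evalg_def g_def psi'_gen_def fst_conv snd_conv by simp
  also have "\<dots> = \<eta> ?o {(0,1),(0,2)}" by (rule oriented_rep[OF inv]) (auto simp: T0_def)
  also have "\<dots> = 1" using \<chi>(2) by (simp add: \<eta>_def mulX_def T0_def)
  finally have ev: "evalg w \<eta> g = 1" .
  have van: "evalg w \<eta> g' = 0" if g': "g' \<in> kh_gens 3 w" "\<not> marked_plus g'" for g'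
  proof -
    obtain s P where sP: "g' = (s, P)" by (cases g')
    have s: "length s = length w" using g'(1) sP by (simp add: kh_gens_def)
    let ?c = "conn (zs w s) `` {(0,0)}"
    have c: "?c \<in> diagram_points 3 w // conn (zs w s)" by (rule quotientI) (simp add: diagram_points_def)
    have "(0,0) \<in> ?c" by simp
    then have "?c \<notin> P" using g'(2) unfolding marked_plus_def sP snd_conv by blast
    then have T: "rep ?c \<in> rep ` (circles 3 w s - P)" using c unfolding circles_eq[OF assms(2) s] by blast
    have r: "((0,0), rep ?c) \<in> conn (zs w s)" using rep_class(1)[OF equiv_conn c] by simp
    have i: "Inv UNIV (conn (zs w s)) (\<chi> s)" using cocycle_coch[OF \<chi>(1)] s by (simp add: coch_def)
    let ?T = "rep ` (circles 3 w s - P)"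
    have "\<chi> s (insert (0,0) ?T) = 0" if "(0,0) \<notin> ?T"
      by (rule Inv_vanish[OF i r]) (use that T in auto)
    then show ?thesis unfolding evalg_def sP fst_conv snd_conv \<eta>_def mulX_def by simp
  qed
  have "False" if x: "\<forall>g'\<in>kh_gens 3 w. marked_plus g' \<longrightarrow> (\<Sum>g\<in>kh_gens 3 w. x g * of_int (kh_dcoef 3 w g g')) = (if g' = psi'_gen 3 w then 1 else 0 :: bit)" for x
  proof -
    have "0 = (\<Sum>g'\<in>kh_gens 3 w. (\<Sum>g\<in>kh_gens 3 w. x g * of_int (kh_dcoef 3 w g g')) * evalg w \<eta> g')"
      using boundary_pairing[OF assms(2) \<eta>, of x] by simp
    also have "\<dots> = (\<Sum>g'\<in>kh_gens 3 w. if g' = g then evalg w \<eta> g else 0)"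
    proof (rule sum.cong[OF HOL.refl])
      fix g' assume g': "g' \<in> kh_gens 3 w"
      show "(\<Sum>g\<in>kh_gens 3 w. x g * of_int (kh_dcoef 3 w g g')) * evalg w \<eta> g' = (if g' = g then evalg w \<eta> g else 0)"
      proof (cases "marked_plus g'")
        case True
        then have e: "(\<Sum>g\<in>kh_gens 3 w. x g * of_int (kh_dcoef 3 w g g')) = (if g' = g then 1 else 0 :: bit)"
          using x g' unfolding g_def by blast
        show ?thesis unfolding e by simp
      next
        case False
        have e: "evalg w \<eta> g' = 0" by (rule van[OF g' False])
        then show ?thesis using ev by (cases "g' = g") simp_all
      qed
    qed
    also have "\<dots> = 1" using g finite_gens[OF assms(2)] by (simp add: ev)
    finally show False by simp
  qed
  then show ?thesis unfolding psi'_nonzero_def by blast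
qed

section \<open>Invariance under braid relations and conjugation\<close>

lemma braid_eq_valid: "braid_eq 3 u v \<Longrightarrow> valid_word 3 u \<longleftrightarrow> valid_word 3 v"
  by (induction rule: braid_eq.induct) (auto simp: valid_word_def)

text \<open>The moves were established at the beginning of a word only; conjugation carries a
  subword there and back.\<close>

lemma detected_subword:
  assumes "\<And>v. valid_word 3 v \<Longrightarrow> detected R [] (u @ v) \<Longrightarrow> detected R [] (u' @ v)"
    and "valid_word 3 (a @ u @ b)" "valid_word 3 u'" "detected R [] (a @ u @ b)"
  shows "detected R [] (a @ u' @ b)"
proof -
  have "detected R [] (u @ (b @ a))" using detected_rotate[OF assms(4,2)] by simp
  then have "detected R [] (u' @ (b @ a))" using assms(1)[of "b @ a"] assms(2) by simp
  then show ?thesis using detected_rotate[of R "u' @ b" a] assms(2,3) by simp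
qed

lemma detected_insert_pos_at:
  assumes "detected R [] (a @ b)" "x > 0" "valid_word 3 (a @ x # b)"
  shows "detected R [] (a @ x # b)"
  using detected_subword[of R "[]" "[x]" a b] detected_insert_pos[of R _ x] assms by simp

lemma detected_delete_neg_at:
  assumes "detected R [] (a @ x # b)" "x < 0" "valid_word 3 (a @ x # b)"
  shows "detected R [] (a @ b)"
  using detected_subword[of R "[x]" "[]" a b] detected_delete_neg[of R x] assms by simp

lemma detected_insert_pos_list:
  assumes "detected R [] (a @ b)" "\<forall>x\<in>set p. x > 0" "valid_word 3 (a @ p @ b)"
  shows "detected R [] (a @ p @ b)"
  using assms(2,3)
proof (induction p)
  case Nil then show ?case using assms(1) by simp
next
  case (Cons x p) then show ?case using detected_insert_pos_at[of R a "p @ b" x] by simp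
qed

lemma detected_braid_eq_at:
  assumes "braid_eq 3 u v" "valid_word 3 (a @ u @ b)"
  shows "detected R [] (a @ u @ b) \<longleftrightarrow> detected R [] (a @ v @ b)"
  using assms
proof (induction arbitrary: a b rule: braid_eq.induct)
  case (sym u v) then show ?case using braid_eq_valid[OF sym(1)] by simp
next
  case (trans u v x) then show ?case using braid_eq_valid[OF trans(1)] by simp
next
  case (ctx u v c d) then show ?case using ctx.IH[of "a @ c" "d @ b"] by simp
next
  case (cancel i)
  have "i = 1 \<or> i = 2 \<or> i = -1 \<or> i = -2" using cancel by auto
  then obtain k :: nat where k: "k = 1 \<or> k = 2" "i = int k \<or> i = - int k" by (metis of_nat_1 of_nat_numeral)
  have v: "valid_word 3 [i, - i]" using k by auto
  have c: "detected R [] ([] @ v)" if "valid_word 3 v" "detected R [] ([i, - i] @ v)" for v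
    using k(2)
  proof
    assume "i = int k" then show ?thesis using detected_cancel1[OF _ k(1) that(1)] that(2) by simp
  next
    assume "i = - int k" then show ?thesis using detected_cancel2[OF _ k(1) that(1)] that(2) by simp
  qed
  have d: "detected R [] ([i, - i] @ v)" if "valid_word 3 v" "detected R [] ([] @ v)" for v
    using k(2)
  proof
    assume "i = int k" then show ?thesis using detected_insert1[OF _ k(1) that(1)] that(2) by simp
  next
    assume "i = - int k" then show ?thesis using detected_insert2[OF _ k(1) that(1)] that(2) by simp
  qed
  have "detected R [] (a @ [] @ b)" if "detected R [] (a @ [i, - i] @ b)"
  proof (rule detected_subword[of R "[i, - i]" "[]" a b])
      show "valid_word 3 (a @ [i, - i] @ b)" "valid_word 3 []" using v cancel.prems by simp_all
      show "detected R [] (a @ [i, - i] @ b)" using that by simp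
    qed (rule c)
  moreover have "detected R [] (a @ [i, - i] @ b)" if "detected R [] (a @ [] @ b)"
  proof (rule detected_subword[of R "[]" "[i, - i]" a b])
      show "valid_word 3 (a @ [] @ b)" "valid_word 3 [i, - i]" using v cancel.prems by simp_all
      show "detected R [] (a @ [] @ b)" using that by simp
    qed (rule d)
  ultimately show ?case by blast
next
  case (braid_rel i)
  then have i: "i = 1" by auto
  have b: "detected R [] ([1,2,1] @ v) \<Longrightarrow> detected R [] ([2,1,2] @ v)" "detected R [] ([2,1,2] @ v) \<Longrightarrow> detected R [] ([1,2,1] @ v)"
    if "valid_word 3 v" for v
    using detected_braid[of R 1 2 v] detected_braid[of R 2 1 v] that by simp_all
  have "detected R [] (a @ [2, 1, 2] @ b)" if "detected R [] (a @ [1, 2, 1] @ b)"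
  proof (rule detected_subword[of R "[1, 2, 1]" "[2, 1, 2]" a b])
      show "valid_word 3 (a @ [1, 2, 1] @ b)" "valid_word 3 [2, 1, 2]" using braid_rel.prems by simp_all
      show "detected R [] (a @ [1, 2, 1] @ b)" using that by simp
    qed (rule b(1))
  moreover have "detected R [] (a @ [1, 2, 1] @ b)" if "detected R [] (a @ [2, 1, 2] @ b)"
  proof (rule detected_subword[of R "[2, 1, 2]" "[1, 2, 1]" a b])
      show "valid_word 3 (a @ [2, 1, 2] @ b)" "valid_word 3 [1, 2, 1]" using braid_rel.prems by simp_all
      show "detected R [] (a @ [2, 1, 2] @ b)" using that by simp
    qed (rule b(2))
  ultimately show ?case unfolding i one_add_one by blast
next
  case (refl u) show ?case by (rule HOL.refl)
next
  case (far_comm i j) then show ?case by linarith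
qed

lemma detected_braid_eq: "braid_eq 3 u v \<Longrightarrow> valid_word 3 u \<Longrightarrow> detected R [] u \<longleftrightarrow> detected R [] v"
  using detected_braid_eq_at[of u v "[]" "[]" R] by simp

lemma detected_Nil: "detected R [] []"
proof -
  have "p = q" if "(p, q) \<in> conn []" for p q
  proof -
    have "p \<in> {p} \<longleftrightarrow> q \<in> {p}" by (rule conn_closed[OF that]) (auto simp: flat_edges_def)
    then show ?thesis by blast
  qed
  then have "Inv UNIV (conn []) \<phi>" for \<phi> :: "(pt, 'a) dual" by (intro InvI) metis
  then have "cocycle [] [] ((\<lambda>_ T. if T = T0 then 1 else 0) :: 'a cochain)"
    unfolding cocycle_def coch_def by simp
  then show ?thesis unfolding detected_def by (intro exI[of _ "\<lambda>_ T. if T = T0 then 1 else 0"]) simp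
qed

section \<open>The base family\<close>

text \<open>Two copies of s1 s2^2 s1. By \<open>br_base\<close> the square of the full twist is this
  braid times s2^4, so \<open>b\<close> further letters -2 give the exponent -4 - b of the
  family.\<close>

definition base :: "int list" where
  "base = [1, 2, 2, 1, 1, 2, 2, 1]"

lemma braid_eq_step: "braid_eq 3 l r \<Longrightarrow> u = a @ l @ b \<Longrightarrow> v = a @ r @ b \<Longrightarrow> braid_eq 3 u v"
  using braid_eq.ctx by blast

lemma braid_eq_conj: "braid_eq 3 [-2, 1, 2] [1, 2, -1]"
proof -
  have c: "braid_eq 3 [i, -i] []" if "i = 1 \<or> i = -2" for i using that by (intro braid_eq.cancel) auto
  have "braid_eq 3 [-2, 1, 2] [-2, 1, 2, 1, -1]"
    using braid_eq_step[OF braid_eq.sym[OF c[of 1]], of _ "[-2,1,2]" "[]"] by simp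
  also have "braid_eq 3 \<dots> [-2, 2, 1, 2, -1]"
    using braid_eq_step[OF braid_eq.braid_rel[of 1 3], of _ "[-2]" "[-1]"] by simp
  also (braid_eq.trans) have "braid_eq 3 \<dots> [1, 2, -1]"
    using braid_eq_step[OF c[of "-2"], of _ "[]" "[1,2,-1]"] by simp
  finally (braid_eq.trans) show ?thesis .
qed

text \<open>Quasipositivity made explicit. Nested cancelling pairs build a trivial word, into which
  the three positive letters 1, 2, 1 are inserted, three being the exponent sum 8 - 5. Two uses of
  \<open>braid_eq_conj\<close> then trade the letters -1 for letters -2 further left.\<close>

lemma detected_base5: "detected R [] (base @ replicate 5 (-2))"
proof -
  have c: "detected R [] (a @ i # -i # b)" if "detected R [] (a @ b)" "i = 1 \<or> i = -1 \<or> i = 2 \<or> i = -2" "valid_word 3 (a @ b)" for a b i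
    using detected_braid_eq_at[OF braid_eq.cancel[of i], of a b R] that by auto
  have "detected R [] [-2, 2]" using c[of "[]" "[]" "-2"] detected_Nil[of R] by simp
  then have "detected R [] [-2, -2, 2, 2]" using c[of "[-2]" "[2]" "-2"] by simp
  then have "detected R [] [-2, -2, -2, 2, 2, 2]" using c[of "[-2,-2]" "[2,2]" "-2"] by simp
  then have "detected R [] [-2, -2, -2, 2, -1, 1, 2, 2]" using c[of "[-2,-2,-2,2]" "[2,2]" "-1"] by simp
  then have "detected R [] [-2, -2, -2, 2, -1, -1, 1, 1, 2, 2]" using c[of "[-2,-2,-2,2,-1]" "[1,2,2]" "-1"] by simp
  then have "detected R [] [-2, -2, -2, 1, 2, -1, -1, 1, 1, 2, 2]"
    using detected_insert_pos_at[of R "[-2,-2,-2]" "[2, -1, -1, 1, 1, 2, 2]" 1] by simp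
  then have "detected R [] [-2, -2, -2, 1, 2, -1, -1, 2, 1, 1, 2, 2]"
    using detected_insert_pos_at[of R "[-2,-2,-2,1,2,-1,-1]" "[1, 1, 2, 2]" 2] by simp
  then have "detected R [] [-2, -2, -2, 1, 2, -1, -1, 2, 1, 1, 2, 2, 1]"
    using detected_insert_pos_at[of R "[-2,-2,-2,1,2,-1,-1,2,1,1,2,2]" "[]" 1] by simp
  then have "detected R [] [-2, -2, -2, -2, 1, 2, -1, 2, 1, 1, 2, 2, 1]"
    using detected_braid_eq_at[OF braid_eq_conj, of "[-2,-2,-2]" "[-1,2,1,1,2,2,1]" R] by simp
  then have "detected R [] [-2, -2, -2, -2, -2, 1, 2, 2, 1, 1, 2, 2, 1]"
    using detected_braid_eq_at[OF braid_eq_conj, of "[-2,-2,-2,-2]" "[2,1,1,2,2,1]" R] by simp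
  moreover have "replicate 5 (-2) = [-2, -2, -2, -2, -2 :: int]" by (simp add: eval_nat_numeral)
  ultimately show ?thesis using detected_rotate[of R "[-2,-2,-2,-2,-2]" base] by (simp add: base_def)
qed

text \<open>Every negative letter is absorbed as a curl without changing the bound. The empty word
  has one state with no 1-resolution, so the bound is 1.\<close>

lemma acyclic_curls: "flat g \<Longrightarrow> acyclic_from R (g @ [2]) (replicate b (-2)) 1"
proof (induction b arbitrary: g)
  case 0 then show ?case by (simp add: acyclic_Nil)
next
  case (Suc b)
  have v: "valid_word 3 (replicate b (-2))" by (simp add: valid_word_def)
  have "acyclic_from R (g @ [0, 2]) (replicate b (-2)) 1" using Suc.IH[of "g @ [0]"] Suc.prems by simp
  then show ?case using acyclic_curl[of R g 2 "replicate b (-2)" 1] v Suc.prems by simp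
qed

lemma acyclic_pass_blank:
  assumes "acyclic_from R (g @ [i, j]) v k" "i = 1 \<and> j = 2 \<or> i = 2 \<and> j = 1" "flat g" "valid_word 3 v"
  shows "acyclic_from R (g @ [i]) (int j # int i # v) (Suc k)"
  using acyclic_blank[OF assms(1) _ assms(4)] acyclic_pass[of R g i j v k] assms by auto

text \<open>\<open>base\<close> breaks up into the pairs 12, 21, 12, 21. Each pass changes the index
  of the turn-back, so that it always meets the pair beginning with the other index; four passes
  raise the bound from 1 to 5.\<close>

lemma acyclic_base: "acyclic_from R [2] (base @ replicate b (-2)) 5"
proof -
  have v: "valid_word 3 (replicate b (-2))" by (simp add: valid_word_def)
  have p: "acyclic_from R (g @ [1]) (2 # 1 # v) l"
    if "l = Suc k" "acyclic_from R (g @ [1, 2]) v k" "flat g" "valid_word 3 v" for g v k l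
    using acyclic_pass_blank[of R g 1 2 v k] that by simp
  have q: "acyclic_from R (g @ [2]) (1 # 2 # v) l"
    if "l = Suc k" "acyclic_from R (g @ [2, 1]) v k" "flat g" "valid_word 3 v" for g v k l
    using acyclic_pass_blank[of R g 2 1 v k] that by simp
  \<comment> \<open>The situation after all four passes: the slices 2, 1, 2, 1 are left behind and
    the turn-back 2 faces the negative letters. From here the passes are undone one at a
    time.\<close>
  have "acyclic_from R ([2,1,2,1] @ [2]) (replicate b (-2)) 1" by (rule acyclic_curls) simp
  then have "acyclic_from R ([2,1] @ [2,1]) (2 # 1 # replicate b (-2)) 2"
    using p[of 2 1 "[2,1,2]" "replicate b (-2)"] v by simp
  then have "acyclic_from R ([2] @ [1,2]) (1 # 2 # 2 # 1 # replicate b (-2)) 3"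
    using q[of 3 2 "[2,1]" "2 # 1 # replicate b (-2)"] v by simp
  then have "acyclic_from R ([] @ [2,1]) (2 # 1 # 1 # 2 # 2 # 1 # replicate b (-2)) 4"
    using p[of 4 3 "[2]" "1 # 2 # 2 # 1 # replicate b (-2)"] v by simp
  then show ?thesis
    using q[of 5 4 "[]" "2 # 1 # 1 # 2 # 2 # 1 # replicate b (-2)"] v by (simp add: base_def)
qed

lemma detected_base: "detected R [] (base @ replicate b (-2))"
proof -
  have v: "valid_word 3 (base @ replicate b (-2))" for b by (simp add: valid_word_def base_def)
  have large: "detected R [] (base @ replicate (5 + b) (-2))" for b
  proof (induction b)
    case 0 then show ?case using detected_base5 by simp
  next
    case (Suc b)
    \<comment> \<open>The degree of the cocycle, the number of negative letters, has reached the
      bound of \<open>acyclic_base\<close>.\<close>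
    have "5 \<le> length (filter (\<lambda>x. x < 0) (base @ replicate (5 + b) (-2)))" by (simp add: base_def)
    from detected_neg_step[OF Suc.IH acyclic_base[of R "5 + b"] this _ v]
    have "detected R [] ([-2] @ (base @ replicate (5 + b) (-2)))" by simp
    from detected_rotate[OF this] v[of "5 + b"]
    have "detected R [] (base @ replicate (5 + b) (-2) @ [-2])" by simp
    then show ?case by (metis add_Suc_right replicate_Suc replicate_append_same)
  qed
  \<comment> \<open>Members of the family with fewer than five negative letters come from larger
    ones by deletion.\<close>
  have del: "detected R [] (base @ replicate (n + b) (-2)) \<Longrightarrow> detected R [] (base @ replicate b (-2))" for n
  proof (induction n)
    case (Suc n)
    then show ?case using detected_delete_neg_at[of R base "-2" "replicate (n + b) (-2)"] v[of "Suc (n + b)"] by simp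
  qed simp
  show ?thesis by (rule del[of 5]) (rule large)
qed

section \<open>The braid group on three strands\<close>

lemma braid_eq_append: "braid_eq n u u' \<Longrightarrow> braid_eq n v v' \<Longrightarrow> braid_eq n (u @ v) (u' @ v')"
  using braid_eq.ctx[of n u u' "[]" v] braid_eq.ctx[of n v v' u' "[]"] braid_eq.trans by force

lemma winv_winv: "winv (winv w) = w"
  by (simp add: winv_def rev_map comp_def)

lemma valid_winv [simp]: "valid_word n (winv w) \<longleftrightarrow> valid_word n w"
  by (auto simp: valid_word_def winv_def)

lemma braid_eq_winv_right: "valid_word n w \<Longrightarrow> braid_eq n (w @ winv w) []"
proof (induction w)
  case Nil then show ?case by (simp add: winv_def braid_eq.refl)
next
  case (Cons x w)
  have x: "x \<noteq> 0" "\<bar>x\<bar> < int n" and w: "valid_word n w" using Cons.prems by (auto simp: valid_word_def)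
  have "braid_eq n ([x] @ (w @ winv w) @ [- x]) ([x] @ [] @ [- x])" by (rule braid_eq.ctx) (rule Cons.IH[OF w])
  moreover have "(x # w) @ winv (x # w) = [x] @ (w @ winv w) @ [- x]" by (simp add: winv_def)
  moreover have "[x] @ [] @ [- x] = [x, - x]" by simp
  ultimately show ?case using braid_eq.cancel[OF x] braid_eq.trans by metis
qed

lemma braid_eq_winv_left: "valid_word n w \<Longrightarrow> braid_eq n (winv w @ w) []"
  using braid_eq_winv_right[of n "winv w"] by (simp add: winv_winv)

lemma braid_eq_winv: assumes "braid_eq n u v" "valid_word n u" "valid_word n v" shows "braid_eq n (winv u) (winv v)"
proof -
  have "braid_eq n (winv u @ []) (winv u @ (v @ winv v))"
    by (rule braid_eq_append[OF braid_eq.refl braid_eq.sym[OF braid_eq_winv_right[OF assms(3)]]])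
  moreover have "braid_eq n (winv u @ (v @ winv v)) (winv u @ (u @ winv v))"
    by (rule braid_eq_append[OF braid_eq.refl braid_eq_append[OF braid_eq.sym[OF assms(1)] braid_eq.refl]])
  moreover have "braid_eq n ((winv u @ u) @ winv v) ([] @ winv v)"
    by (rule braid_eq_append[OF braid_eq_winv_left[OF assms(2)] braid_eq.refl])
  ultimately have "braid_eq n (winv u @ []) ([] @ winv v)" by (metis append_assoc braid_eq.trans)
  then show ?thesis by simp
qed

text \<open>The braid group as a type of its own, so that computations in it become rewriting in a
  monoid with inverses.\<close>

typedef b3 = "{X. \<exists>w. valid_word 3 w \<and> X = {v. braid_eq 3 w v}}"
  by (auto intro: exI[of _ "[]"])

definition br :: "int list \<Rightarrow> b3" where
  "br w = Abs_b3 {v. braid_eq 3 w v}"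

lemma br_eq_iff:
  assumes "valid_word 3 u" "valid_word 3 v"
  shows "br u = br v \<longleftrightarrow> braid_eq 3 u v"
proof -
  have "br u = br v \<longleftrightarrow> {x. braid_eq 3 u x} = {x. braid_eq 3 v x}"
    unfolding br_def by (rule Abs_b3_inject) (use assms in blast)+
  also have "\<dots> \<longleftrightarrow> braid_eq 3 u v" by (auto intro: braid_eq.intros(1-3))
  finally show ?thesis .
qed

lemma br_surj: "\<exists>w. valid_word 3 w \<and> x = br w"
  by (cases x) (auto simp: br_def)

definition wd :: "b3 \<Rightarrow> int list" where
  "wd x = (SOME w. valid_word 3 w \<and> x = br w)"

lemma wd: "valid_word 3 (wd x)" "br (wd x) = x"
  using someI_ex[OF br_surj[of x]] unfolding wd_def by simp_all

instantiation b3 :: "{one, times, inverse}"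
begin
definition "1 = br []"
definition "x * y = br (wd x @ wd y)"
definition "inverse x = br (winv (wd x))"
definition "x div y = x * inverse y" for x y :: b3
instance ..
end

lemma wd_br: "valid_word 3 w \<Longrightarrow> braid_eq 3 (wd (br w)) w"
  using br_eq_iff[OF wd(1)[of "br w"]] wd(2)[of "br w"] by blast

lemma br_append: assumes "valid_word 3 u" "valid_word 3 v" shows "br (u @ v) = br u * br v"
proof -
  have "braid_eq 3 (wd (br u) @ wd (br v)) (u @ v)" using assms by (intro braid_eq_append wd_br)
  then have "br (wd (br u) @ wd (br v)) = br (u @ v)" using assms wd(1) by (subst br_eq_iff) simp_all
  then show ?thesis unfolding times_b3_def by simp
qed

lemma br_winv: assumes "valid_word 3 w" shows "br (winv w) = inverse (br w)"
proof -
  have "braid_eq 3 (winv (wd (br w))) (winv w)" using assms wd(1) by (intro braid_eq_winv wd_br)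
  then have "br (winv (wd (br w))) = br (winv w)" using assms wd(1) by (subst br_eq_iff) simp_all
  then show ?thesis unfolding inverse_b3_def by simp
qed

lemma br_Nil: "br [] = 1"
  by (simp add: one_b3_def)

instance b3 :: monoid_mult
proof
  fix a b c :: b3
  obtain u v w where a: "valid_word 3 u" "a = br u" and b: "valid_word 3 v" "b = br v" and c: "valid_word 3 w" "c = br w"
    using br_surj by metis
  show "a * b * c = a * (b * c)"
    using br_append[of "u @ v" w] br_append[of u "v @ w"] br_append[of u v] br_append[of v w] a b c by simp
  show "1 * a = a" using br_append[of "[]" u] a by (simp add: br_Nil)
  show "a * 1 = a" using br_append[of u "[]"] a by (simp add: br_Nil)
qed

lemma b3_right_inverse [simp]: "x * inverse x = 1" for x :: b3
proof -
  obtain w where w: "valid_word 3 w" "x = br w" using br_surj by blast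
  have "br (w @ winv w) = br []" by (subst br_eq_iff) (use w(1) braid_eq_winv_right in simp_all)
  then show ?thesis using w by (simp add: br_append br_winv br_Nil)
qed

lemma b3_left_inverse [simp]: "inverse x * x = 1" for x :: b3
proof -
  obtain w where w: "valid_word 3 w" "x = br w" using br_surj by blast
  have "br (winv w @ w) = br []" by (subst br_eq_iff) (use w(1) braid_eq_winv_left in simp_all)
  then show ?thesis using w by (simp add: br_append br_winv br_Nil)
qed

lemma b3_inverse_cancel [simp]: "inverse x * (x * y) = y" "x * (inverse x * y) = y" for x y :: b3
  by (simp_all add: mult.assoc[symmetric])

lemma b3_left_cancel: "a * x = a * y \<longleftrightarrow> x = y" for a x y :: b3
  by (metis b3_inverse_cancel(1))

lemma b3_inverse_unique: "x * y = 1 \<Longrightarrow> inverse x = y" for x y :: b3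
  by (metis b3_inverse_cancel(1) mult.right_neutral)

lemma b3_inverse_mult [simp]: "inverse (x * y) = inverse y * inverse x" for x y :: b3
  by (rule b3_inverse_unique) (simp add: mult.assoc)

lemma b3_inverse_inverse [simp]: "inverse (inverse x) = x" for x :: b3
  by (rule b3_inverse_unique) simp

lemma b3_inverse_one [simp]: "inverse 1 = (1 :: b3)"
  by (rule b3_inverse_unique) simp

lemma b3_inverse_power: "inverse (x ^ n) = inverse x ^ n" for x :: b3
  by (induction n) (simp_all add: power_commutes)

lemma b3_conj_power: "(a * x * inverse a) ^ n = a * x ^ n * inverse a" for a x :: b3
  by (induction n) (simp_all add: mult.assoc)

lemma br_wpow: "valid_word 3 w \<Longrightarrow> valid_word 3 (wpow w n) \<and> br (wpow w n) = br w ^ n"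
  by (induction n) (simp_all add: wpow_def br_Nil br_append)

abbreviation s1 :: b3 where "s1 \<equiv> br [1]"
abbreviation s2 :: b3 where "s2 \<equiv> br [2]"

lemma br_Cons: "valid_word 3 (x # w) \<Longrightarrow> br (x # w) = br [x] * br w"
  using br_append[of "[x]" w] by simp

lemma br_neg: "br [-1] = inverse s1" "br [-2] = inverse s2"
  using br_winv[of "[1]"] br_winv[of "[2]"] by (simp_all add: winv_def)

lemma braid_relation: "s1 * (s2 * s1) = s2 * (s1 * s2)"
proof -
  have "br [1, 2, 1] = br [2, 1, 2]" using br_eq_iff[of "[1,2,1]" "[2,1,2]"] braid_eq.braid_rel[of 1 3] by simp
  then show ?thesis by (simp add: br_Cons[of _ "_ # _"])
qed

text \<open>The half twist. Conjugation by it exchanges \<open>s1\<close> and \<open>s2\<close>, and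
  its square is the full twist.\<close>

definition dl :: b3 where "dl = s1 * (s2 * s1)"

lemma dl_alt: "dl = s2 * (s1 * s2)"
  by (simp add: dl_def braid_relation)

lemma dl_s1: "s1 * dl = dl * s2"
proof -
  have "s1 * dl = (s1 * (s2 * s1)) * s2" by (simp add: dl_alt mult.assoc)
  then show ?thesis by (simp add: dl_def)
qed

lemma dl_s2: "s2 * dl = dl * s1"
proof -
  have "s2 * dl = (s2 * (s1 * s2)) * s1" by (simp add: dl_def mult.assoc)
  then show ?thesis by (simp add: dl_alt)
qed

lemma dl_commute:
  shows dl_inv_s1: "inverse s1 * dl = dl * inverse s2"
    and dl_inv_s2: "inverse s2 * dl = dl * inverse s1"
proof -
  have "inverse s1 * dl = inverse s1 * (dl * s2) * inverse s2" by (simp add: mult.assoc)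
  then show "inverse s1 * dl = dl * inverse s2" by (simp add: dl_s1[symmetric])
  have "inverse s2 * dl = inverse s2 * (dl * s1) * inverse s1" by (simp add: mult.assoc)
  then show "inverse s2 * dl = dl * inverse s1" by (simp add: dl_s2[symmetric])
qed

lemma s1_inverse: "inverse s1 = inverse dl * (s1 * s2)"
  by (simp add: dl_def mult.assoc)

lemma s2_inverse: "inverse s2 = inverse dl * (s2 * s1)"
  by (simp add: dl_alt mult.assoc)

lemma s2_s1: "s2 * s1 = dl * inverse s2"
  by (simp add: dl_alt mult.assoc)

text \<open>The inverses of \<open>s1\<close> and \<open>s2\<close> are \<open>inverse dl\<close>
  times positive words, so these three elements generate the group as a monoid.\<close>

lemma b3_induct [case_names one s1 s2 dl]:
  assumes "P 1" "\<And>x. P x \<Longrightarrow> P (s1 * x)" "\<And>x. P x \<Longrightarrow> P (s2 * x)" "\<And>x. P x \<Longrightarrow> P (inverse dl * x)"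
  shows "P x"
proof -
  obtain w where w: "valid_word 3 w" "x = br w" using br_surj by blast
  have "P (br w)" using w(1)
  proof (induction w)
    case Nil then show ?case using assms(1) by (simp add: br_Nil)
  next
    case (Cons y w)
    then have IH: "P (br w)" by simp
    have y: "y = 1 \<or> y = 2 \<or> y = -1 \<or> y = -2" using Cons.prems by (auto simp: valid_word_def)
    have e: "br (y # w) = br [y] * br w" by (rule br_Cons[OF Cons.prems])
    have "P (inverse dl * (s1 * (s2 * br w)))" "P (inverse dl * (s2 * (s1 * br w)))" using IH assms by blast+
    then have "P (inverse s1 * br w)" "P (inverse s2 * br w)" by (simp_all only: s1_inverse s2_inverse mult.assoc)
    moreover have "P (s1 * br w)" "P (s2 * br w)" using IH assms(2,3) by blast+
    ultimately show ?case unfolding e using y by (elim disjE) (simp_all only: br_neg)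
  qed
  then show ?thesis using w(2) by simp
qed

definition tw :: b3 where "tw = dl * dl"

lemma tw_commute: "tw * x = x * tw"
proof (induction x rule: b3_induct)
  case one then show ?case by simp
next
  case (s1 x)
  have "tw * s1 = s1 * tw" by (simp add: tw_def mult.assoc dl_s2[symmetric]) (simp add: mult.assoc[symmetric] dl_s1)
  then have "tw * (s1 * x) = s1 * (tw * x)" by (simp add: mult.assoc[symmetric])
  then show ?case using s1 by (simp add: mult.assoc)
next
  case (s2 x)
  have "tw * s2 = s2 * tw" by (simp add: tw_def mult.assoc dl_s1[symmetric]) (simp add: mult.assoc[symmetric] dl_s2)
  then have "tw * (s2 * x) = s2 * (tw * x)" by (simp add: mult.assoc[symmetric])
  then show ?case using s2 by (simp add: mult.assoc)
next
  case (dl x)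
  have "tw * inverse dl = inverse dl * tw" by (simp add: tw_def mult.assoc)
  then have "tw * (inverse dl * x) = inverse dl * (tw * x)" by (simp add: mult.assoc[symmetric])
  then show ?case using dl by (simp add: mult.assoc)
qed

definition twp :: "int \<Rightarrow> b3" where
  "twp m = (if m \<ge> 0 then tw ^ nat m else inverse tw ^ nat (- m))"

lemma twp_0 [simp]: "twp 0 = 1" and twp_1: "twp 1 = tw"
  by (simp_all add: twp_def)

lemma twp_Suc: "twp (m + 1) = tw * twp m"
proof (cases "m \<ge> 0")
  case True then show ?thesis by (simp add: twp_def nat_add_distrib)
next
  case False
  then obtain k where k: "nat (- m) = Suc k" by (metis gr0_implies_Suc neg_0_less_iff_less not_le zero_less_nat_eq)
  then have "nat (- (m + 1)) = k" "m = - int (Suc k)" by linarith+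
  then have "twp (m + 1) = inverse tw ^ k" by (cases "k = 0") (simp_all add: twp_def)
  moreover have "twp m = inverse tw * inverse tw ^ k" using False k by (simp add: twp_def)
  ultimately show ?thesis by simp
qed

lemma twp_add: "twp (m + n) = twp m * twp n"
proof (induction m rule: int_induct[where k = 0])
  case base then show ?case by simp
next
  case (step1 i)
  have "twp (i + 1 + n) = tw * twp (i + n)" using twp_Suc[of "i + n"] by (simp add: algebra_simps)
  then show ?case using step1 by (simp add: twp_Suc mult.assoc)
next
  case (step2 i)
  have "tw * twp (i - 1 + n) = twp (i + n)" using twp_Suc[of "i - 1 + n"] by (simp add: algebra_simps)
  also have "\<dots> = tw * (twp (i - 1) * twp n)" using step2 twp_Suc[of "i - 1"] by (simp add: mult.assoc)
  finally show ?case by (simp add: b3_left_cancel)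
qed

lemma twp_inverse: "inverse (twp m) = twp (- m)"
  by (rule b3_inverse_unique) (simp add: twp_add[symmetric])

lemma twp_commute: "x * twp m = twp m * x"
proof (induction m rule: int_induct[where k = 0])
  case base then show ?case by simp
next
  case (step1 i)
  have "x * (tw * twp i) = tw * (x * twp i)" unfolding mult.assoc[symmetric] tw_commute[of x] ..
  then show ?case using step1 by (simp add: twp_Suc mult.assoc)
next
  case (step2 i)
  have e: "twp i = tw * twp (i - 1)" using twp_Suc[of "i - 1"] by simp
  have "tw * (x * twp (i - 1)) = x * (tw * twp (i - 1))" unfolding mult.assoc[symmetric] tw_commute[of x] ..
  also have "\<dots> = tw * (twp (i - 1) * x)" using step2 unfolding e by (simp add: mult.assoc)
  finally show ?case by (simp add: b3_left_cancel)
qed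

lemma twp_power: "(twp m * x) ^ k = twp (m * int k) * x ^ k"
proof (induction k)
  case (Suc k)
  have "(twp m * x) ^ Suc k = twp m * (x * twp (m * int k)) * x ^ k" using Suc by (simp add: mult.assoc)
  also have "\<dots> = (twp m * twp (m * int k)) * (x * x ^ k)" unfolding twp_commute[of x "m * int k"] by (simp add: mult.assoc)
  also have "twp m * twp (m * int k) = twp (m * int (Suc k))" by (simp add: twp_add[symmetric] algebra_simps)
  finally show ?case by simp
qed simp

lemma twp_nat: "twp (int n) = dl ^ (2 * n)"
  by (simp add: twp_def tw_def power_mult power2_eq_square)

lemma br_full_twist: "br (full_twist 3) = tw" "valid_word 3 (full_twist 3)"
proof -
  have "full_twist 3 = [1,2,1,2,1,2]" by (simp add: full_twist_def wpow_def upt_rec numeral_3_eq_3)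
  moreover have "tw = dl * (s2 * (s1 * s2))" by (simp add: tw_def dl_alt)
  then have "br [1,2,1,2,1,2] = tw" by (simp add: br_Cons[of _ "_ # _"] dl_def mult.assoc)
  ultimately show "br (full_twist 3) = tw" "valid_word 3 (full_twist 3)" by simp_all
qed

lemma br_wzpow: "valid_word 3 (wzpow (full_twist 3) m)" "br (wzpow (full_twist 3) m) = twp m"
  using br_wpow[OF br_full_twist(2)] br_wpow[of "winv (full_twist 3)"] br_full_twist
  by (simp_all add: wzpow_def twp_def br_winv)

section \<open>Dehornoy positivity\<close>

text \<open>The action of the braid group on the universal cover of the real projective line, written as
  \<open>int \<times> real option\<close> with \<open>None\<close> the point at infinity of each sheet.\<close>

fun act :: "int \<Rightarrow> int \<times> real option \<Rightarrow> int \<times> real option" where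
  "act i (m, None) = (if i = 2 then (m + 1, Some (- 1)) else if i = - 2 then (m, Some 1) else (m, None))"
| "act i (m, Some x) =
     (if i = 1 then (m, Some (x + 1))
      else if i = - 1 then (m, Some (x - 1))
      else if i = 2 then (if x = 1 then (m, None) else (if x < 1 then m else m + 1, Some (x / (1 - x))))
      else if i = - 2 then (if x = - 1 then (m - 1, None) else (if x > - 1 then m else m - 1, Some (x / (1 + x))))
      else (m, Some x))"

lemma act_cancel:
  assumes "i = 1 \<or> i = -1 \<or> i = 2 \<or> i = -2"
  shows "act i (act (- i) p) = p"
proof (cases p)
  case (Pair m y)
  show ?thesis
  proof (cases y)
    case None then show ?thesis using assms Pair by auto
  next
    case (Some x)
    have "act 2 (act (- 2) (m, Some x)) = (m, Some x)"
    proof -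
      consider "x = - 1" | "x > - 1" | "x < - 1" by linarith
      then show ?thesis
      proof cases
        case 2
        have "x / (1 + x) < 1" "x / (1 + x) / (1 - x / (1 + x)) = x" using 2 by (auto simp: field_simps)
        then show ?thesis using 2 by simp
      next
        case 3
        have "x / (1 + x) > 1" "x / (1 + x) / (1 - x / (1 + x)) = x" using 3 by (auto simp: field_simps)
        then show ?thesis using 3 by simp
      qed simp
    qed
    moreover have "act (- 2) (act 2 (m, Some x)) = (m, Some x)"
    proof -
      consider "x = 1" | "x < 1" | "x > 1" by linarith
      then show ?thesis
      proof cases
        case 2
        have "x / (1 - x) > - 1" "x / (1 - x) / (1 + x / (1 - x)) = x" using 2 by (auto simp: field_simps)
        then show ?thesis using 2 by simp
      next
        case 3
        have "x / (1 - x) < - 1" "x / (1 - x) / (1 + x / (1 - x)) = x" using 3 by (auto simp: field_simps)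
        then show ?thesis using 3 by simp
      qed simp
    qed
    moreover have "act 1 (act (- 1) (m, Some x)) = (m, Some x)" "act (- 1) (act 1 (m, Some x)) = (m, Some x)" by simp_all
    ultimately show ?thesis using assms unfolding Pair Some by (metis minus_minus)
  qed
qed

lemma act_braid: "act 1 (act 2 (act 1 p)) = act 2 (act 1 (act 2 p))"
proof (cases p)
  case (Pair m y)
  show ?thesis
  proof (cases y)
    case None then show ?thesis using Pair by simp
  next
    case (Some x)
    consider "x < 0" | "x = 0" | "0 < x" "x < 1" | "x = 1" | "1 < x" by linarith
    then show ?thesis
      by cases (use Pair Some in \<open>auto simp: field_simps\<close>)
  qed
qed

lemma act_braid_eq: "braid_eq 3 u v \<Longrightarrow> valid_word 3 u \<Longrightarrow> foldr act u = foldr act v"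
proof (induction rule: braid_eq.induct)
  case (sym u v) then show ?case using braid_eq_valid[OF sym(1)] by simp
next
  case (trans u v x) then show ?case using braid_eq_valid[OF trans(1)] by simp
next
  case (ctx u v a b) then show ?case by simp
next
  case (cancel i)
  then have "i = 1 \<or> i = -1 \<or> i = 2 \<or> i = -2" by auto
  then show ?case using act_cancel by (simp add: fun_eq_iff)
next
  case (far_comm i j) then show ?case by linarith
next
  case (braid_rel i)
  then have "i = 1" by linarith
  then show ?case using act_braid by (simp add: fun_eq_iff)
qed simp

text \<open>The points beyond \<open>(0, Some 0)\<close> in the order of the line, in which
  \<open>None\<close> closes each sheet. The point \<open>(0, Some 0)\<close> itself is fixed by
  \<open>s2\<close> and its inverse and pushed up by \<open>s1\<close>.\<close>

definition above :: "(int \<times> real option) set" where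
  "above = {(m, y). m > 0 \<or> m = 0 \<and> (case y of None \<Rightarrow> True | Some x \<Rightarrow> x > 0)}"

lemma act_above:
  assumes "p \<in> above" "i = 1 \<or> i = 2 \<or> i = -2"
  shows "act i p \<in> above"
proof (cases p)
  case (Pair m y)
  show ?thesis
  proof (cases y)
    case None then show ?thesis using assms Pair by (auto simp: above_def)
  next
    case (Some x)
    have "m > 0 \<or> m = 0 \<and> x > 0" using assms(1) Pair Some by (simp add: above_def)
    moreover have "x < -1 \<longrightarrow> x / (1 + x) > 0" "x > 0 \<longrightarrow> x / (1 + x) > 0" "x > 0 \<and> x < 1 \<longrightarrow> x / (1 - x) > 0"
      by (auto simp: field_simps)
    ultimately show ?thesis using assms(2) Pair Some by (auto simp: above_def)
  qed
qed

lemma foldr_act_above: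
  assumes "valid_word 3 u" "- 1 \<notin> set u"
  shows "foldr act u (0, Some 0) \<in> above \<or> foldr act u (0, Some 0) = (0, Some 0) \<and> 1 \<notin> set u"
  using assms
proof (induction u)
  case (Cons y u)
  then have y: "y = 1 \<or> y = 2 \<or> y = -2" by (auto simp: valid_word_def)
  have "act 1 (0, Some 0) \<in> above" by (simp add: above_def)
  moreover have "foldr act u (0, Some 0) \<in> above \<or> foldr act u (0, Some 0) = (0, Some 0) \<and> 1 \<notin> set u"
    using Cons by simp
  moreover have "foldr act u (0, Some 0) \<in> above \<Longrightarrow> foldr act (y # u) (0, Some 0) \<in> above" using act_above[OF _ y] by simp
  ultimately show ?case using y by auto
qed simp

text \<open>Acyclicity of the Dehornoy order: letters 2 and -2 fix the base point, the first letter
  1 moves it up, and without a letter -1 it never comes back.\<close>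

lemma not_trivial_pos1:
  assumes "braid_eq 3 u []" "valid_word 3 u" "1 \<in> set u"
  shows "- 1 \<in> set u"
proof (rule ccontr)
  assume "- 1 \<notin> set u"
  from foldr_act_above[OF assms(2) this] show False
    using act_braid_eq[OF assms(1,2)] assms(3) by (simp add: above_def)
qed

text \<open>The base point of the previous argument is fixed by \<open>s2\<close>. The point at
  infinity serves instead: the first letter carries it to the next sheet, and later ones never lower
  the sheet.\<close>

lemma not_trivial_pos2:
  assumes "braid_eq 3 u []" "set u \<subseteq> {2}"
  shows "u = []"
proof -
  have f: "fst (foldr act u (m, y)) \<ge> m" if "set u \<subseteq> {2}" for u :: "int list" and m y
    using that
  proof (induction u)
    case (Cons z u)
    obtain n z' where n: "foldr act u (m, y) = (n, z')" by (cases "foldr act u (m, y)")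
    then show ?case using Cons by (cases z') auto
  qed simp
  have v: "valid_word 3 u" using assms(2) by (auto simp: valid_word_def)
  show ?thesis
  proof (cases u rule: rev_cases)
    case (snoc w z)
    then have "fst (foldr act u (0, None)) \<ge> 1" using f[of w 1 "Some (-1)"] assms(2) by simp
    then show ?thesis using act_braid_eq[OF assms(1) v] by simp
  qed simp
qed

definition pos :: "b3 \<Rightarrow> bool" where
  "pos x \<longleftrightarrow> (\<exists>u. valid_word 3 u \<and> x = br u \<and> (1 \<in> set u \<and> - 1 \<notin> set u \<or> u \<noteq> [] \<and> set u \<subseteq> {2}))"

lemma dehornoy_pos_iff: assumes w: "valid_word 3 w" shows "dehornoy_pos 3 w \<longleftrightarrow> pos (br w)"
proof
  assume "dehornoy_pos 3 w"
  then obtain u i where u: "braid_eq 3 w u" "valid_word 3 u" "1 \<le> i" "i < 3" "\<forall>x\<in>set u. i \<le> \<bar>x\<bar>" "i \<in> set u" "- i \<notin> set u"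
    unfolding dehornoy_pos_def by auto
  have e: "br w = br u" using br_eq_iff[OF w u(2)] u(1) by simp
  have "i = 1 \<or> i = 2" using u(3,4) by linarith
  then show "pos (br w)"
  proof
    assume "i = 1" then show ?thesis unfolding pos_def using u e by blast
  next
    assume i: "i = 2"
    have "x = 2" if "x \<in> set u" for x
    proof -
      have "\<bar>x\<bar> < 3" "2 \<le> \<bar>x\<bar>" "x \<noteq> -2" using u that i by (auto simp: valid_word_def)
      then show ?thesis by linarith
    qed
    then have "set u \<subseteq> {2}" "u \<noteq> []" using u(6) by auto
    then show ?thesis unfolding pos_def using u(2) e by blast
  qed
next
  assume "pos (br w)"
  then obtain u where u: "valid_word 3 u" "br w = br u" "1 \<in> set u \<and> - 1 \<notin> set u \<or> u \<noteq> [] \<and> set u \<subseteq> {2}" unfolding pos_def by blast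
  have b: "braid_eq 3 w u" using br_eq_iff[OF w u(1)] u(2) by simp
  show "dehornoy_pos 3 w"
    using u(3)
  proof
    assume "1 \<in> set u \<and> - 1 \<notin> set u"
    moreover have "\<forall>x\<in>set u. 1 \<le> \<bar>x\<bar>" using u(1) by (auto simp: valid_word_def)
    ultimately show ?thesis unfolding dehornoy_pos_def using b u(1) by (intro exI[of _ u] exI[of _ 1]) simp
  next
    assume "u \<noteq> [] \<and> set u \<subseteq> {2}"
    then have "set u = {2}" by (metis set_empty subset_singletonD)
    then show ?thesis unfolding dehornoy_pos_def using b u(1) by (intro exI[of _ u] exI[of _ 2]) simp
  qed
qed

lemma not_pos_one: "\<not> pos 1"
proof
  assume "pos 1"
  then obtain u where u: "valid_word 3 u" "br [] = br u" "1 \<in> set u \<and> - 1 \<notin> set u \<or> u \<noteq> [] \<and> set u \<subseteq> {2}" unfolding pos_def br_Nil by blast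
  have "braid_eq 3 u []" using br_eq_iff[OF u(1), of "[]"] u(2) by simp
  then show False using not_trivial_pos1[OF _ u(1)] not_trivial_pos2[of u] u(3) by blast
qed

lemma pos_mult: assumes "pos x" "pos y" shows "pos (x * y)"
proof -
  obtain u where u: "valid_word 3 u" "x = br u" "1 \<in> set u \<and> - 1 \<notin> set u \<or> u \<noteq> [] \<and> set u \<subseteq> {2}" using assms(1) unfolding pos_def by blast
  obtain v where v: "valid_word 3 v" "y = br v" "1 \<in> set v \<and> - 1 \<notin> set v \<or> v \<noteq> [] \<and> set v \<subseteq> {2}" using assms(2) unfolding pos_def by blast
  have "x * y = br (u @ v)" "valid_word 3 (u @ v)" using u v by (simp_all add: br_append)
  moreover have "- 1 \<notin> {2 :: int}" by simp
  then have "1 \<in> set (u @ v) \<and> - 1 \<notin> set (u @ v) \<or> u @ v \<noteq> [] \<and> set (u @ v) \<subseteq> {2}"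
    using u(3) v(3) by auto
  ultimately show ?thesis unfolding pos_def by blast
qed

lemma pos1I: "valid_word 3 u \<Longrightarrow> 1 \<in> set u \<Longrightarrow> - 1 \<notin> set u \<Longrightarrow> x = br u \<Longrightarrow> pos x"
  unfolding pos_def by blast

section \<open>A normal form\<close>

definition alt :: "int list \<Rightarrow> bool" where
  "alt w \<longleftrightarrow> set w \<subseteq> {1, -2}"

lemma alt_simps [simp]: "alt []" "alt (x # w) \<longleftrightarrow> (x = 1 \<or> x = -2) \<and> alt w" "alt (u @ v) \<longleftrightarrow> alt u \<and> alt v"
  by (auto simp: alt_def)

lemma alt_valid: "alt w \<Longrightarrow> valid_word 3 w"
  by (auto simp: alt_def valid_word_def)

text \<open>The tail collects factors \<open>s2\<close> that find no letter of \<open>w\<close> to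
  react with; otherwise \<open>s2\<close> cancels against a letter -2, or turns a letter 1 into
  \<open>dl * inverse s2\<close>.\<close>

definition nf :: "b3 set" where
  "nf = {br w * s2 ^ j | w j. alt w}"

lemma nfE: assumes "x \<in> nf" obtains w j where "alt w" "x = br w * s2 ^ j"
  using assms unfolding nf_def by blast

lemma nfI: "alt w \<Longrightarrow> br w * s2 ^ j \<in> nf"
  unfolding nf_def by blast

lemma br_replicate: "x = 1 \<or> x = -1 \<or> x = 2 \<or> x = -2 \<Longrightarrow> valid_word 3 (replicate n x) \<and> br (replicate n x) = br [x] ^ n"
proof (induction n)
  case (Suc n) then show ?case using br_Cons[of x "replicate n x"] by auto
qed (simp add: br_Nil)

lemma s1_nf: assumes "x \<in> nf" shows "s1 * x \<in> nf"
proof -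
  obtain w j where w: "alt w" "x = br w * s2 ^ j" using assms by (rule nfE)
  have "s1 * x = br (1 # w) * s2 ^ j" using w br_Cons[of 1 w] alt_valid by (simp add: mult.assoc)
  then show ?thesis using nfI[of "1 # w" j] w(1) by simp
qed

lemma s2_nf: assumes "x \<in> nf" shows "s2 * x \<in> nf \<or> (\<exists>y\<in>nf. s2 * x = dl * y)"
proof -
  obtain w j where w: "alt w" "x = br w * s2 ^ j" using assms by (rule nfE)
  show ?thesis
  proof (cases w)
    case Nil
    then show ?thesis using w nfI[of "[]" "Suc j"] by (simp add: br_Nil)
  next
    case (Cons y v)
    have v: "alt v" and y: "y = 1 \<or> y = -2" using w(1) Cons by simp_all
    have e: "x = br [y] * (br v * s2 ^ j)" using w(2) Cons br_Cons[of y v] alt_valid[OF w(1)] by (simp add: mult.assoc)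
    show ?thesis
      using y
    proof
      assume "y = -2" then show ?thesis using e br_neg nfI[OF v, of j] by simp
    next
      assume "y = 1"
      then have "s2 * x = dl * (inverse s2 * (br v * s2 ^ j))" unfolding e by (simp add: mult.assoc[symmetric] s2_s1)
      also have "inverse s2 * (br v * s2 ^ j) = br (-2 # v) * s2 ^ j"
        using br_Cons[of "-2" v] alt_valid[OF v] br_neg by (simp add: mult.assoc)
      finally show ?thesis using nfI[of "-2 # v" j] v by auto
    qed
  qed
qed

text \<open>Among left multiplications by generators only that by \<open>s2\<close> can leave
  \<open>nf\<close>, and it does so at the price of one factor \<open>dl\<close>. Two such factors
  form a full twist, which is central and joins the power in front.\<close>

lemma normal_form: "\<exists>m y. y \<in> nf \<and> (x = twp m * y \<or> x = twp m * (dl * y))"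
proof (induction x rule: b3_induct)
  case one
  have "1 \<in> nf" using nfI[of "[]" 0] by (simp add: br_Nil)
  then show ?case by (intro exI[of _ 0] exI[of _ 1]) simp
next
  case (s1 x)
  then obtain m y where y: "y \<in> nf" "x = twp m * y \<or> x = twp m * (dl * y)" by blast
  show ?case
    using y(2)
  proof
    assume "x = twp m * y"
    then have "s1 * x = twp m * (s1 * y)" using twp_commute[of s1 m] by (simp add: mult.assoc[symmetric])
    then show ?thesis using s1_nf[OF y(1)] by blast
  next
    assume "x = twp m * (dl * y)"
    then have e: "s1 * x = twp m * (dl * (s2 * y))" using twp_commute[of s1 m] dl_s1 by (metis mult.assoc)
    have e2: "twp m * (dl * (dl * z)) = twp (m + 1) * z" for z
      using twp_commute[of tw m] unfolding twp_Suc tw_def by (simp add: mult.assoc)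
    show ?thesis using s2_nf[OF y(1)] e e2 by metis
  qed
next
  case (s2 x)
  then obtain m y where y: "y \<in> nf" "x = twp m * y \<or> x = twp m * (dl * y)" by blast
  show ?case
    using y(2)
  proof
    assume "x = twp m * y"
    then have "s2 * x = twp m * (s2 * y)" using twp_commute[of s2 m] by (simp add: mult.assoc[symmetric])
    then show ?thesis using s2_nf[OF y(1)] by metis
  next
    assume "x = twp m * (dl * y)"
    then have "s2 * x = twp m * (dl * (s1 * y))" using twp_commute[of s2 m] dl_s2 by (metis mult.assoc)
    then show ?thesis using s1_nf[OF y(1)] by blast
  qed
next
  case (dl x)
  then obtain m y where y: "y \<in> nf" "x = twp m * y \<or> x = twp m * (dl * y)" by blast
  have c: "inverse dl * (twp m * z) = twp m * (inverse dl * z)" for z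
    using twp_commute[of "inverse dl" m] by (simp add: mult.assoc[symmetric])
  show ?case
    using y(2)
  proof
    assume x: "x = twp m * y"
    have "twp (m - 1) * (dl * y) = twp m * (inverse tw * (dl * y))"
      using twp_add[of m "-1"] twp_inverse[of 1] by (simp add: twp_1 mult.assoc)
    also have "inverse tw * (dl * y) = inverse dl * y" by (simp add: tw_def mult.assoc)
    finally show ?thesis using x c y(1) by metis
  next
    assume "x = twp m * (dl * y)"
    then have "inverse dl * x = twp m * y" using c by simp
    then show ?thesis using y(1) by blast
  qed
qed

section \<open>The Dehornoy floor\<close>

lemma nf_word: assumes "y \<in> nf"
  obtains u where "valid_word 3 u" "y = br u" "- 1 \<notin> set u"
proof -
  obtain w j where w: "alt w" "y = br w * s2 ^ j" using assms by (rule nfE)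
  have "valid_word 3 (w @ replicate j 2)" "y = br (w @ replicate j 2)"
    using w br_replicate[of 2 j] alt_valid[OF w(1)] by (simp_all add: br_append)
  moreover have "- 1 \<notin> set (w @ replicate j 2)" using w(1) by (auto simp: alt_def)
  ultimately show ?thesis by (rule that)
qed

lemma dl_word: "valid_word 3 (wpow [1,2,1] n) \<and> dl ^ n = br (wpow [1,2,1] n)"
proof -
  have "br [1,2,1] = dl" by (simp add: br_Cons[of _ "_ # _"] dl_def)
  then show ?thesis using br_wpow[of "[1,2,1]" n] by simp
qed

lemma set_wpow: "set (wpow w n) = (if n = 0 then {} else set w)"
  by (auto simp: wpow_def)

lemma pos_dl_nf: assumes "y \<in> nf" "n > 0" shows "pos (dl ^ n * y)"
proof -
  obtain u where u: "valid_word 3 u" "y = br u" "- 1 \<notin> set u" using assms(1) by (rule nf_word)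
  show ?thesis
    by (rule pos1I[of "wpow [1,2,1] n @ u"]) (use u dl_word[of n] assms(2) in \<open>simp_all add: br_append set_wpow\<close>)
qed

text \<open>Inversion turns the letters 1 and -2 into -1 and 2; moving them past \<open>dl\<close>
  exchanges the indices and so returns letters of the original kind.\<close>

lemma inverse_alt: "alt w \<Longrightarrow> \<exists>u. alt u \<and> inverse (br w) * dl = dl * br u"
proof (induction w)
  case Nil then show ?case by (intro exI[of _ "[]"]) (simp add: br_Nil)
next
  case (Cons y w)
  then obtain u where u: "alt u" "inverse (br w) * dl = dl * br u" by auto
  have e: "inverse (br (y # w)) * dl = inverse (br w) * (inverse (br [y]) * dl)"
    using br_Cons[OF alt_valid[OF Cons.prems]] by (simp add: mult.assoc)
  obtain z where z: "z = 1 \<or> z = -2" "inverse (br [y]) * dl = dl * br [z]"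
  proof (cases "y = 1")
    case True then show ?thesis using that[of "-2"] dl_inv_s1 br_neg by simp
  next
    case False
    then have "y = -2" using Cons.prems by simp
    then show ?thesis using that[of 1] dl_s2 br_neg by simp
  qed
  have "inverse (br (y # w)) * dl = (inverse (br w) * dl) * br [z]" unfolding e z(2) by (simp add: mult.assoc)
  also have "\<dots> = dl * br (u @ [z])"
    using br_append[of u "[z]"] alt_valid[OF u(1)] z(1) u(2) by (auto simp: mult.assoc)
  finally show ?case using u(1) z(1) by (intro exI[of _ "u @ [z]"]) simp
qed

lemma pos_inverse_nf: assumes "y \<in> nf" "n > 0" shows "pos (inverse y * dl ^ n)"
proof -
  obtain w j where w: "alt w" "y = br w * s2 ^ j" using assms(1) by (rule nfE)
  obtain u where u: "alt u" "inverse (br w) * dl = dl * br u" using inverse_alt[OF w(1)] by blast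
  obtain k where k: "n = Suc k" using assms(2) gr0_implies_Suc by blast
  have "inverse y * dl ^ n = inverse s2 ^ j * ((inverse (br w) * dl) * dl ^ k)"
    unfolding w(2) k by (simp add: mult.assoc b3_inverse_power)
  also have "\<dots> = inverse s2 ^ j * (dl * (br u * dl ^ k))" unfolding u(2) by (simp add: mult.assoc)
  also have "\<dots> = br (replicate j (-2) @ wpow [1,2,1] 1 @ u @ wpow [1,2,1] k)"
    using br_replicate[of "-2" j] dl_word[of 1] dl_word[of k] alt_valid[OF u(1)] by (simp add: br_append br_neg)
  finally show ?thesis
    by (rule pos1I[rotated -1])
      (use br_replicate[of "-2" j] dl_word[of 1] dl_word[of k] alt_valid[OF u(1)] u(1) in \<open>auto simp: set_wpow alt_def\<close>)
qed

text \<open>The sign of the total exponent of \<open>dl\<close> in the normal form decides. If that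
  exponent is 0, a letter 1 in the word makes the element positive, and without one only a power of
  \<open>s2\<close> is left.\<close>

lemma pos_total: "pos x \<or> x = 1 \<or> pos (inverse x)"
proof -
  obtain m y where y: "y \<in> nf" "x = twp m * y \<or> x = twp m * (dl * y)" using normal_form by blast
  define e :: nat where "e = (if x = twp m * y then 0 else 1)"
  have x: "x = twp m * (dl ^ e * y)" using y(2) by (auto simp: e_def)
  consider "m \<ge> 0" "2 * nat m + e > 0" | "m = 0" "e = 0" | "m < 0" by linarith
  then show ?thesis
  proof cases
    case 1
    have "twp m = dl ^ (2 * nat m)" using twp_nat[of "nat m"] 1(1) by simp
    then have "x = dl ^ (2 * nat m + e) * y" unfolding x by (simp add: power_add mult.assoc)
    then show ?thesis using pos_dl_nf[OF y(1) 1(2)] by simp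
  next
    case 2
    then have xy: "x = y" using x by simp
    obtain w j where w: "alt w" "y = br w * s2 ^ j" using y(1) by (rule nfE)
    show ?thesis
    proof (cases "1 \<in> set w")
      case True
      have "pos x"
        by (rule pos1I[of "w @ replicate j 2"])
          (use True w br_replicate[of 2 j] alt_valid[OF w(1)] xy in \<open>auto simp: br_append alt_def\<close>)
      then show ?thesis ..
    next
      case False
      then have "\<forall>z\<in>set w. z = -2" using w(1) by (auto simp: alt_def)
      then have "w = replicate (length w) (-2)" by (simp add: replicate_length_same)
      then have "br w = inverse s2 ^ length w" using br_replicate[of "-2" "length w"] br_neg by metis
      then have e: "x = inverse s2 ^ length w * s2 ^ j" using w(2) xy by simp
      have p: "pos (s2 ^ n)" if "n > 0" for n
        unfolding pos_def using br_replicate[of 2 n] that by (intro exI[of _ "replicate n 2"]) auto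
      have c: "inverse s2 ^ n * s2 ^ n = 1" for n by (metis b3_inverse_power b3_left_inverse)
      show ?thesis
      proof (cases "length w \<le> j")
        case True
        then obtain d where d: "j = length w + d" using le_Suc_ex by blast
        have "x = s2 ^ d" unfolding e d power_add using c[of "length w"] by (simp add: mult.assoc[symmetric])
        then show ?thesis using p[of d] by (cases "d = 0") simp_all
      next
        case False
        then obtain d where d: "length w = d + j" "d > 0" by (metis add.commute le_Suc_ex nat_le_linear add_cancel_right_right neq0_conv)
        have "x = inverse s2 ^ d" unfolding e d power_add using c[of j] by (simp add: mult.assoc)
        then have "inverse x = s2 ^ d" by (simp add: b3_inverse_power)
        then show ?thesis using p[OF d(2)] by simp
      qed
    qed
  next
    case 3
    define n where "n = 2 * nat (- m) - e"
    have n: "n > 0" "2 * nat (- m) = e + n" using 3 by (auto simp: n_def e_def)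
    have "twp (- m) = dl ^ (e + n)" using twp_nat[of "nat (- m)"] 3 n(2) by simp
    then have "inverse x = inverse y * inverse (dl ^ e) * dl ^ (e + n)" unfolding x by (simp add: twp_inverse)
    also have "\<dots> = inverse y * dl ^ n" by (simp add: power_add mult.assoc)
    finally show ?thesis using pos_inverse_nf[OF y(1) n(1)] by simp
  qed
qed

section \<open>Comparison with powers of the full twist\<close>

text \<open>In the Dehornoy order: \<open>x\<close> lies strictly between the full twist powers with
  exponents \<open>a\<close> and \<open>b\<close>.\<close>

definition bounds :: "int \<Rightarrow> b3 \<Rightarrow> int \<Rightarrow> bool" where
  "bounds a x b \<longleftrightarrow> pos (twp (- a) * x) \<and> pos (inverse x * twp b)"

lemma pos_twp: "pos (twp k)" if "k > 0"
proof -
  have "1 \<in> nf" using nfI[of "[]" 0] by (simp add: br_Nil)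
  then show ?thesis using pos_dl_nf[of 1 "2 * nat k"] twp_nat[of "nat k"] that by simp
qed

lemma bounds_nf: assumes "y \<in> nf" shows "bounds (m - 1) (twp m * y) (m + 1)"
proof -
  have "twp (- (m - 1)) * (twp m * y) = dl ^ 2 * y"
    using twp_add[of "1 - m" m] twp_nat[of 1] by (simp add: mult.assoc[symmetric])
  moreover have "inverse (twp m * y) * twp (m + 1) = inverse y * dl ^ 2"
    using twp_add[of "- m" "m + 1"] twp_nat[of 1] by (simp add: twp_inverse mult.assoc)
  ultimately show ?thesis unfolding bounds_def using pos_dl_nf[OF assms, of 2] pos_inverse_nf[OF assms, of 2] by simp
qed

text \<open>The order is only left-invariant, but full twists are central, so inequalities with them
  can be multiplied.\<close>

lemma bounds_mult: assumes "bounds a x b" "bounds c y d" shows "bounds (a + c) (x * y) (b + d)"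
proof -
  have "twp (- (a + c)) * (x * y) = (twp (- a) * twp (- c)) * (x * y)" using twp_add[of "- a" "- c"] by simp
  also have "\<dots> = (twp (- a) * x) * (twp (- c) * y)" using twp_commute[of x "- c"] by (metis mult.assoc)
  finally have "pos (twp (- (a + c)) * (x * y))" using assms pos_mult unfolding bounds_def by simp
  moreover have "inverse (x * y) * twp (b + d) = inverse y * (inverse x * twp b) * twp d" by (simp add: twp_add mult.assoc)
  then have "inverse (x * y) * twp (b + d) = (inverse y * twp d) * (inverse x * twp b)"
    using twp_commute[of "inverse x * twp b" d] by (simp add: mult.assoc)
  then have "pos (inverse (x * y) * twp (b + d))" using assms pos_mult unfolding bounds_def by simp
  ultimately show ?thesis unfolding bounds_def ..
qed

lemma bounds_mono: assumes "bounds a x b" "a' \<le> a" "b \<le> b'" shows "bounds a' x b'"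
proof -
  have "pos (twp (- a') * x)"
  proof (cases "a' = a")
    case False
    have "twp (- a') * x = twp (a - a') * (twp (- a) * x)" by (simp add: mult.assoc[symmetric] twp_add[symmetric])
    then show ?thesis using pos_mult[OF pos_twp[of "a - a'"]] assms(1,2) False by (simp add: bounds_def)
  qed (use assms in \<open>simp add: bounds_def\<close>)
  moreover have "pos (inverse x * twp b')"
  proof (cases "b' = b")
    case False
    have "inverse x * twp b' = (inverse x * twp b) * twp (b' - b)" by (simp add: mult.assoc twp_add[symmetric])
    then show ?thesis using pos_mult[OF _ pos_twp[of "b' - b"]] assms(1,3) False by (simp add: bounds_def)
  qed (use assms in \<open>simp add: bounds_def\<close>)
  ultimately show ?thesis unfolding bounds_def ..
qed

lemma bounds_exists: "\<exists>N. bounds (- N) x N"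
proof -
  obtain m y where y: "y \<in> nf" "x = twp m * y \<or> x = twp m * (dl * y)" using normal_form by blast
  have one: "1 \<in> nf" using nfI[of "[]" 0] by (simp add: br_Nil)
  have "pos (tw * dl)" using pos_dl_nf[OF one, of 3] by (simp add: tw_def numeral_3_eq_3 mult.assoc)
  moreover have "pos (inverse dl * tw)" using pos_dl_nf[OF one, of 1] by (simp add: tw_def)
  ultimately have dl: "bounds (- 1) dl 1" by (simp add: bounds_def twp_1)
  from y(2) have "\<exists>a b. bounds a x b"
  proof
    assume "x = twp m * y" then show ?thesis using bounds_nf[OF y(1)] by blast
  next
    assume "x = twp m * (dl * y)"
    then have "x = dl * (twp m * y)" using twp_commute[of dl m] by (metis mult.assoc)
    then show ?thesis using bounds_mult[OF dl bounds_nf[OF y(1)]] by blast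
  qed
  then obtain a b where "bounds a x b" by blast
  then show ?thesis using bounds_mono[of a x b "- max (- a) b" "max (- a) b"] by (intro exI[of _ "max (- a) b"]) linarith
qed

text \<open>The loss \<open>N\<close> depends on the conjugator alone. Powers of a conjugate are
  conjugates of powers by the same element, so the loss stays bounded and disappears in the
  limit.\<close>

lemma bounds_conj: "\<exists>N. \<forall>x a b. bounds a x b \<longrightarrow> bounds (a - N) (c * x * inverse c) (b + N)"
proof -
  obtain N where N: "bounds (- N) c N" using bounds_exists by blast
  obtain M where M: "bounds (- M) (inverse c) M" using bounds_exists by blast
  have "bounds (a - (N + M)) (c * x * inverse c) (b + (N + M))" if "bounds a x b" for x a b
    using bounds_mult[OF bounds_mult[OF N that] M] by (simp add: algebra_simps)
  then show ?thesis by blast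
qed

text \<open>Totality of the order and the failure of \<open>pos 1\<close> make the floor well
  defined; the given bounds supply the two ends between which the jump must occur.\<close>

lemma floor_bounds:
  assumes w: "valid_word 3 w" and ab: "bounds a (br w) b"
  shows "a \<le> braid_floor 3 w \<and> braid_floor 3 w < b"
proof -
  let ?x = "br w"
  define q where "q = (\<lambda>m. pos (twp (- m) * ?x) \<or> ?x = twp m)"
  define r where "r = (\<lambda>m. pos (inverse ?x * twp m))"
  have le: "dehornoy_le 3 (wzpow (full_twist 3) m) w \<longleftrightarrow> q m" for m
    unfolding dehornoy_le_def dehornoy_less_def q_def using w br_wzpow[of m]
    by (auto simp: dehornoy_pos_iff br_append br_winv twp_inverse br_eq_iff[symmetric])
  have less: "dehornoy_less 3 w (wzpow (full_twist 3) m) \<longleftrightarrow> r m" for m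
    unfolding dehornoy_less_def r_def using w br_wzpow[of m] by (simp add: dehornoy_pos_iff br_append br_winv)
  have lt: "m < n" if "q m" "r n" for m n
  proof (rule ccontr)
    assume "\<not> m < n"
    then have nm: "n \<le> m" by simp
    have "pos (twp (n - m))"
    proof (cases "?x = twp m")
      case True
      then show ?thesis using that(2) twp_add[of "- m" n] by (simp add: r_def twp_inverse)
    next
      case False
      then have "pos ((twp (- m) * ?x) * (inverse ?x * twp n))" using that pos_mult by (simp add: q_def r_def)
      then show ?thesis using twp_add[of "- m" n] by (simp add: mult.assoc)
    qed
    moreover have "pos (twp (m - n))" if "m \<noteq> n" using pos_twp[of "m - n"] nm that by simp
    ultimately have "pos (twp (n - m) * twp (m - n)) \<or> pos (twp 0)" using pos_mult by (cases "m = n") auto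
    then show False using not_pos_one by (simp add: twp_add[symmetric])
  qed
  have qr: "q m \<or> r m" for m
  proof -
    have "?x = twp m" if "twp (- m) * ?x = 1" using b3_inverse_unique[OF that] by (simp add: twp_inverse)
    moreover have "inverse (twp (- m) * ?x) = inverse ?x * twp m" by (simp add: twp_inverse)
    ultimately show ?thesis using pos_total[of "twp (- m) * ?x"] unfolding q_def r_def by metis
  qed
  have qa: "q a" and rb: "r b" using ab by (simp_all add: bounds_def q_def r_def)
  have "\<exists>m. q m \<and> r (m + 1)"
  proof (rule ccontr)
    assume "\<nexists>m. q m \<and> r (m + 1)"
    then have step: "q (m + 1)" if "q m" for m using qr that by blast
    \<comment> \<open>If there were no jump, the lower inequality would climb from \<open>a\<close>
      up to \<open>b\<close>, where the upper one already holds.\<close>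
    have "q (a + int n)" for n
    proof (induction n)
      case 0 then show ?case using qa by simp
    next
      case (Suc n)
      have "a + int (Suc n) = (a + int n) + 1" by simp
      then show ?case using step[OF Suc] by (simp only:)
    qed
    from this[of "nat (b - a)"] lt[OF qa rb] have "q b" by simp
    then show False using lt[OF _ rb] by blast
  qed
  then obtain m where m: "q m" "r (m + 1)" by blast
  have "braid_floor 3 w = m"
    unfolding braid_floor_def le less
  proof (rule the_equality)
    show "q m \<and> r (m + 1)" using m by simp
    fix n assume "q n \<and> r (n + 1)"
    then show "n = m" using lt[of n "m + 1"] lt[of m "n + 1"] m by simp
  qed
  then show ?thesis using lt[OF m(1) rb] lt[OF qa m(2)] by simp
qed

lemma fdtc_eq:
  assumes w: "valid_word 3 w" and B: "\<And>k. \<bar>real_of_int (braid_floor 3 (wpow w k)) - c * real k\<bar> \<le> C"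
  shows "fdtc 3 w = c"
proof -
  let ?f = "\<lambda>k. real_of_int (braid_floor 3 (wpow w k))"
  have C: "0 \<le> C" by (rule order_trans[OF abs_ge_zero B[of 0]])
  have "(\<lambda>k. (?f k - c * real k) / real k) \<longlonglongrightarrow> 0"
  proof (rule tendsto_0_le)
    have "\<bar>?f k - c * real k\<bar> / real k \<le> C / real k" for k by (rule divide_right_mono[OF B]) simp
    then have "norm ((?f k - c * real k) / real k) \<le> norm (C / real k) * 1" for k using C by simp
    then show "\<forall>\<^sub>F k in sequentially. norm ((?f k - c * real k) / real k) \<le> norm (C / real k) * 1" by (intro always_eventually allI)
    show "(\<lambda>k. C / real k) \<longlonglongrightarrow> 0" by (rule lim_const_over_n)
  qed
  then have "(\<lambda>k. (?f k - c * real k) / real k + c) \<longlonglongrightarrow> 0 + c" by (intro tendsto_add tendsto_const)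
  moreover have "\<forall>\<^sub>F k in sequentially. (?f k - c * real k) / real k + c = ?f k / real k"
    using eventually_gt_at_top[of 0] by eventually_elim (simp add: field_simps)
  ultimately have "(\<lambda>k. ?f k / real k) \<longlonglongrightarrow> 0 + c" by (rule Lim_transform_eventually)
  then have "(\<lambda>k. ?f k / real k) \<longlonglongrightarrow> c" by simp
  then show ?thesis unfolding fdtc_def by (rule limI)
qed

lemma fdtc_bounds:
  assumes w: "valid_word 3 w" and B: "\<And>k. bounds (m * int k - N) (br w ^ k) (m * int k + N)"
  shows "fdtc 3 w = real_of_int m"
proof (rule fdtc_eq[OF w, of _ "real_of_int N"])
  fix k
  have "m * int k - N \<le> braid_floor 3 (wpow w k) \<and> braid_floor 3 (wpow w k) < m * int k + N"
    using floor_bounds[of "wpow w k"] br_wpow[OF w, of k] B[of k] by simp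
  then have "\<bar>braid_floor 3 (wpow w k) - m * int k\<bar> \<le> N" by linarith
  then have "real_of_int \<bar>braid_floor 3 (wpow w k) - m * int k\<bar> \<le> real_of_int N" by (simp only: of_int_le_iff)
  then show "\<bar>real_of_int (braid_floor 3 (wpow w k)) - real_of_int m * real k\<bar> \<le> real_of_int N" by simp
qed

text \<open>Dividing \<open>k\<close> by \<open>p\<close>, the power is a central full twist power
  times one of the finitely many powers with exponent below \<open>p\<close>. A common bound for
  these controls the floor.\<close>

lemma fdtc_periodic:
  assumes w: "valid_word 3 w" and p: "br w ^ p = twp e" "p > 0"
  shows "fdtc 3 w = real_of_int e / real p"
proof -
  have "\<forall>r. \<exists>N. bounds (- N) (br w ^ r) N" using bounds_exists by blast
  then obtain N where N: "\<And>r. bounds (- N r) (br w ^ r) (N r)" using choice[of "\<lambda>r N. bounds (- N) (br w ^ r) N"] by blast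
  define M where "M = Max (N ` {..<p})"
  have M: "N r \<le> M" if "r < p" for r unfolding M_def using that by simp
  show ?thesis
  proof (rule fdtc_eq[OF w, of _ "real_of_int (M + \<bar>e\<bar>)"])
    fix k
    let ?q = "int (k div p)" and ?r = "k mod p"
    have r: "?r < p" using p(2) by simp
    have "br w ^ k = (br w ^ p) ^ (k div p) * br w ^ ?r" by (simp add: power_mult[symmetric] power_add[symmetric])
    also have "(br w ^ p) ^ (k div p) = twp (e * ?q)" using twp_power[of e 1 "k div p"] p(1) by simp
    finally have x: "br w ^ k = twp (e * ?q) * br w ^ ?r" .
    have "twp (- (e * ?q - N ?r)) * br w ^ k = twp (- (- N ?r)) * br w ^ ?r"
      unfolding x by (simp add: mult.assoc[symmetric] twp_add[symmetric])
    moreover have "inverse (br w ^ k) * twp (e * ?q + N ?r) = inverse (br w ^ ?r) * twp (N ?r)"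
      unfolding x by (simp add: mult.assoc twp_inverse twp_add[symmetric])
    ultimately have "bounds (e * ?q - N ?r) (br w ^ k) (e * ?q + N ?r)" using N[of ?r] unfolding bounds_def by simp
    then have "e * ?q - N ?r \<le> braid_floor 3 (wpow w k) \<and> braid_floor 3 (wpow w k) < e * ?q + N ?r"
      using floor_bounds[of "wpow w k"] br_wpow[OF w, of k] by simp
    then have "\<bar>braid_floor 3 (wpow w k) - e * ?q\<bar> \<le> M" using M[OF r] by linarith
    then have 1: "\<bar>real_of_int (braid_floor 3 (wpow w k)) - real_of_int e * real (k div p)\<bar> \<le> real_of_int M"
      by (metis (no_types, lifting) of_int_abs of_int_diff of_int_le_iff of_int_mult of_int_of_nat_eq)
    have "real k = real p * real (k div p) + real ?r" by (metis mult_div_mod_eq of_nat_add of_nat_mult)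
    then have "real_of_int e * real (k div p) - real_of_int e / real p * real k = - real_of_int e * (real ?r / real p)"
      using p(2) by (simp add: field_simps)
    moreover have "\<bar>real_of_int e * (real ?r / real p)\<bar> \<le> \<bar>real_of_int e\<bar> * 1"
      unfolding abs_mult using r p(2) by (intro mult_left_mono) (auto simp: field_simps)
    ultimately have "\<bar>real_of_int e * real (k div p) - real_of_int e / real p * real k\<bar> \<le> real_of_int \<bar>e\<bar>" by simp
    with 1 show "\<bar>real_of_int (braid_floor 3 (wpow w k)) - real_of_int e / real p * real k\<bar> \<le> real_of_int (M + \<bar>e\<bar>)" by simp
  qed
qed

section \<open>Conjugacy classes\<close>

text \<open>The last representative is \<open>s2 * s1\<close> by \<open>s2_s1\<close>. The elements
  in the third line are the periodic ones: some power of each is a power of the full twist.\<close>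

definition reduced :: "b3 \<Rightarrow> bool" where
  "reduced y \<longleftrightarrow> (\<exists>m w. alt w \<and> y = twp m * br w) \<or> (\<exists>m j. y = twp m * s2 ^ j) \<or>
     (\<exists>m. y = twp m * dl \<or> y = twp m * (dl * s1) \<or> y = twp m * (dl * inverse s2))"

definition reducible :: "b3 \<Rightarrow> bool" where
  "reducible x \<longleftrightarrow> (\<exists>a y. x = a * y * inverse a \<and> reduced y)"

lemma reduced_reducible: "reduced y \<Longrightarrow> reducible y"
  unfolding reducible_def by (intro exI[of _ 1] exI[of _ y]) simp

lemma reducible_swap: assumes "reducible (twp m * (v * u))" shows "reducible (twp m * (u * v))"
proof -
  obtain a y where y: "twp m * (v * u) = a * y * inverse a" "reduced y" using assms unfolding reducible_def by blast
  have "twp m * (u * v) = twp m * u * (v * u) * inverse u" by (simp add: mult.assoc)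
  also have "\<dots> = u * (twp m * (v * u)) * inverse u" using twp_commute[of u m] by (simp add: mult.assoc[symmetric])
  also have "\<dots> = (u * a) * y * inverse (u * a)" unfolding y(1) by (simp add: mult.assoc)
  finally show ?thesis unfolding reducible_def using y(2) by blast
qed

lemma twp_tw: "twp m * (dl * (dl * z)) = twp (m + 1) * z"
  using twp_add[of m 1] by (simp add: twp_1 tw_def mult.assoc)

lemma s2_power_dl: "s2 ^ i * dl = dl * s1 ^ i"
proof (induction i)
  case (Suc i)
  have "s2 ^ Suc i * dl = s2 * (s2 ^ i * dl)" by (simp add: mult.assoc)
  also have "\<dots> = (s2 * dl) * s1 ^ i" unfolding Suc by (simp add: mult.assoc)
  finally show ?case unfolding dl_s2 by (simp add: mult.assoc)
qed simp

lemma alt_replicate: "alt (replicate i 1)"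
  by (auto simp: alt_def)

lemma br_alt_Cons: "alt (y # w) \<Longrightarrow> br (y # w) = br [y] * br w"
  by (rule br_Cons) (rule alt_valid)

lemma br_ones_append: "alt w \<Longrightarrow> br (replicate i 1 @ w) = s1 ^ i * br w"
  using br_append[of "replicate i 1" w] br_replicate[of 1 i] alt_valid by simp

text \<open>A simultaneous induction on length for elements with and without a factor
  \<open>dl\<close>, because each kind produces the other. Conjugation brings letters from the end
  to the front, where they cancel or combine into half twists; a pair of half twists is absorbed
  into the central power.\<close>

lemma reducible_aux:
  "(\<forall>m w j. alt w \<and> length w + j = n \<longrightarrow> reducible (twp m * (br w * s2 ^ j))) \<and>
   (\<forall>m w. alt w \<and> length w = n \<longrightarrow> reducible (twp m * (dl * br w)))"
proof (induction n rule: less_induct)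
  case (less n)
  have IHe: "reducible (twp m * (br w * s2 ^ j))" if "alt w" "length w + j < n" for m w j using less that by blast
  have IHo: "reducible (twp m * (dl * br w))" if "alt w" "length w < n" for m w using less that by blast
  have alt_red: "reducible (twp m * br w)" if "alt w" for m w
    by (rule reduced_reducible) (use that in \<open>auto simp: reduced_def\<close>)
  have "reducible (twp m * (br w * s2 ^ j))" if w: "alt w" "length w + j = n" for m w j
  proof (cases j)
    case 0 then show ?thesis using alt_red[OF w(1)] by simp
  next
    case (Suc i)
    show ?thesis
    proof (cases w)
      case Nil
      then have "reduced (twp m * (br w * s2 ^ j))" by (auto simp: reduced_def br_Nil)
      then show ?thesis by (rule reduced_reducible)
    next
      case (Cons y v)
      have v: "alt v" and y: "y = 1 \<or> y = -2" using w(1) Cons by simp_all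
      have e: "s2 ^ j * br w = s2 ^ i * (s2 * (br [y] * br v))"
        unfolding Cons Suc power_Suc2 using br_alt_Cons[of y v] w(1) Cons by (simp add: mult.assoc)
      have "reducible (twp m * (s2 ^ j * br w))"
        using y
      proof
        assume "y = -2"
        then have "s2 ^ j * br w = s2 ^ i * br v" unfolding e by (simp add: br_neg)
        moreover have "reducible (twp m * (br v * s2 ^ i))" by (rule IHe[OF v]) (use w(2) Cons Suc in simp)
        ultimately show ?thesis using reducible_swap by metis
      next
        \<comment> \<open>One pair \<open>s2 * s1\<close> becomes a half twist and a single letter
          -2, and the remaining \<open>s2\<close> turn into letters 1 on passing it. The new word
          has length \<open>n - 1\<close>.\<close>
        assume "y = 1"
        then have "s2 ^ j * br w = s2 ^ i * ((s2 * s1) * br v)" unfolding e by (simp add: mult.assoc)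
        also have "\<dots> = (s2 ^ i * dl) * (inverse s2 * br v)" unfolding s2_s1 by (simp add: mult.assoc)
        also have "\<dots> = dl * (s1 ^ i * br (-2 # v))" unfolding s2_power_dl using br_alt_Cons[of "-2" v] v by (simp add: mult.assoc br_neg)
        also have "\<dots> = dl * br (replicate i 1 @ -2 # v)" using br_ones_append[of "-2 # v" i] v by simp
        finally show ?thesis using IHo[of "replicate i 1 @ -2 # v" m] v alt_replicate w(2) Cons Suc by simp
      qed
      then show ?thesis by (rule reducible_swap)
    qed
  qed
  moreover have "reducible (twp m * (dl * br w))" if w: "alt w" "length w = n" for m w
  proof (cases w rule: rev_cases)
    case Nil
    then have "reduced (twp m * (dl * br w))" by (auto simp: reduced_def br_Nil)
    then show ?thesis by (rule reduced_reducible)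
  next
    case (snoc v y)
    have v: "alt v" and y: "y = 1 \<or> y = -2" using w(1) snoc by simp_all
    have e: "dl * br w = (dl * br v) * br [y]"
      using br_append[of v "[y]"] alt_valid[OF v] y snoc by (auto simp: mult.assoc)
    show ?thesis
    proof (cases v)
      case Nil
      have "br w = s1 \<or> br w = inverse s2" using snoc Nil y by (auto simp: br_neg)
      then have "reduced (twp m * (dl * br w))" unfolding reduced_def by metis
      then show ?thesis by (rule reduced_reducible)
    next
      case (Cons z u)
      have u: "alt u" and z: "z = 1 \<or> z = -2" using v Cons by simp_all
      have bv: "br v = br [z] * br u" using br_alt_Cons[of z u] v Cons by simp
      have len: "length u < n" using w(2) snoc Cons by simp
      \<comment> \<open>The last letter is conjugated to the front and moved past \<open>dl\<close>.
        Against the first letter of \<open>v\<close>, each of the four combinations leaves either a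
        shorter word with one \<open>dl\<close> or a word in the letters 1 and -2 without
        \<open>dl\<close>.\<close>
      have "reducible (twp m * (br [y] * (dl * br v)))"
        using y
      proof
        assume "y = 1"
        then have f: "br [y] * (dl * br v) = dl * (s2 * (br [z] * br u))"
          unfolding bv using dl_s1 by (simp add: mult.assoc[symmetric])
        show ?thesis
          using z
        proof
          assume "z = 1"
          then have "s2 * (br [z] * br u) = dl * br (-2 # u)"
            using br_alt_Cons[of "-2" u] u s2_s1 by (simp add: mult.assoc[symmetric] br_neg)
          then show ?thesis unfolding f using twp_tw alt_red[of "-2 # u"] u by simp
        next
          assume "z = -2"
          then show ?thesis unfolding f using IHo[OF u len] by (simp add: br_neg)
        qed
      next
        assume "y = -2"
        then have "br [y] * (dl * br v) = dl * (inverse s1 * br v)"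
          using dl_inv_s2 by (simp add: br_neg mult.assoc[symmetric])
        also have "dl * (inverse s1 * br v) = s1 * (s2 * br v)" by (simp add: dl_def mult.assoc)
        finally have f: "br [y] * (dl * br v) = s1 * (s2 * (br [z] * br u))" unfolding bv .
        show ?thesis
          using z
        proof
          assume "z = 1"
          then have "br [y] * (dl * br v) = dl * br u" unfolding f by (simp add: dl_def mult.assoc)
          then show ?thesis using IHo[OF u len] by simp
        next
          assume "z = -2"
          then have "br [y] * (dl * br v) = br (1 # u)" unfolding f using br_alt_Cons[of 1 u] u by (simp add: br_neg)
          then show ?thesis using alt_red[of "1 # u"] u by simp
        qed
      qed
      then show ?thesis unfolding e by (rule reducible_swap)
    qed
  qed
  ultimately show ?case by blast
qed

lemma reducible: "reducible x"
proof -
  obtain m y where y: "y \<in> nf" "x = twp m * y \<or> x = twp m * (dl * y)" using normal_form by blast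
  obtain w j where w: "alt w" "y = br w * s2 ^ j" using y(1) by (rule nfE)
  from y(2) show ?thesis
  proof
    assume "x = twp m * y" then show ?thesis using reducible_aux w by blast
  next
    assume x: "x = twp m * (dl * y)"
    have "s2 ^ j * (dl * br w) = dl * br (replicate j 1 @ w)"
      using br_ones_append[OF w(1), of j] s2_power_dl[of j] by (simp add: mult.assoc[symmetric])
    moreover have "reducible (twp m * (dl * br (replicate j 1 @ w)))"
      using conjunct2[OF reducible_aux[of "length (replicate j 1 @ w)"]] w(1) alt_replicate by simp
    ultimately have "reducible (twp m * (s2 ^ j * (dl * br w)))" by simp
    then have "reducible (twp m * ((dl * br w) * s2 ^ j))" by (rule reducible_swap)
    then show ?thesis unfolding x w(2) by (simp add: mult.assoc)
  qed
qed

section \<open>Twist coefficients greater than one\<close>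

lemma detected_conj:
  assumes "detected R [] v" "valid_word 3 v" "valid_word 3 w" "br w = a * br v * inverse a"
  shows "detected R [] w"
proof -
  let ?a = "wd a"
  have a: "valid_word 3 ?a" "br ?a = a" by (rule wd)+
  have va: "valid_word 3 (v @ winv ?a @ ?a)" using a(1) assms(2) by simp
  have "br v = br (v @ winv ?a @ ?a)" using a assms(2) by (simp add: br_append br_winv)
  then have "braid_eq 3 v (v @ winv ?a @ ?a)" using br_eq_iff[OF assms(2) va] by simp
  then have "detected R [] ((v @ winv ?a) @ ?a)" using detected_braid_eq[of v _ R] assms(1,2) by simp
  then have d: "detected R [] (?a @ v @ winv ?a)" by (rule detected_rotate) (use va in simp)
  have va': "valid_word 3 (?a @ v @ winv ?a)" using va by simp
  have "br (?a @ v @ winv ?a) = br w" using a assms(2,4) by (simp add: br_append br_winv mult.assoc)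
  then have "braid_eq 3 (?a @ v @ winv ?a) w" using br_eq_iff[OF va' assms(3)] by simp
  then show ?thesis using detected_braid_eq[of _ w R] va' d by blast
qed

lemma detected_positive: "\<forall>x\<in>set p. x > 0 \<Longrightarrow> valid_word 3 p \<Longrightarrow> detected R [] p"
  using detected_insert_pos_list[of R "[]" "[]" p] detected_Nil[of R] by simp

lemma detected_insert_ones:
  "detected R [] (a @ filter (\<lambda>x. x \<noteq> 1) u) \<Longrightarrow> valid_word 3 (a @ u) \<Longrightarrow> detected R [] (a @ u)"
proof (induction u arbitrary: a)
  case (Cons x u)
  show ?case
  proof (cases "x = 1")
    case True
    then show ?thesis using Cons.IH[of a] Cons.prems detected_insert_pos_at[of R a u 1] by simp
  next
    case False
    then show ?thesis using Cons.IH[of "a @ [x]"] Cons.prems by simp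
  qed
qed simp

text \<open>With q = s1 s2^2 s1 the full twist is q s2^2. Being central, it can be extracted twice
  from q q s2^4.\<close>

lemma br_base: "br (base @ [2,2,2,2]) = tw * tw"
proof -
  have "tw = (s1 * s2) * (s1 * dl)" unfolding tw_def by (simp add: dl_def mult.assoc)
  also have "\<dots> = s1 * (s2 * (s2 * (s1 * (s2 * s2))))" unfolding dl_s1 by (simp add: dl_alt mult.assoc)
  finally have t: "s1 * (s2 * (s2 * (s1 * (s2 * s2)))) = tw" ..
  define q where "q = s1 * (s2 * (s2 * s1))"
  have q: "q * (s2 * s2) = tw" using t by (simp add: q_def mult.assoc)
  have "br (base @ [2,2,2,2]) = q * (q * (s2 * s2)) * (s2 * s2)"
    by (simp add: base_def br_Cons[of _ "_ # _"] q_def mult.assoc)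
  also have "\<dots> = (q * tw) * (s2 * s2)" unfolding q ..
  also have "\<dots> = tw * (q * (s2 * s2))" unfolding tw_commute[symmetric, of q] by (simp only: mult.assoc)
  finally show ?thesis unfolding q .
qed

text \<open>Without its letters 1 the word \<open>u\<close> is a power of \<open>inverse s2\<close>.
  The desired word arises from a member of the base family by inserting those letters and the
  positive word \<open>p\<close>, which completes \<open>base\<close> to the full twist power with
  exponent \<open>m\<close>.\<close>

lemma detected_alt:
  assumes "alt u" "m \<ge> 2"
  shows "\<exists>v. valid_word 3 v \<and> br v = twp m * br u \<and> detected R [] v"
proof -
  define p :: "int list" where "p = [2,2,2,2] @ wpow [1,2,1] (2 * nat (m - 2))"
  have p: "valid_word 3 p" using dl_word[of "2 * nat (m - 2)"] by (simp add: p_def)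
  have pp: "\<forall>x\<in>set p. x > 0" by (simp add: p_def set_wpow)
  have vb: "valid_word 3 base" by (simp add: base_def)
  define k where "k = length (filter (\<lambda>x. x \<noteq> 1) u)"
  have "\<forall>x\<in>set (filter (\<lambda>x. x \<noteq> 1) u). x = -2" using assms(1) by (auto simp: alt_def)
  then have f: "filter (\<lambda>x. x \<noteq> 1) u = replicate k (-2)" unfolding k_def by (simp only: replicate_length_same)
  have vk: "valid_word 3 (replicate k (-2))" using br_replicate[of "-2" k] by blast
  have "detected R [] (base @ p @ replicate k (-2))"
    by (rule detected_insert_pos_list[OF detected_base[of R k] pp]) (simp add: vb p vk)
  then have "detected R [] ((base @ p) @ filter (\<lambda>x. x \<noteq> 1) u)" unfolding f by simp
  then have "detected R [] ((base @ p) @ u)"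
    by (rule detected_insert_ones) (simp add: vb p alt_valid[OF assms(1)])
  moreover have "br ((base @ p) @ u) = twp m * br u"
  proof -
    let ?d = "wpow [1,2,1] (2 * nat (m - 2))"
    have d: "valid_word 3 ?d" "br ?d = twp (m - 2)"
      using dl_word[of "2 * nat (m - 2)"] twp_nat[of "nat (m - 2)"] assms(2) by simp_all
    have "base @ p = (base @ [2,2,2,2]) @ ?d" by (simp add: p_def)
    also have "br \<dots> = br (base @ [2,2,2,2]) * br ?d" by (rule br_append) (use vb d(1) in simp_all)
    also have "\<dots> = twp 2 * twp (m - 2)"
      using twp_add[of 1 1] unfolding br_base d(2) by (simp add: twp_1)
    also have "\<dots> = twp m" by (simp add: twp_add[symmetric])
    finally show ?thesis using br_append[of "base @ p" u] vb p alt_valid[OF assms(1)] by simp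
  qed
  ultimately show ?thesis using vb p alt_valid[OF assms(1)] by (intro exI[of _ "(base @ p) @ u"]) simp
qed

lemma detected_pos_word:
  assumes "m \<ge> 0" "valid_word 3 p" "\<forall>x\<in>set p. x > 0"
  shows "\<exists>v. valid_word 3 v \<and> br v = twp m * br p \<and> detected R [] v"
proof -
  let ?v = "wpow [1,2,1] (2 * nat m) @ p"
  have "valid_word 3 ?v" "br ?v = twp m * br p"
    using dl_word[of "2 * nat m"] twp_nat[of "nat m"] assms(1,2) by (simp_all add: br_append)
  moreover have "\<forall>x\<in>set ?v. x > 0" using assms(3) by (auto simp: set_wpow split: if_splits)
  ultimately show ?thesis using detected_positive by blast
qed

text \<open>Elements of \<open>nf\<close> lie between the full twist and its inverse, so when all
  powers of \<open>y\<close> are such elements only the central factor contributes to the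
  limit.\<close>

lemma fdtc_conj_nf:
  assumes w: "valid_word 3 w" and x: "br w = a * (twp m * y) * inverse a" and y: "\<And>k. y ^ k \<in> nf"
  shows "fdtc 3 w = real_of_int m"
proof -
  obtain N where N: "\<And>x c d. bounds c x d \<Longrightarrow> bounds (c - N) (a * x * inverse a) (d + N)" using bounds_conj[of a] by blast
  show ?thesis
  proof (rule fdtc_bounds[OF w, of _ "N + 1"])
    fix k
    have "br w ^ k = a * (twp (m * int k) * y ^ k) * inverse a" unfolding x b3_conj_power twp_power ..
    then show "bounds (m * int k - (N + 1)) (br w ^ k) (m * int k + (N + 1))"
      using N[OF bounds_nf[OF y, of "m * int k" k]] by (simp add: algebra_simps)
  qed
qed

lemma fdtc_conj_periodic:
  assumes w: "valid_word 3 w" and x: "br w = a * (twp m * y) * inverse a" and y: "y ^ p = twp e" "p > 0"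
  shows "fdtc 3 w = real_of_int (m * int p + e) / real p"
proof (rule fdtc_periodic[OF w _ y(2)])
  have "br w ^ p = a * twp (m * int p + e) * inverse a" unfolding x b3_conj_power twp_power y(1) twp_add ..
  then show "br w ^ p = twp (m * int p + e)" unfolding twp_commute by (simp add: mult.assoc)
qed

lemma dl_s1_cubed: "(dl * s1) ^ 3 = twp 2"
proof -
  have "(dl * s1) ^ 3 = dl * ((s1 * dl) * ((s1 * dl) * s1))" by (simp add: numeral_3_eq_3 mult.assoc)
  also have "\<dots> = dl * (dl * ((s2 * dl) * (s2 * s1)))" unfolding dl_s1 by (simp add: mult.assoc)
  also have "\<dots> = dl * (dl * (dl * dl))" unfolding dl_s2 by (simp add: dl_def mult.assoc)
  finally show ?thesis using twp_nat[of 2] by (simp add: eval_nat_numeral mult.assoc)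
qed

lemma dl_s2_cubed: "(dl * inverse s2) ^ 3 = twp 1"
proof -
  have "(dl * inverse s2) ^ 3 = dl * ((inverse s2 * dl) * ((inverse s2 * dl) * inverse s2))" by (simp add: numeral_3_eq_3 mult.assoc)
  also have "\<dots> = dl * (dl * ((inverse s1 * dl) * (inverse s1 * inverse s2)))" unfolding dl_inv_s2 by (simp add: mult.assoc)
  also have "\<dots> = dl * (dl * (dl * inverse (s2 * (s1 * s2))))" unfolding dl_inv_s1 by (simp add: mult.assoc)
  also have "\<dots> = tw" unfolding dl_alt[symmetric] by (simp add: tw_def)
  finally show ?thesis by (simp add: twp_1)
qed

lemma detected_fdtc:
  assumes w: "valid_word 3 w" and f: "fdtc 3 w > 1"
  shows "detected R [] w"
proof -
  obtain a y where x: "br w = a * y * inverse a" and y: "reduced y" using reducible[of "br w"] unfolding reducible_def by blast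
  have "\<exists>v. valid_word 3 v \<and> br v = y \<and> detected R [] v"
    using y unfolding reduced_def
  proof (elim disjE exE conjE)
    fix m u assume u: "alt u" "y = twp m * br u"
    have "br u ^ k \<in> nf" for k
    proof -
      have "alt (wpow u k)" using u(1) by (auto simp: alt_def set_wpow)
      then show ?thesis using nfI[of "wpow u k" 0] br_wpow[OF alt_valid[OF u(1)], of k] by simp
    qed
    \<comment> \<open>Here the coefficient is the integer \<open>m\<close> itself, and exceeding 1
      means at least 2, as the base family demands. In the other cases the representative is a
      positive word, so a nonnegative \<open>m\<close> is enough.\<close>
    from fdtc_conj_nf[OF w x[unfolded u(2)] this] have "m \<ge> 2" using f by simp
    then show ?thesis unfolding u(2) by (rule detected_alt[OF u(1)])
  next
    fix m j assume u: "y = twp m * s2 ^ j"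
    have "(s2 ^ j) ^ k \<in> nf" for k using nfI[of "[]" "j * k"] by (simp add: br_Nil power_mult)
    from fdtc_conj_nf[OF w x[unfolded u] this] have "m \<ge> 0" using f by simp
    then show ?thesis unfolding u using detected_pos_word[of m "replicate j 2" R] br_replicate[of 2 j] by simp
  next
    fix m assume u: "y = twp m * dl"
    have "dl ^ 2 = twp 1" by (simp add: twp_1 tw_def power2_eq_square)
    from fdtc_conj_periodic[OF w x[unfolded u] this] have "m \<ge> 0" using f by simp
    then show ?thesis unfolding u using detected_pos_word[of m "[1,2,1]" R] by (simp add: dl_def br_Cons[of _ "_ # _"])
  next
    fix m assume u: "y = twp m * (dl * s1)"
    from fdtc_conj_periodic[OF w x[unfolded u] dl_s1_cubed] have "m \<ge> 0" using f by simp
    then show ?thesis unfolding u using detected_pos_word[of m "[1,2,1,1]" R] by (simp add: dl_def br_Cons[of _ "_ # _"] mult.assoc)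
  next
    fix m assume u: "y = twp m * (dl * inverse s2)"
    from fdtc_conj_periodic[OF w x[unfolded u] dl_s2_cubed] have "m \<ge> 0" using f by simp
    then show ?thesis unfolding u s2_s1[symmetric] using detected_pos_word[of m "[2,1]" R] by (simp add: br_Cons[of _ "_ # _"])
  qed
  then obtain v where "valid_word 3 v" "br v = y" "detected R [] v" by blast
  then show ?thesis using detected_conj[of R v w a] w x by simp
qed

theorem theorem1p4:
  fixes \<beta> :: "int list"
  assumes "valid_word 3 \<beta>"
    and "closure_is_knot 3 \<beta>"
    and "fdtc 3 \<beta> > 1"
  shows "psi_nonzero TYPE(rat) 3 \<beta> \<and> psi_nonzero TYPE(int) 3 \<beta> \<and>
         psi_nonzero TYPE(bit) 3 \<beta> \<and> psi'_nonzero 3 \<beta>"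
  by (intro conjI psi_nonzero_detected psi'_nonzero_detected detected_fdtc[OF assms(1,3)] assms(1))

end
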